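(* Let $F$ be a global field, let $p$ be an odd prime with $p\neq\operatorname{char}F$, and assume $\mu_p\subset F$. Let $a,b,c,d\in F^\times$ be such that \[K=F(\sqrt[p]{a},\sqrt[p]{b},\sqrt[p]{c},\sqrt[p]{d})\] is a $C_p^4$-extension of $F$ (i.e. Galois with group $C_p^4$). Consider the central extension \[1\longrightarrow C_p\longrightarrow \mathcal E_p\longrightarrow C_p^4\longrightarrow 1,\] where $\mathcal E_p=H_{p^3}*H_{p^3}$, as an embedding problem over $K/F$. Its obstruction is \[(a,b)_p-(c,d)_p\in\operatorname{Br}(F)[p].\] Consequently, the embedding problem is solvable if and only if $(a,b)_p=(c,d)_p$.
   Context: Fix a primitive $p$-th root of unity $\zeta\in F$. For $u,v\in F^\times$, $(u,v)_p$ denotes the class in $\operatorname{Br}(F)[p]$ (written additively) of the degree-$p$ symbol algebra generated by $i,j$ with $i^p=u$, $j^p=v$, $ji=\zeta ij$. Commutators are $[g,h]=g^{-1}h^{-1}gh$. $H_{p^3}$ is the Heisenberg group of order $p^3$ and exponent $p$. $\mathcal E_p=H_{p^3}*H_{p^3}$ is the central product of two copies of $H_{p^3}$ obtained by identifying the centers with opposite orientation; equivalently it is the group of order $p^5$ with generators $s_a,s_b,s_c,s_d,\tau$ and relations: $s_a^p=s_b^p=s_c^p=s_d^p=\tau^p=1$; $\tau$ is central; $[s_a,s_b]=\tau$; $[s_c,s_d]=\tau^{-1}$; $[s_a,s_c]=[s_a,s_d]=[s_b,s_c]=[s_b,s_d]=1$. In the central extension the kernel $C_p$ is $\langle\tau\rangle$,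 identified with $\mu_p$ by $\tau\mapsto\zeta$, and the quotient $C_p^4=\mathcal E_p/\langle\tau\rangle$ is identified with $\operatorname{Gal}(K/F)$ by sending the image of $s_u$ ($u\in\{a,b,c,d\}$) to the standard Kummer generator $\sigma_u$, which satisfies $\sigma_u(\sqrt[p]{u})=\zeta\sqrt[p]{u}$ and fixes the other three chosen radicals. The embedding problem is solvable if there is a Galois extension $L/F$ containing $K$ and an isomorphism $\operatorname{Gal}(L/F)\cong\mathcal E_p$ under which restriction $\operatorname{Gal}(L/F)\to\operatorname{Gal}(K/F)$ corresponds to the quotient map $\mathcal E_p\to\mathcal E_p/\langle\tau\rangle$. Its obstruction is the class in $\operatorname{Br}(F)[p]$ of the crossed product algebra $\bigoplus_{\sigma\in\operatorname{Gal}(K/F)}K u_\sigma$, with $u_\sigma k=\sigma(k)u_\sigma$ for $k\in K$ and $u_\sigma u_{\sigma'}=c(\sigma,\sigma')u_{\sigma\sigma'}$, where $c$ is a $\mu_p$-valued factor set of the central extension (i.e. $s_\sigma s_{\sigma'}=c(\sigma,\sigma')s_{\sigma\sigma'}$ for a set of lifts $s_\sigma\in\mathcal E_p$). *)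

theory Defs
  imports "HOL-Algebra.Algebra" "HOL-Algebra.Algebraic_Closure_Type"
begin

section \<open>Fields and Galois extensions\<close>

text \<open>
  The base field is a type \<open>'f\<close> of class \<open>field\<close>; every extension field is a subfield of its
  algebraic closure \<open>'f alg_closure\<close>, in which \<open>'f\<close> is embedded by \<^const>\<open>to_ac\<close>.  The locale
  based notions are used through \<^const>\<open>ring_of_type_algebra\<close>, the ring record of a type.
\<close>

abbreviation base_ring :: "'f::field ring" where
  "base_ring \<equiv> ring_of_type_algebra"

abbreviation closure_ring :: "'f::field alg_closure ring" where
  "closure_ring \<equiv> ring_of_type_algebra"

text \<open>
  Number fields are the finite extensions of the prime field in characteristic \<open>0\<close>; global
  function fields are the finite extensions of \<open>k(t)\<close>, where \<open>k\<close> is finite and \<open>t\<close> is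
  transcendental over \<open>k\<close>.
\<close>

definition number_field :: "'f::field itself \<Rightarrow> bool" where
  "number_field _ \<longleftrightarrow> CHAR('f) = 0 \<and>
     ring.finite_dimension base_ring (generate_field base_ring {}) (UNIV :: 'f set)"

definition global_function_field :: "'f::field itself \<Rightarrow> bool" where
  "global_function_field _ \<longleftrightarrow> (\<exists>(k :: 'f set) t.
     subfield k base_ring \<and> finite k \<and> ring.transcendental base_ring k t \<and>
     ring.finite_dimension base_ring (generate_field base_ring (insert t k)) (UNIV :: 'f set))"

definition global_field :: "'f::field itself \<Rightarrow> bool" where
  "global_field F \<longleftrightarrow> number_field F \<or> global_function_field F"

definition adjoin :: "'f::field alg_closure set \<Rightarrow> 'f alg_closure set" where
  "adjoin S = generate_field closure_ring (range to_ac \<union> S)"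

definition gal :: "'f::field alg_closure set \<Rightarrow> ('f alg_closure \<Rightarrow> 'f alg_closure) monoid" where
  "gal L = BijGroup L \<lparr>carrier := {\<sigma> \<in> Bij L.
     \<sigma> \<in> ring_hom (closure_ring\<lparr>carrier := L\<rparr>) (closure_ring\<lparr>carrier := L\<rparr>) \<and>
     (\<forall>x. \<sigma> (to_ac x) = to_ac x)}\<rparr>"

definition galois_extension :: "'f::field alg_closure set \<Rightarrow> bool" where
  "galois_extension L \<longleftrightarrow> subfield L closure_ring \<and> range to_ac \<subseteq> L \<and>
     ring.finite_dimension closure_ring (range to_ac) L \<and>
     {x \<in> L. \<forall>\<sigma> \<in> carrier (gal L). \<sigma> x = x} = range to_ac"

text \<open>\<open>\<sigma>\<close> multiplies the radical \<open>r\<close> by \<open>\<zeta>\<close> and fixes the other radicals \<open>S\<close>.\<close>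

definition kummer_generator :: "'f::field alg_closure set \<Rightarrow> 'f \<Rightarrow> 'f alg_closure \<Rightarrow>
    'f alg_closure set \<Rightarrow> ('f alg_closure \<Rightarrow> 'f alg_closure) \<Rightarrow> bool" where
  "kummer_generator K \<zeta> r S \<sigma> \<longleftrightarrow>
     \<sigma> \<in> carrier (gal K) \<and> \<sigma> r = to_ac \<zeta> * r \<and> (\<forall>s \<in> S. \<sigma> s = s)"

definition primitive_root_of_unity :: "nat \<Rightarrow> 'f::field \<Rightarrow> bool" where
  "primitive_root_of_unity n \<zeta> \<longleftrightarrow> \<zeta> ^ n = 1 \<and> (\<forall>k. 0 < k \<and> k < n \<longrightarrow> \<zeta> ^ k \<noteq> 1)"

section \<open>Central simple algebras and the Brauer group\<close>

text \<open>The library locale \<^locale>\<open>algebra\<close> is about commutative algebras.\<close>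

locale assoc_algebra = Module.module R A + ring A for R (structure) and A (structure) +
  assumes smult_mult_left:
      "\<lbrakk>r \<in> carrier R; x \<in> carrier A; y \<in> carrier A\<rbrakk> \<Longrightarrow>
        (r \<odot>\<^bsub>A\<^esub> x) \<otimes>\<^bsub>A\<^esub> y = r \<odot>\<^bsub>A\<^esub> (x \<otimes>\<^bsub>A\<^esub> y)"
    and smult_mult_right:
      "\<lbrakk>r \<in> carrier R; x \<in> carrier A; y \<in> carrier A\<rbrakk> \<Longrightarrow>
        x \<otimes>\<^bsub>A\<^esub> (r \<odot>\<^bsub>A\<^esub> y) = r \<odot>\<^bsub>A\<^esub> (x \<otimes>\<^bsub>A\<^esub> y)"

definition algebra_isos :: "('f::field, 'v) module \<Rightarrow> ('f, 'w) module \<Rightarrow> ('v \<Rightarrow> 'w) set" where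
  "algebra_isos A B = {h \<in> ring_hom A B. bij_betw h (carrier A) (carrier B) \<and>
     (\<forall>r. \<forall>x \<in> carrier A. h (r \<odot>\<^bsub>A\<^esub> x) = r \<odot>\<^bsub>B\<^esub> h x)}"

definition finite_dim_algebra :: "('f::field, 'v) module \<Rightarrow> bool" where
  "finite_dim_algebra A \<longleftrightarrow> (\<exists>S. finite S \<and> S \<subseteq> carrier A \<and>
     (\<forall>x \<in> carrier A. \<exists>r :: 'v \<Rightarrow> 'f. x = finsum A (\<lambda>s. r s \<odot>\<^bsub>A\<^esub> s) S))"

definition central_simple :: "('f::field, 'v) module \<Rightarrow> bool" where
  "central_simple A \<longleftrightarrow> assoc_algebra base_ring A \<and> finite_dim_algebra A \<and>
     {z \<in> carrier A. \<forall>x \<in> carrier A. z \<otimes>\<^bsub>A\<^esub> x = x \<otimes>\<^bsub>A\<^esub> z} = range (\<lambda>r. r \<odot>\<^bsub>A\<^esub> \<one>\<^bsub>A\<^esub>) \<and>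
     \<one>\<^bsub>A\<^esub> \<noteq> \<zero>\<^bsub>A\<^esub> \<and> (\<forall>I. ideal I A \<longrightarrow> I = {\<zero>\<^bsub>A\<^esub>} \<or> I = carrier A)"

text \<open>Matrices are functions vanishing outside \<open>{..<n} \<times> {..<n}\<close>.\<close>

definition matrix_algebra :: "nat \<Rightarrow> ('f::field, 'v) module \<Rightarrow> ('f, nat \<Rightarrow> nat \<Rightarrow> 'v) module" where
  "matrix_algebra n A = \<lparr>
     carrier = {M. \<forall>i j. if i < n \<and> j < n then M i j \<in> carrier A else M i j = \<zero>\<^bsub>A\<^esub>},
     monoid.mult = (\<lambda>M N i j. if i < n \<and> j < n
        then finsum A (\<lambda>k. M i k \<otimes>\<^bsub>A\<^esub> N k j) {..<n} else \<zero>\<^bsub>A\<^esub>),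
     one = (\<lambda>i j. if i < n \<and> i = j then \<one>\<^bsub>A\<^esub> else \<zero>\<^bsub>A\<^esub>),
     ring.zero = (\<lambda>i j. \<zero>\<^bsub>A\<^esub>),
     ring.add = (\<lambda>M N i j. if i < n \<and> j < n then M i j \<oplus>\<^bsub>A\<^esub> N i j else \<zero>\<^bsub>A\<^esub>),
     module.smult = (\<lambda>r M i j. if i < n \<and> j < n then r \<odot>\<^bsub>A\<^esub> M i j else \<zero>\<^bsub>A\<^esub>)\<rparr>"

definition brauer_equiv :: "('f::field, 'v) module \<Rightarrow> ('f, 'w) module \<Rightarrow> bool" where
  "brauer_equiv A B \<longleftrightarrow>
     (\<exists>m > 0. \<exists>n > 0. algebra_isos (matrix_algebra m A) (matrix_algebra n B) \<noteq> {})"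

text \<open>
  A structure constant table \<open>T\<close> encodes the algebra with basis \<open>(e\<^sub>i)\<close>, indexed by
  \<open>sc_index T\<close>, such that \<open>e\<^sub>i e\<^sub>j = (\<Sum>k. sc_const T i j k \<cdot> e\<^sub>k)\<close>, and with unit
  \<open>(\<Sum>k. sc_unit T k \<cdot> e\<^sub>k)\<close>.
\<close>

record ('i, 'f) sc_table =
  sc_index :: "'i set"
  sc_const :: "'i \<Rightarrow> 'i \<Rightarrow> 'i \<Rightarrow> 'f"
  sc_unit :: "'i \<Rightarrow> 'f"

definition sc_algebra :: "('i, 'f::field) sc_table \<Rightarrow> ('f, 'i \<Rightarrow> 'f) module" where
  "sc_algebra T = \<lparr>
     carrier = {x. \<forall>i. i \<notin> sc_index T \<longrightarrow> x i = 0},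
     monoid.mult = (\<lambda>x y k. if k \<in> sc_index T
        then \<Sum>i\<in>sc_index T. \<Sum>j\<in>sc_index T. x i * y j * sc_const T i j k else 0),
     one = (\<lambda>k. if k \<in> sc_index T then sc_unit T k else 0),
     ring.zero = (\<lambda>k. 0),
     ring.add = (\<lambda>x y k. x k + y k),
     module.smult = (\<lambda>r x k. r * x k)\<rparr>"

definition sc_tensor ::
    "('i, 'f::field) sc_table \<Rightarrow> ('j, 'f) sc_table \<Rightarrow> ('i \<times> 'j, 'f) sc_table" where
  "sc_tensor S T = \<lparr>
     sc_index = sc_index S \<times> sc_index T,
     sc_const = (\<lambda>(i, i') (j, j') (k, k'). sc_const S i j k * sc_const T i' j' k'),
     sc_unit = (\<lambda>(k, k'). sc_unit S k * sc_unit T k')\<rparr>"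

text \<open>
  Every finite-dimensional algebra has a basis indexed by natural numbers.  Hence the tables
  indexed by sets of natural numbers contain representatives of all Brauer classes, and the Brauer
  class of an algebra over an arbitrary carrier type is the set of the equivalent tables.
\<close>

definition csa_tables :: "(nat, 'f::field) sc_table set" where
  "csa_tables = {T. finite (sc_index T) \<and> central_simple (sc_algebra T)}"

definition brauer_class :: "('f::field, 'v) module \<Rightarrow> (nat, 'f) sc_table set" where
  "brauer_class A = {T \<in> csa_tables. brauer_equiv A (sc_algebra T)}"

definition base_algebra :: "('f::field, 'f) module" where
  "base_algebra = \<lparr>carrier = UNIV, monoid.mult = (*), one = 1, ring.zero = 0,
     ring.add = (+), module.smult = (*)\<rparr>"

definition brauer_group :: "(nat, 'f::field) sc_table set monoid" where
  "brauer_group = \<lparr>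
     carrier = (\<lambda>T. brauer_class (sc_algebra T)) ` csa_tables,
     monoid.mult = (\<lambda>\<beta> \<gamma>. \<Union>S\<in>\<beta>. \<Union>T\<in>\<gamma>. brauer_class (sc_algebra (sc_tensor S T))),
     one = brauer_class base_algebra\<rparr>"

definition brauer_torsion :: "nat \<Rightarrow> (nat, 'f::field) sc_table set set" where
  "brauer_torsion n = {\<beta> \<in> carrier brauer_group. \<beta> [^]\<^bsub>brauer_group\<^esub> n = \<one>\<^bsub>brauer_group\<^esub>}"

definition brauer_diff ::
    "(nat, 'f::field) sc_table set \<Rightarrow> (nat, 'f) sc_table set \<Rightarrow> (nat, 'f) sc_table set" where
  "brauer_diff \<beta> \<gamma> = \<beta> \<otimes>\<^bsub>brauer_group\<^esub> inv\<^bsub>brauer_group\<^esub> \<gamma>"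

section \<open>Symbol algebras and crossed products\<close>

text \<open>
  The symbol algebra generated by \<open>i\<close>, \<open>j\<close> with \<open>i\<^sup>p = u\<close>, \<open>j\<^sup>p = v\<close>, \<open>j i = \<zeta> i j\<close> has the basis
  \<open>i\<^sup>r j\<^sup>s\<close> for \<open>r, s < p\<close>, here indexed by \<open>(r, s)\<close>, and
  \<open>(i\<^sup>r j\<^sup>s) (i\<^sup>m j\<^sup>n) = \<zeta>\<^bsup>s m\<^esup> i\<^bsup>r + m\<^esup> j\<^bsup>s + n\<^esup>\<close>.
\<close>

definition symbol_table :: "nat \<Rightarrow> 'f::field \<Rightarrow> 'f \<Rightarrow> 'f \<Rightarrow> (nat \<times> nat, 'f) sc_table" where
  "symbol_table p \<zeta> u v = \<lparr>
     sc_index = {..<p} \<times> {..<p},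
     sc_const = (\<lambda>(r, s) (m, n) k. if k = ((r + m) mod p, (s + n) mod p)
        then \<zeta> ^ (s * m) * u ^ ((r + m) div p) * v ^ ((s + n) div p) else 0),
     sc_unit = (\<lambda>k. if k = (0, 0) then 1 else 0)\<rparr>"

lemma symbol_algebra_relations:
  fixes \<zeta> u v :: "'f::field"
  assumes "p > 1"
  defines "A \<equiv> sc_algebra (symbol_table p \<zeta> u v)"
  defines "e \<equiv> (\<lambda>(k::nat\<times>nat) l. if l = k then 1 else (0::'f))"
  shows "r < p \<Longrightarrow> s < p \<Longrightarrow> m < p \<Longrightarrow> n < p \<Longrightarrow> e (r, s) \<otimes>\<^bsub>A\<^esub> e (m, n) =
     (\<zeta> ^ (s * m) * u ^ ((r + m) div p) * v ^ ((s + n) div p)) \<odot>\<^bsub>A\<^esub> e ((r + m) mod p, (s + n) mod p)"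
    and "e (0, 1) \<otimes>\<^bsub>A\<^esub> e (1, 0) = \<zeta> \<odot>\<^bsub>A\<^esub> (e (1, 0) \<otimes>\<^bsub>A\<^esub> e (0, 1))"
    and "e (1, 0) [^]\<^bsub>A\<^esub> p = u \<odot>\<^bsub>A\<^esub> \<one>\<^bsub>A\<^esub>"
    and "e (0, 1) [^]\<^bsub>A\<^esub> p = v \<odot>\<^bsub>A\<^esub> \<one>\<^bsub>A\<^esub>"
proof -
  show m: "e (r, s) \<otimes>\<^bsub>A\<^esub> e (m, n) =
     (\<zeta> ^ (s * m) * u ^ ((r + m) div p) * v ^ ((s + n) div p)) \<odot>\<^bsub>A\<^esub> e ((r + m) mod p, (s + n) mod p)"
    if "r < p" "s < p" "m < p" "n < p" for r s m n
  proof -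
    let ?I = "{..<p} \<times> {..<p}" and ?c = "sc_const (symbol_table p \<zeta> u v)"
    have "(\<Sum>i\<in>?I. \<Sum>j\<in>?I. e (r, s) i * e (m, n) j * ?c i j k) = ?c (r, s) (m, n) k" for k
    proof -
      have "(\<Sum>i\<in>?I. \<Sum>j\<in>?I. e (r, s) i * e (m, n) j * ?c i j k) =
        (\<Sum>i\<in>?I. if i = (r, s) then (\<Sum>j\<in>?I. if j = (m, n) then ?c i j k else 0) else 0)"
      proof (intro sum.cong refl)
        fix i
        have "e (r, s) i * e (m, n) j * ?c i j k = (if i = (r, s) then (if j = (m, n) then ?c i j k else 0) else 0)" for j
          by (simp add: e_def)
        then have "(\<Sum>j\<in>?I. e (r, s) i * e (m, n) j * ?c i j k) =
            (\<Sum>j\<in>?I. if i = (r, s) then (if j = (m, n) then ?c i j k else 0) else 0)" by simp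
        also have "\<dots> = (if i = (r, s) then (\<Sum>j\<in>?I. if j = (m, n) then ?c i j k else 0) else 0)" by simp
        finally show "(\<Sum>j\<in>?I. e (r, s) i * e (m, n) j * ?c i j k) =
            (if i = (r, s) then (\<Sum>j\<in>?I. if j = (m, n) then ?c i j k else 0) else 0)" .
      qed
      also have "\<dots> = ?c (r, s) (m, n) k" using that by (simp add: sum.delta)
      finally show ?thesis .
    qed
    then have *: "(e (r, s) \<otimes>\<^bsub>A\<^esub> e (m, n)) k = (if k \<in> ?I then ?c (r, s) (m, n) k else 0)" for k
      by (simp add: A_def sc_algebra_def symbol_table_def)
    have "((r + m) mod p, (s + n) mod p) \<in> ?I" using assms(1) by simp
    then have "(e (r, s) \<otimes>\<^bsub>A\<^esub> e (m, n)) k = ((\<zeta> ^ (s * m) * u ^ ((r + m) div p) * v ^ ((s + n) div p)) \<odot>\<^bsub>A\<^esub> e ((r + m) mod p, (s + n) mod p)) k" for k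
      unfolding * by (cases "k = ((r + m) mod p, (s + n) mod p)") (simp_all add: A_def sc_algebra_def symbol_table_def e_def)
    then show ?thesis by (rule ext)
  qed
  have one: "\<one>\<^bsub>A\<^esub> = e (0, 0)"
    using assms(1) by (auto simp: A_def sc_algebra_def symbol_table_def e_def fun_eq_iff)
  have sm: "(a::'f) \<odot>\<^bsub>A\<^esub> (b \<odot>\<^bsub>A\<^esub> x) = (a * b) \<odot>\<^bsub>A\<^esub> x" "(1::'f) \<odot>\<^bsub>A\<^esub> x = x" for a b x
    by (auto simp: A_def sc_algebra_def)
  show "e (0, 1) \<otimes>\<^bsub>A\<^esub> e (1, 0) = \<zeta> \<odot>\<^bsub>A\<^esub> (e (1, 0) \<otimes>\<^bsub>A\<^esub> e (0, 1))"
    using assms(1) by (simp add: m sm)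
  have i: "e (1, 0) [^]\<^bsub>A\<^esub> n = e (n, 0)" if "n < p" for n :: nat
    using that by (induction n) (simp_all add: one m sm)
  have j: "e (0, 1) [^]\<^bsub>A\<^esub> n = e (0, n)" if "n < p" for n :: nat
    using that by (induction n) (simp_all add: one m sm)
  obtain q where q: "p = Suc q" using assms(1) by (cases p) auto
  show "e (1, 0) [^]\<^bsub>A\<^esub> p = u \<odot>\<^bsub>A\<^esub> \<one>\<^bsub>A\<^esub>"
    using i[of q] m[of q 0 1 0] assms(1) q by (simp add: one)
  show "e (0, 1) [^]\<^bsub>A\<^esub> p = v \<odot>\<^bsub>A\<^esub> \<one>\<^bsub>A\<^esub>"
    using j[of q] m[of 0 q 0 1] assms(1) q by (simp add: one)
qed

definition symbol_class :: "nat \<Rightarrow> 'f::field \<Rightarrow> 'f \<Rightarrow> 'f \<Rightarrow> (nat, 'f) sc_table set" where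
  "symbol_class p \<zeta> u v = brauer_class (sc_algebra (symbol_table p \<zeta> u v))"

text \<open>
  The element \<open>\<Sum>\<sigma>. x \<sigma> \<cdot> u\<^sub>\<sigma>\<close> of the crossed product is the function \<open>x\<close>.  The factor set \<open>c\<close>
  has its values in the base field and need not be normalized, so the unit is
  \<open>c(1,1)\<^sup>-\<^sup>1 \<cdot> u\<^sub>1\<close>.
\<close>

definition crossed_product :: "'f::field alg_closure set \<Rightarrow>
    (('f alg_closure \<Rightarrow> 'f alg_closure) \<Rightarrow> ('f alg_closure \<Rightarrow> 'f alg_closure) \<Rightarrow> 'f) \<Rightarrow>
    ('f, ('f alg_closure \<Rightarrow> 'f alg_closure) \<Rightarrow> 'f alg_closure) module" where
  "crossed_product K c = \<lparr>
     carrier = {x. \<forall>\<sigma>. if \<sigma> \<in> carrier (gal K) then x \<sigma> \<in> K else x \<sigma> = 0},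
     monoid.mult = (\<lambda>x y \<rho>. \<Sum>\<sigma>\<in>carrier (gal K). \<Sum>\<sigma>'\<in>carrier (gal K).
        if \<sigma> \<otimes>\<^bsub>gal K\<^esub> \<sigma>' = \<rho> then x \<sigma> * \<sigma> (y \<sigma>') * to_ac (c \<sigma> \<sigma>') else 0),
     one = (\<lambda>\<rho>. if \<rho> = \<one>\<^bsub>gal K\<^esub> then to_ac (inverse (c \<one>\<^bsub>gal K\<^esub> \<one>\<^bsub>gal K\<^esub>)) else 0),
     ring.zero = (\<lambda>\<rho>. 0),
     ring.add = (\<lambda>x y \<rho>. x \<rho> + y \<rho>),
     module.smult = (\<lambda>r x \<rho>. to_ac r * x \<rho>)\<rparr>"

section \<open>Embedding problems\<close>

text \<open>
  An embedding problem over \<open>K\<close> is given by a group \<open>E\<close> and the quotient map \<open>q\<close> from \<open>E\<close> onto the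
  Galois group of \<open>K\<close>.
\<close>

definition embedding_problem_solvable :: "'f::field alg_closure set \<Rightarrow> 'e monoid \<Rightarrow>
    ('e \<Rightarrow> ('f alg_closure \<Rightarrow> 'f alg_closure)) \<Rightarrow> bool" where
  "embedding_problem_solvable K E q \<longleftrightarrow>
     (\<exists>L. galois_extension L \<and> K \<subseteq> L \<and>
       (\<exists>\<phi> \<in> iso (gal L) E. \<forall>\<sigma> \<in> carrier (gal L). q (\<phi> \<sigma>) = restrict \<sigma> K))"

text \<open>The kernel is generated by \<open>t\<close> and is identified with the roots of unity by \<open>t \<mapsto> \<zeta>\<close>.\<close>

definition factor_set :: "'f::field alg_closure set \<Rightarrow> 'e monoid \<Rightarrow>
    ('e \<Rightarrow> ('f alg_closure \<Rightarrow> 'f alg_closure)) \<Rightarrow> 'e \<Rightarrow> 'f \<Rightarrow>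
    (('f alg_closure \<Rightarrow> 'f alg_closure) \<Rightarrow> ('f alg_closure \<Rightarrow> 'f alg_closure) \<Rightarrow> 'f) \<Rightarrow> bool" where
  "factor_set K E q t \<zeta> c \<longleftrightarrow>
     (\<exists>s. (\<forall>\<sigma> \<in> carrier (gal K). s \<sigma> \<in> carrier E \<and> q (s \<sigma>) = \<sigma>) \<and>
       (\<forall>\<sigma> \<in> carrier (gal K). \<forall>\<sigma>' \<in> carrier (gal K). \<exists>n::nat.
          c \<sigma> \<sigma>' = \<zeta> ^ n \<and> s \<sigma> \<otimes>\<^bsub>E\<^esub> s \<sigma>' = t [^]\<^bsub>E\<^esub> n \<otimes>\<^bsub>E\<^esub> s (\<sigma> \<otimes>\<^bsub>gal K\<^esub> \<sigma>')))"

definition is_obstruction :: "'f::field alg_closure set \<Rightarrow> 'e monoid \<Rightarrow>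
    ('e \<Rightarrow> ('f alg_closure \<Rightarrow> 'f alg_closure)) \<Rightarrow> 'e \<Rightarrow> 'f \<Rightarrow> (nat, 'f) sc_table set \<Rightarrow> bool" where
  "is_obstruction K E q t \<zeta> \<beta> \<longleftrightarrow>
     (\<exists>c. factor_set K E q t \<zeta> c \<and> \<beta> = brauer_class (crossed_product K c))"

section \<open>The central product of two Heisenberg groups\<close>

text \<open>The triple \<open>(x, y, z)\<close> is the matrix with rows \<open>1 x z\<close>, \<open>0 1 y\<close>, \<open>0 0 1\<close> modulo \<open>p\<close>.\<close>

definition heisenberg :: "nat \<Rightarrow> (int \<times> int \<times> int) monoid" where
  "heisenberg p = \<lparr>
     carrier = {0..<int p} \<times> {0..<int p} \<times> {0..<int p},
     monoid.mult = (\<lambda>(x, y, z) (x', y', z').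
        ((x + x') mod int p, (y + y') mod int p, (z + z' + x * y') mod int p)),
     one = (0, 0, 0)\<rparr>"

definition group_center :: "('g, 'm) monoid_scheme \<Rightarrow> 'g set" where
  "group_center G = {z \<in> carrier G. \<forall>g \<in> carrier G. z \<otimes>\<^bsub>G\<^esub> g = g \<otimes>\<^bsub>G\<^esub> z}"

text \<open>The relations imposed on the direct product identify each central \<open>z\<close> with \<open>\<phi> z\<close>.\<close>

definition central_product_kernel ::
    "('g, 'm) monoid_scheme \<Rightarrow> ('h, 'n) monoid_scheme \<Rightarrow> ('g \<Rightarrow> 'h) \<Rightarrow> ('g \<times> 'h) set" where
  "central_product_kernel G H \<phi> = (\<lambda>z. (z, inv\<^bsub>H\<^esub> (\<phi> z))) ` group_center G"

definition central_product ::
    "('g, 'm) monoid_scheme \<Rightarrow> ('h, 'n) monoid_scheme \<Rightarrow> ('g \<Rightarrow> 'h) \<Rightarrow> ('g \<times> 'h) set monoid" where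
  "central_product G H \<phi> = (G \<times>\<times> H) Mod central_product_kernel G H \<phi>"

type_synonym ep_elem = "((int \<times> int \<times> int) \<times> (int \<times> int \<times> int)) set"

text \<open>The centers are identified with opposite orientation, that is, by inversion.\<close>

definition Ep :: "nat \<Rightarrow> ep_elem monoid" where
  "Ep p = central_product (heisenberg p) (heisenberg p) (m_inv (heisenberg p))"

abbreviation ep_cover :: "nat \<Rightarrow> ((int \<times> int \<times> int) \<times> (int \<times> int \<times> int)) monoid" where
  "ep_cover p \<equiv> heisenberg p \<times>\<times> heisenberg p"

abbreviation ep_kernel :: "nat \<Rightarrow> ep_elem" where
  "ep_kernel p \<equiv> central_product_kernel (heisenberg p) (heisenberg p) (m_inv (heisenberg p))"

definition ep_class :: "nat \<Rightarrow> int \<times> int \<times> int \<Rightarrow> int \<times> int \<times> int \<Rightarrow> ep_elem" where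
  "ep_class p g h = ep_kernel p #>\<^bsub>ep_cover p\<^esub> (g, h)"

definition ep_a :: "nat \<Rightarrow> ep_elem" where "ep_a p = ep_class p (1, 0, 0) (0, 0, 0)"
definition ep_b :: "nat \<Rightarrow> ep_elem" where "ep_b p = ep_class p (0, 1, 0) (0, 0, 0)"
definition ep_c :: "nat \<Rightarrow> ep_elem" where "ep_c p = ep_class p (0, 0, 0) (1, 0, 0)"
definition ep_d :: "nat \<Rightarrow> ep_elem" where "ep_d p = ep_class p (0, 0, 0) (0, 1, 0)"
definition ep_tau :: "nat \<Rightarrow> ep_elem" where "ep_tau p = ep_class p (0, 0, 1) (0, 0, 0)"

definition Cp4 :: "nat \<Rightarrow> (int \<times> int \<times> int \<times> int) monoid" where
  "Cp4 p = integer_mod_group p \<times>\<times> integer_mod_group p \<times>\<times> integer_mod_group p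
     \<times>\<times> integer_mod_group p"

definition group_commutator :: "('g, 'm) monoid_scheme \<Rightarrow> 'g \<Rightarrow> 'g \<Rightarrow> 'g" where
  "group_commutator G g h = inv\<^bsub>G\<^esub> g \<otimes>\<^bsub>G\<^esub> inv\<^bsub>G\<^esub> h \<otimes>\<^bsub>G\<^esub> g \<otimes>\<^bsub>G\<^esub> h"

text \<open>
  The lemmas up to \<open>Ep_relations\<close> and \<open>Ep_generated\<close> show that this group has order \<open>p\<^sup>5\<close> and
  satisfies the usual presentation in the five given generators.
\<close>

lemma heisenberg_simps [simp]:
  "(x, y, z) \<in> carrier (heisenberg p) \<longleftrightarrow>
     x \<in> {0..<int p} \<and> y \<in> {0..<int p} \<and> z \<in> {0..<int p}"
  "(x, y, z) \<otimes>\<^bsub>heisenberg p\<^esub> (x', y', z') =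
     ((x + x') mod int p, (y + y') mod int p, (z + z' + x * y') mod int p)"
  "\<one>\<^bsub>heisenberg p\<^esub> = (0, 0, 0)"
  by (auto simp: heisenberg_def)

lemma heisenberg_assoc_aux:
  fixes p :: int
  shows "((z + z' + x * y') mod p + z'' + ((x + x') mod p) * y'') mod p =
    (z + (z' + z'' + x' * y'') mod p + x * ((y' + y'') mod p)) mod p"
proof -
  have e: "u mod p = u + p * (- (u div p))" for u
    by (simp add: minus_mult_div_eq_mod)
  define k1 k2 k3 k4 where "k1 = - ((z + z' + x * y') div p)" "k2 = - ((x + x') div p)"
    "k3 = - ((z' + z'' + x' * y'') div p)" "k4 = - ((y' + y'') div p)"
  show ?thesis
    unfolding mod_eq_dvd_iff e[of "z + z' + x * y'"] e[of "x + x'"] e[of "z' + z'' + x' * y''"]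
      e[of "y' + y''"] k1_k2_k3_k4_def[symmetric]
    by (rule dvdI[of _ _ "k1 + k2 * y'' - k3 - x * k4"]) (simp add: algebra_simps)
qed

lemma heisenberg_inv_aux:
  fixes p :: int
  shows "((x * y - z) mod p + z + ((- x) mod p) * y) mod p = 0"
proof -
  have e: "u mod p = u + p * (- (u div p))" for u
    by (simp add: minus_mult_div_eq_mod)
  define k1 k2 where "k1 = - ((x * y - z) div p)" "k2 = - ((- x) div p)"
  show ?thesis
    unfolding mod_eq_0_iff_dvd e[of "x * y - z"] e[of "- x"] k1_k2_def[symmetric]
    by (rule dvdI[of _ _ "k1 + k2 * y"]) (simp add: algebra_simps)
qed

lemma group_heisenberg:
  assumes "p > 0"
  shows "group (heisenberg p)"
proof (rule groupI)
  fix x y z assume "x \<in> carrier (heisenberg p)" "y \<in> carrier (heisenberg p)" "z \<in> carrier (heisenberg p)"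
  then show "x \<otimes>\<^bsub>heisenberg p\<^esub> y \<otimes>\<^bsub>heisenberg p\<^esub> z = x \<otimes>\<^bsub>heisenberg p\<^esub> (y \<otimes>\<^bsub>heisenberg p\<^esub> z)"
    by (cases x; cases y; cases z; simp only: heisenberg_simps heisenberg_assoc_aux)
       (simp add: mod_simps add.assoc)
next
  fix x assume "x \<in> carrier (heisenberg p)"
  moreover obtain u v w where "x = (u, v, w)" by (cases x)
  ultimately show "\<exists>y\<in>carrier (heisenberg p). y \<otimes>\<^bsub>heisenberg p\<^esub> x = \<one>\<^bsub>heisenberg p\<^esub>"
    using assms
    by (intro bexI[of _ "((- u) mod int p, (- v) mod int p, (u * v - w) mod int p)"])
       (simp_all add: mod_simps heisenberg_inv_aux)
next
  fix x y assume "x \<in> carrier (heisenberg p)" "y \<in> carrier (heisenberg p)"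
  then show "x \<otimes>\<^bsub>heisenberg p\<^esub> y \<in> carrier (heisenberg p)"
    using assms by (cases x; cases y) simp
next
  fix x assume "x \<in> carrier (heisenberg p)"
  then show "\<one>\<^bsub>heisenberg p\<^esub> \<otimes>\<^bsub>heisenberg p\<^esub> x = x" by (cases x) simp
qed (use assms in simp)

lemma heisenberg_inv:
  assumes "(x, y, z) \<in> carrier (heisenberg p)"
  shows "inv\<^bsub>heisenberg p\<^esub> (x, y, z) = ((- x) mod int p, (- y) mod int p, (x * y - z) mod int p)"
proof -
  have "p > 0" using assms by auto
  then show ?thesis
    using assms by (intro group.inv_equality[OF group_heisenberg])
       (simp_all add: mod_simps heisenberg_inv_aux)
qed

lemma heisenberg_pow:
  assumes "x * y = 0"
  shows "(x, y, z) [^]\<^bsub>heisenberg p\<^esub> (n::nat) =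
    ((int n * x) mod int p, (int n * y) mod int p, (int n * z) mod int p)"
proof (induction n)
  case (Suc n)
  have 1: "((int n * x) mod int p * y) mod int p = 0"
    using assms by (auto simp: mod_mult_left_eq mult.assoc)
  have "((int n * z) mod int p + z + (int n * x) mod int p * y) mod int p =
      ((int n * z) mod int p + z + ((int n * x) mod int p * y) mod int p) mod int p"
    by (simp only: mod_add_right_eq)
  then have "((int n * z) mod int p + z + (int n * x) mod int p * y) mod int p = (int n * z + z) mod int p"
    unfolding 1 by (simp add: mod_simps)
  then show ?case
    by (simp only: nat_pow_Suc Suc heisenberg_simps) (simp add: mod_simps distrib_right add.commute)
qed simp

lemma heisenberg_center:
  assumes "p > 1"
  shows "group_center (heisenberg p) = {0} \<times> {0} \<times> {0..<int p}"
proof (intro equalityI subsetI)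
  fix g assume g: "g \<in> group_center (heisenberg p)"
  obtain x y z where xyz: "g = (x, y, z)" by (cases g)
  have "g \<otimes>\<^bsub>heisenberg p\<^esub> (1, 0, 0) = (1, 0, 0) \<otimes>\<^bsub>heisenberg p\<^esub> g"
       "g \<otimes>\<^bsub>heisenberg p\<^esub> (0, 1, 0) = (0, 1, 0) \<otimes>\<^bsub>heisenberg p\<^esub> g"
       "g \<in> carrier (heisenberg p)"
    using g assms by (auto simp: group_center_def)
  then have "(z + y) mod int p = z mod int p" "(z + x) mod int p = z mod int p"
      "0 \<le> x" "x < int p" "0 \<le> y" "y < int p" "0 \<le> z" "z < int p"
    using xyz by auto
  moreover from this have "int p dvd y" "int p dvd x"
    by (auto simp only: mod_eq_dvd_iff add_diff_cancel_left')
  ultimately have "x = 0" "y = 0"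
    by (auto dest: zdvd_not_zless simp: order_le_less)
  then show "g \<in> {0} \<times> {0} \<times> {0..<int p}"
    using xyz \<open>0 \<le> z\<close> \<open>z < int p\<close> by auto
qed (use assms in \<open>auto simp: group_center_def add.commute\<close>)

lemma ep_kernel_eq:
  assumes "p > 1"
  shows "ep_kernel p =
    (\<lambda>z. ((0, 0, z), (0, 0, z))) ` {0..<int p}" (is "?N = _")
proof -
  have "inv\<^bsub>heisenberg p\<^esub> (inv\<^bsub>heisenberg p\<^esub> z) = z" if "z \<in> group_center (heisenberg p)" for z
    using that assms group.inv_inv[OF group_heisenberg, of p z] by (simp add: group_center_def)
  then have "?N = (\<lambda>z. (z, z)) ` group_center (heisenberg p)"
    unfolding central_product_kernel_def by (intro image_cong) auto
  then show ?thesis using heisenberg_center[OF assms] by force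
qed

lemma group_ep_cover: "p > 1 \<Longrightarrow> group (ep_cover p)"
  by (intro DirProd_group group_heisenberg) auto

lemma ep_kernel_subgroup:
  assumes "p > 1" shows "subgroup (ep_kernel p) (ep_cover p)"
proof -
  interpret group "ep_cover p" using group_ep_cover assms .
  show ?thesis
  proof (rule subgroupI)
    fix g assume "g \<in> ep_kernel p"
    then obtain z where z: "0 \<le> z" "z < int p" "g = ((0,0,z),(0,0,z))" unfolding ep_kernel_eq[OF assms] by auto
    then have "inv\<^bsub>ep_cover p\<^esub> g = ((0,0,(-z) mod int p),(0,0,(-z) mod int p))"
      using assms by (simp add: inv_DirProd group_heisenberg heisenberg_inv)
    then show "inv\<^bsub>ep_cover p\<^esub> g \<in> ep_kernel p" using assms by (simp add: ep_kernel_eq)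
  qed (use assms in \<open>auto simp: ep_kernel_eq\<close>)
qed

lemma ep_kernel_normal:
  assumes "p > 1" shows "ep_kernel p \<lhd> ep_cover p"
proof -
  interpret group "ep_cover p" using group_ep_cover assms .
  have c: "g \<otimes>\<^bsub>ep_cover p\<^esub> n = n \<otimes>\<^bsub>ep_cover p\<^esub> g" if "g \<in> carrier (ep_cover p)" "n \<in> ep_kernel p" for g n
    using that assms by (auto simp: ep_kernel_eq add.commute)
  show ?thesis
  proof (rule normal_invI[OF ep_kernel_subgroup[OF assms]])
    fix x h assume h: "x \<in> carrier (ep_cover p)" "h \<in> ep_kernel p"
    then have "h \<in> carrier (ep_cover p)" using subgroup.mem_carrier[OF ep_kernel_subgroup[OF assms]] by blast
    then have "x \<otimes>\<^bsub>ep_cover p\<^esub> h \<otimes>\<^bsub>ep_cover p\<^esub> inv\<^bsub>ep_cover p\<^esub> x = h" using h(1)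
      by (simp only: c[OF h] inv_solve_right' m_closed)
    then show "x \<otimes>\<^bsub>ep_cover p\<^esub> h \<otimes>\<^bsub>ep_cover p\<^esub> inv\<^bsub>ep_cover p\<^esub> x \<in> ep_kernel p" using h by simp
  qed
qed

lemma group_Ep:
  assumes "p > 1" shows "group (Ep p)"
  unfolding Ep_def central_product_def by (rule normal.factorgroup_is_group[OF ep_kernel_normal[OF assms]])

lemma order_Ep:
  assumes "p > 1" shows "Coset.order (Ep p) = p ^ 5"
proof -
  have "Coset.order (ep_cover p) = p ^ 6"
    by (simp add: Coset.order_def heisenberg_def DirProd_def card_cartesian_product eval_nat_numeral)
  moreover have "card (ep_kernel p) = p"
    unfolding ep_kernel_eq[OF assms] by (subst card_image) (auto intro: inj_onI)
  moreover have "Coset.order (Ep p) = card (rcosets\<^bsub>ep_cover p\<^esub> ep_kernel p)"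
    by (simp add: Coset.order_def Ep_def central_product_def FactGroup_def)
  ultimately have "Coset.order (Ep p) * p = p ^ 5 * p"
    using group.lagrange[OF group_ep_cover[OF assms] ep_kernel_subgroup[OF assms]] by (simp add: eval_nat_numeral mult.assoc)
  then show ?thesis using assms by simp
qed

lemma ep_class_hom:
  assumes "p > 1" shows "(\<lambda>x. ep_class p (fst x) (snd x)) \<in> hom (ep_cover p) (Ep p)"
  using normal.r_coset_hom_Mod[OF ep_kernel_normal[OF assms]]
  by (simp add: ep_class_def[abs_def] Ep_def central_product_def)

lemma ep_class_mult:
  assumes "p > 1" "(g, h) \<in> carrier (ep_cover p)" "(g', h') \<in> carrier (ep_cover p)"
  shows "ep_class p g h \<otimes>\<^bsub>Ep p\<^esub> ep_class p g' h' =
    ep_class p (g \<otimes>\<^bsub>heisenberg p\<^esub> g') (h \<otimes>\<^bsub>heisenberg p\<^esub> h')"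
  using hom_mult[OF ep_class_hom[OF assms(1)] assms(2,3)] by simp

lemma ep_class_closed:
  assumes "p > 1" "(g, h) \<in> carrier (ep_cover p)"
  shows "ep_class p g h \<in> carrier (Ep p)"
  using hom_in_carrier[OF ep_class_hom[OF assms(1)] assms(2)] by simp

lemma ep_class_one: "ep_class p (0,0,0) (0,0,0) = \<one>\<^bsub>Ep p\<^esub>" if "p > 1"
  using hom_one[OF ep_class_hom[OF that] group_ep_cover[OF that] group_Ep[OF that]] by simp

lemma ep_class_pow:
  assumes "p > 1" "(g, h) \<in> carrier (ep_cover p)"
  shows "ep_class p g h [^]\<^bsub>Ep p\<^esub> (n::nat) = ep_class p (g [^]\<^bsub>heisenberg p\<^esub> n) (h [^]\<^bsub>heisenberg p\<^esub> n)"
proof -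
  have h: "heisenberg p = heisenberg p" ..
  interpret H: group "heisenberg p" using assms by (intro group_heisenberg) simp
  interpret E: group "Ep p" using assms by (intro group_Ep)
  show ?thesis
    by (induction n) (use assms in \<open>simp_all add: ep_class_one[simplified] ep_class_mult\<close>)
qed

lemma group_commutator_eqI:
  assumes "group G" "g \<in> carrier G" "h \<in> carrier G" "t \<in> carrier G"
   "g \<otimes>\<^bsub>G\<^esub> h = h \<otimes>\<^bsub>G\<^esub> g \<otimes>\<^bsub>G\<^esub> t"
  shows "group_commutator G g h = t"
proof -
  interpret group G by fact
  have "group_commutator G g h = inv\<^bsub>G\<^esub> g \<otimes>\<^bsub>G\<^esub> inv\<^bsub>G\<^esub> h \<otimes>\<^bsub>G\<^esub> (g \<otimes>\<^bsub>G\<^esub> h)" using assms by (simp add: group_commutator_def m_assoc)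
  also have "\<dots> = inv\<^bsub>G\<^esub> (h \<otimes>\<^bsub>G\<^esub> g) \<otimes>\<^bsub>G\<^esub> (h \<otimes>\<^bsub>G\<^esub> g \<otimes>\<^bsub>G\<^esub> t)" using assms by (simp add: inv_mult_group)
  also have "\<dots> = (inv\<^bsub>G\<^esub> (h \<otimes>\<^bsub>G\<^esub> g) \<otimes>\<^bsub>G\<^esub> (h \<otimes>\<^bsub>G\<^esub> g)) \<otimes>\<^bsub>G\<^esub> t"
    using assms(2-4) by (intro m_assoc[symmetric]) auto
  also have "\<dots> = t" using assms(2-4) by (subst l_inv) auto
  finally show ?thesis .
qed

lemma ep_tau_inv:
  assumes "p > 1" shows "inv\<^bsub>Ep p\<^esub> ep_tau p = ep_class p (0,0,0) (0,0,1)"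
proof -
  interpret E: group "Ep p" using assms by (intro group_Ep)
  have N: "((0,0,1),(0,0,1)) \<in> ep_kernel p" unfolding ep_kernel_eq[OF assms] using assms by auto
  have "ep_class p (0,0,1) (0,0,1) = ep_kernel p"
    unfolding ep_class_def
    using group.coset_join2[OF group_ep_cover[OF assms] _ ep_kernel_subgroup[OF assms] N] assms by simp
  also have "ep_kernel p = \<one>\<^bsub>Ep p\<^esub>" by (simp add: Ep_def central_product_def)
  finally have "ep_class p (0,0,0) (0,0,1) \<otimes>\<^bsub>Ep p\<^esub> ep_tau p = \<one>\<^bsub>Ep p\<^esub>"
    using assms by (simp add: ep_tau_def ep_class_mult)
  then show ?thesis using assms
    by (intro E.inv_equality) (auto simp: ep_tau_def intro!: ep_class_closed)
qed

lemma ep_cases: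
  assumes "p > 1" "w \<in> carrier (Ep p)"
  obtains g h where "(g, h) \<in> carrier (ep_cover p)" "w = ep_class p g h"
proof -
  have "w \<in> rcosets\<^bsub>ep_cover p\<^esub> ep_kernel p"
    using assms(2) by (simp add: Ep_def central_product_def FactGroup_def)
  then obtain u where u: "u \<in> carrier (ep_cover p)" "w = ep_kernel p #>\<^bsub>ep_cover p\<^esub> u"
    unfolding RCOSETS_def by blast
  show thesis
    by (rule that[of "fst u" "snd u"]) (use u in \<open>simp_all only: prod.collapse ep_class_def\<close>)
qed

lemma Ep_relations:
  assumes "p > 1"
  shows "ep_a p [^]\<^bsub>Ep p\<^esub> p = \<one>\<^bsub>Ep p\<^esub>" "ep_b p [^]\<^bsub>Ep p\<^esub> p = \<one>\<^bsub>Ep p\<^esub>"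
    "ep_c p [^]\<^bsub>Ep p\<^esub> p = \<one>\<^bsub>Ep p\<^esub>" "ep_d p [^]\<^bsub>Ep p\<^esub> p = \<one>\<^bsub>Ep p\<^esub>"
    "ep_tau p [^]\<^bsub>Ep p\<^esub> p = \<one>\<^bsub>Ep p\<^esub>"
    "ep_tau p \<in> group_center (Ep p)"
    "group_commutator (Ep p) (ep_a p) (ep_b p) = ep_tau p"
    "group_commutator (Ep p) (ep_c p) (ep_d p) = inv\<^bsub>Ep p\<^esub> ep_tau p"
    "group_commutator (Ep p) (ep_a p) (ep_c p) = \<one>\<^bsub>Ep p\<^esub>" "group_commutator (Ep p) (ep_a p) (ep_d p) = \<one>\<^bsub>Ep p\<^esub>"
    "group_commutator (Ep p) (ep_b p) (ep_c p) = \<one>\<^bsub>Ep p\<^esub>" "group_commutator (Ep p) (ep_b p) (ep_d p) = \<one>\<^bsub>Ep p\<^esub>"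
proof -
  note gens = ep_a_def ep_b_def ep_c_def ep_d_def ep_tau_def
  note s = ep_class_pow heisenberg_pow ep_class_mult ep_class_closed
  show "ep_a p [^]\<^bsub>Ep p\<^esub> p = \<one>\<^bsub>Ep p\<^esub>" "ep_b p [^]\<^bsub>Ep p\<^esub> p = \<one>\<^bsub>Ep p\<^esub>"
    "ep_c p [^]\<^bsub>Ep p\<^esub> p = \<one>\<^bsub>Ep p\<^esub>" "ep_d p [^]\<^bsub>Ep p\<^esub> p = \<one>\<^bsub>Ep p\<^esub>"
    "ep_tau p [^]\<^bsub>Ep p\<^esub> p = \<one>\<^bsub>Ep p\<^esub>"
    using assms by (simp_all add: gens s flip: ep_class_one)
  show "group_commutator (Ep p) (ep_a p) (ep_b p) = ep_tau p"
    "group_commutator (Ep p) (ep_c p) (ep_d p) = inv\<^bsub>Ep p\<^esub> ep_tau p"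
    "group_commutator (Ep p) (ep_a p) (ep_c p) = \<one>\<^bsub>Ep p\<^esub>" "group_commutator (Ep p) (ep_a p) (ep_d p) = \<one>\<^bsub>Ep p\<^esub>"
    "group_commutator (Ep p) (ep_b p) (ep_c p) = \<one>\<^bsub>Ep p\<^esub>" "group_commutator (Ep p) (ep_b p) (ep_d p) = \<one>\<^bsub>Ep p\<^esub>"
    unfolding ep_tau_inv[OF assms]
    using assms by (intro group_commutator_eqI group_Ep; simp add: gens s flip: ep_class_one)+
  show "ep_tau p \<in> group_center (Ep p)"
  proof -
    have "ep_tau p \<otimes>\<^bsub>Ep p\<^esub> w = w \<otimes>\<^bsub>Ep p\<^esub> ep_tau p" if "w \<in> carrier (Ep p)" for w
    proof -
      obtain g h where gh: "(g, h) \<in> carrier (ep_cover p)" "w = ep_class p g h"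
        using ep_cases[OF assms \<open>w \<in> carrier (Ep p)\<close>] by metis
      obtain x y z x' y' z' where "g = (x, y, z)" "h = (x', y', z')" by (cases g; cases h)
      then show ?thesis using assms gh by (simp add: gens ep_class_mult add.commute)
    qed
    then show ?thesis using assms by (simp add: group_center_def gens s)
  qed
qed

lemma Ep_generated:
  assumes "p > 1"
  shows "generate (Ep p) {ep_a p, ep_b p, ep_c p, ep_d p, ep_tau p} = carrier (Ep p)" (is "?G = _")
proof -
  note gens = ep_a_def ep_b_def ep_c_def ep_d_def ep_tau_def
  note s = ep_class_pow heisenberg_pow ep_class_mult ep_class_closed
  interpret E: group "Ep p" using assms by (intro group_Ep)
  have sub: "{ep_a p, ep_b p, ep_c p, ep_d p, ep_tau p} \<subseteq> carrier (Ep p)"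
    using assms by (simp add: gens ep_class_closed)
  interpret G: subgroup ?G "Ep p" by (rule E.generate_is_subgroup[OF sub])
  have pow: "w [^]\<^bsub>Ep p\<^esub> n \<in> ?G" if "w \<in> ?G" for w and n :: nat
    using that by (induction n) auto
  have ti: "inv\<^bsub>Ep p\<^esub> ep_tau p \<in> ?G" by (intro G.m_inv_closed generate.incl) simp
  have "w \<in> ?G" if w: "w \<in> carrier (Ep p)" for w
  proof -
    obtain g h where gh: "(g, h) \<in> carrier (ep_cover p)" "w = ep_class p g h"
      using ep_cases[OF assms w] by metis
    obtain x0 y0 z0 x1 y1 z1 where xyz0: "g = (x0, y0, z0)" "h = (x1, y1, z1)" by (cases g; cases h)
    then obtain x y z x' y' z' :: nat
      where xyz: "g = (int x, int y, int z)" "h = (int x', int y', int z')"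
      using gh(1) that[of "nat x0" "nat y0" "nat z0" "nat x1" "nat y1" "nat z1"] by simp
    have w_eq: "w = ep_b p [^]\<^bsub>Ep p\<^esub> y \<otimes>\<^bsub>Ep p\<^esub> ep_a p [^]\<^bsub>Ep p\<^esub> x \<otimes>\<^bsub>Ep p\<^esub> ep_tau p [^]\<^bsub>Ep p\<^esub> z
       \<otimes>\<^bsub>Ep p\<^esub> ep_d p [^]\<^bsub>Ep p\<^esub> y' \<otimes>\<^bsub>Ep p\<^esub> ep_c p [^]\<^bsub>Ep p\<^esub> x' \<otimes>\<^bsub>Ep p\<^esub> (inv\<^bsub>Ep p\<^esub> ep_tau p) [^]\<^bsub>Ep p\<^esub> z'"
    proof -
      have b: "x < p" "y < p" "z < p" "x' < p" "y' < p" "z' < p" "0 < p"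
        using gh(1) assms unfolding xyz by auto
      have pw: "ep_b p [^]\<^bsub>Ep p\<^esub> y = ep_class p (0, int y, 0) (0, 0, 0)"
        "ep_a p [^]\<^bsub>Ep p\<^esub> x = ep_class p (int x, 0, 0) (0, 0, 0)"
        "ep_tau p [^]\<^bsub>Ep p\<^esub> z = ep_class p (0, 0, int z) (0, 0, 0)"
        "ep_d p [^]\<^bsub>Ep p\<^esub> y' = ep_class p (0, 0, 0) (0, int y', 0)"
        "ep_c p [^]\<^bsub>Ep p\<^esub> x' = ep_class p (0, 0, 0) (int x', 0, 0)"
        "(inv\<^bsub>Ep p\<^esub> ep_tau p) [^]\<^bsub>Ep p\<^esub> z' = ep_class p (0, 0, 0) (0, 0, int z')"
        unfolding ep_tau_inv[OF assms]
        using assms b by (simp_all add: gens ep_class_pow heisenberg_pow)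
      show ?thesis
        unfolding pw gh(2) xyz using assms b by (simp add: ep_class_mult)
    qed
    show ?thesis
      unfolding w_eq by (intro G.m_closed pow ti; rule generate.incl; simp)
  qed
  then show ?thesis using G.subset by blast
qed

end

theory Submission
  imports Defs
begin

text \<open>
  Write \<open>\<sigma> \<mapsto> u\<^sub>\<sigma>\<close> for the basis of the crossed product over \<open>K\<close>.  It contains \<open>K\<close> and an
  image of the group \<open>E\<close> of order \<open>p\<^sup>5\<close> in which the central element \<open>\<tau>\<close> is the scalar \<open>\<zeta>\<close>; products are governed by
  \<open>(k e) (k' e') = k e(k') e e'\<close>.  Let \<open>\<alpha>, \<beta>, \<gamma>, \<delta>\<close> be \<open>s\<^sub>a\<^sup>-\<^sup>1, s\<^sub>b\<^sup>-\<^sup>1, s\<^sub>c\<^sup>-\<^sup>1, s\<^sub>d\<close> and let \<open>r\<^sub>u\<close> be the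
  chosen radical of \<open>u\<close>.  The four pairs
  \<open>(\<alpha>, r\<^sub>a)\<close>, \<open>(\<gamma>, r\<^sub>c)\<close>, \<open>(r\<^sub>a \<beta>, r\<^sub>b)\<close>, \<open>(r\<^sub>d, r\<^sub>c \<delta>)\<close>
  satisfy the relations of the symbol algebras \<open>(1, a)\<close>, \<open>(1, c)\<close>, \<open>(a, b)\<close>, \<open>(d, c)\<close>, and elements of
  different pairs commute: \<open>\<alpha>\<close> and \<open>\<beta>\<close> commute up to \<open>\<tau>\<close>, which is compensated by the action of
  \<open>\<alpha>\<close> on \<open>r\<^sub>a\<close>, and similarly for \<open>\<gamma>\<close> and \<open>\<delta>\<close> (\<open>four_symbols_rep\<close>).  The tensor product of the four
  symbol algebras is simple and has the dimension \<open>p\<^sup>8\<close> of the crossed product, so that the two are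
  isomorphic (\<open>four_symbols_iso_CP\<close>).  The algebras \<open>(1, a)\<close> and \<open>(1, c)\<close> are matrix algebras, and
  \<open>(d, c)\<close> is inverse to \<open>(c, d)\<close> in the Brauer group; hence the obstruction is \<open>(a, b) - (c, d)\<close>
  (\<open>crossed_product_class\<close>).

  Solvability is compared with the obstruction through a splitting: a function \<open>f\<close> from \<open>E\<close> to the
  nonzero elements of \<open>K\<close> with \<open>f(e e') = f(e) e(f(e'))\<close> and \<open>f(\<tau>) = \<zeta>\<close>.  A solution \<open>L\<close> contains an
  eigenvector \<open>y\<close> of \<open>\<tau>\<close>, and \<open>f(e) = e(y) / y\<close> is a splitting (\<open>solvable_imp_splitting\<close>).  Conversely
  \<open>f\<^sup>p\<close> is a crossed homomorphism on the Galois group, by Hilbert's theorem 90 it is \<open>e \<mapsto> e(w) / w\<close>, and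
  adjoining a \<open>p\<close>-th root of \<open>w\<close> gives a solution; it is a proper extension of \<open>K\<close> because \<open>\<tau>\<close> is
  a commutator (\<open>splitting_imp_solvable\<close>).

  Finally a splitting exists exactly if the crossed product is a matrix algebra up to Brauer
  equivalence (\<open>splitting_iff\<close>).  A splitting lets \<open>k e\<close> act on \<open>K\<close> by \<open>x \<mapsto> k f(e) e(x)\<close>, and this
  identifies the crossed product with the \<open>F\<close>-linear endomorphisms of \<open>K\<close>.  Conversely a split crossed
  product has a module that has the same dimension as \<open>K\<close> over \<open>F\<close>, hence is one-dimensional over \<open>K\<close>,
  say \<open>K v\<close>; the equation \<open>e v = f(e) v\<close> defines a splitting (\<open>split_imp_splitting\<close>).

  Equality of Brauer classes is always reduced to explicit isomorphisms of algebras with structure constants.  The main tool for these is that a twisted group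
  algebra of an abelian group with nondegenerate commutator pairing is central simple, so that it
  is enough to exhibit generators and to count dimensions (\<open>twisted_algebra_iso\<close>).
\<close>

section \<open>Isomorphisms of algebras\<close>

lemma algebra_isosI:
  assumes "\<And>x. x \<in> carrier A \<Longrightarrow> h x \<in> carrier B"
    and "\<And>x y. x \<in> carrier A \<Longrightarrow> y \<in> carrier A \<Longrightarrow> h (x \<otimes>\<^bsub>A\<^esub> y) = h x \<otimes>\<^bsub>B\<^esub> h y"
    and "\<And>x y. x \<in> carrier A \<Longrightarrow> y \<in> carrier A \<Longrightarrow> h (x \<oplus>\<^bsub>A\<^esub> y) = h x \<oplus>\<^bsub>B\<^esub> h y"
    and "h \<one>\<^bsub>A\<^esub> = \<one>\<^bsub>B\<^esub>"
    and "\<And>r x. x \<in> carrier A \<Longrightarrow> h (r \<odot>\<^bsub>A\<^esub> x) = r \<odot>\<^bsub>B\<^esub> h x"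
    and "bij_betw h (carrier A) (carrier B)"
  shows "h \<in> algebra_isos A B"
  using assms by (auto simp: algebra_isos_def intro: ring_hom_memI)

lemma algebra_isosD:
  assumes "h \<in> algebra_isos A B"
  shows "x \<in> carrier A \<Longrightarrow> h x \<in> carrier B"
    and "x \<in> carrier A \<Longrightarrow> y \<in> carrier A \<Longrightarrow> h (x \<otimes>\<^bsub>A\<^esub> y) = h x \<otimes>\<^bsub>B\<^esub> h y"
    and "x \<in> carrier A \<Longrightarrow> y \<in> carrier A \<Longrightarrow> h (x \<oplus>\<^bsub>A\<^esub> y) = h x \<oplus>\<^bsub>B\<^esub> h y"
    and "h \<one>\<^bsub>A\<^esub> = \<one>\<^bsub>B\<^esub>"
    and "x \<in> carrier A \<Longrightarrow> h (r \<odot>\<^bsub>A\<^esub> x) = r \<odot>\<^bsub>B\<^esub> h x"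
    and "bij_betw h (carrier A) (carrier B)"
  using assms unfolding algebra_isos_def ring_hom_def by auto

definition iso_algebras :: "('f::field, 'v) module \<Rightarrow> ('f, 'w) module \<Rightarrow> bool" where
  "iso_algebras A B \<longleftrightarrow> algebra_isos A B \<noteq> {}"

lemma iso_algebrasI: "h \<in> algebra_isos A B \<Longrightarrow> iso_algebras A B"
  by (auto simp: iso_algebras_def)

lemma algebra_isos_comp:
  assumes "h \<in> algebra_isos A B" "k \<in> algebra_isos B C"
  shows "k \<circ> h \<in> algebra_isos A C"
  by (rule algebra_isosI)
    (auto simp: algebra_isosD[OF assms(1)] algebra_isosD[OF assms(2)]
      intro: bij_betw_trans[OF algebra_isosD(6)[OF assms(1)] algebra_isosD(6)[OF assms(2)]])

lemma iso_algebras_trans: "iso_algebras A B \<Longrightarrow> iso_algebras B C \<Longrightarrow> iso_algebras A C"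
  unfolding iso_algebras_def using algebra_isos_comp by fast

lemma iso_algebras_refl: "iso_algebras A A"
  by (rule iso_algebrasI[of id], rule algebra_isosI) auto

text \<open>
  Closure of the carrier under the operations is all that the inverse of an isomorphism requires, and
  it holds for every table, associative or not.
\<close>

definition closed_algebra :: "('f::field, 'v) module \<Rightarrow> bool" where
  "closed_algebra A \<longleftrightarrow> \<one>\<^bsub>A\<^esub> \<in> carrier A \<and>
     (\<forall>x\<in>carrier A. \<forall>y\<in>carrier A. x \<otimes>\<^bsub>A\<^esub> y \<in> carrier A \<and> x \<oplus>\<^bsub>A\<^esub> y \<in> carrier A) \<and>
     (\<forall>r. \<forall>x\<in>carrier A. r \<odot>\<^bsub>A\<^esub> x \<in> carrier A)"

lemma algebra_isos_inv:
  assumes "h \<in> algebra_isos A B" "closed_algebra A"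
  shows "inv_into (carrier A) h \<in> algebra_isos B A"
proof -
  note h = algebra_isosD[OF assms(1)]
  have inj: "inj_on h (carrier A)" and im: "h ` carrier A = carrier B"
    using h(6) by (auto simp: bij_betw_def)
  let ?g = "inv_into (carrier A) h"
  have g: "?g x \<in> carrier A" "h (?g x) = x" if "x \<in> carrier B" for x
    using that im by (metis inv_into_into, metis f_inv_into_f)
  have eq: "?g y = x" if "x \<in> carrier A" "h x = y" for x y
    using that inj by auto
  show ?thesis
    using assms(2) unfolding closed_algebra_def
    by (intro algebra_isosI eq bij_betw_inv_into[OF h(6)]) (auto simp: g h)
qed

lemma iso_algebras_sym: "iso_algebras A B \<Longrightarrow> closed_algebra A \<Longrightarrow> iso_algebras B A"
  unfolding iso_algebras_def using algebra_isos_inv by fast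

lemma closed_algebra_sc_algebra [simp]: "closed_algebra (sc_algebra T)"
  by (auto simp: closed_algebra_def sc_algebra_def)

lemma sc_carrier: "x \<in> carrier (sc_algebra T) \<longleftrightarrow> (\<forall>i. i \<notin> sc_index T \<longrightarrow> x i = 0)"
  by (simp add: sc_algebra_def)

lemma sc_mult: "(x \<otimes>\<^bsub>sc_algebra T\<^esub> y) k = (if k \<in> sc_index T
    then \<Sum>i\<in>sc_index T. \<Sum>j\<in>sc_index T. x i * y j * sc_const T i j k else 0)"
  by (simp add: sc_algebra_def)

lemma sc_one: "\<one>\<^bsub>sc_algebra T\<^esub> k = (if k \<in> sc_index T then sc_unit T k else 0)"
  by (simp add: sc_algebra_def)

lemma sc_linear [simp]: "\<zero>\<^bsub>sc_algebra T\<^esub> = (\<lambda>k. 0)" "x \<oplus>\<^bsub>sc_algebra T\<^esub> y = (\<lambda>k. x k + y k)"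
    "r \<odot>\<^bsub>sc_algebra T\<^esub> x = (\<lambda>k. r * x k)"
  by (simp_all add: sc_algebra_def)

lemma abelian_group_sc_algebra: "abelian_group (sc_algebra T)"
proof (rule abelian_groupI)
  fix x assume "x \<in> carrier (sc_algebra T)"
  then show "\<exists>y\<in>carrier (sc_algebra T). y \<oplus>\<^bsub>sc_algebra T\<^esub> x = \<zero>\<^bsub>sc_algebra T\<^esub>"
    by (intro bexI[of _ "\<lambda>k. - x k"]) (auto simp: sc_carrier)
qed (auto simp: sc_carrier add.assoc add.commute)

lemma finsum_sc_algebra:
  assumes "finite B" "\<And>b. b \<in> B \<Longrightarrow> f b \<in> carrier (sc_algebra T)"
  shows "finsum (sc_algebra T) f B = (\<lambda>k. \<Sum>b\<in>B. f b k)"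
proof -
  interpret abelian_group "sc_algebra T" by (rule abelian_group_sc_algebra)
  show ?thesis using assms by (induction B rule: finite_induct) (auto simp: Pi_def)
qed

text \<open>
  An isomorphism given by a bijection of the bases.  It is stated as a pullback of coordinates,
  which does not involve the inverse bijection.
\<close>

lemma iso_algebras_relabel:
  assumes f: "bij_betw f (sc_index S) (sc_index T)"
    and c: "\<And>i j k. i \<in> sc_index S \<Longrightarrow> j \<in> sc_index S \<Longrightarrow> k \<in> sc_index S \<Longrightarrow>
          sc_const T (f i) (f j) (f k) = sc_const S i j k"
    and u: "\<And>k. k \<in> sc_index S \<Longrightarrow> sc_unit T (f k) = sc_unit S k"
  shows "iso_algebras (sc_algebra S) (sc_algebra T)" "iso_algebras (sc_algebra T) (sc_algebra S)"
proof -
  let ?h = "\<lambda>x i. if i \<in> sc_index S then x (f i) else 0"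
  have fS: "f i \<in> sc_index T" if "i \<in> sc_index S" for i using f that by (auto simp: bij_betw_def)
  have "?h \<in> algebra_isos (sc_algebra T) (sc_algebra S)"
  proof (rule algebra_isosI)
    fix x y :: "'b \<Rightarrow> 'c"
    show "?h (x \<otimes>\<^bsub>sc_algebra T\<^esub> y) = ?h x \<otimes>\<^bsub>sc_algebra S\<^esub> ?h y"
    proof
      fix k
      show "?h (x \<otimes>\<^bsub>sc_algebra T\<^esub> y) k = (?h x \<otimes>\<^bsub>sc_algebra S\<^esub> ?h y) k"
      proof (cases "k \<in> sc_index S")
        case True
        have "(\<Sum>i\<in>sc_index T. \<Sum>j\<in>sc_index T. x i * y j * sc_const T i j (f k)) =
            (\<Sum>i\<in>sc_index S. \<Sum>j\<in>sc_index S. x (f i) * y (f j) * sc_const T (f i) (f j) (f k))"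
          by (simp add: sum.reindex_bij_betw[OF f, symmetric])
        also have "\<dots> = (\<Sum>i\<in>sc_index S. \<Sum>j\<in>sc_index S. x (f i) * y (f j) * sc_const S i j k)"
          using True by (intro sum.cong refl) (simp add: c)
        also have "\<dots> = (\<Sum>i\<in>sc_index S. \<Sum>j\<in>sc_index S. ?h x i * ?h y j * sc_const S i j k)"
          by (intro sum.cong refl) simp
        finally show ?thesis using True fS by (simp add: sc_mult)
      qed (simp add: sc_mult)
    qed
  next
    show "bij_betw ?h (carrier (sc_algebra T)) (carrier (sc_algebra S))"
    proof (rule bij_betw_byWitness[where f' = "\<lambda>x i. if i \<in> sc_index T then x (inv_into (sc_index S) f i) else 0"])
      show "\<forall>x\<in>carrier (sc_algebra T). (\<lambda>i. if i \<in> sc_index T then ?h x (inv_into (sc_index S) f i) else 0) = x"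
        using f by (auto simp: sc_carrier fun_eq_iff bij_betw_def inv_into_into f_inv_into_f)
      show "\<forall>x\<in>carrier (sc_algebra S). ?h (\<lambda>i. if i \<in> sc_index T then x (inv_into (sc_index S) f i) else 0) = x"
        using f fS by (auto simp: sc_carrier fun_eq_iff bij_betw_def)
    qed (auto simp: sc_carrier)
  qed (auto simp: sc_carrier sc_one u fS)
  then show "iso_algebras (sc_algebra T) (sc_algebra S)" by (rule iso_algebrasI)
  then show "iso_algebras (sc_algebra S) (sc_algebra T)" by (rule iso_algebras_sym) simp
qed

section \<open>Tensor products of tables\<close>

lemma sc_index_tensor [simp]: "sc_index (sc_tensor S T) = sc_index S \<times> sc_index T"
  by (simp add: sc_tensor_def)

lemma sc_const_tensor [simp]:
    "sc_const (sc_tensor S T) (i, i') (j, j') (k, k') = sc_const S i j k * sc_const T i' j' k'"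
  and sc_unit_tensor [simp]: "sc_unit (sc_tensor S T) (k, k') = sc_unit S k * sc_unit T k'"
  by (simp_all add: sc_tensor_def)

lemma iso_tensor_assoc:
  "iso_algebras (sc_algebra (sc_tensor (sc_tensor S T) U)) (sc_algebra (sc_tensor S (sc_tensor T U)))"
  "iso_algebras (sc_algebra (sc_tensor S (sc_tensor T U))) (sc_algebra (sc_tensor (sc_tensor S T) U))"
proof -
  have "bij_betw (\<lambda>((i, j), k). (i, (j, k))) (sc_index (sc_tensor (sc_tensor S T) U)) (sc_index (sc_tensor S (sc_tensor T U)))"
    by (rule bij_betw_byWitness[where f' = "\<lambda>(i, (j, k)). ((i, j), k)"]) auto
  from iso_algebras_relabel[OF this]
  show "iso_algebras (sc_algebra (sc_tensor (sc_tensor S T) U)) (sc_algebra (sc_tensor S (sc_tensor T U)))"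
    "iso_algebras (sc_algebra (sc_tensor S (sc_tensor T U))) (sc_algebra (sc_tensor (sc_tensor S T) U))"
    by (auto simp: mult.assoc)
qed

lemma iso_tensor_commute:
  "iso_algebras (sc_algebra (sc_tensor S T)) (sc_algebra (sc_tensor T S))"
proof -
  have "bij_betw prod.swap (sc_index (sc_tensor S T)) (sc_index (sc_tensor T S))"
    by (auto simp: bij_betw_def product_swap)
  from iso_algebras_relabel(1)[OF this] show ?thesis by (auto simp: mult.commute)
qed

lemma algebra_isos_sum:
  assumes "h \<in> algebra_isos (sc_algebra S) (sc_algebra S')" "\<And>a. a \<in> A \<Longrightarrow> f a \<in> carrier (sc_algebra S)"
  shows "h (\<lambda>k. \<Sum>a\<in>A. r a * f a k) = (\<lambda>k. \<Sum>a\<in>A. r a * h (f a) k)"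
proof -
  note h = algebra_isosD[OF assms(1)]
  have h0: "h (\<lambda>k. 0) = (\<lambda>k. 0)"
    using h(5)[of "\<lambda>k. 0" 0] by (simp add: sc_carrier)
  show ?thesis
    using assms(2)
  proof (induction A rule: infinite_finite_induct)
    case (insert a A)
    have "h (\<lambda>k. r a * f a k + (\<Sum>a\<in>A. r a * f a k)) = (\<lambda>k. h (\<lambda>k. r a * f a k) k + h (\<lambda>k. \<Sum>a\<in>A. r a * f a k) k)"
      using h(3)[of "\<lambda>k. r a * f a k" "\<lambda>k. \<Sum>a\<in>A. r a * f a k"] insert.prems
      by (auto simp: sc_carrier)
    moreover have "h (\<lambda>k. r a * f a k) = (\<lambda>k. r a * h (f a) k)"
      using h(5)[of "f a" "r a"] insert.prems by simp
    ultimately show ?case using insert by simp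
  qed (simp_all add: h0)
qed

text \<open>
  For fixed \<open>t\<close> the slice of an element of the tensor product is an element of the first factor,
  and the slices of a product are combinations of products of slices.
\<close>

lemma sc_tensor_mult_slice:
  "(x \<otimes>\<^bsub>sc_algebra (sc_tensor S T)\<^esub> y) (k, t) = (if t \<in> sc_index T then
     (\<Sum>(u, v)\<in>sc_index T \<times> sc_index T. sc_const T u v t *
        ((\<lambda>i. x (i, u)) \<otimes>\<^bsub>sc_algebra S\<^esub> (\<lambda>i. y (i, v))) k) else 0)"
proof (cases "k \<in> sc_index S \<and> t \<in> sc_index T")
  case True
  let ?S = "sc_index S" and ?T = "sc_index T"
  have "(x \<otimes>\<^bsub>sc_algebra (sc_tensor S T)\<^esub> y) (k, t) =
     (\<Sum>i\<in>?S. \<Sum>u\<in>?T. \<Sum>j\<in>?S. \<Sum>v\<in>?T. x (i, u) * y (j, v) * (sc_const S i j k * sc_const T u v t))"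
    using True by (simp add: sc_mult sum.cartesian_product')
  also have "\<dots> = (\<Sum>u\<in>?T. \<Sum>i\<in>?S. \<Sum>v\<in>?T. \<Sum>j\<in>?S. x (i, u) * y (j, v) * (sc_const S i j k * sc_const T u v t))"
    by (subst sum.swap) (intro sum.cong refl sum.swap)
  also have "\<dots> = (\<Sum>u\<in>?T. \<Sum>v\<in>?T. \<Sum>i\<in>?S. \<Sum>j\<in>?S. x (i, u) * y (j, v) * (sc_const S i j k * sc_const T u v t))"
    by (intro sum.cong refl sum.swap)
  also have "\<dots> = (\<Sum>u\<in>?T. \<Sum>v\<in>?T. sc_const T u v t * (\<Sum>i\<in>?S. \<Sum>j\<in>?S. x (i, u) * y (j, v) * sc_const S i j k))"
    by (simp add: sum_distrib_left mult_ac)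
  finally show ?thesis using True by (simp add: sc_mult sum.cartesian_product)
qed (auto simp: sc_mult)

lemma iso_tensor_left:
  assumes "iso_algebras (sc_algebra S) (sc_algebra S')"
  shows "iso_algebras (sc_algebra (sc_tensor S T)) (sc_algebra (sc_tensor S' T))"
proof -
  obtain h where h0: "h \<in> algebra_isos (sc_algebra S) (sc_algebra S')"
    using assms by (auto simp: iso_algebras_def)
  note h = algebra_isosD[OF h0]
  let ?H = "\<lambda>h x (j, t). h (\<lambda>i. x (i, t)) j"
  have z: "h (\<lambda>k. 0) = (\<lambda>k. 0)" using h(5)[of "\<lambda>k. 0" 0] by (simp add: sc_carrier)
  have slice: "(\<lambda>i. x (i, t)) \<in> carrier (sc_algebra S)" if "x \<in> carrier (sc_algebra (sc_tensor S T))" for x t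
    using that by (auto simp: sc_carrier)
  have "?H h \<in> algebra_isos (sc_algebra (sc_tensor S T)) (sc_algebra (sc_tensor S' T))"
  proof (rule algebra_isosI)
    fix x assume x: "x \<in> carrier (sc_algebra (sc_tensor S T))"
    have "h (\<lambda>i. x (i, t)) = (\<lambda>j. 0)" if "t \<notin> sc_index T" for t
      using x that by (simp add: sc_carrier z)
    then show "?H h x \<in> carrier (sc_algebra (sc_tensor S' T))"
      using h(1)[OF slice[OF x]] by (auto simp: sc_carrier)
    show "?H h (r \<odot>\<^bsub>sc_algebra (sc_tensor S T)\<^esub> x) = r \<odot>\<^bsub>sc_algebra (sc_tensor S' T)\<^esub> ?H h x" for r
      using h(5)[OF slice[OF x]] by (auto simp: fun_eq_iff)
    fix y assume y: "y \<in> carrier (sc_algebra (sc_tensor S T))"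
    show "?H h (x \<oplus>\<^bsub>sc_algebra (sc_tensor S T)\<^esub> y) = ?H h x \<oplus>\<^bsub>sc_algebra (sc_tensor S' T)\<^esub> ?H h y"
      using h(3)[OF slice[OF x] slice[OF y]] by (auto simp: fun_eq_iff)
    show "?H h (x \<otimes>\<^bsub>sc_algebra (sc_tensor S T)\<^esub> y) = ?H h x \<otimes>\<^bsub>sc_algebra (sc_tensor S' T)\<^esub> ?H h y"
    proof
      fix kt :: "'c \<times> 'd"
      obtain k t where kt: "kt = (k, t)" by (cases kt)
      have cl: "(\<lambda>i. x (i, u)) \<otimes>\<^bsub>sc_algebra S\<^esub> (\<lambda>i. y (i, v)) \<in> carrier (sc_algebra S)" for u v
        by (simp add: sc_carrier sc_mult)
      show "?H h (x \<otimes>\<^bsub>sc_algebra (sc_tensor S T)\<^esub> y) kt = (?H h x \<otimes>\<^bsub>sc_algebra (sc_tensor S' T)\<^esub> ?H h y) kt"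
      proof (cases "t \<in> sc_index T")
        case True
        have "h (\<lambda>k. \<Sum>a\<in>sc_index T \<times> sc_index T. sc_const T (fst a) (snd a) t *
            ((\<lambda>i. x (i, fst a)) \<otimes>\<^bsub>sc_algebra S\<^esub> (\<lambda>i. y (i, snd a))) k) k =
          (\<Sum>a\<in>sc_index T \<times> sc_index T. sc_const T (fst a) (snd a) t *
             (h (\<lambda>i. x (i, fst a)) \<otimes>\<^bsub>sc_algebra S'\<^esub> h (\<lambda>i. y (i, snd a))) k)"
          using cl by (subst algebra_isos_sum[OF h0]) (simp_all add: h(2) slice[OF x] slice[OF y])
        then show ?thesis using True
          by (simp add: kt sc_tensor_mult_slice case_prod_beta)
      qed (simp add: kt sc_tensor_mult_slice z)
    qed
  next
    have "h (\<lambda>i. \<one>\<^bsub>sc_algebra (sc_tensor S T)\<^esub> (i, t)) k = \<one>\<^bsub>sc_algebra (sc_tensor S' T)\<^esub> (k, t)" for k t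
    proof (cases "t \<in> sc_index T")
      case True
      have "(\<lambda>i. \<one>\<^bsub>sc_algebra (sc_tensor S T)\<^esub> (i, t)) = sc_unit T t \<odot>\<^bsub>sc_algebra S\<^esub> \<one>\<^bsub>sc_algebra S\<^esub>"
        using True by (auto simp: sc_one fun_eq_iff)
      then have "h (\<lambda>i. \<one>\<^bsub>sc_algebra (sc_tensor S T)\<^esub> (i, t)) = sc_unit T t \<odot>\<^bsub>sc_algebra S'\<^esub> \<one>\<^bsub>sc_algebra S'\<^esub>"
        using h(4) h(5)[of "\<one>\<^bsub>sc_algebra S\<^esub>"] by (simp add: sc_carrier sc_one del: sc_linear)
      then show ?thesis using True by (simp add: sc_one)
    qed (simp add: sc_one z)
    then show "?H h \<one>\<^bsub>sc_algebra (sc_tensor S T)\<^esub> = \<one>\<^bsub>sc_algebra (sc_tensor S' T)\<^esub>"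
      by (auto simp: fun_eq_iff)
  next
    let ?g = "inv_into (carrier (sc_algebra S)) h"
    have g0: "?g \<in> algebra_isos (sc_algebra S') (sc_algebra S)" using h0 by (rule algebra_isos_inv) simp
    note g = algebra_isosD[OF g0]
    have gz: "?g (\<lambda>k. 0) = (\<lambda>k. 0)" using g(5)[of "\<lambda>k. 0" 0] by (simp add: sc_carrier)
    have slice': "(\<lambda>i. x (i, t)) \<in> carrier (sc_algebra S')" if "x \<in> carrier (sc_algebra (sc_tensor S' T))" for x t
      using that by (auto simp: sc_carrier)
    have gh: "?g (h x) = x" if "x \<in> carrier (sc_algebra S)" for x
      using that h(6) by (simp add: bij_betw_def)
    have hg: "h (?g x) = x" if "x \<in> carrier (sc_algebra S')" for x
      using that h(6) by (metis bij_betw_def f_inv_into_f)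
    show "bij_betw (?H h) (carrier (sc_algebra (sc_tensor S T))) (carrier (sc_algebra (sc_tensor S' T)))"
    proof (rule bij_betw_byWitness[where f' = "?H ?g"])
      show "\<forall>x\<in>carrier (sc_algebra (sc_tensor S T)). ?H ?g (?H h x) = x"
        by (auto simp: gh slice fun_eq_iff)
      show "\<forall>x\<in>carrier (sc_algebra (sc_tensor S' T)). ?H h (?H ?g x) = x"
        by (auto simp: hg slice' fun_eq_iff)
      have "h (\<lambda>i. x (i, t)) j = 0" if "x \<in> carrier (sc_algebra (sc_tensor S T))" "(j, t) \<notin> sc_index (sc_tensor S' T)" for x j t
        using h(1)[OF slice[OF that(1)], of t] that z by (cases "t \<in> sc_index T") (auto simp: sc_carrier)
      then show "?H h ` carrier (sc_algebra (sc_tensor S T)) \<subseteq> carrier (sc_algebra (sc_tensor S' T))"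
        by (auto simp: sc_carrier)
      have "?g (\<lambda>i. x (i, t)) j = 0" if "x \<in> carrier (sc_algebra (sc_tensor S' T))" "(j, t) \<notin> sc_index (sc_tensor S T)" for x j t
        using g(1)[OF slice'[OF that(1)], of t] that gz by (cases "t \<in> sc_index T") (auto simp: sc_carrier)
      then show "?H ?g ` carrier (sc_algebra (sc_tensor S' T)) \<subseteq> carrier (sc_algebra (sc_tensor S T))"
        by (auto simp: sc_carrier)
    qed
  qed
  then show ?thesis by (rule iso_algebrasI)
qed

lemma iso_tensor_right:
  assumes "iso_algebras (sc_algebra T) (sc_algebra T')"
  shows "iso_algebras (sc_algebra (sc_tensor S T)) (sc_algebra (sc_tensor S T'))"
  using iso_tensor_left[OF assms] iso_tensor_commute iso_algebras_trans by metis

section \<open>Matrix algebras and Brauer equivalence\<close>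

definition mat_table :: "'j set \<Rightarrow> ('j \<times> 'j, 'f::field) sc_table" where
  "mat_table J = \<lparr>
     sc_index = J \<times> J,
     sc_const = (\<lambda>(i, j) (k, l) (r, s). if j = k \<and> r = i \<and> s = l then 1 else 0),
     sc_unit = (\<lambda>(r, s). if r = s then 1 else 0)\<rparr>"

lemma mat_table_simps [simp]:
  "sc_index (mat_table J) = J \<times> J"
  "sc_const (mat_table J) (i, j) (k, l) (r, s) = (if j = k \<and> r = i \<and> s = l then 1 else 0)"
  "sc_unit (mat_table J) (r, s) = (if r = s then 1 else 0)"
  by (simp_all add: mat_table_def)

lemma mat_table_mult:
  assumes "finite J"
  shows "(x \<otimes>\<^bsub>sc_algebra (mat_table J)\<^esub> y) (r, s) =
    (if r \<in> J \<and> s \<in> J then \<Sum>j\<in>J. x (r, j) * y (j, s) else 0)"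
proof (cases "r \<in> J \<and> s \<in> J")
  case True
  have "(\<Sum>i\<in>J. \<Sum>j\<in>J. \<Sum>k\<in>J. \<Sum>l\<in>J. x (i, j) * y (k, l) * (if j = k \<and> r = i \<and> s = l then 1 else 0)) =
    (\<Sum>i\<in>J. \<Sum>j\<in>J. \<Sum>k\<in>J. \<Sum>l\<in>J. if s = l then if j = k then if r = i then x (i, j) * y (k, l) else 0 else 0 else 0)"
    by (intro sum.cong refl) auto
  also have "\<dots> = (\<Sum>i\<in>J. if r = i then \<Sum>j\<in>J. x (i, j) * y (j, s) else 0)"
    using True assms by (intro sum.cong refl) (auto simp: sum.delta)
  finally show ?thesis using True assms by (simp add: sc_mult sum.cartesian_product')
qed (auto simp: sc_mult)

lemma mat_table_relabel:
  assumes "bij_betw f J J'"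
  shows "iso_algebras (sc_algebra (mat_table J)) (sc_algebra (mat_table J'))"
    "iso_algebras (sc_algebra (mat_table J')) (sc_algebra (mat_table J))"
proof -
  have "bij_betw (map_prod f f) (sc_index (mat_table J)) (sc_index (mat_table J'))"
    using assms by (simp add: bij_betw_map_prod)
  moreover have "f i = f j \<longleftrightarrow> i = j" if "i \<in> J" "j \<in> J" for i j
    using assms that by (auto simp: bij_betw_def inj_on_def)
  ultimately show "iso_algebras (sc_algebra (mat_table J)) (sc_algebra (mat_table J'))"
    "iso_algebras (sc_algebra (mat_table J')) (sc_algebra (mat_table J))"
    by (auto intro!: iso_algebras_relabel[of "map_prod f f" "mat_table J" "mat_table J'"])
qed

lemma mat_table_tensor:
  "iso_algebras (sc_algebra (sc_tensor (mat_table J) (mat_table J'))) (sc_algebra (mat_table (J \<times> J')))"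
proof -
  have "bij_betw (\<lambda>((i, j), (i', j')). ((i, i'), (j, j')))
     (sc_index (sc_tensor (mat_table J) (mat_table J'))) (sc_index (mat_table (J \<times> J')))"
    by (rule bij_betw_byWitness[where f' = "\<lambda>((i, i'), (j, j')). ((i, j), (i', j'))"]) auto
  then show ?thesis by (rule iso_algebras_relabel(1)) auto
qed

lemma mat_table_card:
  assumes "finite J"
  shows "iso_algebras (sc_algebra (mat_table J)) (sc_algebra (mat_table {..<card J}))"
    "iso_algebras (sc_algebra (mat_table {..<card J})) (sc_algebra (mat_table J))"
  using ex_bij_betw_finite_nat[OF assms] mat_table_relabel by (metis atLeast0LessThan)+

lemma matrix_algebra_carrierD:
  assumes "M \<in> carrier (matrix_algebra m A)"
  shows "i < m \<Longrightarrow> j < m \<Longrightarrow> M i j \<in> carrier A" "\<not> (i < m \<and> j < m) \<Longrightarrow> M i j = \<zero>\<^bsub>A\<^esub>"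
proof -
  have *: "if i < m \<and> j < m then M i j \<in> carrier A else M i j = \<zero>\<^bsub>A\<^esub>" for i j
    using assms by (simp add: matrix_algebra_def)
  show "i < m \<Longrightarrow> j < m \<Longrightarrow> M i j \<in> carrier A" "\<not> (i < m \<and> j < m) \<Longrightarrow> M i j = \<zero>\<^bsub>A\<^esub>"
    using *[of i j] by (auto split: if_splits)
qed

lemma matrix_algebra_mat_table:
  "iso_algebras (sc_algebra (sc_tensor (mat_table {..<m}) S)) (matrix_algebra m (sc_algebra S))"
proof -
  let ?k = "\<lambda>x i j l. x ((i, j), l)"
  have "?k \<in> algebra_isos (sc_algebra (sc_tensor (mat_table {..<m}) S)) (matrix_algebra m (sc_algebra S))"
  proof (rule algebra_isosI)
    fix x y assume x: "x \<in> carrier (sc_algebra (sc_tensor (mat_table {..<m}) S))"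
      and y: "y \<in> carrier (sc_algebra (sc_tensor (mat_table {..<m}) S))"
    show "?k (x \<otimes>\<^bsub>sc_algebra (sc_tensor (mat_table {..<m}) S)\<^esub> y) = ?k x \<otimes>\<^bsub>matrix_algebra m (sc_algebra S)\<^esub> ?k y"
    proof (intro ext)
      fix r s l
      let ?I = "sc_index S" and ?c = "sc_const S"
      show "?k (x \<otimes>\<^bsub>sc_algebra (sc_tensor (mat_table {..<m}) S)\<^esub> y) r s l = (?k x \<otimes>\<^bsub>matrix_algebra m (sc_algebra S)\<^esub> ?k y) r s l"
      proof (cases "r < m \<and> s < m \<and> l \<in> ?I")
        case True
        have "?k (x \<otimes>\<^bsub>sc_algebra (sc_tensor (mat_table {..<m}) S)\<^esub> y) r s l =
          (\<Sum>i<m. \<Sum>j<m. \<Sum>a\<in>?I. \<Sum>i'<m. \<Sum>j'<m. \<Sum>b\<in>?I.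
             if s = j' then if j = i' then if r = i then x ((i,j),a) * y ((i',j'),b) * ?c a b l else 0 else 0 else 0)"
          using True by (simp add: sc_mult sum.cartesian_product') (intro sum.cong refl, auto)
        also have "\<dots> = (\<Sum>i<m. if r = i then \<Sum>j<m. \<Sum>a\<in>?I. \<Sum>b\<in>?I. x ((i,j),a) * y ((j,s),b) * ?c a b l else 0)"
        proof (intro sum.cong refl)
          fix i
          have 1: "(\<Sum>b\<in>?I. if P then if Q then if R then f b else 0 else 0 else 0) =
              (if P then if Q then if R then \<Sum>b\<in>?I. f b else 0 else 0 else 0)" for P Q R and f :: "_ \<Rightarrow> 'b"
            by auto
          have 2: "(\<Sum>i'<m. if j = i' then if R then f i' else 0 else 0) = (if R then f j else 0)"
            if "j < m" for R j and f :: "_ \<Rightarrow> 'b"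
            using that by (auto simp: sum.delta)
          have 3: "(\<Sum>a\<in>?I. if R then f a else 0) = (if R then \<Sum>a\<in>?I. f a else 0)" for R and f :: "_ \<Rightarrow> 'b" by auto
          have 4: "(\<Sum>j\<in>{..<m}. if R then f j else 0) = (if R then \<Sum>a<m. f a else 0)" for R and f :: "_ \<Rightarrow> 'b" by auto
          show "(\<Sum>j<m. \<Sum>a\<in>?I. \<Sum>i'<m. \<Sum>j'<m. \<Sum>b\<in>?I.
             if s = j' then if j = i' then if r = i then x ((i,j),a) * y ((i',j'),b) * ?c a b l else 0 else 0 else 0) =
             (if r = i then \<Sum>j<m. \<Sum>a\<in>?I. \<Sum>b\<in>?I. x ((i,j),a) * y ((j,s),b) * ?c a b l else 0)"
            using True unfolding 1 by (simp add: 2 3 cong: sum.cong_simp)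
        qed
        also have "\<dots> = (\<Sum>j<m. \<Sum>a\<in>?I. \<Sum>b\<in>?I. x ((r,j),a) * y ((j,s),b) * ?c a b l)"
          using True by simp
        finally have 1: "?k (x \<otimes>\<^bsub>sc_algebra (sc_tensor (mat_table {..<m}) S)\<^esub> y) r s l =
          (\<Sum>j<m. (?k x r j \<otimes>\<^bsub>sc_algebra S\<^esub> ?k y j s) l)"
          using True by (simp add: sc_mult)
        have "?k x r j \<otimes>\<^bsub>sc_algebra S\<^esub> ?k y j s \<in> carrier (sc_algebra S)" for j
          by (simp add: sc_carrier sc_mult)
        then show ?thesis using True 1
          by (simp add: matrix_algebra_def finsum_sc_algebra)
      next
        case False
        have "finsum (sc_algebra S) (\<lambda>j. ?k x r j \<otimes>\<^bsub>sc_algebra S\<^esub> ?k y j s) {..<m} l = 0" if "l \<notin> ?I"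
          using that by (subst finsum_sc_algebra) (auto simp: sc_carrier sc_mult)
        then show ?thesis using False by (auto simp: matrix_algebra_def sc_mult)
      qed
    qed
  next
    have *: "M i j l = 0" if "M \<in> carrier (matrix_algebra m (sc_algebra S))" "\<not> (i < m \<and> j < m \<and> l \<in> sc_index S)"
      for M i j l
      using matrix_algebra_carrierD[OF that(1), of i j] that(2)
      by (cases "i < m \<and> j < m") (auto simp: sc_carrier)
    show "bij_betw ?k (carrier (sc_algebra (sc_tensor (mat_table {..<m}) S))) (carrier (matrix_algebra m (sc_algebra S)))"
    proof (rule bij_betw_byWitness[where f' = "\<lambda>M ((i, j), l). M i j l"])
      show "?k ` carrier (sc_algebra (sc_tensor (mat_table {..<m}) S)) \<subseteq> carrier (matrix_algebra m (sc_algebra S))"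
        by (auto simp: matrix_algebra_def sc_carrier fun_eq_iff)
      show "(\<lambda>M ((i, j), l). M i j l) ` carrier (matrix_algebra m (sc_algebra S)) \<subseteq>
          carrier (sc_algebra (sc_tensor (mat_table {..<m}) S))"
        using * by (auto simp: sc_carrier)
    qed (auto simp: fun_eq_iff)
  qed (auto simp: matrix_algebra_def sc_carrier fun_eq_iff sc_one)
  then show ?thesis by (rule iso_algebrasI)
qed

text \<open>Brauer equivalence of tables, in which matrix algebras are tensor products.\<close>

definition table_equiv :: "('i, 'f::field) sc_table \<Rightarrow> ('j, 'f) sc_table \<Rightarrow> bool" where
  "table_equiv S T \<longleftrightarrow> (\<exists>m::nat>0. \<exists>n::nat>0. iso_algebras (sc_algebra (sc_tensor (mat_table {..<m}) S))
     (sc_algebra (sc_tensor (mat_table {..<n}) T)))"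

lemma brauer_equiv_table: "brauer_equiv (sc_algebra S) (sc_algebra T) \<longleftrightarrow> table_equiv S T"
proof -
  have "iso_algebras (matrix_algebra m (sc_algebra S)) (matrix_algebra n (sc_algebra T)) \<longleftrightarrow>
    iso_algebras (sc_algebra (sc_tensor (mat_table {..<m}) S)) (sc_algebra (sc_tensor (mat_table {..<n}) T))"
    for m n
  proof
    assume i: "iso_algebras (matrix_algebra m (sc_algebra S)) (matrix_algebra n (sc_algebra T))"
    show "iso_algebras (sc_algebra (sc_tensor (mat_table {..<m}) S)) (sc_algebra (sc_tensor (mat_table {..<n}) T))"
      by (rule iso_algebras_trans[OF matrix_algebra_mat_table iso_algebras_trans[OF i
            iso_algebras_sym[OF matrix_algebra_mat_table closed_algebra_sc_algebra]]])
  next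
    assume i: "iso_algebras (sc_algebra (sc_tensor (mat_table {..<m}) S)) (sc_algebra (sc_tensor (mat_table {..<n}) T))"
    show "iso_algebras (matrix_algebra m (sc_algebra S)) (matrix_algebra n (sc_algebra T))"
      by (rule iso_algebras_trans[OF iso_algebras_sym[OF matrix_algebra_mat_table closed_algebra_sc_algebra]
            iso_algebras_trans[OF i matrix_algebra_mat_table]])
  qed
  then show ?thesis by (simp add: brauer_equiv_def table_equiv_def iso_algebras_def)
qed

lemma table_equivI:
  assumes "iso_algebras (sc_algebra (sc_tensor (mat_table J) S)) (sc_algebra (sc_tensor (mat_table J') T))"
    and "finite J" "J \<noteq> {}" "finite J'" "J' \<noteq> {}"
  shows "table_equiv S T"
proof -
  have "iso_algebras (sc_algebra (sc_tensor (mat_table {..<card J}) S)) (sc_algebra (sc_tensor (mat_table {..<card J'}) T))"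
    by (rule iso_algebras_trans[OF iso_tensor_left[OF mat_table_card(2)[OF assms(2)]]
          iso_algebras_trans[OF assms(1) iso_tensor_left[OF mat_table_card(1)[OF assms(4)]]]])
  moreover have "card J > 0" "card J' > 0" using assms by auto
  ultimately show ?thesis unfolding table_equiv_def by blast
qed

lemma table_equiv_sym: "table_equiv S T \<Longrightarrow> table_equiv T S"
  unfolding table_equiv_def using iso_algebras_sym[OF _ closed_algebra_sc_algebra] by blast

lemma table_equiv_trans:
  assumes "table_equiv S T" "table_equiv T U"
  shows "table_equiv S U"
proof -
  obtain m n :: nat where mn: "m > 0" "n > 0"
    and i: "iso_algebras (sc_algebra (sc_tensor (mat_table {..<m}) S)) (sc_algebra (sc_tensor (mat_table {..<n}) T))"
    using assms(1) unfolding table_equiv_def by blast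
  obtain k l :: nat where kl: "k > 0" "l > 0"
    and j: "iso_algebras (sc_algebra (sc_tensor (mat_table {..<k}) T)) (sc_algebra (sc_tensor (mat_table {..<l}) U))"
    using assms(2) unfolding table_equiv_def by blast
  have r: "iso_algebras (sc_algebra (sc_tensor (mat_table (J \<times> J')) V)) (sc_algebra (sc_tensor (mat_table J) (sc_tensor (mat_table J') V)))"
    for J J' :: "nat set" and V :: "('z, 'b) sc_table"
    by (rule iso_algebras_trans[OF iso_algebras_sym[OF iso_tensor_left[OF mat_table_tensor]] iso_tensor_assoc(1)]) simp
  have r': "iso_algebras (sc_algebra (sc_tensor (mat_table J) (sc_tensor (mat_table J') V))) (sc_algebra (sc_tensor (mat_table (J \<times> J')) V))"
    for J J' :: "nat set" and V :: "('z, 'b) sc_table"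
    by (rule iso_algebras_trans[OF iso_tensor_assoc(2) iso_tensor_left[OF mat_table_tensor]])
  have "bij_betw prod.swap ({..<k} \<times> {..<n}) ({..<n} \<times> {..<k})"
    by (auto simp: bij_betw_def product_swap)
  then have s: "iso_algebras (sc_algebra (sc_tensor (mat_table ({..<k} \<times> {..<n})) T)) (sc_algebra (sc_tensor (mat_table ({..<n} \<times> {..<k})) T))"
    by (intro iso_tensor_left mat_table_relabel(1))
  have "iso_algebras (sc_algebra (sc_tensor (mat_table ({..<k} \<times> {..<m})) S)) (sc_algebra (sc_tensor (mat_table ({..<k} \<times> {..<n})) T))"
    by (rule iso_algebras_trans[OF r iso_algebras_trans[OF iso_tensor_right[OF i] r']])
  moreover have "iso_algebras (sc_algebra (sc_tensor (mat_table ({..<n} \<times> {..<k})) T)) (sc_algebra (sc_tensor (mat_table ({..<n} \<times> {..<l})) U))"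
    by (rule iso_algebras_trans[OF r iso_algebras_trans[OF iso_tensor_right[OF j] r']])
  ultimately have "iso_algebras (sc_algebra (sc_tensor (mat_table ({..<k} \<times> {..<m})) S)) (sc_algebra (sc_tensor (mat_table ({..<n} \<times> {..<l})) U))"
    by (rule iso_algebras_trans[OF _ iso_algebras_trans[OF s]])
  then show ?thesis using mn kl by (intro table_equivI) auto
qed

lemma table_equiv_iso: "iso_algebras (sc_algebra S) (sc_algebra T) \<Longrightarrow> table_equiv S T"
  unfolding table_equiv_def by (rule exI[of _ 1], simp, rule exI[of _ 1], simp add: iso_tensor_right)

lemma table_equiv_refl: "table_equiv S S"
  by (intro table_equiv_iso iso_algebras_refl)

lemma table_equiv_tensor_left:
  assumes "table_equiv S S'" shows "table_equiv (sc_tensor S T) (sc_tensor S' T)"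
proof -
  obtain m n :: nat where mn: "m > 0" "n > 0"
    and i: "iso_algebras (sc_algebra (sc_tensor (mat_table {..<m}) S)) (sc_algebra (sc_tensor (mat_table {..<n}) S'))"
    using assms unfolding table_equiv_def by blast
  have "iso_algebras (sc_algebra (sc_tensor (mat_table {..<m}) (sc_tensor S T))) (sc_algebra (sc_tensor (mat_table {..<n}) (sc_tensor S' T)))"
    by (rule iso_algebras_trans[OF iso_tensor_assoc(2) iso_algebras_trans[OF iso_tensor_left[OF i] iso_tensor_assoc(1)]])
  then show ?thesis using mn unfolding table_equiv_def by blast
qed

lemma table_equiv_commute: "table_equiv (sc_tensor S T) (sc_tensor T S)"
  by (intro table_equiv_iso iso_tensor_commute)

lemma table_equiv_tensor:
  assumes "table_equiv S S'" "table_equiv T T'"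
  shows "table_equiv (sc_tensor S T) (sc_tensor S' T')"
  by (rule table_equiv_trans[OF table_equiv_tensor_left[OF assms(1)] table_equiv_trans[OF table_equiv_commute
        table_equiv_trans[OF table_equiv_tensor_left[OF assms(2)] table_equiv_commute]]])

lemma table_equiv_assoc: "table_equiv (sc_tensor (sc_tensor S T) U) (sc_tensor S (sc_tensor T U))"
  by (intro table_equiv_iso iso_tensor_assoc)

text \<open>
  The isomorphism is applied to the entries.
\<close>

lemma matrix_algebra_functorial:
  assumes "iso_algebras A B" "abelian_group A" "closed_algebra A" "abelian_group B"
  shows "iso_algebras (matrix_algebra m A) (matrix_algebra m B)"
proof -
  obtain h where h0: "h \<in> algebra_isos A B" using assms(1) by (auto simp: iso_algebras_def)
  note h = algebra_isosD[OF h0]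
  interpret A: abelian_group A by fact
  interpret B: abelian_group B by fact
  have cl: "x \<otimes>\<^bsub>A\<^esub> y \<in> carrier A" if "x \<in> carrier A" "y \<in> carrier A" for x y
    using assms(3) that by (auto simp: closed_algebra_def)
  have h_zero: "h \<zero>\<^bsub>A\<^esub> = \<zero>\<^bsub>B\<^esub>"
    using h(3)[of "\<zero>\<^bsub>A\<^esub>" "\<zero>\<^bsub>A\<^esub>"] h(1)[of "\<zero>\<^bsub>A\<^esub>"] by (simp add: B.add.l_cancel_one')
  have h_sum: "h (finsum A f N) = finsum B (\<lambda>k. h (f k)) N" if "f \<in> N \<rightarrow> carrier A" "finite N" for f and N :: "nat set"
    using that(2,1) by (induction N rule: finite_induct) (auto simp: h_zero h(3) h(1) Pi_def)
  let ?H = "\<lambda>h M i j. h (M i j)"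
  have M: "M i j \<in> carrier A" if "M \<in> carrier (matrix_algebra m A)" for M i j
    using matrix_algebra_carrierD[OF that, of i j] by (cases "i < m \<and> j < m") auto
  have MB: "M i j \<in> carrier B" if "M \<in> carrier (matrix_algebra m B)" for M i j
    using matrix_algebra_carrierD[OF that, of i j] by (cases "i < m \<and> j < m") auto
  let ?g = "inv_into (carrier A) h"
  note g = algebra_isosD[OF algebra_isos_inv[OF h0 assms(3)]]
  have g_zero: "?g \<zero>\<^bsub>B\<^esub> = \<zero>\<^bsub>A\<^esub>"
    using h_zero h(6) by (metis A.zero_closed bij_betw_def inv_into_f_f)
  have "?H h \<in> algebra_isos (matrix_algebra m A) (matrix_algebra m B)"
  proof (rule algebra_isosI)
    fix N M assume NM: "N \<in> carrier (matrix_algebra m A)" "M \<in> carrier (matrix_algebra m A)"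
    show "?H h (N \<otimes>\<^bsub>matrix_algebra m A\<^esub> M) = ?H h N \<otimes>\<^bsub>matrix_algebra m B\<^esub> ?H h M"
      using M[OF NM(1)] M[OF NM(2)]
      by (auto simp: matrix_algebra_def fun_eq_iff h_zero h_sum cl h(2))
    show "?H h (N \<oplus>\<^bsub>matrix_algebra m A\<^esub> M) = ?H h N \<oplus>\<^bsub>matrix_algebra m B\<^esub> ?H h M"
      using M[OF NM(1)] M[OF NM(2)]
      by (auto simp: matrix_algebra_def fun_eq_iff h_zero h(3))
  next
    fix N r assume N: "N \<in> carrier (matrix_algebra m A)"
    show "?H h (r \<odot>\<^bsub>matrix_algebra m A\<^esub> N) = r \<odot>\<^bsub>matrix_algebra m B\<^esub> ?H h N"
      using M[OF N] by (auto simp: matrix_algebra_def fun_eq_iff h_zero h(5))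
  next
    show "bij_betw (?H h) (carrier (matrix_algebra m A)) (carrier (matrix_algebra m B))"
    proof (rule bij_betw_byWitness[where f' = "?H ?g"])
      show "\<forall>N\<in>carrier (matrix_algebra m A). ?H ?g (?H h N) = N"
        using M h(6) by (auto simp: bij_betw_def fun_eq_iff)
      show "\<forall>N\<in>carrier (matrix_algebra m B). ?H h (?H ?g N) = N"
        using MB h(6) by (auto simp: bij_betw_def fun_eq_iff f_inv_into_f)
      show "?H h ` carrier (matrix_algebra m A) \<subseteq> carrier (matrix_algebra m B)"
        by (auto simp: matrix_algebra_def h(1) h_zero split: if_splits)
      show "?H ?g ` carrier (matrix_algebra m B) \<subseteq> carrier (matrix_algebra m A)"
        by (auto simp: matrix_algebra_def g(1) g_zero split: if_splits)
    qed
  qed (auto simp: matrix_algebra_def h(1) h(4) h_zero fun_eq_iff split: if_splits)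
  then show ?thesis by (rule iso_algebrasI)
qed

text \<open>
  Only representatives given by tables are compared; an algebra over another carrier enters through an
  isomorphism with a table.
\<close>

lemma brauer_equiv_iso:
  assumes "iso_algebras (sc_algebra S) A" "abelian_group A"
  shows "brauer_equiv A (sc_algebra T) \<longleftrightarrow> table_equiv S T"
proof -
  obtain h where h0: "h \<in> algebra_isos (sc_algebra S) A" using assms(1) by (auto simp: iso_algebras_def)
  note h = algebra_isosD[OF h0]
  have cS: "\<one>\<^bsub>sc_algebra S\<^esub> \<in> carrier (sc_algebra S)"
    "\<And>x y. x \<in> carrier (sc_algebra S) \<Longrightarrow> y \<in> carrier (sc_algebra S) \<Longrightarrow> x \<otimes>\<^bsub>sc_algebra S\<^esub> y \<in> carrier (sc_algebra S)"
    "\<And>x y. x \<in> carrier (sc_algebra S) \<Longrightarrow> y \<in> carrier (sc_algebra S) \<Longrightarrow> x \<oplus>\<^bsub>sc_algebra S\<^esub> y \<in> carrier (sc_algebra S)"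
    "\<And>r x. x \<in> carrier (sc_algebra S) \<Longrightarrow> r \<odot>\<^bsub>sc_algebra S\<^esub> x \<in> carrier (sc_algebra S)"
    using closed_algebra_sc_algebra[of S] unfolding closed_algebra_def by blast+
  have im: "\<exists>x'\<in>carrier (sc_algebra S). x = h x'" if "x \<in> carrier A" for x
    using h(6) that by (auto simp: bij_betw_def)
  have cl: "closed_algebra A"
    unfolding closed_algebra_def
  proof (intro conjI ballI allI)
    show "\<one>\<^bsub>A\<^esub> \<in> carrier A" using h(1)[OF cS(1)] h(4) by simp
    fix x assume "x \<in> carrier A"
    then obtain x' where x': "x' \<in> carrier (sc_algebra S)" "x = h x'" using im by blast
    show "r \<odot>\<^bsub>A\<^esub> x \<in> carrier A" for r
      using h(1)[OF cS(4)[OF x'(1)], of r] h(5)[OF x'(1), of r] x'(2) by (simp del: sc_linear)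
    fix y assume "y \<in> carrier A"
    then obtain y' where y': "y' \<in> carrier (sc_algebra S)" "y = h y'" using im by blast
    show "x \<otimes>\<^bsub>A\<^esub> y \<in> carrier A" "x \<oplus>\<^bsub>A\<^esub> y \<in> carrier A"
      using h(1)[OF cS(2)[OF x'(1) y'(1)]] h(2)[OF x'(1) y'(1)] h(1)[OF cS(3)[OF x'(1) y'(1)]] h(3)[OF x'(1) y'(1)] x'(2) y'(2)
      by (simp_all del: sc_linear)
  qed
  have iso: "iso_algebras A (sc_algebra S)" by (rule iso_algebras_sym[OF assms(1)]) simp
  have 1: "iso_algebras (matrix_algebra m A) (matrix_algebra m (sc_algebra S))" for m
    by (rule matrix_algebra_functorial[OF iso assms(2) cl abelian_group_sc_algebra])
  have 2: "iso_algebras (matrix_algebra m (sc_algebra S)) (matrix_algebra m A)" for m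
    by (rule matrix_algebra_functorial[OF assms(1) abelian_group_sc_algebra _ assms(2)]) simp
  have "iso_algebras (matrix_algebra m A) (matrix_algebra n (sc_algebra T)) \<longleftrightarrow>
      iso_algebras (matrix_algebra m (sc_algebra S)) (matrix_algebra n (sc_algebra T))" for m n
    using iso_algebras_trans[OF 1[of m], of "matrix_algebra n (sc_algebra T)"]
      iso_algebras_trans[OF 2[of m], of "matrix_algebra n (sc_algebra T)"] by argo
  then have "brauer_equiv A (sc_algebra T) \<longleftrightarrow> brauer_equiv (sc_algebra S) (sc_algebra T)"
    unfolding brauer_equiv_def iso_algebras_def by simp
  then show ?thesis by (simp add: brauer_equiv_table)
qed

lemma brauer_class_iso:
  assumes "iso_algebras (sc_algebra S) A" "abelian_group A"
  shows "brauer_class A = {T \<in> csa_tables. table_equiv S T}"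
  using brauer_equiv_iso[OF assms] by (auto simp: brauer_class_def)

lemma brauer_class_table: "brauer_class (sc_algebra S) = {T \<in> csa_tables. table_equiv S T}"
  by (auto simp: brauer_class_def brauer_equiv_table)

section \<open>Linear systems with more unknowns than equations\<close>

text \<open>
  Elimination of one equation with the help of an unknown that has a nonzero coefficient in it.
\<close>

lemma underdetermined_system:
  fixes M :: "'i \<Rightarrow> 's \<Rightarrow> 'f::field"
  assumes "finite S" "finite I" "card S < card I"
  shows "\<exists>r. (\<exists>i\<in>I. r i \<noteq> 0) \<and> (\<forall>s\<in>S. (\<Sum>i\<in>I. r i * M i s) = 0)"
  using assms
proof (induction S arbitrary: I M rule: finite_induct)
  case empty
  then show ?case by (intro exI[of _ "\<lambda>_. 1"]) (auto simp: card_gt_0_iff)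
next
  case (insert s S)
  show ?case
  proof (cases "\<forall>i\<in>I. M i s = 0")
    case True
    then show ?thesis using insert.IH[of I M] insert.prems insert.hyps by auto
  next
    case False
    then obtain i0 where i0: "i0 \<in> I" "M i0 s \<noteq> 0" by blast
    let ?M = "\<lambda>i t. M i t - M i s / M i0 s * M i0 t"
    have "card S < card (I - {i0})" using insert.prems insert.hyps i0 by auto
    then obtain r where r: "\<exists>i\<in>I - {i0}. r i \<noteq> 0" "\<forall>t\<in>S. (\<Sum>i\<in>I - {i0}. r i * ?M i t) = 0"
      using insert.IH[of "I - {i0}" ?M] insert.prems by auto
    define r' where "r' = r(i0 := - (\<Sum>i\<in>I - {i0}. r i * M i s / M i0 s))"
    have split: "(\<Sum>i\<in>I. r' i * M i t) = (\<Sum>i\<in>I - {i0}. r i * ?M i t)" for t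
    proof -
      have "(\<Sum>i\<in>I. r' i * M i t) = r' i0 * M i0 t + (\<Sum>i\<in>I - {i0}. r' i * M i t)"
        using insert.prems(1) i0 by (simp add: sum.remove)
      also have "(\<Sum>i\<in>I - {i0}. r' i * M i t) = (\<Sum>i\<in>I - {i0}. r i * M i t)"
        by (intro sum.cong) (auto simp: r'_def)
      finally have "(\<Sum>i\<in>I. r' i * M i t) = (\<Sum>i\<in>I - {i0}. r i * M i t) - (\<Sum>i\<in>I - {i0}. r i * M i s / M i0 s) * M i0 t"
        by (simp add: r'_def)
      then show ?thesis
        by (simp only: sum_distrib_right sum_subtractf[symmetric]) (simp add: algebra_simps)
    qed
    have "(\<Sum>i\<in>I. r' i * M i t) = 0" if "t \<in> insert s S" for t
      using that r(2) i0(2) unfolding split by (cases "t = s") auto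
    moreover have "\<exists>i\<in>I. r' i \<noteq> 0" using r(1) by (auto simp: r'_def)
    ultimately show ?thesis by blast
  qed
qed

section \<open>Associative algebras over the base field\<close>

locale field_algebra =
  fixes A :: "('f::field, 'v) module" (structure)
  assumes alg: "assoc_algebra base_ring A"

sublocale field_algebra \<subseteq> ring A
  using alg by (simp add: assoc_algebra_def)

context field_algebra
begin

lemma
  shows scalar_closed [simp, intro]: "x \<in> carrier A \<Longrightarrow> r \<odot> x \<in> carrier A"
    and scalar_add_left: "x \<in> carrier A \<Longrightarrow> (r + s) \<odot> x = r \<odot> x \<oplus> s \<odot> x"
    and scalar_add_right: "x \<in> carrier A \<Longrightarrow> y \<in> carrier A \<Longrightarrow> r \<odot> (x \<oplus> y) = r \<odot> x \<oplus> r \<odot> y"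
    and scalar_scalar: "x \<in> carrier A \<Longrightarrow> r \<odot> (s \<odot> x) = (r * s) \<odot> x"
    and scalar_one [simp]: "x \<in> carrier A \<Longrightarrow> 1 \<odot> x = x"
    and scalar_mult_left: "x \<in> carrier A \<Longrightarrow> y \<in> carrier A \<Longrightarrow> (r \<odot> x) \<otimes> y = r \<odot> (x \<otimes> y)"
    and scalar_mult_right: "x \<in> carrier A \<Longrightarrow> y \<in> carrier A \<Longrightarrow> x \<otimes> (r \<odot> y) = r \<odot> (x \<otimes> y)"
proof -
  interpret M: assoc_algebra base_ring A by (rule alg)
  have b: "carrier base_ring = UNIV" "\<And>r s. r \<oplus>\<^bsub>base_ring\<^esub> s = r + s" "\<And>r s. r \<otimes>\<^bsub>base_ring\<^esub> s = r * s" "\<one>\<^bsub>base_ring\<^esub> = 1"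
    by (auto simp: ring_of_type_algebra_def)
  show "x \<in> carrier A \<Longrightarrow> r \<odot> x \<in> carrier A" using M.smult_closed[of r x] by (simp add: b)
  show "x \<in> carrier A \<Longrightarrow> (r + s) \<odot> x = r \<odot> x \<oplus> s \<odot> x" using M.smult_l_distr[of r s x] by (simp add: b)
  show "x \<in> carrier A \<Longrightarrow> y \<in> carrier A \<Longrightarrow> r \<odot> (x \<oplus> y) = r \<odot> x \<oplus> r \<odot> y" using M.smult_r_distr[of r x y] by (simp add: b)
  show "x \<in> carrier A \<Longrightarrow> r \<odot> (s \<odot> x) = (r * s) \<odot> x" using M.smult_assoc1[of r s x] by (simp add: b)
  show "x \<in> carrier A \<Longrightarrow> 1 \<odot> x = x" using M.smult_one[of x] by (simp add: b)
  show "x \<in> carrier A \<Longrightarrow> y \<in> carrier A \<Longrightarrow> (r \<odot> x) \<otimes> y = r \<odot> (x \<otimes> y)" using M.smult_mult_left[of r x y] by (simp add: b)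
  show "x \<in> carrier A \<Longrightarrow> y \<in> carrier A \<Longrightarrow> x \<otimes> (r \<odot> y) = r \<odot> (x \<otimes> y)" using M.smult_mult_right[of r x y] by (simp add: b)
qed

lemma scalar_zero_left [simp]: "x \<in> carrier A \<Longrightarrow> 0 \<odot> x = \<zero>"
  using scalar_add_left[of x 0 0] scalar_closed[of x 0] add.l_cancel_one' by fastforce

lemma scalar_zero_right [simp]: "r \<odot> \<zero> = \<zero>"
  using scalar_scalar[of "\<zero>" r 0] scalar_zero_left by simp

lemma scalar_sum:
  assumes "finite I" "x \<in> carrier A"
  shows "(\<Sum>i\<in>I. f i) \<odot> x = (\<Oplus>i\<in>I. f i \<odot> x)"
  using assms by (induction I rule: finite_induct) (simp_all add: scalar_add_left)

lemma scalar_finsum: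
  assumes "finite I" "\<And>i. i \<in> I \<Longrightarrow> x i \<in> carrier A"
  shows "r \<odot> (\<Oplus>i\<in>I. x i) = (\<Oplus>i\<in>I. r \<odot> x i)"
  using assms by (induction I rule: finite_induct) (simp_all add: scalar_add_right Pi_def)

lemma finsum_swap:
  assumes "finite I" "finite J" "\<And>i j. i \<in> I \<Longrightarrow> j \<in> J \<Longrightarrow> x i j \<in> carrier A"
  shows "(\<Oplus>i\<in>I. \<Oplus>j\<in>J. x i j) = (\<Oplus>j\<in>J. \<Oplus>i\<in>I. x i j)"
  using assms
proof (induction I rule: finite_induct)
  case (insert i I)
  have "(\<Oplus>i\<in>insert i I. \<Oplus>j\<in>J. x i j) = (\<Oplus>j\<in>J. x i j) \<oplus> (\<Oplus>j\<in>J. \<Oplus>i\<in>I. x i j)"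
    using insert by (subst finsum_insert) (auto intro!: finsum_closed)
  also have "\<dots> = (\<Oplus>j\<in>J. x i j \<oplus> (\<Oplus>i\<in>I. x i j))"
    using insert.prems by (subst finsum_addf) (auto intro!: finsum_closed)
  also have "\<dots> = (\<Oplus>j\<in>J. \<Oplus>i\<in>insert i I. x i j)"
    using insert by (intro finsum_cong') (auto intro!: finsum_closed)
  finally show ?case .
qed simp

end

lemma assoc_algebraI:
  fixes A :: "('f::field, 'v) module" (structure)
  assumes "abelian_group A" "\<one> \<in> carrier A"
    and "\<And>x y. x \<in> carrier A \<Longrightarrow> y \<in> carrier A \<Longrightarrow> x \<otimes> y \<in> carrier A"
    and "\<And>x y z. x \<in> carrier A \<Longrightarrow> y \<in> carrier A \<Longrightarrow> z \<in> carrier A \<Longrightarrow> x \<otimes> y \<otimes> z = x \<otimes> (y \<otimes> z)"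
    and "\<And>x. x \<in> carrier A \<Longrightarrow> \<one> \<otimes> x = x" "\<And>x. x \<in> carrier A \<Longrightarrow> x \<otimes> \<one> = x"
    and "\<And>x y z. x \<in> carrier A \<Longrightarrow> y \<in> carrier A \<Longrightarrow> z \<in> carrier A \<Longrightarrow> (x \<oplus> y) \<otimes> z = x \<otimes> z \<oplus> y \<otimes> z"
    and "\<And>x y z. x \<in> carrier A \<Longrightarrow> y \<in> carrier A \<Longrightarrow> z \<in> carrier A \<Longrightarrow> z \<otimes> (x \<oplus> y) = z \<otimes> x \<oplus> z \<otimes> y"
    and "\<And>r x. x \<in> carrier A \<Longrightarrow> r \<odot> x \<in> carrier A"
    and "\<And>r s x. x \<in> carrier A \<Longrightarrow> (r + s) \<odot> x = r \<odot> x \<oplus> s \<odot> x"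
    and "\<And>r x y. x \<in> carrier A \<Longrightarrow> y \<in> carrier A \<Longrightarrow> r \<odot> (x \<oplus> y) = r \<odot> x \<oplus> r \<odot> y"
    and "\<And>r s x. x \<in> carrier A \<Longrightarrow> (r * s) \<odot> x = r \<odot> (s \<odot> x)" "\<And>x. x \<in> carrier A \<Longrightarrow> 1 \<odot> x = x"
    and "\<And>r x y. x \<in> carrier A \<Longrightarrow> y \<in> carrier A \<Longrightarrow> (r \<odot> x) \<otimes> y = r \<odot> (x \<otimes> y)"
    and "\<And>r x y. x \<in> carrier A \<Longrightarrow> y \<in> carrier A \<Longrightarrow> x \<otimes> (r \<odot> y) = r \<odot> (x \<otimes> y)"
  shows "assoc_algebra base_ring A"
proof -
  have b: "\<And>r s. r \<oplus>\<^bsub>base_ring\<^esub> s = r + s" "\<And>r s. r \<otimes>\<^bsub>base_ring\<^esub> s = r * s" "\<one>\<^bsub>base_ring\<^esub> = 1"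
    by (auto simp: ring_of_type_algebra_def)
  have "monoid A" by (rule monoidI) (use assms in auto)
  then have "ring A" using assms by (intro ringI) auto
  moreover have "Module.module base_ring A"
    by (rule moduleI) (use assms in \<open>auto simp: b\<close>)
  ultimately show ?thesis
    using assms by (auto simp: assoc_algebra_def assoc_algebra_axioms_def)
qed

lemma assoc_algebra_sc_algebra:
  assumes fin: "finite (sc_index T)"
    and assoc: "\<And>i j k l. i \<in> sc_index T \<Longrightarrow> j \<in> sc_index T \<Longrightarrow> k \<in> sc_index T \<Longrightarrow> l \<in> sc_index T \<Longrightarrow>
      (\<Sum>r\<in>sc_index T. sc_const T i j r * sc_const T r k l) = (\<Sum>r\<in>sc_index T. sc_const T j k r * sc_const T i r l)"
    and unit_l: "\<And>j k. j \<in> sc_index T \<Longrightarrow> k \<in> sc_index T \<Longrightarrow> (\<Sum>i\<in>sc_index T. sc_unit T i * sc_const T i j k) = (if j = k then 1 else 0)"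
    and unit_r: "\<And>i k. i \<in> sc_index T \<Longrightarrow> k \<in> sc_index T \<Longrightarrow> (\<Sum>j\<in>sc_index T. sc_unit T j * sc_const T i j k) = (if i = k then 1 else 0)"
  shows "assoc_algebra base_ring (sc_algebra T)"
proof (rule assoc_algebraI)
  let ?I = "sc_index T" and ?c = "sc_const T" and ?u = "sc_unit T"
  fix x y z assume x: "x \<in> carrier (sc_algebra T)" and y: "y \<in> carrier (sc_algebra T)" and z: "z \<in> carrier (sc_algebra T)"
  show "x \<otimes>\<^bsub>sc_algebra T\<^esub> y \<otimes>\<^bsub>sc_algebra T\<^esub> z = x \<otimes>\<^bsub>sc_algebra T\<^esub> (y \<otimes>\<^bsub>sc_algebra T\<^esub> z)"
  proof
    fix l
    show "(x \<otimes>\<^bsub>sc_algebra T\<^esub> y \<otimes>\<^bsub>sc_algebra T\<^esub> z) l = (x \<otimes>\<^bsub>sc_algebra T\<^esub> (y \<otimes>\<^bsub>sc_algebra T\<^esub> z)) l"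
    proof (cases "l \<in> ?I")
      case True
      have "(x \<otimes>\<^bsub>sc_algebra T\<^esub> y \<otimes>\<^bsub>sc_algebra T\<^esub> z) l =
          (\<Sum>r\<in>?I. \<Sum>k\<in>?I. \<Sum>i\<in>?I. \<Sum>j\<in>?I. x i * y j * z k * (?c i j r * ?c r k l))"
        using True by (simp add: sc_mult sum_distrib_left sum_distrib_right mult_ac)
      also have "\<dots> = (\<Sum>k\<in>?I. \<Sum>r\<in>?I. \<Sum>i\<in>?I. \<Sum>j\<in>?I. x i * y j * z k * (?c i j r * ?c r k l))"
        by (rule sum.swap)
      also have "\<dots> = (\<Sum>k\<in>?I. \<Sum>i\<in>?I. \<Sum>r\<in>?I. \<Sum>j\<in>?I. x i * y j * z k * (?c i j r * ?c r k l))"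
        by (intro sum.cong refl sum.swap)
      also have "\<dots> = (\<Sum>k\<in>?I. \<Sum>i\<in>?I. \<Sum>j\<in>?I. \<Sum>r\<in>?I. x i * y j * z k * (?c i j r * ?c r k l))"
        by (intro sum.cong refl sum.swap)
      also have "\<dots> = (\<Sum>k\<in>?I. \<Sum>i\<in>?I. \<Sum>j\<in>?I. x i * y j * z k * (\<Sum>r\<in>?I. ?c i j r * ?c r k l))"
        by (simp add: sum_distrib_left)
      also have "\<dots> = (\<Sum>k\<in>?I. \<Sum>i\<in>?I. \<Sum>j\<in>?I. x i * y j * z k * (\<Sum>r\<in>?I. ?c j k r * ?c i r l))"
        using True by (intro sum.cong refl) (simp add: assoc)
      also have "\<dots> = (\<Sum>i\<in>?I. \<Sum>k\<in>?I. \<Sum>j\<in>?I. x i * y j * z k * (\<Sum>r\<in>?I. ?c j k r * ?c i r l))"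
        by (rule sum.swap)
      also have "\<dots> = (\<Sum>i\<in>?I. \<Sum>j\<in>?I. \<Sum>k\<in>?I. x i * y j * z k * (\<Sum>r\<in>?I. ?c j k r * ?c i r l))"
        by (intro sum.cong refl sum.swap)
      also have "\<dots> = (\<Sum>i\<in>?I. \<Sum>j\<in>?I. \<Sum>k\<in>?I. \<Sum>r\<in>?I. x i * y j * z k * (?c j k r * ?c i r l))"
        by (simp add: sum_distrib_left)
      also have "\<dots> = (\<Sum>i\<in>?I. \<Sum>j\<in>?I. \<Sum>r\<in>?I. \<Sum>k\<in>?I. x i * y j * z k * (?c j k r * ?c i r l))"
        by (intro sum.cong refl sum.swap)
      also have "\<dots> = (\<Sum>i\<in>?I. \<Sum>r\<in>?I. \<Sum>j\<in>?I. \<Sum>k\<in>?I. x i * y j * z k * (?c j k r * ?c i r l))"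
        by (intro sum.cong refl sum.swap)
      also have "\<dots> = (x \<otimes>\<^bsub>sc_algebra T\<^esub> (y \<otimes>\<^bsub>sc_algebra T\<^esub> z)) l"
        using True by (simp add: sc_mult sum_distrib_left sum_distrib_right mult_ac)
      finally show ?thesis .
    qed (simp add: sc_mult)
  qed
  show "\<one>\<^bsub>sc_algebra T\<^esub> \<otimes>\<^bsub>sc_algebra T\<^esub> x = x"
  proof
    fix k
    have "(\<Sum>i\<in>?I. \<Sum>j\<in>?I. ?u i * x j * ?c i j k) = (\<Sum>j\<in>?I. x j * (\<Sum>i\<in>?I. ?u i * ?c i j k))"
      by (subst sum.swap) (simp add: sum_distrib_left mult_ac)
    moreover have "(\<Sum>j\<in>?I. x j * (\<Sum>i\<in>?I. ?u i * ?c i j k)) = (\<Sum>j\<in>?I. if j = k then x j else 0)" if "k \<in> ?I"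
      using that by (intro sum.cong refl) (simp add: unit_l)
    ultimately show "(\<one>\<^bsub>sc_algebra T\<^esub> \<otimes>\<^bsub>sc_algebra T\<^esub> x) k = x k"
      using x fin by (simp add: sc_mult sc_one sc_carrier)
  qed
  show "x \<otimes>\<^bsub>sc_algebra T\<^esub> \<one>\<^bsub>sc_algebra T\<^esub> = x"
  proof
    fix k
    have "(\<Sum>i\<in>?I. \<Sum>j\<in>?I. x i * ?u j * ?c i j k) = (\<Sum>i\<in>?I. x i * (\<Sum>j\<in>?I. ?u j * ?c i j k))"
      by (simp add: sum_distrib_left mult_ac)
    moreover have "(\<Sum>i\<in>?I. x i * (\<Sum>j\<in>?I. ?u j * ?c i j k)) = (\<Sum>i\<in>?I. if i = k then x i else 0)" if "k \<in> ?I"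
      using that by (intro sum.cong refl) (simp add: unit_r)
    ultimately show "(x \<otimes>\<^bsub>sc_algebra T\<^esub> \<one>\<^bsub>sc_algebra T\<^esub>) k = x k"
      using x fin by (simp add: sc_mult sc_one sc_carrier)
  qed
qed (auto simp: abelian_group_sc_algebra sc_carrier sc_one sc_mult fun_eq_iff algebra_simps sum.distrib sum_distrib_left)

lemma assoc_algebra_mat_table:
  assumes "finite J"
  shows "assoc_algebra base_ring (sc_algebra (mat_table J :: ('j \<times> 'j, 'f::field) sc_table))"
proof -
  have m: "(\<Sum>r\<in>J \<times> J. f (fst r) (snd r) * (if fst r = i \<and> snd r = l then 1 else 0)) = f i l"
    if "i \<in> J" "l \<in> J" for f :: "'j \<Rightarrow> 'j \<Rightarrow> 'f" and i l
  proof -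
    have "(\<Sum>r\<in>J \<times> J. f (fst r) (snd r) * (if fst r = i \<and> snd r = l then 1 else 0)) =
        (\<Sum>r\<in>J \<times> J. if r = (i, l) then f i l else 0)"
      by (intro sum.cong refl) (auto simp: prod_eq_iff)
    then show ?thesis using that assms by simp
  qed
  have c: "sc_const (mat_table J) a b r = (if snd a = fst b then if fst r = fst a \<and> snd r = snd b then 1 else 0 else (0::'f))"
    "sc_unit (mat_table J) a = (if fst a = snd a then 1 else (0::'f))" for a b r :: "'j \<times> 'j"
    by (cases a; cases b; cases r; simp)+
  show ?thesis
  proof (rule assoc_algebra_sc_algebra)
    fix i j k l :: "'j \<times> 'j"
    assume ijkl: "i \<in> sc_index (mat_table J :: (_, 'f) sc_table)" "j \<in> sc_index (mat_table J :: (_, 'f) sc_table)"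
      "k \<in> sc_index (mat_table J :: (_, 'f) sc_table)" "l \<in> sc_index (mat_table J :: (_, 'f) sc_table)"
    have "(\<Sum>r\<in>J \<times> J. sc_const (mat_table J) i j r * sc_const (mat_table J) r k l) =
       (if snd i = fst j then sc_const (mat_table J) (fst i, snd j) k l else (0::'f))"
      using m[of "fst i" "snd j" "\<lambda>u v. sc_const (mat_table J) (u, v) k l"] ijkl
      by (cases "snd i = fst j") (auto simp: c(1)[of i j] mult.commute)
    moreover have "(\<Sum>r\<in>J \<times> J. sc_const (mat_table J) j k r * sc_const (mat_table J) i r l) =
       (if snd j = fst k then sc_const (mat_table J) i (fst j, snd k) l else (0::'f))"
      using m[of "fst j" "snd k" "\<lambda>u v. sc_const (mat_table J) i (u, v) l"] ijkl
      by (cases "snd j = fst k") (auto simp: c(1)[of j k] mult.commute)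
    ultimately show "(\<Sum>r\<in>sc_index (mat_table J). sc_const (mat_table J) i j r * sc_const (mat_table J) r k l) =
        (\<Sum>r\<in>sc_index (mat_table J). sc_const (mat_table J) j k r * (sc_const (mat_table J) i r l :: 'f))"
      by (simp add: c)
  next
    fix j k :: "'j \<times> 'j"
    assume jk: "j \<in> sc_index (mat_table J :: (_, 'f) sc_table)" "k \<in> sc_index (mat_table J :: (_, 'f) sc_table)"
    have "(\<Sum>i\<in>J \<times> J. sc_unit (mat_table J) i * sc_const (mat_table J) i j k) =
        (\<Sum>i\<in>J \<times> J. if i = (fst j, fst j) then if j = k then 1 else 0 else (0::'f))"
      by (intro sum.cong refl) (auto simp: c prod_eq_iff)
    then show "(\<Sum>i\<in>sc_index (mat_table J). sc_unit (mat_table J) i * sc_const (mat_table J) i j k) = (if j = k then 1 else (0::'f))"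
      using jk assms by (auto simp: sum.delta)
    have "(\<Sum>i\<in>J \<times> J. sc_unit (mat_table J) i * sc_const (mat_table J) j i k) =
        (\<Sum>i\<in>J \<times> J. if i = (snd j, snd j) then if j = k then 1 else 0 else (0::'f))"
      by (intro sum.cong refl) (auto simp: c prod_eq_iff)
    then show "(\<Sum>i\<in>sc_index (mat_table J). sc_unit (mat_table J) i * sc_const (mat_table J) j i k) = (if j = k then 1 else (0::'f))"
      using jk assms by (auto simp: sum.delta)
  qed (simp add: assms)
qed

definition basis_vector :: "'i \<Rightarrow> 'i \<Rightarrow> 'f::field" where
  "basis_vector i = (\<lambda>k. if k = i then 1 else 0)"

lemma sc_algebra_expand:
  assumes "finite (sc_index T)" "x \<in> carrier (sc_algebra T)"
  shows "x = finsum (sc_algebra T) (\<lambda>i. x i \<odot>\<^bsub>sc_algebra T\<^esub> basis_vector i) (sc_index T)"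
proof -
  have "finsum (sc_algebra T) (\<lambda>i. x i \<odot>\<^bsub>sc_algebra T\<^esub> basis_vector i) (sc_index T) =
      (\<lambda>k. \<Sum>i\<in>sc_index T. x i * basis_vector i k)"
    using assms(1) by (subst finsum_sc_algebra) (auto simp: sc_carrier basis_vector_def)
  also have "\<dots> = x"
  proof
    fix k
    have "(\<Sum>i\<in>sc_index T. x i * basis_vector i k) = (\<Sum>i\<in>sc_index T. if i = k then x i else 0)"
      by (intro sum.cong) (auto simp: basis_vector_def)
    then show "(\<Sum>i\<in>sc_index T. x i * basis_vector i k) = x k" using assms by (simp add: sc_carrier)
  qed
  finally show ?thesis by (rule sym)
qed

section \<open>Twisted group algebras\<close>

text \<open>
  The algebra with basis \<open>(e\<^sub>g)\<close>, \<open>g\<close> in \<open>G\<close>, and \<open>e\<^sub>g e\<^sub>h = \<omega>(g, h) e\<^bsub>g h\<^esub>\<close>.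
\<close>

definition twisted_table :: "('g, 'm) monoid_scheme \<Rightarrow> ('g \<Rightarrow> 'g \<Rightarrow> 'f::field) \<Rightarrow> ('g, 'f) sc_table" where
  "twisted_table G \<omega> = \<lparr>sc_index = carrier G,
     sc_const = (\<lambda>g h k. if k = g \<otimes>\<^bsub>G\<^esub> h then \<omega> g h else 0),
     sc_unit = (\<lambda>k. if k = \<one>\<^bsub>G\<^esub> then 1 else 0)\<rparr>"

lemma twisted_table_simps [simp]:
  "sc_index (twisted_table G \<omega>) = carrier G"
  "sc_const (twisted_table G \<omega>) g h k = (if k = g \<otimes>\<^bsub>G\<^esub> h then \<omega> g h else 0)"
  "sc_unit (twisted_table G \<omega>) k = (if k = \<one>\<^bsub>G\<^esub> then 1 else 0)"
  by (simp_all add: twisted_table_def)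

text \<open>
  The last assumption says that the alternating pairing \<open>(g, h) \<mapsto> \<omega>(g, h) / \<omega>(h, g)\<close> has no kernel: no basis
  vector but the unit commutes with all the others.  This makes the algebra central simple.
\<close>

locale nondegenerate_twist = comm_group G for G :: "('g, 'm) monoid_scheme" (structure) +
  fixes \<omega> :: "'g \<Rightarrow> 'g \<Rightarrow> 'f::field"
  assumes finite_carrier: "finite (carrier G)"
    and twist_nonzero: "g \<in> carrier G \<Longrightarrow> h \<in> carrier G \<Longrightarrow> \<omega> g h \<noteq> 0"
    and cocycle: "g \<in> carrier G \<Longrightarrow> h \<in> carrier G \<Longrightarrow> k \<in> carrier G \<Longrightarrow>
      \<omega> g h * \<omega> (g \<otimes> h) k = \<omega> h k * \<omega> g (h \<otimes> k)"
    and twist_one: "g \<in> carrier G \<Longrightarrow> \<omega> \<one> g = 1" "g \<in> carrier G \<Longrightarrow> \<omega> g \<one> = 1"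
    and nondegenerate: "g \<in> carrier G \<Longrightarrow> g \<noteq> \<one> \<Longrightarrow> \<exists>h\<in>carrier G. \<omega> g h \<noteq> \<omega> h g"
begin

abbreviation "TA \<equiv> sc_algebra (twisted_table G \<omega>)"

lemma assoc_algebra_twisted: "assoc_algebra base_ring TA"
proof (rule assoc_algebra_sc_algebra)
  have d: "(\<Sum>r\<in>carrier G. (if r = g then a else 0) * f r) = a * f g" if "g \<in> carrier G" for g a and f :: "'g \<Rightarrow> 'f"
  proof -
    have "(\<Sum>r\<in>carrier G. (if r = g then a else 0) * f r) = (\<Sum>r\<in>carrier G. if r = g then a * f g else 0)"
      by (intro sum.cong) auto
    then show ?thesis using that finite_carrier by simp
  qed
  fix i j k l assume ijkl: "i \<in> sc_index (twisted_table G \<omega>)" "j \<in> sc_index (twisted_table G \<omega>)"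
      "k \<in> sc_index (twisted_table G \<omega>)" "l \<in> sc_index (twisted_table G \<omega>)"
  then show "(\<Sum>r\<in>sc_index (twisted_table G \<omega>). sc_const (twisted_table G \<omega>) i j r * sc_const (twisted_table G \<omega>) r k l) =
    (\<Sum>r\<in>sc_index (twisted_table G \<omega>). sc_const (twisted_table G \<omega>) j k r * sc_const (twisted_table G \<omega>) i r l)"
    by (simp only: twisted_table_simps d m_closed) (simp add: m_assoc cocycle)
next
  fix j k assume jk: "j \<in> sc_index (twisted_table G \<omega>)" "k \<in> sc_index (twisted_table G \<omega>)"
  have "(\<Sum>i\<in>carrier G. (if i = \<one> then 1 else 0) * (if k = i \<otimes> j then \<omega> i j else 0)) =
      (\<Sum>i\<in>carrier G. if i = \<one> then if j = k then 1 else 0 else 0)"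
    using jk by (intro sum.cong) (auto simp: twist_one)
  then show "(\<Sum>i\<in>sc_index (twisted_table G \<omega>). sc_unit (twisted_table G \<omega>) i * sc_const (twisted_table G \<omega>) i j k) = (if j = k then 1 else 0)"
    using finite_carrier by (simp add: twisted_table_simps)
  have "(\<Sum>i\<in>carrier G. (if i = \<one> then 1 else 0) * (if k = j \<otimes> i then \<omega> j i else 0)) =
      (\<Sum>i\<in>carrier G. if i = \<one> then if j = k then 1 else 0 else 0)"
    using jk by (intro sum.cong) (auto simp: twist_one)
  then show "(\<Sum>i\<in>sc_index (twisted_table G \<omega>). sc_unit (twisted_table G \<omega>) i * sc_const (twisted_table G \<omega>) j i k) = (if j = k then 1 else 0)"
    using finite_carrier by (simp add: twisted_table_simps)
qed (simp add: finite_carrier)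

lemma mult_basis_right:
  assumes "g \<in> carrier G" "h \<in> carrier G"
  shows "(x \<otimes>\<^bsub>TA\<^esub> basis_vector h) (g \<otimes> h) = x g * \<omega> g h"
proof -
  have "(\<Sum>i\<in>carrier G. \<Sum>j\<in>carrier G. x i * basis_vector h j * (if g \<otimes> h = i \<otimes> j then \<omega> i j else 0)) =
      (\<Sum>i\<in>carrier G. \<Sum>j\<in>carrier G. if j = h then if i = g then x i * \<omega> i h else 0 else 0)"
    using assms by (intro sum.cong refl) (auto simp: basis_vector_def)
  then show ?thesis using assms finite_carrier by (simp add: sc_mult)
qed

lemma mult_basis_left:
  assumes "g \<in> carrier G" "h \<in> carrier G"
  shows "(basis_vector h \<otimes>\<^bsub>TA\<^esub> x) (g \<otimes> h) = \<omega> h g * x g"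
proof -
  have "(\<Sum>i\<in>carrier G. \<Sum>j\<in>carrier G. basis_vector h i * x j * (if g \<otimes> h = i \<otimes> j then \<omega> i j else 0)) =
      (\<Sum>i\<in>carrier G. \<Sum>j\<in>carrier G. if i = h then if j = g then \<omega> h j * x j else 0 else 0)"
    using assms by (intro sum.cong refl) (auto simp: basis_vector_def m_comm[of h])
  also have "\<dots> = (\<Sum>i\<in>carrier G. if i = h then \<Sum>j\<in>carrier G. if j = g then \<omega> h j * x j else 0 else 0)"
    by (intro sum.cong refl) auto
  finally show ?thesis using assms finite_carrier by (simp add: sc_mult)
qed

lemma basis_vector_closed: "g \<in> carrier G \<Longrightarrow> basis_vector g \<in> carrier TA"
  by (auto simp: sc_carrier basis_vector_def)

lemma one_eq_basis_vector: "\<one>\<^bsub>TA\<^esub> = basis_vector \<one>"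
  by (auto simp: fun_eq_iff sc_one basis_vector_def)

lemma support_in: "x \<in> carrier TA \<Longrightarrow> x g \<noteq> 0 \<Longrightarrow> g \<in> carrier G"
  by (auto simp: sc_carrier)

text \<open>
  Conjugation by a basis vector multiplies each coefficient by a value of the commutator pairing, and
  only the coefficient at the neutral element is fixed by all of them.
\<close>

lemma center_twisted:
  "{z \<in> carrier TA. \<forall>x\<in>carrier TA. z \<otimes>\<^bsub>TA\<^esub> x = x \<otimes>\<^bsub>TA\<^esub> z} = range (\<lambda>r. r \<odot>\<^bsub>TA\<^esub> \<one>\<^bsub>TA\<^esub>)"
proof (intro equalityI subsetI)
  fix z assume "z \<in> {z \<in> carrier TA. \<forall>x\<in>carrier TA. z \<otimes>\<^bsub>TA\<^esub> x = x \<otimes>\<^bsub>TA\<^esub> z}"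
  then have z: "z \<in> carrier TA" "\<And>x. x \<in> carrier TA \<Longrightarrow> z \<otimes>\<^bsub>TA\<^esub> x = x \<otimes>\<^bsub>TA\<^esub> z" by blast+
  have "z g = 0" if g1: "g \<noteq> \<one>" for g
  proof (cases "g \<in> carrier G")
    case True
    then obtain h where h: "h \<in> carrier G" "\<omega> g h \<noteq> \<omega> h g" using nondegenerate[OF True g1] by blast
    have "z g * \<omega> g h = (z \<otimes>\<^bsub>TA\<^esub> basis_vector h) (g \<otimes> h)"
      by (simp add: mult_basis_right True h(1))
    also have "\<dots> = (basis_vector h \<otimes>\<^bsub>TA\<^esub> z) (g \<otimes> h)"
      by (simp only: z(2)[OF basis_vector_closed[OF h(1)]])
    also have "\<dots> = \<omega> h g * z g"
      by (simp add: mult_basis_left True h(1))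
    finally have "z g * \<omega> g h = \<omega> h g * z g" .
    then have "z g * (\<omega> g h - \<omega> h g) = 0" by (simp add: algebra_simps)
    then show ?thesis using h(2) by simp
  qed (use z(1) in \<open>simp add: sc_carrier\<close>)
  then have "z \<one> \<odot>\<^bsub>TA\<^esub> \<one>\<^bsub>TA\<^esub> = z" by (auto simp: one_eq_basis_vector basis_vector_def fun_eq_iff)
  then have "z = z \<one> \<odot>\<^bsub>TA\<^esub> \<one>\<^bsub>TA\<^esub>" by (rule sym)
  then show "z \<in> range (\<lambda>r. r \<odot>\<^bsub>TA\<^esub> \<one>\<^bsub>TA\<^esub>)" by blast
next
  interpret TA: field_algebra TA by (rule field_algebra.intro[OF assoc_algebra_twisted])
  fix z assume "z \<in> range (\<lambda>r. r \<odot>\<^bsub>TA\<^esub> \<one>\<^bsub>TA\<^esub>)"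
  then obtain r where r: "z = r \<odot>\<^bsub>TA\<^esub> \<one>\<^bsub>TA\<^esub>" by blast
  have "z \<otimes>\<^bsub>TA\<^esub> x = r \<odot>\<^bsub>TA\<^esub> x" "x \<otimes>\<^bsub>TA\<^esub> z = r \<odot>\<^bsub>TA\<^esub> x" if "x \<in> carrier TA" for x
    using TA.scalar_mult_left[OF TA.one_closed that] TA.scalar_mult_right[OF that TA.one_closed] that
    by (simp_all add: r del: sc_linear)
  moreover have "z \<in> carrier TA" unfolding r by (rule TA.scalar_closed) simp
  ultimately show "z \<in> {z \<in> carrier TA. \<forall>x\<in>carrier TA. z \<otimes>\<^bsub>TA\<^esub> x = x \<otimes>\<^bsub>TA\<^esub> z}" by simp
qed

text \<open>
  A nonzero element of smallest support in an ideal is, up to a basis vector, a scalar: otherwise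
  the commutator with a suitable basis vector has smaller support.
\<close>

lemma ideal_twisted:
  assumes "ideal I TA" "I \<noteq> {\<zero>\<^bsub>TA\<^esub>}"
  shows "I = carrier TA"
proof -
  interpret TA: field_algebra TA by (rule field_algebra.intro[OF assoc_algebra_twisted])
  interpret I: ideal I TA by fact
  let ?supp = "\<lambda>x :: 'g \<Rightarrow> 'f. {g. x g \<noteq> 0}"
  have fin: "finite (?supp x)" if "x \<in> I" for x
  proof (rule finite_subset[OF _ finite_carrier], rule subsetI)
    fix g assume "g \<in> ?supp x"
    then show "g \<in> carrier G" using that I.a_subset support_in[of x g] by blast
  qed
  obtain x0 where "x0 \<in> I \<and> x0 \<noteq> \<zero>\<^bsub>TA\<^esub>" using assms(2) I.zero_closed by blast
  from ex_has_least_nat[of "\<lambda>x. x \<in> I \<and> x \<noteq> \<zero>\<^bsub>TA\<^esub>", OF this, of "\<lambda>x. card (?supp x)"]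
  obtain x where x: "x \<in> I" "x \<noteq> \<zero>\<^bsub>TA\<^esub>"
    and x_min: "\<And>y. y \<in> I \<Longrightarrow> y \<noteq> \<zero>\<^bsub>TA\<^esub> \<Longrightarrow> card (?supp x) \<le> card (?supp y)"
    by auto
  have xc: "x \<in> carrier TA" using x(1) I.a_subset by blast
  obtain g0 where g0: "x g0 \<noteq> 0" using x(2) by (auto simp: fun_eq_iff)
  have g0c: "g0 \<in> carrier G" using support_in[OF xc g0] .
  define y where "y = x \<otimes>\<^bsub>TA\<^esub> basis_vector (inv g0)"
  have y: "y \<in> I" unfolding y_def using x(1) g0c by (intro I.I_r_closed basis_vector_closed) auto
  have yc: "y \<in> carrier TA" using y I.a_subset by blast
  have y_val: "y (g \<otimes> inv g0) = x g * \<omega> g (inv g0)" if "g \<in> carrier G" for g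
    unfolding y_def using mult_basis_right that g0c by simp
  have supp_y: "?supp y = (\<lambda>g. g \<otimes> inv g0) ` ?supp x"
  proof (intro equalityI subsetI)
    fix k assume k: "k \<in> ?supp y"
    then have kc: "k \<in> carrier G" using support_in[OF yc] by simp
    then have "k = (k \<otimes> g0) \<otimes> inv g0" using g0c by (simp add: m_assoc)
    then show "k \<in> (\<lambda>g. g \<otimes> inv g0) ` ?supp x"
      using y_val[of "k \<otimes> g0"] k kc g0c by (intro image_eqI[of _ _ "k \<otimes> g0"]) auto
  next
    fix k assume "k \<in> (\<lambda>g. g \<otimes> inv g0) ` ?supp x"
    then obtain g where g: "x g \<noteq> 0" "k = g \<otimes> inv g0" by blast
    then show "k \<in> ?supp y"
      using y_val[OF support_in[OF xc g(1)]] twist_nonzero[OF support_in[OF xc g(1)], of "inv g0"] g0c by simp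
  qed
  have card_y: "card (?supp y) = card (?supp x)"
    unfolding supp_y using support_in[OF xc] g0c by (intro card_image inj_onI) auto
  have y1: "y \<one> \<noteq> 0" using y_val[of g0] g0c g0 twist_nonzero[of g0 "inv g0"] by simp
  have y_scalar: "y g = 0" if g: "g \<noteq> \<one>" for g
  proof (rule ccontr)
    assume yg: "y g \<noteq> 0"
    have gc: "g \<in> carrier G" using support_in[OF yc yg] .
    obtain h where h: "h \<in> carrier G" "\<omega> g h \<noteq> \<omega> h g" using nondegenerate[OF gc g] by blast
    let ?z = "basis_vector h \<otimes>\<^bsub>TA\<^esub> y \<ominus>\<^bsub>TA\<^esub> y \<otimes>\<^bsub>TA\<^esub> basis_vector h"
    have bh: "basis_vector h \<in> carrier TA" using h(1) by (rule basis_vector_closed)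
    have zI: "?z \<in> I" unfolding a_minus_def
      by (rule I.a_closed[OF I.I_l_closed[OF y bh] I.a_inv_closed[OF I.I_r_closed[OF y bh]]])
    have zc: "?z \<in> carrier TA" using zI I.a_subset by blast
    have "\<ominus>\<^bsub>TA\<^esub> v = (\<lambda>k. - v k)" if "v \<in> carrier TA" for v
      using that by (intro TA.minus_equality) (auto simp: sc_carrier)
    then have z_val: "?z (k \<otimes> h) = (\<omega> h k - \<omega> k h) * y k" if "k \<in> carrier G" for k
      using mult_basis_left[OF that h(1), of y] mult_basis_right[OF that h(1), of y] yc basis_vector_closed[OF h(1)]
      by (simp add: a_minus_def algebra_simps)
    have "?z (g \<otimes> h) \<noteq> 0" using z_val[OF gc] h(2) yg by simp
    then have "card (?supp x) \<le> card (?supp ?z)" using zI by (intro x_min) auto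
    moreover have "?supp ?z \<subseteq> (\<lambda>k. k \<otimes> h) ` (?supp y - {\<one>})"
    proof
      fix k assume k: "k \<in> ?supp ?z"
      then have kc: "k \<in> carrier G" using support_in[OF zc] by simp
      have keq: "k = (k \<otimes> inv h) \<otimes> h" using h(1) kc by (simp add: m_assoc)
      then have "(\<omega> h (k \<otimes> inv h) - \<omega> (k \<otimes> inv h) h) * y (k \<otimes> inv h) \<noteq> 0"
        using z_val[of "k \<otimes> inv h"] k kc h(1) by simp
      then have "k \<otimes> inv h \<in> ?supp y - {\<one>}" using twist_one h(1) by auto
      then show "k \<in> (\<lambda>k. k \<otimes> h) ` (?supp y - {\<one>})" using keq by blast
    qed
    then have "card (?supp ?z) \<le> card (?supp y - {\<one>})"
      using fin[OF y] by (intro surj_card_le) auto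
    moreover have "card (?supp y - {\<one>}) < card (?supp y)"
      using fin[OF y] y1 by (intro psubset_card_mono) auto
    ultimately show False using card_y by linarith
  qed
  have "\<one>\<^bsub>TA\<^esub> = (inverse (y \<one>) \<odot>\<^bsub>TA\<^esub> \<one>\<^bsub>TA\<^esub>) \<otimes>\<^bsub>TA\<^esub> y"
  proof -
    have "(inverse (y \<one>) \<odot>\<^bsub>TA\<^esub> \<one>\<^bsub>TA\<^esub>) \<otimes>\<^bsub>TA\<^esub> y = inverse (y \<one>) \<odot>\<^bsub>TA\<^esub> y"
      using yc TA.scalar_mult_left[of "\<one>\<^bsub>TA\<^esub>" y "inverse (y \<one>)"] by (simp del: sc_linear)
    also have "\<dots> = \<one>\<^bsub>TA\<^esub>"
      using y_scalar y1 by (auto simp: one_eq_basis_vector basis_vector_def fun_eq_iff)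
    finally show ?thesis by (rule sym)
  qed
  moreover have "(inverse (y \<one>) \<odot>\<^bsub>TA\<^esub> \<one>\<^bsub>TA\<^esub>) \<otimes>\<^bsub>TA\<^esub> y \<in> I"
    using y by (intro I.I_l_closed TA.scalar_closed) auto
  ultimately show ?thesis using I.one_imp_carrier by simp
qed

lemma one_not_zero_twisted: "\<one>\<^bsub>TA\<^esub> \<noteq> \<zero>\<^bsub>TA\<^esub>"
  unfolding one_eq_basis_vector by (auto simp: basis_vector_def fun_eq_iff)

lemma central_simple_twisted: "central_simple TA"
proof -
  have inj: "inj (basis_vector :: 'g \<Rightarrow> 'g \<Rightarrow> 'f)"
    by (rule injI) (metis basis_vector_def zero_neq_one)
  have "finite_dim_algebra TA"
    unfolding finite_dim_algebra_def
  proof (intro exI[of _ "basis_vector ` carrier G"] conjI ballI)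
    fix x assume x: "x \<in> carrier TA"
    interpret TA: field_algebra TA by (rule field_algebra.intro[OF assoc_algebra_twisted])
    have "x = finsum TA (\<lambda>i. x i \<odot>\<^bsub>TA\<^esub> basis_vector i) (carrier G)"
      using sc_algebra_expand[of "twisted_table G \<omega>" x] finite_carrier x by simp
    also have "\<dots> = finsum TA (\<lambda>s. x (inv_into UNIV basis_vector s) \<odot>\<^bsub>TA\<^esub> s) (basis_vector ` carrier G)"
    proof -
      have "inj_on (basis_vector :: 'g \<Rightarrow> 'g \<Rightarrow> 'f) (carrier G)" by (rule inj_on_subset[OF inj]) simp
      then have "finsum TA (\<lambda>s. x (inv_into UNIV basis_vector s) \<odot>\<^bsub>TA\<^esub> s) (basis_vector ` carrier G) =
          finsum TA (\<lambda>i. x (inv_into UNIV basis_vector (basis_vector i :: 'g \<Rightarrow> 'f)) \<odot>\<^bsub>TA\<^esub> basis_vector i) (carrier G)"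
        by (intro TA.finsum_reindex) (use TA.scalar_closed basis_vector_closed in blast)
      then show ?thesis by (simp only: inv_into_f_f[OF inj UNIV_I])
    qed
    finally show "\<exists>r. x = finsum TA (\<lambda>s. r s \<odot>\<^bsub>TA\<^esub> s) (basis_vector ` carrier G)"
      by (intro exI[of _ "\<lambda>s. x (inv_into UNIV basis_vector s)"]) simp
  qed (auto simp: finite_carrier basis_vector_closed)
  then show ?thesis
    unfolding central_simple_def
    using assoc_algebra_twisted center_twisted one_not_zero_twisted ideal_twisted by blast
qed

end

section \<open>Projective representations\<close>

text \<open>
  The relations of the twisted group algebra, in another algebra.
\<close>

definition projective_rep :: "('g, 'm) monoid_scheme \<Rightarrow> ('g \<Rightarrow> 'g \<Rightarrow> 'f::field) \<Rightarrow> ('f, 'v) module \<Rightarrow> ('g \<Rightarrow> 'v) \<Rightarrow> bool" where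
  "projective_rep G \<omega> A \<rho> \<longleftrightarrow> (\<forall>g\<in>carrier G. \<rho> g \<in> carrier A) \<and> \<rho> \<one>\<^bsub>G\<^esub> = \<one>\<^bsub>A\<^esub> \<and>
     (\<forall>g\<in>carrier G. \<forall>h\<in>carrier G. \<rho> g \<otimes>\<^bsub>A\<^esub> \<rho> h = \<omega> g h \<odot>\<^bsub>A\<^esub> \<rho> (g \<otimes>\<^bsub>G\<^esub> h))"

lemma projective_repD:
  assumes "projective_rep G \<omega> A \<rho>"
  shows "g \<in> carrier G \<Longrightarrow> \<rho> g \<in> carrier A" "\<rho> \<one>\<^bsub>G\<^esub> = \<one>\<^bsub>A\<^esub>"
    "g \<in> carrier G \<Longrightarrow> h \<in> carrier G \<Longrightarrow> \<rho> g \<otimes>\<^bsub>A\<^esub> \<rho> h = \<omega> g h \<odot>\<^bsub>A\<^esub> \<rho> (g \<otimes>\<^bsub>G\<^esub> h)"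
  using assms unfolding projective_rep_def by auto

context nondegenerate_twist
begin

text \<open>
  By simplicity the linear extension of a projective representation is injective; if the target is
  spanned by no more elements than the group has, it is onto as well.
\<close>

theorem twisted_algebra_iso:
  fixes A :: "('f, 'v) module" and b :: "'j \<Rightarrow> 'v"
  assumes A: "assoc_algebra base_ring A" and nontriv: "\<one>\<^bsub>A\<^esub> \<noteq> \<zero>\<^bsub>A\<^esub>" and rep: "projective_rep G \<omega> A \<rho>"
    and J: "finite J" "card J \<le> card (carrier G)" and b: "\<And>j. j \<in> J \<Longrightarrow> b j \<in> carrier A"
    and span: "\<And>x. x \<in> carrier A \<Longrightarrow> \<exists>r. x = finsum A (\<lambda>j. r j \<odot>\<^bsub>A\<^esub> b j) J"
  shows "iso_algebras TA A"
proof -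
  interpret A: field_algebra A by (rule field_algebra.intro[OF A])
  interpret TA: field_algebra TA by (rule field_algebra.intro[OF assoc_algebra_twisted])
  note \<rho> = projective_repD[OF rep]
  note fin = finite_carrier
  define H where "H x = finsum A (\<lambda>g. x g \<odot>\<^bsub>A\<^esub> \<rho> g) (carrier G)" for x
  have H_closed: "H x \<in> carrier A" for x
    unfolding H_def using \<rho>(1) by (intro A.finsum_closed) auto
  have H_add: "H (\<lambda>k. x k + y k) = H x \<oplus>\<^bsub>A\<^esub> H y" for x y
  proof -
    have "H (\<lambda>k. x k + y k) = finsum A (\<lambda>g. x g \<odot>\<^bsub>A\<^esub> \<rho> g \<oplus>\<^bsub>A\<^esub> y g \<odot>\<^bsub>A\<^esub> \<rho> g) (carrier G)"
      unfolding H_def using \<rho>(1) by (intro A.finsum_cong') (auto simp: A.scalar_add_left)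
    then show ?thesis unfolding H_def using \<rho>(1) by (simp add: A.finsum_addf Pi_def)
  qed
  have H_scalar: "H (\<lambda>k. r * x k) = r \<odot>\<^bsub>A\<^esub> H x" for r x
  proof -
    have "r \<odot>\<^bsub>A\<^esub> H x = finsum A (\<lambda>g. r \<odot>\<^bsub>A\<^esub> (x g \<odot>\<^bsub>A\<^esub> \<rho> g)) (carrier G)"
      unfolding H_def using \<rho>(1) fin by (intro A.scalar_finsum) auto
    also have "\<dots> = H (\<lambda>k. r * x k)"
      unfolding H_def using \<rho>(1) by (intro A.finsum_cong') (auto simp: A.scalar_scalar)
    finally show ?thesis by simp
  qed
  have H_mult: "H (x \<otimes>\<^bsub>TA\<^esub> y) = H x \<otimes>\<^bsub>A\<^esub> H y" for x y
  proof -
    let ?G = "carrier G" and ?c = "\<lambda>g h k. x g * y h * (if k = g \<otimes> h then \<omega> g h else 0)"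
    have "H (x \<otimes>\<^bsub>TA\<^esub> y) = finsum A (\<lambda>k. (\<Sum>g\<in>?G. \<Sum>h\<in>?G. ?c g h k) \<odot>\<^bsub>A\<^esub> \<rho> k) ?G"
      unfolding H_def using \<rho>(1) by (intro A.finsum_cong') (auto simp: sc_mult)
    also have "\<dots> = finsum A (\<lambda>k. finsum A (\<lambda>g. finsum A (\<lambda>h. ?c g h k \<odot>\<^bsub>A\<^esub> \<rho> k) ?G) ?G) ?G"
      using \<rho>(1) fin by (intro A.finsum_cong') (auto simp: A.scalar_sum intro!: A.finsum_closed A.finsum_cong')
    also have "\<dots> = finsum A (\<lambda>g. finsum A (\<lambda>k. finsum A (\<lambda>h. ?c g h k \<odot>\<^bsub>A\<^esub> \<rho> k) ?G) ?G) ?G"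
      using \<rho>(1) fin by (intro A.finsum_swap) (auto intro!: A.finsum_closed)
    also have "\<dots> = finsum A (\<lambda>g. finsum A (\<lambda>h. finsum A (\<lambda>k. ?c g h k \<odot>\<^bsub>A\<^esub> \<rho> k) ?G) ?G) ?G"
      using \<rho>(1) fin by (intro A.finsum_cong' A.finsum_swap) (auto intro!: A.finsum_closed)
    also have "\<dots> = finsum A (\<lambda>g. finsum A (\<lambda>h. (x g \<odot>\<^bsub>A\<^esub> \<rho> g) \<otimes>\<^bsub>A\<^esub> (y h \<odot>\<^bsub>A\<^esub> \<rho> h)) ?G) ?G"
    proof (intro A.finsum_cong' refl)
      fix g h assume gh: "g \<in> ?G" "h \<in> ?G"
      have "finsum A (\<lambda>k. ?c g h k \<odot>\<^bsub>A\<^esub> \<rho> k) ?G =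
          finsum A (\<lambda>k. if g \<otimes> h = k then (x g * y h * \<omega> g h) \<odot>\<^bsub>A\<^esub> \<rho> k else \<zero>\<^bsub>A\<^esub>) ?G"
        using \<rho>(1) by (intro A.finsum_cong') auto
      also have "\<dots> = (x g * y h * \<omega> g h) \<odot>\<^bsub>A\<^esub> \<rho> (g \<otimes> h)"
        using gh \<rho>(1) fin by (intro A.finsum_singleton) auto
      also have "\<dots> = (x g \<odot>\<^bsub>A\<^esub> \<rho> g) \<otimes>\<^bsub>A\<^esub> (y h \<odot>\<^bsub>A\<^esub> \<rho> h)"
        using gh \<rho>(1) by (simp add: A.scalar_mult_left A.scalar_mult_right \<rho>(3) A.scalar_scalar mult_ac)
      finally show "finsum A (\<lambda>k. ?c g h k \<odot>\<^bsub>A\<^esub> \<rho> k) ?G = (x g \<odot>\<^bsub>A\<^esub> \<rho> g) \<otimes>\<^bsub>A\<^esub> (y h \<odot>\<^bsub>A\<^esub> \<rho> h)" .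
    qed (use \<rho>(1) in \<open>auto intro!: A.finsum_closed\<close>)
    also have "\<dots> = finsum A (\<lambda>g. (x g \<odot>\<^bsub>A\<^esub> \<rho> g) \<otimes>\<^bsub>A\<^esub> H y) ?G"
      unfolding H_def using \<rho>(1) fin
      by (intro A.finsum_cong' A.finsum_rdistr[symmetric]) (auto intro!: A.finsum_closed)
    also have "\<dots> = H x \<otimes>\<^bsub>A\<^esub> H y"
      unfolding H_def[of x] using \<rho>(1) fin H_closed by (intro A.finsum_ldistr[symmetric]) auto
    finally show ?thesis .
  qed
  have H_basis: "H (basis_vector g) = \<rho> g" if "g \<in> carrier G" for g
  proof -
    have "H (basis_vector g) = finsum A (\<lambda>k. if g = k then \<rho> k else \<zero>\<^bsub>A\<^esub>) (carrier G)"
      unfolding H_def using \<rho>(1) by (intro A.finsum_cong') (auto simp: basis_vector_def)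
    then show ?thesis using that \<rho>(1) fin by (simp add: A.finsum_singleton Pi_def)
  qed
  have H_one: "H \<one>\<^bsub>TA\<^esub> = \<one>\<^bsub>A\<^esub>" unfolding one_eq_basis_vector by (simp add: H_basis \<rho>(2))
  have ring_hom: "H \<in> ring_hom TA A"
    by (rule ring_hom_memI) (auto simp: H_closed H_mult H_add H_one)
  interpret H: ring_hom_ring TA A H
    by (rule ring_hom_ringI2[OF TA.ring_axioms A.ring_axioms ring_hom])
  have inj: "inj_on H (carrier TA)"
  proof (rule H.trivial_ker_imp_inj)
    have "\<one>\<^bsub>TA\<^esub> \<notin> a_kernel TA A H"
      using H.kernel_zero[of "\<one>\<^bsub>TA\<^esub>"] nontriv unfolding H_one by blast
    then have "a_kernel TA A H \<noteq> carrier TA" using TA.one_closed by metis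
    then show "a_kernel TA A H = {\<zero>\<^bsub>TA\<^esub>}"
      using ideal_twisted[OF H.kernel_is_ideal] by argo
  qed
  have "\<exists>x\<in>carrier TA. y = H x" if y: "y \<in> carrier A" for y
  proof -
    have "\<exists>M. \<forall>g\<in>carrier G. \<rho> g = finsum A (\<lambda>j. M g j \<odot>\<^bsub>A\<^esub> b j) J"
      using span \<rho>(1) by (intro bchoice) auto
    then obtain M where M: "\<And>g. g \<in> carrier G \<Longrightarrow> \<rho> g = finsum A (\<lambda>j. M g j \<odot>\<^bsub>A\<^esub> b j) J" by blast
    obtain m where m: "y = finsum A (\<lambda>j. m j \<odot>\<^bsub>A\<^esub> b j) J" using span[OF y] by blast
    let ?M = "\<lambda>i. case i of None \<Rightarrow> m | Some g \<Rightarrow> M g" and ?I = "insert None (Some ` carrier G)"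
    have "card ?I = Suc (card (carrier G))" using fin by (simp add: card_image)
    then obtain r where r: "\<exists>i\<in>?I. r i \<noteq> 0" "\<And>j. j \<in> J \<Longrightarrow> (\<Sum>i\<in>?I. r i * ?M i j) = 0"
      using underdetermined_system[of J ?I ?M] J fin by auto
    define x where "x g = (if g \<in> carrier G then r (Some g) else 0)" for g
    have xc: "x \<in> carrier TA" by (simp add: sc_carrier x_def)
    have "H x = finsum A (\<lambda>g. finsum A (\<lambda>j. (x g * M g j) \<odot>\<^bsub>A\<^esub> b j) J) (carrier G)"
      unfolding H_def using b J(1)
      by (intro A.finsum_cong') (auto simp: M A.scalar_finsum A.scalar_scalar intro!: A.finsum_closed A.finsum_cong')
    also have "\<dots> = finsum A (\<lambda>j. finsum A (\<lambda>g. (x g * M g j) \<odot>\<^bsub>A\<^esub> b j) (carrier G)) J"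
      using b J(1) fin by (intro A.finsum_swap) auto
    also have "\<dots> = finsum A (\<lambda>j. (\<Sum>g\<in>carrier G. x g * M g j) \<odot>\<^bsub>A\<^esub> b j) J"
      using b fin by (intro A.finsum_cong') (auto simp: A.scalar_sum)
    also have "\<dots> = finsum A (\<lambda>j. (- r None) \<odot>\<^bsub>A\<^esub> (m j \<odot>\<^bsub>A\<^esub> b j)) J"
    proof (intro A.finsum_cong' refl)
      fix j assume j: "j \<in> J"
      have "(\<Sum>i\<in>?I. r i * ?M i j) = r None * m j + (\<Sum>g\<in>carrier G. r (Some g) * M g j)"
        using fin by (simp add: sum.reindex)
      moreover have "(\<Sum>g\<in>carrier G. x g * M g j) = (\<Sum>g\<in>carrier G. r (Some g) * M g j)"
        by (intro sum.cong) (auto simp: x_def)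
      ultimately have "(\<Sum>g\<in>carrier G. x g * M g j) = (- r None) * m j"
        using r(2)[OF j] by (simp add: add_eq_0_iff)
      then show "(\<Sum>g\<in>carrier G. x g * M g j) \<odot>\<^bsub>A\<^esub> b j = (- r None) \<odot>\<^bsub>A\<^esub> (m j \<odot>\<^bsub>A\<^esub> b j)"
        using b j by (simp add: A.scalar_scalar)
    qed (use b in auto)
    also have "\<dots> = (- r None) \<odot>\<^bsub>A\<^esub> y"
      unfolding m using b J(1) by (intro A.scalar_finsum[symmetric]) auto
    finally have Hx: "H x = (- r None) \<odot>\<^bsub>A\<^esub> y" .
    have "r None \<noteq> 0"
    proof
      assume r0: "r None = 0"
      have "H x = \<zero>\<^bsub>A\<^esub>" using Hx y r0 by simp
      also have "\<dots> = H \<zero>\<^bsub>TA\<^esub>" using H.hom_zero by (simp only:)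
      finally have "H x = H \<zero>\<^bsub>TA\<^esub>" .
      then have "x = \<zero>\<^bsub>TA\<^esub>" by (rule inj_onD[OF inj _ xc TA.zero_closed])
      then have "x g = 0" for g by simp
      then have "r (Some g) = 0" if "g \<in> carrier G" for g
        using that by (metis x_def)
      then show False using r(1) r0 by auto
    qed
    then have "H (\<lambda>k. inverse (- r None) * x k) = y"
      using y by (simp only: H_scalar Hx A.scalar_scalar) simp
    moreover have "(\<lambda>k. inverse (- r None) * x k) \<in> carrier TA" using xc by (simp add: sc_carrier)
    ultimately show ?thesis by blast
  qed
  then have "bij_betw H (carrier TA) (carrier A)"
    using inj H_closed by (auto simp: bij_betw_def)
  then have "H \<in> algebra_isos TA A"
    by (intro algebra_isosI) (auto simp: H_closed H_mult H_add H_one H_scalar)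
  then show ?thesis by (rule iso_algebrasI)
qed

text \<open>The table of the target provides the spanning set.\<close>

corollary twisted_table_iso:
  assumes "assoc_algebra base_ring (sc_algebra T)" "\<one>\<^bsub>sc_algebra T\<^esub> \<noteq> \<zero>\<^bsub>sc_algebra T\<^esub>"
    and "projective_rep G \<omega> (sc_algebra T) \<rho>"
    and "finite (sc_index T)" "card (sc_index T) \<le> card (carrier G)"
  shows "iso_algebras TA (sc_algebra T)"
proof (rule twisted_algebra_iso[OF assms, of basis_vector])
  fix x assume "x \<in> carrier (sc_algebra T)"
  then show "\<exists>r. x = finsum (sc_algebra T) (\<lambda>j. r j \<odot>\<^bsub>sc_algebra T\<^esub> basis_vector j) (sc_index T)"
    using sc_algebra_expand[OF assms(4)] by blast
qed (auto simp: sc_carrier basis_vector_def)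

lemma projective_rep_basis: "projective_rep G \<omega> TA basis_vector"
  unfolding projective_rep_def
proof (intro conjI ballI)
  fix g h assume gh: "g \<in> carrier G" "h \<in> carrier G"
  show "basis_vector g \<otimes>\<^bsub>TA\<^esub> basis_vector h = \<omega> g h \<odot>\<^bsub>TA\<^esub> basis_vector (g \<otimes> h)"
  proof
    fix k
    show "(basis_vector g \<otimes>\<^bsub>TA\<^esub> basis_vector h) k = (\<omega> g h \<odot>\<^bsub>TA\<^esub> basis_vector (g \<otimes> h)) k"
    proof (cases "k \<in> carrier G")
      case True
      then have k: "k = (k \<otimes> inv h) \<otimes> h" using gh by (simp add: m_assoc)
      have "(basis_vector g \<otimes>\<^bsub>TA\<^esub> basis_vector h) k = basis_vector g (k \<otimes> inv h) * \<omega> (k \<otimes> inv h) h"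
        using mult_basis_right[of "k \<otimes> inv h" h "basis_vector g"] True gh k by simp
      moreover have "k \<otimes> inv h = g \<longleftrightarrow> k = g \<otimes> h" using True gh by (metis inv_solve_right' m_closed)
      ultimately show ?thesis by (auto simp: basis_vector_def)
    next
      case False
      then show ?thesis using gh by (auto simp: sc_mult basis_vector_def)
    qed
  qed
qed (auto simp: basis_vector_closed one_eq_basis_vector)

end

lemma (in field_algebra) projective_rep_commuting:
  assumes "projective_rep G \<omega> A \<rho>" "projective_rep H \<eta> A \<rho>'" "group G" "group H"
    and comm: "\<And>g h. g \<in> carrier G \<Longrightarrow> h \<in> carrier H \<Longrightarrow> \<rho> g \<otimes> \<rho>' h = \<rho>' h \<otimes> \<rho> g"
  shows "projective_rep (G \<times>\<times> H) (\<lambda>(g, h) (g', h'). \<omega> g g' * \<eta> h h') A (\<lambda>(g, h). \<rho> g \<otimes> \<rho>' h)"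
proof -
  note \<rho> = projective_repD[OF assms(1)]
  note \<rho>' = projective_repD[OF assms(2)]
  interpret G: group G by fact
  interpret H: group H by fact
  have "\<rho> g \<otimes> \<rho>' h \<otimes> (\<rho> g' \<otimes> \<rho>' h') = (\<omega> g g' * \<eta> h h') \<odot> (\<rho> (g \<otimes>\<^bsub>G\<^esub> g') \<otimes> \<rho>' (h \<otimes>\<^bsub>H\<^esub> h'))"
    if c: "g \<in> carrier G" "h \<in> carrier H" "g' \<in> carrier G" "h' \<in> carrier H" for g h g' h'
  proof -
    have "\<rho> g \<otimes> \<rho>' h \<otimes> (\<rho> g' \<otimes> \<rho>' h') = \<rho> g \<otimes> (\<rho>' h \<otimes> \<rho> g') \<otimes> \<rho>' h'"
      using c \<rho>(1) \<rho>'(1) by (simp add: m_assoc)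
    also have "\<dots> = (\<rho> g \<otimes> \<rho> g') \<otimes> (\<rho>' h \<otimes> \<rho>' h')"
      using c \<rho>(1) \<rho>'(1) by (simp add: comm[symmetric] m_assoc)
    finally show ?thesis
      using c \<rho>(1) \<rho>'(1) by (simp add: \<rho>(3) \<rho>'(3) scalar_mult_left scalar_mult_right scalar_scalar mult.commute)
  qed
  then show ?thesis
    unfolding projective_rep_def using \<rho>(1,2) \<rho>'(1,2) by auto
qed

text \<open>
  If one component of \<open>(g, h)\<close> is trivial, the other one detects the pair; if neither is, then an element of
  the first factor already does.
\<close>

lemma nondegenerate_twist_DirProd:
  assumes "nondegenerate_twist G \<omega>" "nondegenerate_twist H \<eta>"
  shows "nondegenerate_twist (G \<times>\<times> H) (\<lambda>(g, h) (g', h'). \<omega> g g' * \<eta> h h')"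
proof -
  interpret G: nondegenerate_twist G \<omega> by fact
  interpret H: nondegenerate_twist H \<eta> by fact
  interpret GH: group "G \<times>\<times> H" by (rule DirProd_group) (rule G.group_axioms H.group_axioms)+
  have "comm_group (G \<times>\<times> H)"
    by (rule GH.group_comm_groupI) (auto simp: G.m_comm H.m_comm)
  then show ?thesis
  proof (intro nondegenerate_twist.intro nondegenerate_twist_axioms.intro)
    fix x assume x: "x \<in> carrier (G \<times>\<times> H)" "x \<noteq> \<one>\<^bsub>G \<times>\<times> H\<^esub>"
    obtain g h where gh: "x = (g, h)" "g \<in> carrier G" "h \<in> carrier H" using x by auto
    show "\<exists>y\<in>carrier (G \<times>\<times> H). (\<lambda>(g, h) (g', h'). \<omega> g g' * \<eta> h h') x y \<noteq> (\<lambda>(g, h) (g', h'). \<omega> g g' * \<eta> h h') y x"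
    proof (cases "g = \<one>\<^bsub>G\<^esub>")
      case True
      then have "h \<noteq> \<one>\<^bsub>H\<^esub>" using x gh by auto
      then obtain k where "k \<in> carrier H" "\<eta> h k \<noteq> \<eta> k h" using H.nondegenerate[OF gh(3)] by blast
      then show ?thesis using gh by (intro bexI[of _ "(\<one>\<^bsub>G\<^esub>, k)"]) (auto simp: G.twist_one)
    next
      case False
      then obtain k where "k \<in> carrier G" "\<omega> g k \<noteq> \<omega> k g" using G.nondegenerate[OF gh(2)] by blast
      then show ?thesis using gh by (intro bexI[of _ "(k, \<one>\<^bsub>H\<^esub>)"]) (auto simp: H.twist_one)
    qed
  next
    fix x y z assume "x \<in> carrier (G \<times>\<times> H)" "y \<in> carrier (G \<times>\<times> H)" "z \<in> carrier (G \<times>\<times> H)"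
    then obtain g1 h1 g2 h2 g3 h3 where e: "x = (g1, h1)" "y = (g2, h2)" "z = (g3, h3)"
      and c: "g1 \<in> carrier G" "g2 \<in> carrier G" "g3 \<in> carrier G" "h1 \<in> carrier H" "h2 \<in> carrier H" "h3 \<in> carrier H"
      by auto
    have "(\<omega> g1 g2 * \<omega> (g1 \<otimes>\<^bsub>G\<^esub> g2) g3) * (\<eta> h1 h2 * \<eta> (h1 \<otimes>\<^bsub>H\<^esub> h2) h3) =
        (\<omega> g2 g3 * \<omega> g1 (g2 \<otimes>\<^bsub>G\<^esub> g3)) * (\<eta> h2 h3 * \<eta> h1 (h2 \<otimes>\<^bsub>H\<^esub> h3))"
      using c by (simp only: G.cocycle H.cocycle)
    then show "(\<lambda>(g, h) (g', h'). \<omega> g g' * \<eta> h h') x y * (\<lambda>(g, h) (g', h'). \<omega> g g' * \<eta> h h') (x \<otimes>\<^bsub>G \<times>\<times> H\<^esub> y) z =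
        (\<lambda>(g, h) (g', h'). \<omega> g g' * \<eta> h h') y z * (\<lambda>(g, h) (g', h'). \<omega> g g' * \<eta> h h') x (y \<otimes>\<^bsub>G \<times>\<times> H\<^esub> z)"
      by (simp add: e mult_ac)
  qed (auto simp: G.finite_carrier H.finite_carrier G.twist_nonzero H.twist_nonzero G.twist_one H.twist_one)
qed

lemma twisted_table_DirProd:
  "sc_tensor (twisted_table G \<omega>) (twisted_table H \<eta>) =
     twisted_table (G \<times>\<times> H) (\<lambda>(g, h) (g', h'). \<omega> g g' * \<eta> h h')"
  by (auto simp: sc_tensor_def twisted_table_def fun_eq_iff)

section \<open>Symbol algebras\<close>

definition residue_group :: "nat \<Rightarrow> nat monoid" where
  "residue_group p = \<lparr>carrier = {..<p}, monoid.mult = (\<lambda>r m. (r + m) mod p), one = 0\<rparr>"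

lemma residue_group_simps [simp]:
  "carrier (residue_group p) = {..<p}" "r \<otimes>\<^bsub>residue_group p\<^esub> m = (r + m) mod p" "\<one>\<^bsub>residue_group p\<^esub> = 0"
  by (simp_all add: residue_group_def)

lemma comm_group_residue_group: "p > 0 \<Longrightarrow> comm_group (residue_group p)"
proof (rule comm_groupI)
  fix x assume "p > 0" "x \<in> carrier (residue_group p)"
  then show "\<exists>y\<in>carrier (residue_group p). y \<otimes>\<^bsub>residue_group p\<^esub> x = \<one>\<^bsub>residue_group p\<^esub>"
    by (intro bexI[of _ "(p - x) mod p"]) (auto simp: mod_simps)
qed (auto simp: mod_simps add_ac)

text \<open>
  The structure constants of the symbol algebra are a cocycle on \<open>(\<int>/p)\<^sup>2\<close>; the powers of \<open>u\<close> and \<open>v\<close> are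
  the carries of the two additions.
\<close>

definition symbol_twist :: "nat \<Rightarrow> 'f::field \<Rightarrow> 'f \<Rightarrow> 'f \<Rightarrow> nat \<times> nat \<Rightarrow> nat \<times> nat \<Rightarrow> 'f" where
  "symbol_twist p \<zeta> u v = (\<lambda>(r, s) (m, n). \<zeta> ^ (s * m) * u ^ ((r + m) div p) * v ^ ((s + n) div p))"

abbreviation "symbol_group p \<equiv> residue_group p \<times>\<times> residue_group p"

lemma symbol_table_twisted: "symbol_table p \<zeta> u v = twisted_table (symbol_group p) (symbol_twist p \<zeta> u v)"
  by (auto simp: symbol_table_def twisted_table_def symbol_twist_def fun_eq_iff)

lemma root_of_unity_mod: "\<zeta> ^ p = (1::'f::field) \<Longrightarrow> \<zeta> ^ (n mod p) = \<zeta> ^ n"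
  by (metis mult_1_left power_add power_mult power_one div_mult_mod_eq mult.commute)

lemma div_add_carry:
  fixes r m k p :: nat
  assumes "p > 0"
  shows "(r + m) div p + ((r + m) mod p + k) div p = (r + m + k) div p"
proof -
  have "r + m + k = ((r + m) mod p + k) + p * ((r + m) div p)" by simp
  then show ?thesis using assms by (metis add.commute div_mult_self2 less_numeral_extra(3))
qed

lemma nondegenerate_symbol_twist:
  assumes p: "p > 1" and \<zeta>: "primitive_root_of_unity p \<zeta>" and uv: "u \<noteq> 0" "v \<noteq> 0"
  shows "nondegenerate_twist (symbol_group p) (symbol_twist p \<zeta> u v)"
proof -
  interpret R: comm_group "residue_group p" using p by (intro comm_group_residue_group) simp
  interpret RR: group "symbol_group p" by (rule DirProd_group) (rule R.group_axioms)+
  have \<zeta>p: "\<zeta> ^ p = 1" and \<zeta>k: "\<And>k. 0 < k \<Longrightarrow> k < p \<Longrightarrow> \<zeta> ^ k \<noteq> 1"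
    using \<zeta> by (auto simp: primitive_root_of_unity_def)
  have \<zeta>0: "\<zeta> \<noteq> 0" using \<zeta>p p by (intro notI) (simp add: power_0_left)
  have "comm_group (symbol_group p)"
    by (rule RR.group_comm_groupI) (auto simp: add.commute)
  then show ?thesis
  proof (intro nondegenerate_twist.intro nondegenerate_twist_axioms.intro)
    fix x assume x: "x \<in> carrier (symbol_group p)" "x \<noteq> \<one>\<^bsub>symbol_group p\<^esub>"
    obtain r s where rs: "x = (r, s)" "r < p" "s < p" using x by auto
    show "\<exists>y\<in>carrier (symbol_group p). symbol_twist p \<zeta> u v x y \<noteq> symbol_twist p \<zeta> u v y x"
    proof (cases "r = 0")
      case True
      then show ?thesis using x rs p uv \<zeta>k[of s]
        by (intro bexI[of _ "(1, 0)"]) (auto simp: symbol_twist_def)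
    next
      case False
      then show ?thesis using x rs p uv \<zeta>k[of r]
        by (intro bexI[of _ "(0, 1)"]) (auto simp: symbol_twist_def add.commute)
    qed
  next
    fix x y z assume "x \<in> carrier (symbol_group p)" "y \<in> carrier (symbol_group p)" "z \<in> carrier (symbol_group p)"
    obtain r s m n k l where e: "x = (r, s)" "y = (m, n)" "z = (k, l)" by (cases x; cases y; cases z)
    have 1: "w ^ ((r + m) div p) * w ^ (((r + m) mod p + k) div p) =
        w ^ ((m + k) div p) * w ^ ((r + (m + k) mod p) div p)" for w :: 'a and r m k
      using div_add_carry[of p r m k] div_add_carry[of p m k r] p
      by (simp add: power_add[symmetric] add_ac)
    have "\<zeta> ^ ((s + n) mod p * k) = \<zeta> ^ ((s + n) * k)" "\<zeta> ^ (s * ((m + k) mod p)) = \<zeta> ^ (s * (m + k))"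
      using root_of_unity_mod[OF \<zeta>p] by (metis mod_mult_left_eq, metis mod_mult_right_eq)
    then have 2: "\<zeta> ^ (s * m) * \<zeta> ^ ((s + n) mod p * k) = \<zeta> ^ (n * k) * \<zeta> ^ (s * ((m + k) mod p))"
      by (simp add: power_add[symmetric] algebra_simps)
    have "(\<zeta> ^ (s * m) * \<zeta> ^ ((s + n) mod p * k)) * (u ^ ((r + m) div p) * u ^ (((r + m) mod p + k) div p)) *
          (v ^ ((s + n) div p) * v ^ (((s + n) mod p + l) div p)) =
        (\<zeta> ^ (n * k) * \<zeta> ^ (s * ((m + k) mod p))) * (u ^ ((m + k) div p) * u ^ ((r + (m + k) mod p) div p)) *
          (v ^ ((n + l) div p) * v ^ ((s + (n + l) mod p) div p))"
      by (simp only: 1 2)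
    then show "symbol_twist p \<zeta> u v x y * symbol_twist p \<zeta> u v (x \<otimes>\<^bsub>symbol_group p\<^esub> y) z =
        symbol_twist p \<zeta> u v y z * symbol_twist p \<zeta> u v x (y \<otimes>\<^bsub>symbol_group p\<^esub> z)"
      by (simp add: e symbol_twist_def mult_ac)
  qed (use uv \<zeta>0 in \<open>auto simp: symbol_twist_def\<close>)
qed

context field_algebra
begin

definition q_commute :: "'f \<Rightarrow> 'v \<Rightarrow> 'v \<Rightarrow> bool" where
  "q_commute \<kappa> x y \<longleftrightarrow> x \<otimes> y = \<kappa> \<odot> (y \<otimes> x)"

definition mutual_inverse :: "'v \<Rightarrow> 'v \<Rightarrow> bool" where
  "mutual_inverse x x' \<longleftrightarrow> x \<in> carrier A \<and> x' \<in> carrier A \<and> x \<otimes> x' = \<one> \<and> x' \<otimes> x = \<one>"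

lemma q_commute_mult_right:
  assumes "q_commute \<kappa> x y" "q_commute \<mu> x z" "x \<in> carrier A" "y \<in> carrier A" "z \<in> carrier A"
  shows "q_commute (\<kappa> * \<mu>) x (y \<otimes> z)"
proof -
  have "x \<otimes> (y \<otimes> z) = (x \<otimes> y) \<otimes> z" using assms by (simp add: m_assoc)
  also have "\<dots> = \<kappa> \<odot> (y \<otimes> (x \<otimes> z))"
    using assms(1,3-5) unfolding q_commute_def by (simp add: scalar_mult_left m_assoc)
  also have "\<dots> = \<kappa> \<odot> (y \<otimes> (\<mu> \<odot> (z \<otimes> x)))"
    using assms(2) unfolding q_commute_def by simp
  finally show ?thesis
    using assms(3-5) unfolding q_commute_def by (simp add: scalar_mult_right scalar_scalar m_assoc)
qed

lemma q_commute_swap: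
  assumes "q_commute \<kappa> x y" "\<kappa> \<noteq> 0" "x \<in> carrier A" "y \<in> carrier A"
  shows "q_commute (inverse \<kappa>) y x"
  using assms unfolding q_commute_def by (simp add: scalar_scalar)

lemma q_commute_mult_left:
  assumes "q_commute \<kappa> x z" "q_commute \<mu> y z" "x \<in> carrier A" "y \<in> carrier A" "z \<in> carrier A"
  shows "q_commute (\<kappa> * \<mu>) (x \<otimes> y) z"
proof -
  have "(x \<otimes> y) \<otimes> z = x \<otimes> (y \<otimes> z)" using assms by (simp add: m_assoc)
  also have "\<dots> = \<mu> \<odot> ((x \<otimes> z) \<otimes> y)"
    using assms(2-5) unfolding q_commute_def by (simp add: scalar_mult_right m_assoc)
  also have "\<dots> = \<mu> \<odot> ((\<kappa> \<odot> (z \<otimes> x)) \<otimes> y)"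
    using assms(1) unfolding q_commute_def by simp
  finally show ?thesis
    using assms(3-5) unfolding q_commute_def by (simp add: scalar_mult_left scalar_scalar m_assoc mult.commute)
qed

lemma q_commute_inverse_left:
  assumes "q_commute \<kappa> x y" "\<kappa> \<noteq> 0" "mutual_inverse x x'" "y \<in> carrier A"
  shows "q_commute (inverse \<kappa>) x' y"
proof -
  have x: "x \<in> carrier A" "x' \<in> carrier A" "x \<otimes> x' = \<one>" "x' \<otimes> x = \<one>"
    using assms(3) by (auto simp: mutual_inverse_def)
  have "x' \<otimes> (x \<otimes> y) \<otimes> x' = y \<otimes> x'" using x assms(4) by (simp add: m_assoc[symmetric])
  moreover have "x' \<otimes> (x \<otimes> y) \<otimes> x' = \<kappa> \<odot> (x' \<otimes> y)"
    using assms(1) x assms(4) unfolding q_commute_def by (simp add: scalar_mult_left scalar_mult_right m_assoc)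
  ultimately have "y \<otimes> x' = \<kappa> \<odot> (x' \<otimes> y)" by simp
  then show ?thesis using assms(2,4) x unfolding q_commute_def by (simp add: scalar_scalar)
qed

lemma q_commute_inverse_right:
  assumes "q_commute \<kappa> y x" "\<kappa> \<noteq> 0" "mutual_inverse x x'" "y \<in> carrier A"
  shows "q_commute (inverse \<kappa>) y x'"
proof -
  have x: "x \<in> carrier A" "x' \<in> carrier A" using assms(3) by (auto simp: mutual_inverse_def)
  have "q_commute (inverse (inverse \<kappa>)) x' y"
    using assms x by (intro q_commute_inverse_left[OF _ _ assms(3,4)] q_commute_swap) auto
  from q_commute_swap[OF this _ x(2) assms(4)] show ?thesis using assms(2) by simp
qed

lemma q_commute_pow_left:
  assumes "q_commute \<kappa> x y" "x \<in> carrier A" "y \<in> carrier A"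
  shows "q_commute (\<kappa> ^ n) (x [^] (n::nat)) y"
proof (induction n)
  case (Suc n)
  then show ?case using q_commute_mult_left[OF Suc assms(1)] assms(2,3) by (simp add: mult.commute)
qed (simp add: q_commute_def assms)

lemma q_commute_pow_right:
  assumes "q_commute \<kappa> x y" "x \<in> carrier A" "y \<in> carrier A"
  shows "q_commute (\<kappa> ^ n) x (y [^] (n::nat))"
proof (induction n)
  case (Suc n)
  then show ?case using q_commute_mult_right[OF Suc assms(1)] assms(2,3) by (simp add: mult.commute)
qed (simp add: q_commute_def assms)

lemma mutual_inverse_pow:
  assumes "mutual_inverse x x'" "x [^] (p::nat) = u \<odot> \<one>" "u \<noteq> 0"
  shows "x' [^] p = inverse u \<odot> \<one>"
proof -
  have x: "x \<in> carrier A" "x' \<in> carrier A" "x \<otimes> x' = \<one>" "x' \<otimes> x = \<one>"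
    using assms(1) by (auto simp: mutual_inverse_def)
  have "x [^] p \<otimes> x' [^] p = \<one>" using pow_mult_distrib[of x x' p] x by simp
  then have "u \<odot> (x' [^] p) = \<one>" using assms(2) x by (simp add: scalar_mult_left)
  then have "inverse u \<odot> (u \<odot> (x' [^] p)) = inverse u \<odot> \<one>" by simp
  then show ?thesis using x assms(3) by (simp add: scalar_scalar)
qed

lemma pow_mult_q_commute:
  assumes "q_commute 1 x y" "x \<in> carrier A" "y \<in> carrier A" "x [^] (p::nat) = u \<odot> \<one>" "y [^] p = v \<odot> \<one>"
  shows "(x \<otimes> y) [^] p = (u * v) \<odot> \<one>"
  using pow_mult_distrib[of x y p] assms unfolding q_commute_def by (simp add: scalar_mult_left scalar_scalar)

lemma pow_scalar:
  assumes "x \<in> carrier A" shows "(r \<odot> x) [^] (n::nat) = r ^ n \<odot> (x [^] n)"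
  using assms by (induction n) (simp_all add: scalar_mult_left scalar_mult_right scalar_scalar mult.commute)

text \<open>
  The defining relations of a symbol algebra, satisfied by two elements of an arbitrary algebra.
\<close>

definition symbol_pair :: "nat \<Rightarrow> 'f \<Rightarrow> 'f \<Rightarrow> 'f \<Rightarrow> 'v \<Rightarrow> 'v \<Rightarrow> bool" where
  "symbol_pair p \<zeta> u v i j \<longleftrightarrow> i \<in> carrier A \<and> j \<in> carrier A \<and>
     i [^] p = u \<odot> \<one> \<and> j [^] p = v \<odot> \<one> \<and> q_commute \<zeta> j i"

lemma symbol_pair_inverse:
  assumes "symbol_pair p \<zeta> u v i j" "u \<noteq> 0" "v \<noteq> 0" "p > 0"
  shows "\<exists>i'. mutual_inverse i i'" "\<exists>j'. mutual_inverse j j'"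
proof -
  have *: "\<exists>x'. mutual_inverse x x'" if x: "x \<in> carrier A" and xp: "x [^] p = w \<odot> \<one>" "w \<noteq> 0" for x w
  proof -
    obtain n where n: "p = Suc n" using assms(4) by (cases p) auto
    have "x \<otimes> x [^] n = x [^] p" "x [^] n \<otimes> x = x [^] p" using x nat_pow_Suc2[OF x, of n] by (simp_all add: n)
    then have "mutual_inverse x (inverse w \<odot> x [^] n)"
      using x xp by (simp add: mutual_inverse_def scalar_mult_left scalar_mult_right scalar_scalar)
    then show ?thesis by (rule exI)
  qed
  show "\<exists>i'. mutual_inverse i i'" "\<exists>j'. mutual_inverse j j'"
    using assms * unfolding symbol_pair_def by blast+
qed

lemma pow_mod:
  assumes "x \<in> carrier A" "x [^] (p::nat) = w \<odot> \<one>"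
  shows "x [^] n = w ^ (n div p) \<odot> x [^] (n mod p)"
proof -
  have "x [^] (p * k) = w ^ k \<odot> \<one>" for k
    using assms by (simp add: nat_pow_pow[symmetric] pow_scalar)
  moreover have "x [^] n = x [^] (p * (n div p)) \<otimes> x [^] (n mod p)"
    using assms(1) by (simp add: nat_pow_mult)
  ultimately show ?thesis using assms(1) by (simp add: scalar_mult_left)
qed

lemma symbol_pair_projective_rep:
  assumes "symbol_pair p \<zeta> u v i j" "p > 0"
  shows "projective_rep (symbol_group p) (symbol_twist p \<zeta> u v) A (\<lambda>(r, s). i [^] r \<otimes> j [^] s)"
proof -
  have ij: "i \<in> carrier A" "j \<in> carrier A" "i [^] p = u \<odot> \<one>" "j [^] p = v \<odot> \<one>" "q_commute \<zeta> j i"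
    using assms(1) by (auto simp: symbol_pair_def)
  have "(i [^] r \<otimes> j [^] s) \<otimes> (i [^] m \<otimes> j [^] n) =
      symbol_twist p \<zeta> u v (r, s) (m, n) \<odot> (i [^] ((r + m) mod p) \<otimes> j [^] ((s + n) mod p))" for r s m n
  proof -
    have "q_commute ((\<zeta> ^ s) ^ m) (j [^] s) (i [^] m)"
      using ij by (intro q_commute_pow_left q_commute_pow_right) auto
    then have c: "j [^] s \<otimes> i [^] m = \<zeta> ^ (s * m) \<odot> (i [^] m \<otimes> j [^] s)"
      by (simp add: q_commute_def power_mult)
    have "(i [^] r \<otimes> j [^] s) \<otimes> (i [^] m \<otimes> j [^] n) = i [^] r \<otimes> (j [^] s \<otimes> i [^] m) \<otimes> j [^] n"
      using ij by (simp add: m_assoc)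
    also have "\<dots> = \<zeta> ^ (s * m) \<odot> ((i [^] r \<otimes> i [^] m) \<otimes> (j [^] s \<otimes> j [^] n))"
      using ij unfolding c by (simp add: scalar_mult_left scalar_mult_right m_assoc)
    also have "\<dots> = \<zeta> ^ (s * m) \<odot> ((u ^ ((r + m) div p) \<odot> i [^] ((r + m) mod p)) \<otimes> (v ^ ((s + n) div p) \<odot> j [^] ((s + n) mod p)))"
      using ij pow_mod[OF ij(1,3), of "r + m"] pow_mod[OF ij(2,4), of "s + n"] by (simp add: nat_pow_mult)
    finally show ?thesis
      using ij by (simp add: scalar_mult_left scalar_mult_right scalar_scalar symbol_twist_def mult_ac)
  qed
  then show ?thesis unfolding projective_rep_def using ij by auto
qed

lemma projective_rep_symbol_pair:
  assumes "projective_rep (symbol_group p) (symbol_twist p \<zeta> u v) A \<rho>" "p > 1"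
  shows "symbol_pair p \<zeta> u v (\<rho> (1, 0)) (\<rho> (0, 1))"
proof -
  note \<rho> = projective_repD[OF assms(1)]
  have c: "\<rho> (r, s) \<in> carrier A" if "r < p" "s < p" for r s using \<rho>(1) that by simp
  have m: "\<rho> (r, s) \<otimes> \<rho> (m, n) = symbol_twist p \<zeta> u v (r, s) (m, n) \<odot> \<rho> ((r + m) mod p, (s + n) mod p)"
    if "r < p" "s < p" "m < p" "n < p" for r s m n using \<rho>(3)[of "(r, s)" "(m, n)"] that by simp
  have one: "\<rho> (0, 0) = \<one>" using \<rho>(2) by simp
  have i: "\<rho> (1, 0) [^] n = \<rho> (n, 0)" if "n < p" for n
    using that by (induction n) (simp_all add: one m c symbol_twist_def)
  have j: "\<rho> (0, 1) [^] n = \<rho> (0, n)" if "n < p" for n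
    using that by (induction n) (simp_all add: one m c symbol_twist_def)
  obtain q where q: "p = Suc q" using assms(2) by (cases p) auto
  have "\<rho> (1, 0) [^] p = u \<odot> \<one>" using i[of q] m[of q 0 1 0] q assms(2) by (simp add: one symbol_twist_def)
  moreover have "\<rho> (0, 1) [^] p = v \<odot> \<one>" using j[of q] m[of 0 q 0 1] q assms(2) by (simp add: one symbol_twist_def)
  moreover have "q_commute \<zeta> (\<rho> (0, 1)) (\<rho> (1, 0))"
    using m[of 0 1 1 0] m[of 1 0 0 1] assms(2) c[of 1 1] by (simp add: q_commute_def symbol_twist_def)
  ultimately show ?thesis using c assms(2) by (simp add: symbol_pair_def)
qed

definition commuting_pairs :: "'v \<Rightarrow> 'v \<Rightarrow> 'v \<Rightarrow> 'v \<Rightarrow> bool" where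
  "commuting_pairs i j i' j' \<longleftrightarrow> q_commute 1 i i' \<and> q_commute 1 i j' \<and> q_commute 1 j i' \<and> q_commute 1 j j'"

lemma commuting_words:
  assumes "symbol_pair p \<zeta> u v i j" "symbol_pair p \<zeta> u' v' i' j'" "commuting_pairs i j i' j'"
  shows "(i [^] (r::nat) \<otimes> j [^] (s::nat)) \<otimes> (i' [^] (m::nat) \<otimes> j' [^] (n::nat)) =
    (i' [^] m \<otimes> j' [^] n) \<otimes> (i [^] r \<otimes> j [^] s)"
proof -
  have c: "i \<in> carrier A" "j \<in> carrier A" "i' \<in> carrier A" "j' \<in> carrier A"
    using assms(1,2) by (auto simp: symbol_pair_def)
  have w: "q_commute 1 (x [^] k) (y [^] l)" if "q_commute 1 x y" "x \<in> carrier A" "y \<in> carrier A" for x y and k l :: nat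
    using q_commute_pow_left[OF q_commute_pow_right[OF that, of l], of k] that by simp
  have "q_commute ((1 * 1) * (1 * 1)) (i [^] r \<otimes> j [^] s) (i' [^] m \<otimes> j' [^] n)"
    using assms(3) c unfolding commuting_pairs_def
    by (intro q_commute_mult_right q_commute_mult_left w) auto
  then show ?thesis using c by (simp add: q_commute_def)
qed

lemma two_symbol_pairs_projective_rep:
  assumes "symbol_pair p \<zeta> u v i j" "symbol_pair p \<zeta> u' v' i' j'" "commuting_pairs i j i' j'" "p > 0"
  shows "projective_rep (symbol_group p \<times>\<times> symbol_group p)
      (\<lambda>(g, h) (g', h'). symbol_twist p \<zeta> u v g g' * symbol_twist p \<zeta> u' v' h h')
      A (\<lambda>(g, h). (\<lambda>(r, s). i [^] r \<otimes> j [^] s) g \<otimes> (\<lambda>(r, s). i' [^] r \<otimes> j' [^] s) h)"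
proof (rule projective_rep_commuting[OF symbol_pair_projective_rep[OF assms(1,4)] symbol_pair_projective_rep[OF assms(2,4)]])
  show "group (symbol_group p)"
    using comm_group_residue_group[OF assms(4)] by (auto intro!: DirProd_group simp: comm_group_def)
  then show "group (symbol_group p)" .
qed (auto simp: commuting_words[OF assms(1-3)])

end

lemma symbol_tensor_twisted:
  "sc_tensor (symbol_table p \<zeta> u v) (symbol_table p \<zeta> u' v') = twisted_table (symbol_group p \<times>\<times> symbol_group p)
      (\<lambda>(g, h) (g', h'). symbol_twist p \<zeta> u v g g' * symbol_twist p \<zeta> u' v' h h')"
  by (simp add: symbol_table_twisted twisted_table_DirProd)

locale symbol_algebras =
  fixes p :: nat and \<zeta> :: "'f::field"
  assumes p: "p > 1" and \<zeta>: "primitive_root_of_unity p \<zeta>"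
begin

abbreviation "symb \<equiv> symbol_table p \<zeta>"

lemma \<zeta>_pow: "\<zeta> ^ p = 1" and \<zeta>_nonzero: "\<zeta> \<noteq> 0"
proof -
  show "\<zeta> ^ p = 1" using \<zeta> by (simp add: primitive_root_of_unity_def)
  then show "\<zeta> \<noteq> 0" using p by (intro notI) (simp add: power_0_left)
qed

lemma twist: "u \<noteq> 0 \<Longrightarrow> v \<noteq> 0 \<Longrightarrow> nondegenerate_twist (symbol_group p) (symbol_twist p \<zeta> u v)"
  by (rule nondegenerate_symbol_twist[OF p \<zeta>])

lemma tensor_twist:
  assumes "u \<noteq> 0" "v \<noteq> 0" "u' \<noteq> 0" "v' \<noteq> 0"
  shows "nondegenerate_twist (symbol_group p \<times>\<times> symbol_group p)
      (\<lambda>(g, h) (g', h'). symbol_twist p \<zeta> u v g g' * symbol_twist p \<zeta> u' v' h h')"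
  using assms by (intro nondegenerate_twist_DirProd twist)

text \<open>The two commuting symbol pairs that generate a tensor product of symbol algebras.\<close>

lemma tensor_symbol_pairs:
  assumes "u \<noteq> 0" "v \<noteq> 0" "u' \<noteq> 0" "v' \<noteq> 0"
  defines "A \<equiv> sc_algebra (sc_tensor (symb u v) (symb u' v'))"
  shows "assoc_algebra base_ring A" "\<one>\<^bsub>A\<^esub> \<noteq> \<zero>\<^bsub>A\<^esub>"
    "\<exists>i j i' j'. field_algebra.symbol_pair A p \<zeta> u v i j \<and> field_algebra.symbol_pair A p \<zeta> u' v' i' j' \<and>
       field_algebra.commuting_pairs A i j i' j'"
proof -
  let ?G = "symbol_group p"
  interpret T: nondegenerate_twist "?G \<times>\<times> ?G"
    "\<lambda>(g, h) (g', h'). symbol_twist p \<zeta> u v g g' * symbol_twist p \<zeta> u' v' h h'"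
    using assms by (intro tensor_twist)
  interpret S: nondegenerate_twist ?G "symbol_twist p \<zeta> u v" using assms by (intro twist)
  interpret S': nondegenerate_twist ?G "symbol_twist p \<zeta> u' v'" using assms by (intro twist)
  have A: "A = T.TA" by (simp add: A_def symbol_tensor_twisted)
  show alg: "assoc_algebra base_ring A" and "\<one>\<^bsub>A\<^esub> \<noteq> \<zero>\<^bsub>A\<^esub>"
    unfolding A by (rule T.assoc_algebra_twisted, rule T.one_not_zero_twisted)
  interpret A: field_algebra A by (rule field_algebra.intro[OF alg])
  note \<rho> = projective_repD[OF T.projective_rep_basis, folded A]
  let ?e = "basis_vector :: _ \<Rightarrow> _ \<Rightarrow> 'f"
  have r1: "projective_rep ?G (symbol_twist p \<zeta> u v) A (\<lambda>g. ?e (g, (0, 0)))"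
    unfolding projective_rep_def
  proof (intro conjI ballI)
    fix g h assume gh: "g \<in> carrier ?G" "h \<in> carrier ?G"
    show "?e (g, (0, 0)) \<otimes>\<^bsub>A\<^esub> ?e (h, (0, 0)) = symbol_twist p \<zeta> u v g h \<odot>\<^bsub>A\<^esub> ?e (g \<otimes>\<^bsub>?G\<^esub> h, (0, 0))"
      using \<rho>(3)[of "(g, (0, 0))" "(h, (0, 0))"] gh S'.twist_one(1)[of "(0, 0)"] p by simp
  qed (use \<rho>(1,2) p in auto)
  have r2: "projective_rep ?G (symbol_twist p \<zeta> u' v') A (\<lambda>g. ?e ((0, 0), g))"
    unfolding projective_rep_def
  proof (intro conjI ballI)
    fix g h assume gh: "g \<in> carrier ?G" "h \<in> carrier ?G"
    show "?e ((0, 0), g) \<otimes>\<^bsub>A\<^esub> ?e ((0, 0), h) = symbol_twist p \<zeta> u' v' g h \<odot>\<^bsub>A\<^esub> ?e ((0, 0), g \<otimes>\<^bsub>?G\<^esub> h)"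
      using \<rho>(3)[of "((0, 0), g)" "((0, 0), h)"] gh S.twist_one(1)[of "(0, 0)"] p by simp
  qed (use \<rho>(1,2) p in auto)
  have c: "A.q_commute 1 (?e (g, (0, 0))) (?e ((0, 0), h))" if "g \<in> carrier ?G" "h \<in> carrier ?G" for g h
  proof -
    have z: "(0, 0) \<in> carrier ?G" using p by simp
    have gz: "g \<otimes>\<^bsub>?G\<^esub> (0, 0) = g" "h \<otimes>\<^bsub>?G\<^esub> (0, 0) = h" "(0, 0) \<otimes>\<^bsub>?G\<^esub> g = g" "(0, 0) \<otimes>\<^bsub>?G\<^esub> h = h"
      using that by auto
    show ?thesis
      unfolding A.q_commute_def
      using \<rho>(3)[of "(g, (0, 0))" "((0, 0), h)"] \<rho>(3)[of "((0, 0), h)" "(g, (0, 0))"] that z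
        S.twist_one[OF that(1)] S'.twist_one[OF that(2)] \<rho>(1)[of "(g, h)"]
      by (simp add: gz del: mult_DirProd')
  qed
  have "A.commuting_pairs (?e ((1, 0), (0, 0))) (?e ((0, 1), (0, 0))) (?e ((0, 0), (1, 0))) (?e ((0, 0), (0, 1)))"
    unfolding A.commuting_pairs_def using p by (intro conjI c) auto
  with A.projective_rep_symbol_pair[OF r1 p] A.projective_rep_symbol_pair[OF r2 p]
  show "\<exists>i j i' j'. A.symbol_pair p \<zeta> u v i j \<and> A.symbol_pair p \<zeta> u' v' i' j' \<and> A.commuting_pairs i j i' j'"
    by blast
qed

text \<open>Two commuting symbol pairs in an algebra of the right dimension make it a tensor product.\<close>

lemma tensor_symbol_iso:
  assumes nz: "u \<noteq> 0" "v \<noteq> 0" "u' \<noteq> 0" "v' \<noteq> 0" "c \<noteq> 0" "d \<noteq> 0" "c' \<noteq> 0" "d' \<noteq> 0"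
  defines "A \<equiv> sc_algebra (sc_tensor (symb c d) (symb c' d'))"
  assumes sp: "field_algebra.symbol_pair A p \<zeta> u v i j" "field_algebra.symbol_pair A p \<zeta> u' v' i' j'"
      "field_algebra.commuting_pairs A i j i' j'"
  shows "iso_algebras (sc_algebra (sc_tensor (symb u v) (symb u' v'))) A"
proof -
  have A: "assoc_algebra base_ring A" "\<one>\<^bsub>A\<^esub> \<noteq> \<zero>\<^bsub>A\<^esub>"
    unfolding A_def by (rule tensor_symbol_pairs[OF nz(5-8)])+
  interpret A: field_algebra A by (rule field_algebra.intro[OF A(1)])
  interpret T: nondegenerate_twist "symbol_group p \<times>\<times> symbol_group p"
    "\<lambda>(g, h) (g', h'). symbol_twist p \<zeta> u v g g' * symbol_twist p \<zeta> u' v' h h'"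
    using nz by (intro tensor_twist)
  have "p > 0" using p by simp
  note rep = A.two_symbol_pairs_projective_rep[OF sp this]
  show ?thesis
    unfolding A_def symbol_tensor_twisted[of p \<zeta> u v u' v']
    by (rule T.twisted_table_iso[OF A[unfolded A_def] rep[unfolded A_def]]) (simp_all add: symbol_table_def)
qed

text \<open>
  With the generators \<open>i, j\<close> of \<open>(c, d)\<close> and \<open>i', j'\<close> of \<open>(d, c)\<close>, the pairs \<open>(i j'\<^sup>-\<^sup>1, j)\<close> and \<open>(i' j\<^sup>-\<^sup>1, j')\<close>
  commute with each other, and the \<open>p\<close>-th powers of their first members are \<open>1\<close>.
\<close>

lemma symbol_mult_opposite_iso:
  assumes "c \<noteq> 0" "d \<noteq> 0"
  shows "iso_algebras (sc_algebra (sc_tensor (symb 1 d) (symb 1 c))) (sc_algebra (sc_tensor (symb c d) (symb d c)))"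
proof -
  let ?A = "sc_algebra (sc_tensor (symb c d) (symb d c))"
  have alg: "assoc_algebra base_ring ?A" using assms by (intro tensor_symbol_pairs)
  interpret A: field_algebra ?A by (rule field_algebra.intro[OF alg])
  obtain i j i' j' where sp: "A.symbol_pair p \<zeta> c d i j" "A.symbol_pair p \<zeta> d c i' j'" "A.commuting_pairs i j i' j'"
    using tensor_symbol_pairs(3)[OF assms assms(2,1)] by blast
  have p0: "p > 0" using p by simp
  have cl: "i \<in> carrier ?A" "j \<in> carrier ?A" "i' \<in> carrier ?A" "j' \<in> carrier ?A"
    and pw: "i [^]\<^bsub>?A\<^esub> p = c \<odot>\<^bsub>?A\<^esub> \<one>\<^bsub>?A\<^esub>" "j [^]\<^bsub>?A\<^esub> p = d \<odot>\<^bsub>?A\<^esub> \<one>\<^bsub>?A\<^esub>"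
      "i' [^]\<^bsub>?A\<^esub> p = d \<odot>\<^bsub>?A\<^esub> \<one>\<^bsub>?A\<^esub>" "j' [^]\<^bsub>?A\<^esub> p = c \<odot>\<^bsub>?A\<^esub> \<one>\<^bsub>?A\<^esub>"
    and qc: "A.q_commute \<zeta> j i" "A.q_commute \<zeta> j' i'" "A.q_commute 1 i i'" "A.q_commute 1 i j'"
      "A.q_commute 1 j i'" "A.q_commute 1 j j'"
    using sp unfolding A.symbol_pair_def A.commuting_pairs_def by blast+
  obtain y where y: "A.mutual_inverse j' y" using A.symbol_pair_inverse(2)[OF sp(2) assms(2,1) p0] by blast
  obtain x where x: "A.mutual_inverse j x" using A.symbol_pair_inverse(2)[OF sp(1) assms p0] by blast
  have xy: "x \<in> carrier ?A" "y \<in> carrier ?A" using x y by (auto simp: A.mutual_inverse_def)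
  have iy: "A.q_commute 1 i y" and jy: "A.q_commute 1 j y" and i'y: "A.q_commute \<zeta> i' y"
    and xi: "A.q_commute 1 i' x" and xj': "A.q_commute 1 j' x" and xi0: "A.q_commute \<zeta> i x" and yx: "A.q_commute 1 y x"
    and xj: "A.q_commute 1 j x" and yj': "A.q_commute 1 y j'"
  proof -
    show "A.q_commute 1 i y" "A.q_commute 1 j y"
      using A.q_commute_inverse_right[OF qc(4) _ y cl(1)] A.q_commute_inverse_right[OF qc(6) _ y cl(2)] by simp_all
    have *: "A.q_commute (inverse \<zeta>) i' j'" "A.q_commute (inverse \<zeta>) i j" "A.q_commute 1 i' j" "A.q_commute 1 j' j"
      using A.q_commute_swap[OF qc(2) \<zeta>_nonzero] A.q_commute_swap[OF qc(1) \<zeta>_nonzero]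
        A.q_commute_swap[OF qc(5)] A.q_commute_swap[OF qc(6)] cl by simp_all
    show "A.q_commute \<zeta> i' y" using A.q_commute_inverse_right[OF *(1) _ y cl(3)] \<zeta>_nonzero by simp
    show "A.q_commute 1 i' x" using A.q_commute_inverse_right[OF *(3) _ x cl(3)] by simp
    show 1: "A.q_commute 1 j' x" using A.q_commute_inverse_right[OF *(4) _ x cl(4)] by simp
    show "A.q_commute \<zeta> i x" using A.q_commute_inverse_right[OF *(2) _ x cl(1)] \<zeta>_nonzero by simp
    show "A.q_commute 1 y x" using A.q_commute_inverse_left[OF 1 _ y xy(1)] by simp
    show "A.q_commute 1 j x" "A.q_commute 1 y j'" using x y by (auto simp: A.q_commute_def A.mutual_inverse_def cl)
  qed
  have "A.symbol_pair p \<zeta> 1 d (i \<otimes>\<^bsub>?A\<^esub> y) j"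
    using A.pow_mult_q_commute[OF iy cl(1) xy(2) pw(1) A.mutual_inverse_pow[OF y pw(4) assms(1)]]
      A.q_commute_mult_right[OF qc(1) jy cl(2,1) xy(2)] cl xy pw assms
    by (simp add: A.symbol_pair_def del: sc_linear)
  moreover have "A.symbol_pair p \<zeta> 1 c (i' \<otimes>\<^bsub>?A\<^esub> x) j'"
    using A.pow_mult_q_commute[OF xi cl(3) xy(1) pw(3) A.mutual_inverse_pow[OF x pw(2) assms(2)]]
      A.q_commute_mult_right[OF qc(2) xj' cl(4,3) xy(1)] cl xy pw assms
    by (simp add: A.symbol_pair_def del: sc_linear)
  moreover have "A.commuting_pairs (i \<otimes>\<^bsub>?A\<^esub> y) j (i' \<otimes>\<^bsub>?A\<^esub> x) j'"
  proof -
    have yi': "A.q_commute (inverse \<zeta>) y i'" using A.q_commute_swap[OF i'y \<zeta>_nonzero cl(3) xy(2)] .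
    have "A.q_commute (1 * \<zeta>) i (i' \<otimes>\<^bsub>?A\<^esub> x)" by (rule A.q_commute_mult_right[OF qc(3) xi0 cl(1,3) xy(1)])
    moreover have "A.q_commute (inverse \<zeta> * 1) y (i' \<otimes>\<^bsub>?A\<^esub> x)" by (rule A.q_commute_mult_right[OF yi' yx xy(2) cl(3) xy(1)])
    ultimately have "A.q_commute (1 * \<zeta> * (inverse \<zeta> * 1)) (i \<otimes>\<^bsub>?A\<^esub> y) (i' \<otimes>\<^bsub>?A\<^esub> x)"
      using cl xy by (intro A.q_commute_mult_left) auto
    moreover have "A.q_commute (1 * 1) (i \<otimes>\<^bsub>?A\<^esub> y) j'" by (rule A.q_commute_mult_left[OF qc(4) yj' cl(1) xy(2) cl(4)])
    moreover have "A.q_commute (1 * 1) j (i' \<otimes>\<^bsub>?A\<^esub> x)" by (rule A.q_commute_mult_right[OF qc(5) xj cl(2,3) xy(1)])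
    ultimately show ?thesis using qc(6) \<zeta>_nonzero by (simp add: A.commuting_pairs_def)
  qed
  ultimately show ?thesis using assms by (intro tensor_symbol_iso) auto
qed

text \<open>
  The commuting pairs are \<open>(i i', j)\<close> and \<open>(j j'\<^sup>-\<^sup>1, i')\<close>.
\<close>

lemma symbol_mult_iso:
  assumes "a \<noteq> 0" "a' \<noteq> 0" "b \<noteq> 0"
  shows "iso_algebras (sc_algebra (sc_tensor (symb (a * a') b) (symb 1 a'))) (sc_algebra (sc_tensor (symb a b) (symb a' b)))"
proof -
  let ?A = "sc_algebra (sc_tensor (symb a b) (symb a' b))"
  have alg: "assoc_algebra base_ring ?A" using assms by (intro tensor_symbol_pairs)
  interpret A: field_algebra ?A by (rule field_algebra.intro[OF alg])
  obtain i j i' j' where sp: "A.symbol_pair p \<zeta> a b i j" "A.symbol_pair p \<zeta> a' b i' j'" "A.commuting_pairs i j i' j'"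
    using tensor_symbol_pairs(3)[OF assms(1,3,2,3)] by blast
  have p0: "p > 0" using p by simp
  have cl: "i \<in> carrier ?A" "j \<in> carrier ?A" "i' \<in> carrier ?A" "j' \<in> carrier ?A"
    and pw: "i [^]\<^bsub>?A\<^esub> p = a \<odot>\<^bsub>?A\<^esub> \<one>\<^bsub>?A\<^esub>" "j [^]\<^bsub>?A\<^esub> p = b \<odot>\<^bsub>?A\<^esub> \<one>\<^bsub>?A\<^esub>"
      "i' [^]\<^bsub>?A\<^esub> p = a' \<odot>\<^bsub>?A\<^esub> \<one>\<^bsub>?A\<^esub>" "j' [^]\<^bsub>?A\<^esub> p = b \<odot>\<^bsub>?A\<^esub> \<one>\<^bsub>?A\<^esub>"
    and qc: "A.q_commute \<zeta> j i" "A.q_commute \<zeta> j' i'" "A.q_commute 1 i i'" "A.q_commute 1 i j'"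
      "A.q_commute 1 j i'" "A.q_commute 1 j j'"
    using sp unfolding A.symbol_pair_def A.commuting_pairs_def by blast+
  obtain y where y: "A.mutual_inverse j' y" using A.symbol_pair_inverse(2)[OF sp(2) assms(2,3) p0] by blast
  have yc: "y \<in> carrier ?A" using y by (auto simp: A.mutual_inverse_def)
  have iy: "A.q_commute 1 i y" and jy: "A.q_commute 1 j y" and i'y: "A.q_commute \<zeta> i' y" and i'j: "A.q_commute 1 i' j"
  proof -
    show "A.q_commute 1 i y" "A.q_commute 1 j y"
      using A.q_commute_inverse_right[OF qc(4) _ y cl(1)] A.q_commute_inverse_right[OF qc(6) _ y cl(2)] by simp_all
    show "A.q_commute \<zeta> i' y"
      using A.q_commute_inverse_right[OF A.q_commute_swap[OF qc(2) \<zeta>_nonzero] _ y cl(3)] cl \<zeta>_nonzero by simp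
    show "A.q_commute 1 i' j" using A.q_commute_swap[OF qc(5)] cl by simp
  qed
  have "A.symbol_pair p \<zeta> (a * a') b (i \<otimes>\<^bsub>?A\<^esub> i') j"
    using A.pow_mult_q_commute[OF qc(3) cl(1,3) pw(1,3)] A.q_commute_mult_right[OF qc(1,5) cl(2,1,3)] cl pw
    by (simp add: A.symbol_pair_def del: sc_linear)
  moreover have "A.symbol_pair p \<zeta> 1 a' (j \<otimes>\<^bsub>?A\<^esub> y) i'"
    using A.pow_mult_q_commute[OF jy cl(2) yc pw(2) A.mutual_inverse_pow[OF y pw(4) assms(3)]]
      A.q_commute_mult_right[OF i'j i'y cl(3,2) yc] cl yc pw assms
    by (simp add: A.symbol_pair_def del: sc_linear)
  moreover have "A.commuting_pairs (i \<otimes>\<^bsub>?A\<^esub> i') j (j \<otimes>\<^bsub>?A\<^esub> y) i'"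
  proof -
    have ij: "A.q_commute (inverse \<zeta>) i j" using A.q_commute_swap[OF qc(1) \<zeta>_nonzero cl(2,1)] .
    have "A.q_commute (inverse \<zeta> * 1) i (j \<otimes>\<^bsub>?A\<^esub> y)" by (rule A.q_commute_mult_right[OF ij iy cl(1,2) yc])
    moreover have "A.q_commute (1 * \<zeta>) i' (j \<otimes>\<^bsub>?A\<^esub> y)" by (rule A.q_commute_mult_right[OF i'j i'y cl(3,2) yc])
    ultimately have "A.q_commute (inverse \<zeta> * 1 * (1 * \<zeta>)) (i \<otimes>\<^bsub>?A\<^esub> i') (j \<otimes>\<^bsub>?A\<^esub> y)"
      using cl yc by (intro A.q_commute_mult_left) auto
    moreover have "A.q_commute (1 * 1) (i \<otimes>\<^bsub>?A\<^esub> i') i'"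
      using cl qc(3) by (intro A.q_commute_mult_left) (auto simp: A.q_commute_def)
    moreover have "A.q_commute (1 * 1) j (j \<otimes>\<^bsub>?A\<^esub> y)"
      using cl yc jy by (intro A.q_commute_mult_right) (auto simp: A.q_commute_def)
    ultimately show ?thesis using qc(5) \<zeta>_nonzero by (simp add: A.commuting_pairs_def)
  qed
  ultimately show ?thesis using assms by (intro tensor_symbol_iso) auto
qed

text \<open>
  The first generator is divided by \<open>w\<close>.
\<close>

lemma symbol_pth_power_iso:
  assumes "w \<noteq> 0" "b \<noteq> 0"
  shows "iso_algebras (sc_algebra (symb 1 b)) (sc_algebra (symb (w ^ p) b))"
proof -
  interpret T: nondegenerate_twist "symbol_group p" "symbol_twist p \<zeta> (w ^ p) b" using assms by (intro twist) auto
  interpret S: nondegenerate_twist "symbol_group p" "symbol_twist p \<zeta> 1 b" using assms by (intro twist) auto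
  interpret A: field_algebra T.TA by (rule field_algebra.intro[OF T.assoc_algebra_twisted])
  obtain i j where sp: "A.symbol_pair p \<zeta> (w ^ p) b i j"
    using A.projective_rep_symbol_pair[OF T.projective_rep_basis p] by blast
  have "A.symbol_pair p \<zeta> 1 b (inverse w \<odot>\<^bsub>T.TA\<^esub> i) j"
    using sp assms unfolding A.symbol_pair_def A.q_commute_def
    by (auto simp: A.pow_scalar A.scalar_scalar A.scalar_mult_left A.scalar_mult_right mult.commute power_mult_distrib[symmetric] simp del: sc_linear)
  then have "projective_rep (symbol_group p) (symbol_twist p \<zeta> 1 b) T.TA (\<lambda>(r, s). (inverse w \<odot>\<^bsub>T.TA\<^esub> i) [^]\<^bsub>T.TA\<^esub> r \<otimes>\<^bsub>T.TA\<^esub> j [^]\<^bsub>T.TA\<^esub> s)"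
    using p by (intro A.symbol_pair_projective_rep) auto
  from S.twisted_table_iso[OF T.assoc_algebra_twisted T.one_not_zero_twisted this]
  show ?thesis by (simp add: symbol_table_twisted)
qed

text \<open>
  The algebra \<open>(1, v)\<close> acts on \<open>F\<^sup>p\<close>: the first generator by the diagonal matrix of the powers of
  \<open>\<zeta>\<^sup>-\<^sup>1\<close>, the second one by a cyclic shift of the coordinates that multiplies the last one by \<open>v\<close>.
\<close>

lemma symbol_one_split:
  assumes "v \<noteq> 0"
  shows "iso_algebras (sc_algebra (symb 1 v)) (sc_algebra (mat_table {..<p} :: (nat \<times> nat, 'f) sc_table))"
proof -
  interpret S: nondegenerate_twist "symbol_group p" "symbol_twist p \<zeta> 1 v" using assms by (intro twist) auto
  let ?\<xi> = "inverse \<zeta>"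
  define \<rho> where "\<rho> = (\<lambda>(r, s) (a, k). if a < p \<and> k < p \<and> a = (k + s) mod p then ?\<xi> ^ (r * a) * v ^ ((k + s) div p) else 0)"
  have \<xi>p: "?\<xi> ^ p = 1" using \<zeta>_pow by (simp add: power_inverse)
  have "projective_rep (symbol_group p) (symbol_twist p \<zeta> 1 v) (sc_algebra (mat_table {..<p})) \<rho>"
    unfolding projective_rep_def
  proof (intro conjI ballI)
    show "\<rho> \<one>\<^bsub>symbol_group p\<^esub> = \<one>\<^bsub>sc_algebra (mat_table {..<p})\<^esub>"
      using p by (auto simp: \<rho>_def fun_eq_iff sc_one)
  next
    fix g h assume "g \<in> carrier (symbol_group p)" "h \<in> carrier (symbol_group p)"
    obtain r s m n where gh: "g = (r, s)" "h = (m, n)" by (cases g; cases h)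
    show "\<rho> g \<otimes>\<^bsub>sc_algebra (mat_table {..<p})\<^esub> \<rho> h = symbol_twist p \<zeta> 1 v g h \<odot>\<^bsub>sc_algebra (mat_table {..<p})\<^esub> \<rho> (g \<otimes>\<^bsub>symbol_group p\<^esub> h)"
    proof
      fix bk :: "nat \<times> nat" obtain b k where bk: "bk = (b, k)" by (cases bk)
      show "(\<rho> g \<otimes>\<^bsub>sc_algebra (mat_table {..<p})\<^esub> \<rho> h) bk = (symbol_twist p \<zeta> 1 v g h \<odot>\<^bsub>sc_algebra (mat_table {..<p})\<^esub> \<rho> (g \<otimes>\<^bsub>symbol_group p\<^esub> h)) bk"
      proof (cases "b < p \<and> k < p")
        case True
        define a where "a = (k + n) mod p"
        have ap: "a < p" using p by (simp add: a_def)
        have b': "(k + (s + n) mod p) mod p = (a + s) mod p" by (simp add: a_def mod_simps add_ac)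
        have "(\<Sum>j<p. \<rho> (r, s) (b, j) * \<rho> (m, n) (j, k)) = (\<Sum>j<p. if j = a then \<rho> (r, s) (b, a) * \<rho> (m, n) (a, k) else 0)"
          by (intro sum.cong) (auto simp: \<rho>_def a_def)
        then have l: "(\<rho> g \<otimes>\<^bsub>sc_algebra (mat_table {..<p})\<^esub> \<rho> h) bk = \<rho> (r, s) (b, a) * \<rho> (m, n) (a, k)"
          using True ap by (simp add: bk gh mat_table_mult)
        show ?thesis
        proof (cases "b = (a + s) mod p")
          case b: True
          have "?\<xi> ^ (m * a) = \<zeta> ^ (s * m) * ?\<xi> ^ (m * b)"
          proof -
            have "?\<xi> ^ (m * b) = ?\<xi> ^ (m * (a + s))"
              unfolding b using root_of_unity_mod[OF \<xi>p] by (metis mod_mult_right_eq)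
            then have "\<zeta> ^ (s * m) * ?\<xi> ^ (m * b) = (\<zeta> * ?\<xi>) ^ (s * m) * ?\<xi> ^ (m * a)"
              by (simp only: power_mult_distrib) (simp add: algebra_simps power_add)
            then show ?thesis using \<zeta>_nonzero by simp
          qed
          moreover have "?\<xi> ^ ((r + m) mod p * b) = ?\<xi> ^ (r * b) * ?\<xi> ^ (m * b)"
            using root_of_unity_mod[OF \<xi>p] by (metis mod_mult_left_eq power_add distrib_right)
          moreover have "v ^ ((k + n) div p) * v ^ ((a + s) div p) = v ^ ((s + n) div p) * v ^ ((k + (s + n) mod p) div p)"
            using div_add_carry[of p k n s] div_add_carry[of p s n k] p by (simp add: a_def power_add[symmetric] add_ac)
          ultimately show ?thesis
            using True ap b b' unfolding l by (simp add: \<rho>_def bk gh symbol_twist_def a_def[symmetric] mult_ac)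
        next
          case False
          then show ?thesis using True b' unfolding l by (simp add: \<rho>_def bk gh)
        qed
      qed (auto simp: bk gh mat_table_mult \<rho>_def)
    qed
  qed (auto simp: sc_carrier \<rho>_def)
  moreover have "\<one>\<^bsub>sc_algebra (mat_table {..<p})\<^esub> (0, 0) \<noteq> (0::'f)" using p by (simp add: sc_one)
  then have "\<one>\<^bsub>sc_algebra (mat_table {..<p})\<^esub> \<noteq> (\<zero>\<^bsub>sc_algebra (mat_table {..<p})\<^esub> :: _ \<Rightarrow> 'f)" by (auto simp: fun_eq_iff)
  ultimately have "iso_algebras S.TA (sc_algebra (mat_table {..<p} :: (nat \<times> nat, 'f) sc_table))"
    by (intro S.twisted_table_iso[OF assoc_algebra_mat_table]) auto
  then show ?thesis by (simp add: symbol_table_twisted)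
qed

end

section \<open>Calculations in the Brauer group\<close>

abbreviation unit_table :: "(nat \<times> nat, 'f::field) sc_table" where
  "unit_table \<equiv> mat_table {..<1}"

lemma unit_tensor_iso: "iso_algebras (sc_algebra (sc_tensor (unit_table :: (_, 'f::field) sc_table) T)) (sc_algebra T)"
proof (rule iso_algebras_relabel(1)[of snd])
  show "bij_betw snd (sc_index (sc_tensor (unit_table :: (_, 'f) sc_table) T)) (sc_index T)"
    by (rule bij_betw_byWitness[where f' = "\<lambda>k. ((0, 0), k)"]) auto
qed auto

lemma table_equiv_mat_tensor:
  assumes "finite J" "J \<noteq> {}"
  shows "table_equiv (sc_tensor (mat_table J) S) S"
  by (rule table_equivI[of "{..<1::nat}" _ J]) (use assms unit_tensor_iso in auto)

lemma table_equiv_mat_unit: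
  assumes "finite J" "J \<noteq> {}"
  shows "table_equiv (mat_table J) (unit_table :: (_, 'f::field) sc_table)"
  by (rule table_equiv_trans[OF table_equiv_sym[OF table_equiv_iso[OF unit_tensor_iso]]
        table_equiv_trans[OF table_equiv_commute table_equiv_mat_tensor[OF assms]]])

lemma table_equiv_split_left:
  assumes "table_equiv S (unit_table :: (_, 'f::field) sc_table)"
  shows "table_equiv (sc_tensor S T) T"
  by (rule table_equiv_trans[OF table_equiv_tensor_left[OF assms] table_equiv_iso[OF unit_tensor_iso]])

lemma table_equiv_split_right:
  assumes "table_equiv T (unit_table :: (_, 'f::field) sc_table)"
  shows "table_equiv (sc_tensor S T) S"
  by (rule table_equiv_trans[OF table_equiv_commute table_equiv_split_left[OF assms]])

lemma table_equiv_interchange: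
  "table_equiv (sc_tensor (sc_tensor P Q) (sc_tensor R S)) (sc_tensor (sc_tensor P R) (sc_tensor Q S))"
proof -
  have 1: "table_equiv (sc_tensor Q (sc_tensor R S)) (sc_tensor R (sc_tensor Q S))"
    by (rule table_equiv_trans[OF table_equiv_sym[OF table_equiv_assoc]
          table_equiv_trans[OF table_equiv_tensor_left[OF table_equiv_commute] table_equiv_assoc]])
  show ?thesis
    by (rule table_equiv_trans[OF table_equiv_assoc table_equiv_trans[OF
            table_equiv_tensor[OF table_equiv_refl 1] table_equiv_sym[OF table_equiv_assoc]]])
qed

lemma iso_unit_table_base_algebra: "iso_algebras (sc_algebra (unit_table :: (_, 'f::field) sc_table)) base_algebra"
proof (rule iso_algebrasI[of "\<lambda>x. x (0, 0)"], rule algebra_isosI)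
  show "bij_betw (\<lambda>x. x (0, 0)) (carrier (sc_algebra (unit_table :: (_, 'f) sc_table))) (carrier base_algebra)"
    by (rule bij_betw_byWitness[where f' = "\<lambda>r k. if k = (0, 0) then r else 0"])
      (auto simp: base_algebra_def sc_carrier fun_eq_iff)
qed (auto simp: base_algebra_def mat_table_mult sc_one)

lemma abelian_group_base_algebra: "abelian_group (base_algebra :: ('f::field, 'f) module)"
proof (rule abelian_groupI)
  fix x :: 'f
  show "\<exists>y\<in>carrier base_algebra. y \<oplus>\<^bsub>base_algebra\<^esub> x = \<zero>\<^bsub>base_algebra\<^esub>"
    by (intro bexI[of _ "- x"]) (auto simp: base_algebra_def)
qed (auto simp: base_algebra_def add_ac)

text \<open>
  The Brauer class of a table over an arbitrary index type.
\<close>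

definition table_class :: "('i, 'f::field) sc_table \<Rightarrow> (nat, 'f) sc_table set" where
  "table_class S = {T \<in> csa_tables. table_equiv S T}"

lemma one_brauer_group: "\<one>\<^bsub>brauer_group\<^esub> = table_class (unit_table :: (_, 'f::field) sc_table)"
  using brauer_class_iso[OF iso_unit_table_base_algebra abelian_group_base_algebra]
  by (simp add: brauer_group_def table_class_def)

lemma table_class_cong: "table_equiv S S' \<Longrightarrow> table_class S = table_class S'"
  unfolding table_class_def
  by (auto intro: table_equiv_trans[of S S'] table_equiv_trans[OF table_equiv_sym[of S S']])

lemma table_class_eqD:
  assumes "table_class S = table_class S'" "table_class S \<noteq> {}"
  shows "table_equiv S S'"
proof -
  obtain T where "T \<in> table_class S" using assms(2) by blast
  then have "table_equiv S T" "table_equiv S' T" using assms(1) by (auto simp: table_class_def)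
  then show ?thesis by (rule table_equiv_trans[OF _ table_equiv_sym])
qed

lemma mult_table_class:
  assumes "table_class S \<noteq> {}" "table_class T \<noteq> {}"
  shows "table_class S \<otimes>\<^bsub>brauer_group\<^esub> table_class T = table_class (sc_tensor S T)"
proof -
  have "brauer_class (sc_algebra (sc_tensor S' T')) = table_class (sc_tensor S T)"
    if "S' \<in> table_class S" "T' \<in> table_class T" for S' T'
  proof -
    have "table_equiv (sc_tensor S T) (sc_tensor S' T')"
      using that by (intro table_equiv_tensor) (auto simp: table_class_def)
    then have "table_class (sc_tensor S T) = table_class (sc_tensor S' T')" by (rule table_class_cong)
    then show ?thesis by (simp add: brauer_class_table table_class_def)
  qed
  then have "(\<Union>S'\<in>table_class S. \<Union>T'\<in>table_class T. brauer_class (sc_algebra (sc_tensor S' T'))) =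
      (\<Union>S'\<in>table_class S. \<Union>T'\<in>table_class T. table_class (sc_tensor S T))" by simp
  then show ?thesis using assms by (simp add: brauer_group_def)
qed

lemma csa_table_class: "T \<in> csa_tables \<Longrightarrow> T \<in> table_class T"
  by (simp add: table_class_def table_equiv_refl)

lemma carrier_brauer_group: "carrier brauer_group = table_class ` csa_tables"
  by (simp add: brauer_group_def brauer_class_table table_class_def)

lemma table_class_in_carrier:
  assumes "table_class S \<noteq> {}" shows "table_class S \<in> carrier brauer_group"
proof -
  obtain T where "T \<in> csa_tables" "table_equiv S T" using assms by (auto simp: table_class_def)
  then show ?thesis using table_class_cong[of S T] unfolding carrier_brauer_group by blast
qed

text \<open>Transport of structure to an initial segment of the natural numbers.\<close>

lemma (in nondegenerate_twist) table_class_twisted: "table_class (twisted_table G \<omega>) \<noteq> {}"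
proof -
  obtain f where f: "bij_betw f (carrier G) {..<card (carrier G)}"
    using ex_bij_betw_finite_nat[OF finite_carrier] by (auto simp: atLeast0LessThan)
  define n where "n = card (carrier G)"
  define g where "g = inv_into (carrier G) f"
  have fg: "f x < n" "g (f x) = x" if "x \<in> carrier G" for x
    using f that by (auto simp: bij_betw_def n_def g_def)
  have gf: "g i \<in> carrier G" "f (g i) = i" if "i < n" for i
    using f that unfolding g_def n_def bij_betw_def by (metis inv_into_into lessThan_iff, metis f_inv_into_f lessThan_iff)
  have finj: "f x = f y \<longleftrightarrow> x = y" if "x \<in> carrier G" "y \<in> carrier G" for x y
    using f that by (auto simp: bij_betw_def inj_on_def)
  have fn: "bij_betw f (carrier G) {..<n}" using f by (simp add: n_def)
  define G' where "G' = \<lparr>carrier = {..<n}, monoid.mult = (\<lambda>i j. f (g i \<otimes> g j)), one = f \<one>\<rparr>"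
  define \<omega>' where "\<omega>' i j = \<omega> (g i) (g j)" for i j
  have G': "carrier G' = {..<n}" "i \<otimes>\<^bsub>G'\<^esub> j = f (g i \<otimes> g j)" "\<one>\<^bsub>G'\<^esub> = f \<one>" for i j
    by (simp_all add: G'_def)
  have "comm_group G'"
  proof (rule comm_groupI)
    fix i assume "i \<in> carrier G'"
    then show "\<exists>j\<in>carrier G'. j \<otimes>\<^bsub>G'\<^esub> i = \<one>\<^bsub>G'\<^esub>"
      using gf by (intro bexI[of _ "f (inv (g i))"]) (auto simp: G' fg gf)
  qed (auto simp: G' fg gf m_ac)
  then have tw: "nondegenerate_twist G' \<omega>'"
  proof (intro nondegenerate_twist.intro nondegenerate_twist_axioms.intro)
    fix i assume i: "i \<in> carrier G'" "i \<noteq> \<one>\<^bsub>G'\<^esub>"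
    then have "g i \<in> carrier G" "g i \<noteq> \<one>" using gf[of i] by (auto simp: G')
    from nondegenerate[OF this] obtain h where "h \<in> carrier G" "\<omega> (g i) h \<noteq> \<omega> h (g i)" by blast
    then show "\<exists>j\<in>carrier G'. \<omega>' i j \<noteq> \<omega>' j i"
      by (intro bexI[of _ "f h"]) (auto simp: G' \<omega>'_def fg)
  qed (auto simp: G' \<omega>'_def fg gf twist_nonzero twist_one cocycle)
  have "iso_algebras TA (sc_algebra (twisted_table G' \<omega>'))"
    by (rule iso_algebras_relabel(1)[of f]) (auto simp: G' \<omega>'_def fg finj fn)
  then have "table_equiv (twisted_table G \<omega>) (twisted_table G' \<omega>')" by (rule table_equiv_iso)
  moreover have "twisted_table G' \<omega>' \<in> csa_tables"
    using nondegenerate_twist.central_simple_twisted[OF tw] by (simp add: csa_tables_def G')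
  ultimately show ?thesis by (auto simp: table_class_def)
qed

context symbol_algebras
begin

lemma symbol_one_equiv: "v \<noteq> 0 \<Longrightarrow> table_equiv (symb 1 v) (unit_table :: (_, 'f) sc_table)"
  by (rule table_equiv_trans[OF table_equiv_iso[OF symbol_one_split] table_equiv_mat_unit]) (use p in auto)

lemma table_class_symbol: "u \<noteq> 0 \<Longrightarrow> v \<noteq> 0 \<Longrightarrow> table_class (symb u v) \<noteq> {}"
  unfolding symbol_table_twisted by (rule nondegenerate_twist.table_class_twisted[OF twist])

lemma table_class_symbol_tensor:
  "u \<noteq> 0 \<Longrightarrow> v \<noteq> 0 \<Longrightarrow> u' \<noteq> 0 \<Longrightarrow> v' \<noteq> 0 \<Longrightarrow> table_class (sc_tensor (symb u v) (symb u' v')) \<noteq> {}"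
  unfolding symbol_tensor_twisted by (rule nondegenerate_twist.table_class_twisted[OF tensor_twist])

lemma table_class_unit: "table_class (unit_table :: (_, 'f) sc_table) \<noteq> {}"
  using table_class_symbol[of 1 1] table_class_cong[OF symbol_one_equiv[of 1]] by simp

lemma symbol_class_eq: "symbol_class p \<zeta> u v = table_class (symb u v)"
  by (simp add: symbol_class_def brauer_class_table table_class_def)

lemma symbol_mult_opposite:
  assumes "c \<noteq> 0" "d \<noteq> 0"
  shows "table_equiv (sc_tensor (symb c d) (symb d c)) (unit_table :: (_, 'f) sc_table)"
  by (rule table_equiv_trans[OF table_equiv_sym[OF table_equiv_iso[OF symbol_mult_opposite_iso[OF assms]]]
        table_equiv_trans[OF table_equiv_split_left[OF symbol_one_equiv[OF assms(2)]] symbol_one_equiv[OF assms(1)]]])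

lemma symbol_mult:
  assumes "a \<noteq> 0" "a' \<noteq> 0" "b \<noteq> 0"
  shows "table_equiv (sc_tensor (symb a b) (symb a' b)) (symb (a * a') b)"
  by (rule table_equiv_trans[OF table_equiv_sym[OF table_equiv_iso[OF symbol_mult_iso[OF assms]]]
        table_equiv_split_right[OF symbol_one_equiv[OF assms(2)]]])

text \<open>
  Uniqueness of the inverse has to be shown for the monoid record that defines the Brauer group, by
  associativity of the tensor product up to equivalence.
\<close>

lemma inv_table_class:
  assumes Y: "table_class Y \<noteq> {}" and Z: "table_class Z \<noteq> {}"
    and YZ: "table_equiv (sc_tensor Y Z) (unit_table :: (_, 'f) sc_table)"
  shows "inv\<^bsub>brauer_group\<^esub> (table_class Y) = table_class Z"
  unfolding m_inv_def
proof (rule the_equality)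
  have "table_equiv (sc_tensor Z Y) (unit_table :: (_, 'f) sc_table)"
    by (rule table_equiv_trans[OF table_equiv_commute YZ])
  then show "table_class Z \<in> carrier brauer_group \<and> table_class Y \<otimes>\<^bsub>brauer_group\<^esub> table_class Z = \<one>\<^bsub>brauer_group\<^esub> \<and>
      table_class Z \<otimes>\<^bsub>brauer_group\<^esub> table_class Y = \<one>\<^bsub>brauer_group\<^esub>"
    using table_class_in_carrier[OF Z] table_class_cong[OF YZ] table_class_cong[of "sc_tensor Z Y"] Y Z
    by (simp add: mult_table_class one_brauer_group)
next
  fix \<gamma> :: "(nat, 'f) sc_table set"
  assume \<gamma>: "\<gamma> \<in> carrier brauer_group \<and> table_class Y \<otimes>\<^bsub>brauer_group\<^esub> \<gamma> = \<one>\<^bsub>brauer_group\<^esub> \<and>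
      \<gamma> \<otimes>\<^bsub>brauer_group\<^esub> table_class Y = \<one>\<^bsub>brauer_group\<^esub>"
  then obtain T :: "(nat, 'f) sc_table" where T: "T \<in> csa_tables" "\<gamma> = table_class T" unfolding carrier_brauer_group by blast
  have Tn: "table_class T \<noteq> {}" using csa_table_class[OF T(1)] by blast
  have YZ1: "table_class (sc_tensor Y Z) = table_class (unit_table :: (_, 'f) sc_table)" by (rule table_class_cong[OF YZ])
  have TY: "table_class (sc_tensor T Y) = table_class (unit_table :: (_, 'f) sc_table)"
    using \<gamma> Tn Y by (simp add: T(2) mult_table_class one_brauer_group)
  have "table_equiv (sc_tensor T Y) (unit_table :: (_, 'f) sc_table)"
    using table_class_eqD[OF TY] TY table_class_unit by simp
  then have "table_equiv (sc_tensor (sc_tensor T Y) Z) Z" by (rule table_equiv_split_left)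
  moreover have "table_equiv (sc_tensor (sc_tensor T Y) Z) T"
    by (rule table_equiv_trans[OF table_equiv_assoc table_equiv_split_right[OF YZ]])
  ultimately have "table_equiv T Z" by (rule table_equiv_trans[OF table_equiv_sym, rotated])
  then show "\<gamma> = table_class Z" unfolding T(2) by (rule table_class_cong)
qed

lemma brauer_diff_symbol:
  assumes "a \<noteq> 0" "b \<noteq> 0" "c \<noteq> 0" "d \<noteq> 0"
  shows "brauer_diff (symbol_class p \<zeta> a b) (symbol_class p \<zeta> c d) = table_class (sc_tensor (symb a b) (symb d c))"
  using inv_table_class[OF table_class_symbol table_class_symbol symbol_mult_opposite, of c d] assms
  by (simp add: brauer_diff_def symbol_class_eq mult_table_class table_class_symbol)

lemma symbol_tensor_trivial_iff:
  assumes "a \<noteq> 0" "b \<noteq> 0" "c \<noteq> 0" "d \<noteq> 0"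
  shows "table_equiv (sc_tensor (symb a b) (symb d c)) (unit_table :: (_, 'f) sc_table) \<longleftrightarrow>
    symbol_class p \<zeta> a b = symbol_class p \<zeta> c d"
proof
  assume t: "table_equiv (sc_tensor (symb a b) (symb d c)) (unit_table :: (_, 'f) sc_table)"
  have "table_equiv (symb a b) (sc_tensor (sc_tensor (symb a b) (symb d c)) (symb c d))"
    by (rule table_equiv_trans[OF table_equiv_sym[OF table_equiv_split_right[OF symbol_mult_opposite[of d c]]]
          table_equiv_sym[OF table_equiv_assoc]]) (use assms in auto)
  then have "table_equiv (symb a b) (symb c d)"
    by (rule table_equiv_trans[OF _ table_equiv_split_left[OF t]])
  then show "symbol_class p \<zeta> a b = symbol_class p \<zeta> c d"
    unfolding symbol_class_eq by (rule table_class_cong)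
next
  assume "symbol_class p \<zeta> a b = symbol_class p \<zeta> c d"
  then have "table_equiv (symb a b) (symb c d)"
    unfolding symbol_class_eq using table_class_symbol assms by (intro table_class_eqD) auto
  then show "table_equiv (sc_tensor (symb a b) (symb d c)) (unit_table :: (_, 'f) sc_table)"
    by (rule table_equiv_trans[OF table_equiv_tensor_left symbol_mult_opposite]) (use assms in auto)
qed

text \<open>
  By bilinearity the \<open>p\<close>-th multiple is the class of \<open>(a\<^sup>p, b) \<otimes> (d\<^sup>p, c)\<close>, and \<open>p\<close>-th powers are trivial in a
  symbol.
\<close>

lemma symbol_tensor_torsion:
  assumes "a \<noteq> 0" "b \<noteq> 0" "c \<noteq> 0" "d \<noteq> 0"
  shows "table_class (sc_tensor (symb a b) (symb d c)) \<in> brauer_torsion p"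
proof -
  let ?S = "\<lambda>n. sc_tensor (symb (a ^ n) b) (symb (d ^ n) c)"
  have nonempty: "table_class (?S n) \<noteq> {}" for n using assms by (intro table_class_symbol_tensor) auto
  have unit: "table_equiv (sc_tensor (symb 1 b) (symb 1 c)) (unit_table :: (_, 'f) sc_table)"
    by (rule table_equiv_trans[OF table_equiv_split_left[OF symbol_one_equiv] symbol_one_equiv]) (use assms in auto)
  have "table_class (?S 1) [^]\<^bsub>brauer_group\<^esub> n = table_class (?S n)" for n :: nat
  proof (induction n)
    case 0
    show ?case using table_class_cong[OF unit] by (simp add: nat_pow_def one_brauer_group)
  next
    case (Suc n)
    have "table_class (?S 1) [^]\<^bsub>brauer_group\<^esub> Suc n = table_class (?S 1) [^]\<^bsub>brauer_group\<^esub> n \<otimes>\<^bsub>brauer_group\<^esub> table_class (?S 1)"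
      by (simp add: nat_pow_def)
    also have "\<dots> = table_class (sc_tensor (?S n) (?S 1))"
      unfolding Suc by (rule mult_table_class[OF nonempty nonempty])
    also have "\<dots> = table_class (?S (Suc n))"
    proof (rule table_class_cong)
      have "table_equiv (sc_tensor (symb (a ^ n) b) (symb (a ^ 1) b)) (symb (a ^ n * a ^ 1) b)"
        "table_equiv (sc_tensor (symb (d ^ n) c) (symb (d ^ 1) c)) (symb (d ^ n * d ^ 1) c)"
        using assms by (intro symbol_mult; simp)+
      from table_equiv_trans[OF table_equiv_interchange table_equiv_tensor[OF this]]
      show "table_equiv (sc_tensor (?S n) (?S 1)) (?S (Suc n))" by (simp add: mult.commute)
    qed
    finally show ?case .
  qed
  then have "table_class (?S 1) [^]\<^bsub>brauer_group\<^esub> p = table_class (?S p)" .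
  also have "\<dots> = table_class (sc_tensor (symb 1 b) (symb 1 c))"
    using assms by (intro table_class_cong table_equiv_sym[OF table_equiv_tensor] table_equiv_iso symbol_pth_power_iso)
  also have "\<dots> = \<one>\<^bsub>brauer_group\<^esub>" unfolding one_brauer_group by (rule table_class_cong[OF unit])
  finally show ?thesis using table_class_in_carrier[OF nonempty[of 1]] by (simp add: brauer_torsion_def)
qed

end

section \<open>Galois groups\<close>

locale extension_field =
  fixes L :: "'f::field alg_closure set"
  assumes subfield: "subfield L closure_ring" and base: "range to_ac \<subseteq> L"
begin

lemma base_in [simp, intro]: "to_ac x \<in> L"
  using base by blast

lemma zero_in [simp, intro]: "0 \<in> L" and one_in [simp, intro]: "1 \<in> L"
  using base_in[of 0] base_in[of 1] by simp_all

lemma add_in [intro]: "x \<in> L \<Longrightarrow> y \<in> L \<Longrightarrow> x + y \<in> L"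
  and mult_in [intro]: "x \<in> L \<Longrightarrow> y \<in> L \<Longrightarrow> x * y \<in> L"
proof -
  note E = subringE[OF subfieldE(1)[OF subfield]]
  show "x \<in> L \<Longrightarrow> y \<in> L \<Longrightarrow> x + y \<in> L" "x \<in> L \<Longrightarrow> y \<in> L \<Longrightarrow> x * y \<in> L"
    using E(6,7)[of x y] by (simp_all add: ring_of_type_algebra_def)
qed

lemma uminus_in [intro]: "x \<in> L \<Longrightarrow> - x \<in> L"
  using mult_in[of "to_ac (- 1)" x] base_in[of "- 1"] by simp

lemma diff_in [intro]: "x \<in> L \<Longrightarrow> y \<in> L \<Longrightarrow> x - y \<in> L"
  using add_in[of x "- y"] by auto

lemma inverse_in [intro]: "x \<in> L \<Longrightarrow> inverse x \<in> L"
proof (cases "x = 0")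
  case False
  assume "x \<in> L"
  interpret R: Ring.field "closure_ring :: 'f alg_closure ring" by (rule field_from_type_algebra)
  have x: "x \<in> L - {\<zero>\<^bsub>closure_ring\<^esub>}" using \<open>x \<in> L\<close> False by (simp add: ring_of_type_algebra_def)
  have "x * inv\<^bsub>closure_ring\<^esub> x = 1"
    using R.subfield_m_inv(2)[OF subfield x] by (simp add: ring_of_type_algebra_def)
  then have "inv\<^bsub>closure_ring\<^esub> x = inverse x" using False by (metis inverse_unique)
  then show ?thesis using R.subfield_m_inv(1)[OF subfield x] by simp
qed simp

lemma divide_in [intro]: "x \<in> L \<Longrightarrow> y \<in> L \<Longrightarrow> x / y \<in> L"
  unfolding divide_inverse by blast

lemma power_in [intro]: "x \<in> L \<Longrightarrow> x ^ n \<in> L"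
  by (induction n) auto

lemma sum_in [intro]: "(\<And>i. i \<in> I \<Longrightarrow> f i \<in> L) \<Longrightarrow> (\<Sum>i\<in>I. f i) \<in> L"
  by (induction I rule: infinite_finite_induct) auto

end

lemma carrier_gal: "\<sigma> \<in> carrier (gal L) \<longleftrightarrow> \<sigma> \<in> extensional L \<and> bij_betw \<sigma> L L \<and>
    (\<forall>x\<in>L. \<forall>y\<in>L. \<sigma> (x * y) = \<sigma> x * \<sigma> y \<and> \<sigma> (x + y) = \<sigma> x + \<sigma> y) \<and> \<sigma> 1 = 1 \<and> (\<forall>x. \<sigma> (to_ac x) = to_ac x)"
  by (auto simp: gal_def Bij_def ring_hom_def ring_of_type_algebra_def bij_betw_def)

lemma mult_gal: "\<sigma> \<in> carrier (gal L) \<Longrightarrow> \<tau> \<in> carrier (gal L) \<Longrightarrow> \<sigma> \<otimes>\<^bsub>gal L\<^esub> \<tau> = compose L \<sigma> \<tau>"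
  by (auto simp: gal_def BijGroup_def)

lemma one_gal: "\<one>\<^bsub>gal L\<^esub> = (\<lambda>x\<in>L. x)"
  by (simp add: gal_def BijGroup_def)

context extension_field
begin

lemma gal_eqI:
  assumes "\<sigma> \<in> carrier (gal L)" "\<tau> \<in> carrier (gal L)" "\<And>x. x \<in> L \<Longrightarrow> \<sigma> x = \<tau> x"
  shows "\<sigma> = \<tau>"
  using assms extensionalityI[of \<sigma> L \<tau>] by (auto simp: carrier_gal)

lemma group_gal: "group (gal L)"
proof (rule groupI)
  fix \<sigma> \<tau> assume s: "\<sigma> \<in> carrier (gal L)" and t: "\<tau> \<in> carrier (gal L)"
  have "bij_betw (compose L \<sigma> \<tau>) L L"
    using s t by (auto simp: carrier_gal intro: bij_betw_compose)
  moreover have "\<tau> x \<in> L" if "x \<in> L" for x using t that by (auto simp: carrier_gal bij_betw_def)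
  ultimately show c: "\<sigma> \<otimes>\<^bsub>gal L\<^esub> \<tau> \<in> carrier (gal L)"
    using s t unfolding mult_gal[OF s t] by (auto simp: carrier_gal compose_eq add_in mult_in)
  fix \<rho> assume r: "\<rho> \<in> carrier (gal L)"
  have "\<tau> \<otimes>\<^bsub>gal L\<^esub> \<rho> \<in> carrier (gal L)"
  proof -
    have "bij_betw (compose L \<tau> \<rho>) L L" using r t by (auto simp: carrier_gal intro: bij_betw_compose)
    moreover have "\<rho> x \<in> L" if "x \<in> L" for x using r that by (auto simp: carrier_gal bij_betw_def)
    ultimately show ?thesis using r t unfolding mult_gal[OF t r] by (auto simp: carrier_gal compose_eq add_in mult_in)
  qed
  then show "\<sigma> \<otimes>\<^bsub>gal L\<^esub> \<tau> \<otimes>\<^bsub>gal L\<^esub> \<rho> = \<sigma> \<otimes>\<^bsub>gal L\<^esub> (\<tau> \<otimes>\<^bsub>gal L\<^esub> \<rho>)"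
    using c r s t by (simp add: mult_gal compose_assoc[of \<rho> L L] carrier_gal bij_betw_imp_funcset)
next
  show one: "\<one>\<^bsub>gal L\<^esub> \<in> carrier (gal L)" by (auto simp: carrier_gal one_gal add_in mult_in bij_betw_def inj_on_def)
  fix \<sigma> assume s: "\<sigma> \<in> carrier (gal L)"
  show "\<one>\<^bsub>gal L\<^esub> \<otimes>\<^bsub>gal L\<^esub> \<sigma> = \<sigma>"
    using mult_gal[OF one s] s by (simp add: one_gal carrier_gal Id_compose bij_betw_imp_funcset)
  have bij: "bij_betw \<sigma> L L" and hom: "\<And>x y. x \<in> L \<Longrightarrow> y \<in> L \<Longrightarrow> \<sigma> (x * y) = \<sigma> x * \<sigma> y \<and> \<sigma> (x + y) = \<sigma> x + \<sigma> y"
    "\<sigma> 1 = 1" "\<And>x. \<sigma> (to_ac x) = to_ac x"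
    using s by (auto simp: carrier_gal)
  let ?g = "\<lambda>x\<in>L. inv_into L \<sigma> x"
  have g: "inv_into L \<sigma> (\<sigma> x) = x" if "x \<in> L" for x using bij that by (simp add: bij_betw_def)
  have sg: "inv_into L \<sigma> x \<in> L" "\<sigma> (inv_into L \<sigma> x) = x" if "x \<in> L" for x
    using bij that by (auto simp: bij_betw_def inv_into_into f_inv_into_f)
  have gm: "inv_into L \<sigma> (x * y) = inv_into L \<sigma> x * inv_into L \<sigma> y" "inv_into L \<sigma> (x + y) = inv_into L \<sigma> x + inv_into L \<sigma> y"
    if "x \<in> L" "y \<in> L" for x y
    using g[of "inv_into L \<sigma> x * inv_into L \<sigma> y"] g[of "inv_into L \<sigma> x + inv_into L \<sigma> y"] hom(1)[of "inv_into L \<sigma> x" "inv_into L \<sigma> y"]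
      sg[OF that(1)] sg[OF that(2)] by (auto simp: add_in mult_in)
  have "bij_betw ?g L L" using bij_betw_inv_into[OF bij] by (subst bij_betw_restrict_eq[symmetric]) simp
  then have "?g \<in> carrier (gal L)"
    using gm g[of 1] g[of "to_ac _"] hom(2,3) by (auto simp: carrier_gal add_in mult_in)
  moreover have "?g \<otimes>\<^bsub>gal L\<^esub> \<sigma> = \<one>\<^bsub>gal L\<^esub>"
    unfolding mult_gal[OF calculation s] one_gal using s
    by (intro extensionalityI[of _ L]) (auto simp: compose_eq g carrier_gal bij_betw_def)
  ultimately show "\<exists>\<tau>\<in>carrier (gal L). \<tau> \<otimes>\<^bsub>gal L\<^esub> \<sigma> = \<one>\<^bsub>gal L\<^esub>" by blast
qed

sublocale G: group "gal L" by (rule group_gal)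

lemma gal_mult_apply: "\<sigma> \<in> carrier (gal L) \<Longrightarrow> \<tau> \<in> carrier (gal L) \<Longrightarrow> x \<in> L \<Longrightarrow> (\<sigma> \<otimes>\<^bsub>gal L\<^esub> \<tau>) x = \<sigma> (\<tau> x)"
  by (simp add: mult_gal compose_eq)

context
  fixes \<sigma> assumes \<sigma>: "\<sigma> \<in> carrier (gal L)"
begin

lemma gal_in [simp]: "x \<in> L \<Longrightarrow> \<sigma> x \<in> L"
  and gal_mult: "x \<in> L \<Longrightarrow> y \<in> L \<Longrightarrow> \<sigma> (x * y) = \<sigma> x * \<sigma> y"
  and gal_add: "x \<in> L \<Longrightarrow> y \<in> L \<Longrightarrow> \<sigma> (x + y) = \<sigma> x + \<sigma> y"
  and gal_base [simp]: "\<sigma> (to_ac r) = to_ac r"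
  and gal_inj: "x \<in> L \<Longrightarrow> y \<in> L \<Longrightarrow> \<sigma> x = \<sigma> y \<Longrightarrow> x = y"
  using \<sigma> by (auto simp: carrier_gal bij_betw_def inj_on_def)

lemma gal_0 [simp]: "\<sigma> 0 = 0" and gal_1 [simp]: "\<sigma> 1 = 1"
  using gal_base[of 0] gal_base[of 1] by simp_all

lemma gal_eq_0 [simp]: "x \<in> L \<Longrightarrow> \<sigma> x = 0 \<longleftrightarrow> x = 0"
  using gal_inj[of x 0] by auto

lemma gal_power: "x \<in> L \<Longrightarrow> \<sigma> (x ^ n) = \<sigma> x ^ n"
  by (induction n) (auto simp: gal_mult power_in)

lemma gal_inverse: "x \<in> L \<Longrightarrow> \<sigma> (inverse x) = inverse (\<sigma> x)"
proof (cases "x = 0")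
  case False
  assume x: "x \<in> L"
  have "\<sigma> x * \<sigma> (inverse x) = 1" using gal_mult[OF x inverse_in[OF x]] False by simp
  then show ?thesis by (metis inverse_unique)
qed simp

lemma gal_divide: "x \<in> L \<Longrightarrow> y \<in> L \<Longrightarrow> \<sigma> (x / y) = \<sigma> x / \<sigma> y"
  by (simp add: divide_inverse gal_mult gal_inverse inverse_in)

lemma gal_uminus: "x \<in> L \<Longrightarrow> \<sigma> (- x) = - \<sigma> x"
  using gal_mult[of "to_ac (- 1)" x] gal_base[of "-1"] base_in[of "-1"] by simp

lemma gal_sum: "(\<And>i. i \<in> I \<Longrightarrow> f i \<in> L) \<Longrightarrow> \<sigma> (\<Sum>i\<in>I. f i) = (\<Sum>i\<in>I. \<sigma> (f i))"
  by (induction I rule: infinite_finite_induct) (auto simp: gal_add sum_in)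

end

text \<open>Dedekind: distinct automorphisms are linearly independent.\<close>

lemma automorphisms_independent:
  assumes "finite S" "S \<subseteq> carrier (gal L)" "\<And>x. x \<in> L \<Longrightarrow> (\<Sum>\<sigma>\<in>S. a \<sigma> * \<sigma> x) = 0" "\<sigma> \<in> S"
  shows "a \<sigma> = 0"
  using assms
proof (induction S arbitrary: a \<sigma> rule: finite_induct)
  case (insert \<tau> S)
  have S: "a \<rho> = 0" if \<rho>: "\<rho> \<in> S" for \<rho>
  proof -
    have "\<rho> \<noteq> \<tau>" using \<rho> insert.hyps by blast
    then obtain z where z: "z \<in> L" "\<rho> z \<noteq> \<tau> z" using gal_eqI[of \<rho> \<tau>] insert.prems(1) \<rho> by blast
    have "(\<Sum>\<sigma>\<in>S. (a \<sigma> * (\<sigma> z - \<tau> z)) * \<sigma> x) = 0" if x: "x \<in> L" for x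
    proof -
      have "0 = (\<Sum>\<sigma>\<in>insert \<tau> S. a \<sigma> * \<sigma> (z * x)) - \<tau> z * (\<Sum>\<sigma>\<in>insert \<tau> S. a \<sigma> * \<sigma> x)"
        using insert.prems(2)[of "z * x"] insert.prems(2)[OF x] z x by (simp add: mult_in)
      also have "\<dots> = (\<Sum>\<sigma>\<in>insert \<tau> S. a \<sigma> * \<sigma> (z * x) - \<tau> z * (a \<sigma> * \<sigma> x))"
        by (simp only: sum_distrib_left sum_subtractf)
      also have "\<dots> = (\<Sum>\<sigma>\<in>insert \<tau> S. (a \<sigma> * (\<sigma> z - \<tau> z)) * \<sigma> x)"
        using insert.prems(1) z x by (intro sum.cong refl) (auto simp: gal_mult algebra_simps)
      also have "\<dots> = (\<Sum>\<sigma>\<in>S. (a \<sigma> * (\<sigma> z - \<tau> z)) * \<sigma> x)"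
        using insert.hyps by simp
      finally show ?thesis by simp
    qed
    then have "a \<rho> * (\<rho> z - \<tau> z) = 0" using insert.IH[of "\<lambda>\<sigma>. a \<sigma> * (\<sigma> z - \<tau> z)"] insert.prems(1) \<rho> by blast
    then show ?thesis using z by simp
  qed
  then have "(\<Sum>\<sigma>\<in>insert \<tau> S. a \<sigma> * \<sigma> 1) = a \<tau>"
    using insert.hyps insert.prems(1) by (simp add: gal_1)
  then have "a \<tau> = 0" using insert.prems(2)[of 1] by simp
  then show ?case using S insert.prems(3) by blast
qed simp

text \<open>
  By the independence of automorphisms some resolvent \<open>b = (\<Sum>\<tau>. g(\<tau>) \<tau>(x))\<close> is nonzero; it satisfies
  \<open>g(\<sigma>) \<sigma>(b) = b\<close>, and \<open>w\<close> is its inverse.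
\<close>

lemma hilbert_90:
  assumes fin: "finite (carrier (gal L))"
    and g: "\<And>\<sigma>. \<sigma> \<in> carrier (gal L) \<Longrightarrow> g \<sigma> \<in> L" "\<And>\<sigma>. \<sigma> \<in> carrier (gal L) \<Longrightarrow> g \<sigma> \<noteq> 0"
    and cocycle: "\<And>\<sigma> \<tau>. \<sigma> \<in> carrier (gal L) \<Longrightarrow> \<tau> \<in> carrier (gal L) \<Longrightarrow> g (\<sigma> \<otimes>\<^bsub>gal L\<^esub> \<tau>) = g \<sigma> * \<sigma> (g \<tau>)"
  obtains w where "w \<in> L" "w \<noteq> 0" "\<And>\<sigma>. \<sigma> \<in> carrier (gal L) \<Longrightarrow> \<sigma> w = g \<sigma> * w"
proof -
  have "\<exists>x\<in>L. (\<Sum>\<tau>\<in>carrier (gal L). g \<tau> * \<tau> x) \<noteq> 0"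
    using automorphisms_independent[OF fin subset_refl, of g "\<one>\<^bsub>gal L\<^esub>"] g(2)[of "\<one>\<^bsub>gal L\<^esub>"] by blast
  then obtain x where x: "x \<in> L" "(\<Sum>\<tau>\<in>carrier (gal L). g \<tau> * \<tau> x) \<noteq> 0" by blast
  define b where "b = (\<Sum>\<tau>\<in>carrier (gal L). g \<tau> * \<tau> x)"
  have b: "b \<in> L" "b \<noteq> 0" using x g by (auto simp: b_def intro!: sum_in mult_in)
  have "g \<sigma> * \<sigma> b = b" if \<sigma>: "\<sigma> \<in> carrier (gal L)" for \<sigma>
  proof -
    have "g \<sigma> * \<sigma> b = (\<Sum>\<tau>\<in>carrier (gal L). g (\<sigma> \<otimes>\<^bsub>gal L\<^esub> \<tau>) * (\<sigma> \<otimes>\<^bsub>gal L\<^esub> \<tau>) x)"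
      using x g \<sigma> unfolding b_def
      by (subst gal_sum) (auto simp: sum_distrib_left gal_mult gal_mult_apply cocycle mult_ac intro!: sum.cong)
    also have "\<dots> = b"
      unfolding b_def
      by (rule sum.reindex_bij_witness[of _ "\<lambda>\<tau>. inv\<^bsub>gal L\<^esub> \<sigma> \<otimes>\<^bsub>gal L\<^esub> \<tau>" "\<lambda>\<tau>. \<sigma> \<otimes>\<^bsub>gal L\<^esub> \<tau>"])
        (use \<sigma> in \<open>auto simp: G.m_assoc[symmetric]\<close>)
    finally show ?thesis .
  qed
  then have *: "\<sigma> b = b / g \<sigma>" if "\<sigma> \<in> carrier (gal L)" for \<sigma>
    using that g(2)[OF that] by (metis nonzero_mult_div_cancel_left)
  have "\<sigma> (inverse b) = g \<sigma> * inverse b" if "\<sigma> \<in> carrier (gal L)" for \<sigma>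
    unfolding gal_inverse[OF that b(1)] *[OF that] by (simp add: field_simps)
  then show ?thesis using that[of "inverse b"] b by auto
qed

end

section \<open>Radical extensions\<close>

lemma roots_of_unity_powers:
  fixes z :: "'a::field"
  assumes "p > 0" "primitive_root_of_unity p z" "x ^ p = 1"
  obtains n where "n < p" "x = z ^ n"
proof -
  let ?P = "Polynomial.monom 1 p - 1 :: 'a Polynomial.poly"
  have zp: "z ^ p = 1" and zk: "\<And>k. 0 < k \<Longrightarrow> k < p \<Longrightarrow> z ^ k \<noteq> 1"
    using assms(2) by (auto simp: primitive_root_of_unity_def)
  have z0: "z \<noteq> 0" using zp assms(1) by (intro notI) (simp add: power_0_left)
  have inj: "inj_on (\<lambda>n. z ^ n) {..<p}"
  proof (rule linorder_inj_onI)
    fix m n assume mn: "m < n" "m \<in> {..<p}" "n \<in> {..<p}"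
    have "z ^ n = z ^ m * z ^ (n - m)" using mn by (simp add: power_add[symmetric])
    then show "z ^ m \<noteq> z ^ n" using zk[of "n - m"] mn z0 by auto
  qed auto
  have deg: "Polynomial.degree ?P = p"
    using assms(1) degree_add_eq_left[of "- 1" "Polynomial.monom (1::'a) p"] by (simp add: Polynomial.degree_monom_eq)
  then have P0: "?P \<noteq> 0" using assms(1) by auto
  have roots: "{y. poly ?P y = 0} = {y. y ^ p = 1}" by (auto simp: poly_monom)
  have sub: "(\<lambda>n. z ^ n) ` {..<p} \<subseteq> {y. y ^ p = 1}"
    using zp by (auto simp: power_mult[symmetric] mult.commute[of _ p]) (simp add: power_mult)
  have "card {y::'a. y ^ p = 1} \<le> p" using card_poly_roots_bound[OF P0] unfolding roots deg .
  moreover have "finite {y::'a. y ^ p = 1}" using poly_roots_finite[OF P0] unfolding roots .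
  ultimately have "(\<lambda>n. z ^ n) ` {..<p} = {y. y ^ p = 1}"
    using sub inj by (intro card_seteq) (auto simp: card_image)
  then show ?thesis using that assms(3) by blast
qed

lemma primitive_root_to_ac: "primitive_root_of_unity p \<zeta> \<Longrightarrow> primitive_root_of_unity p (to_ac \<zeta>)"
  unfolding primitive_root_of_unity_def
  by (metis to_ac_power to_ac_1 to_ac_eq_iff)

context extension_field
begin

lemma monic_division:
  assumes g: "\<And>i. Polynomial.coeff g i \<in> L" "Polynomial.lead_coeff g = 1" "Polynomial.degree g > 0"
    and f: "\<And>i. Polynomial.coeff f i \<in> L"
  shows "\<exists>q r. f = g * q + r \<and> (\<forall>i. Polynomial.coeff r i \<in> L) \<and> Polynomial.degree r < Polynomial.degree g"
  using f
proof (induction f rule: pCons_induct)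
  case 0
  then show ?case using g(3) by (intro exI[of _ 0]) auto
next
  case (pCons a f)
  have "\<And>i. Polynomial.coeff f i \<in> L" using pCons.prems by (metis coeff_pCons_Suc)
  then obtain q r where qr: "f = g * q + r" "\<And>i. Polynomial.coeff r i \<in> L" "Polynomial.degree r < Polynomial.degree g"
    using pCons.IH by blast
  let ?c = "Polynomial.coeff (pCons a r) (Polynomial.degree g)"
  let ?r = "pCons a r - Polynomial.smult ?c g"
  have a: "a \<in> L" using pCons.prems[of 0] by simp
  have rc: "Polynomial.coeff (pCons a r) i \<in> L" for i using a qr(2) by (cases i) auto
  have "Polynomial.degree ?r < Polynomial.degree g"
  proof (rule degree_lessI)
    show "\<forall>k\<ge>Polynomial.degree g. Polynomial.coeff ?r k = 0"
    proof (intro allI impI)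
      fix k assume "Polynomial.degree g \<le> k"
      then consider "k = Polynomial.degree g" | "Polynomial.degree g < k" by linarith
      then show "Polynomial.coeff ?r k = 0"
      proof cases
        case 2
        then have "Polynomial.coeff r (k - 1) = 0" "k \<noteq> 0" using qr(3) by (auto intro: coeff_eq_0)
        then show ?thesis using 2 by (cases k) (auto simp: coeff_eq_0)
      qed (use g(2) in auto)
    qed
  qed (use g(3) in auto)
  moreover have "Polynomial.coeff ?r i \<in> L" for i using rc g(1) by (auto simp: coeff_diff)
  moreover have "pCons a f = g * (pCons 0 q + [:?c:]) + ?r"
    unfolding qr(1) by (simp add: algebra_simps)
  ultimately show ?case by blast
qed

text \<open>
  The constant coefficient of the minimal polynomial of \<open>y\<close> is, up to sign and a root of unity, a
  power of \<open>y\<close> with the degree as exponent; a degree prime to \<open>p\<close> would put \<open>y\<close> into the field.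
\<close>

lemma radical_powers_independent:
  assumes p: "Factorial_Ring.prime p" and \<zeta>: "primitive_root_of_unity p (\<zeta> :: 'f)"
    and y: "y ^ p \<in> L" "y \<notin> L" and k: "\<And>i. k i \<in> L" and rel: "(\<Sum>i<p. k i * y ^ i) = 0" and i: "i < p"
  shows "k i = 0"
proof (rule ccontr)
  assume ki: "k i \<noteq> 0"
  have p0: "p > 0" using p by (simp add: prime_gt_0_nat)
  have y0: "y \<noteq> 0" using y(2) by auto
  let ?K = "\<lambda>g. (\<forall>i. Polynomial.coeff g i \<in> L) \<and> g \<noteq> 0 \<and> poly g y = 0"
  let ?h = "\<Sum>i<p. Polynomial.monom (k i) i"
  have h_coeff: "Polynomial.coeff ?h j = (if j < p then k j else 0)" for j
    by (simp add: coeff_sum)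
  have h: "?K ?h"
  proof (intro conjI allI)
    show "?h \<noteq> 0" using h_coeff[of i] i ki by (metis coeff_0)
    show "poly ?h y = 0" using rel by (simp add: poly_sum poly_monom)
  qed (auto simp: h_coeff k)
  obtain g0 where g0: "?K g0" and g0_min: "\<And>f. ?K f \<Longrightarrow> Polynomial.degree g0 \<le> Polynomial.degree f"
    using ex_has_least_nat[of ?K ?h Polynomial.degree] h by blast
  define g where "g = Polynomial.smult (inverse (Polynomial.lead_coeff g0)) g0"
  define d where "d = Polynomial.degree g"
  have g: "\<And>i. Polynomial.coeff g i \<in> L" "Polynomial.lead_coeff g = 1" "poly g y = 0"
    and deg_g: "Polynomial.degree g = Polynomial.degree g0"
    using g0 by (auto simp: g_def)
  have "d \<noteq> 0"
  proof
    assume "d = 0"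
    then obtain c where "g = [:c:]" using degree_eq_zeroE unfolding d_def by blast
    then show False using g(2,3) by simp
  qed
  have "Polynomial.degree ?h < p"
    by (rule degree_lessI) (use h h_coeff p0 in auto)
  then have dp: "d < p" using g0_min[OF h] deg_g by (simp add: d_def)
  let ?f = "Polynomial.monom 1 p - [:y ^ p:]"
  have "Polynomial.coeff ?f i \<in> L" for i using y(1) by (cases i) (auto simp: coeff_pCons)
  then obtain q r where qr: "?f = g * q + r" "\<And>i. Polynomial.coeff r i \<in> L" "Polynomial.degree r < Polynomial.degree g"
    using monic_division[of g ?f] g \<open>d \<noteq> 0\<close> unfolding d_def by blast
  have "poly (g * q + r) y = 0" unfolding qr(1)[symmetric] by (simp add: poly_monom)
  then have "poly r y = 0" using g(3) by simp
  then have "r = 0" using g0_min[of r] qr(2,3) deg_g by force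
  then have root: "z ^ p = y ^ p" if "poly g z = 0" for z
    using arg_cong[OF qr(1), of "\<lambda>f. poly f z"] that by (simp add: poly_monom)
  have "g \<noteq> 0" using g(2) by auto
  then obtain A where A: "size A = d" "g = (\<Prod>x\<in>#A. [:- x, 1:])"
    using alg_closed_imp_factorization[of g] g(2) unfolding d_def by auto
  have "\<exists>N. (\<Prod>x\<in>#B. - x) = (- 1) ^ size B * to_ac \<zeta> ^ N * y ^ size B" if "B \<subseteq># A" for B
    using that
  proof (induction B)
    case (add z B)
    then obtain N where N: "(\<Prod>x\<in>#B. - x) = (- 1) ^ size B * to_ac \<zeta> ^ N * y ^ size B"
      using subset_mset.order_trans[OF _ add.prems, of B] by auto
    have "z \<in># A" using add.prems by (simp add: insert_subset_eq_iff)
    then have "poly g z = 0" unfolding A(2) by (simp add: poly_prod_mset prod_mset_zero_iff)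
    then have "(z / y) ^ p = 1" using root y0 by (simp add: power_divide)
    then obtain n where "z / y = to_ac \<zeta> ^ n"
      using roots_of_unity_powers[OF p0 primitive_root_to_ac[OF \<zeta>]] by blast
    then have "z = to_ac \<zeta> ^ n * y" using y0 by (simp add: field_simps)
    then show ?case using N by (intro exI[of _ "N + n"]) (simp add: power_add)
  qed (auto intro: exI[of _ 0])
  then obtain N where N: "(\<Prod>x\<in>#A. - x) = (- 1) ^ d * to_ac \<zeta> ^ N * y ^ d" using A(1) by blast
  have "Polynomial.coeff g 0 = (\<Prod>x\<in>#A. - x)"
    unfolding A(2) poly_0_coeff_0[symmetric] by (simp add: poly_prod_mset)
  then have c: "(- 1) ^ d * to_ac \<zeta> ^ N * y ^ d \<in> L" using g(1)[of 0] N by simp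
  have \<zeta>0: "\<zeta> \<noteq> 0" using \<zeta> p0 unfolding primitive_root_of_unity_def by (metis power_0_left not_gr_zero zero_neq_one)
  have "y ^ d = ((- 1) ^ d * to_ac \<zeta> ^ N * y ^ d) / ((- 1) ^ d * to_ac \<zeta> ^ N)" using \<zeta>0 by simp
  also have "\<dots> \<in> L" by (rule divide_in[OF c]) (intro mult_in power_in uminus_in one_in base_in)
  finally have yd: "y ^ d \<in> L" .
  have "\<not> p dvd d" using dp \<open>d \<noteq> 0\<close> by (auto dest: dvd_imp_le)
  then have "coprime d p" using prime_imp_coprime[OF p, of d] by (simp add: coprime_commute)
  then obtain u v where uv: "d * u = p * v + 1"
    using bezout_nat[OF \<open>d \<noteq> 0\<close>, of p] by (auto simp: coprime_iff_gcd_eq_1)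
  have "y = (y ^ d) ^ u / (y ^ p) ^ v" using y0 uv by (simp add: power_mult[symmetric] power_add)
  also have "\<dots> \<in> L" by (rule divide_in[OF power_in[OF yd] power_in[OF y(1)]])
  finally show False using y(2) by simp
qed

text \<open>
  This is the field generated by \<open>y\<close> over \<open>L\<close> when \<open>y\<^sup>p\<close> lies in \<open>L\<close>.
\<close>

definition radical_extension :: "nat \<Rightarrow> 'f alg_closure \<Rightarrow> 'f alg_closure set" where
  "radical_extension p y = {\<Sum>i<p. k i * y ^ i | k. \<forall>i. k i \<in> L}"

lemma
  assumes p: "p > 0" and y: "y ^ p \<in> L"
  shows radical_extension_field: "extension_field (radical_extension p y)"
    and radical_extension_finite: "ring.finite_dimension closure_ring L (radical_extension p y)"
    and radical_extension_incl: "L \<subseteq> radical_extension p y"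
proof -
  interpret R: Ring.field "closure_ring :: 'f alg_closure ring" by (rule field_from_type_algebra)
  let ?M = "radical_extension p y" and ?S = "R.simple_extension L y"
  have R: "carrier closure_ring = UNIV" "\<And>a b. a \<otimes>\<^bsub>closure_ring\<^esub> b = a * b" "\<And>a b. a \<oplus>\<^bsub>closure_ring\<^esub> b = a + b"
    "\<one>\<^bsub>closure_ring\<^esub> = 1" "\<zero>\<^bsub>closure_ring\<^esub> = 0" for a b :: "'f alg_closure"
    by (simp_all add: ring_of_type_algebra_def)
  have sub: "subring L closure_ring" by (rule subfieldE(1)[OF subfield])
  have "x \<in> ?M" if "x \<in> ?S" for x
    using that
  proof (induction rule: R.simple_extension.induct)
    case zero
    show ?case unfolding radical_extension_def R by (intro CollectI exI[of _ "\<lambda>_. 0"]) auto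
  next
    case (lin k1 k2)
    then obtain k where k: "k1 = (\<Sum>i<p. k i * y ^ i)" "\<And>i. k i \<in> L" unfolding radical_extension_def by blast
    obtain n where n: "p = Suc n" using p by (cases p) auto
    let ?k = "\<lambda>i. case i of 0 \<Rightarrow> k n * y ^ p + k2 | Suc j \<Rightarrow> k j"
    have "k1 * y + k2 = (\<Sum>i<p. ?k i * y ^ i)"
    proof -
      have "k1 * y = (\<Sum>i<Suc n. k i * y ^ Suc i)"
        unfolding k(1) n sum_distrib_right by (intro sum.cong refl) simp
      then have "k1 * y + k2 = (k n * y ^ p + k2) + (\<Sum>i<n. k i * y ^ Suc i)" by (simp add: n)
      moreover have "(\<Sum>i<p. ?k i * y ^ i) = (k n * y ^ p + k2) + (\<Sum>i<n. k i * y ^ Suc i)"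
        by (subst n, subst sum.lessThan_Suc_shift) simp
      ultimately show ?thesis by simp
    qed
    moreover have "?k i \<in> L" for i using k(2) lin(2) y by (auto split: nat.split)
    ultimately show ?case unfolding radical_extension_def R by blast
  qed
  moreover have "x \<in> ?S" if x: "x \<in> ?M" for x
  proof -
    obtain k where k: "x = (\<Sum>i<p. k i * y ^ i)" "\<And>i. k i \<in> L" using x unfolding radical_extension_def by blast
    note E = subringE[OF R.simple_extension_is_subring[OF sub, of y], unfolded R, OF UNIV_I]
    have yS: "y \<in> ?S" using R.simple_extension_mem[OF sub, of y] by (simp add: R)
    have LS: "L \<subseteq> ?S" using R.simple_extension_incl[of L y] by (simp add: R)
    have "y ^ i \<in> ?S" for i by (induction i) (use E(3,6) yS in auto)
    then have "k i * y ^ i \<in> ?S" for i using E(6) LS k(2) by blast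
    then show ?thesis unfolding k(1) by (induction p) (use E(2,7) in auto)
  qed
  ultimately have M: "?M = ?S" by blast
  have "(R.algebraic over L) y"
  proof (rule R.algebraicI[of "1 # replicate (p - 1) 0 @ [- (y ^ p)]"])
    have "- (y ^ p) \<in> L" using y by (rule uminus_in)
    then show "1 # replicate (p - 1) 0 @ [- (y ^ p)] \<in> carrier (L [X]\<^bsub>closure_ring\<^esub>)"
      by (auto simp: univ_poly_def polynomial_def R)
    have "R.eval (replicate n 0 @ [c]) y = c" for n c
      by (induction n) (simp_all add: R)
    moreover have "y [^]\<^bsub>closure_ring\<^esub> n = y ^ n" for n :: nat
      by (induction n) (simp_all add: R mult.commute)
    ultimately show "R.eval (1 # replicate (p - 1) 0 @ [- (y ^ p)]) y = \<zero>\<^bsub>closure_ring\<^esub>"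
      using p by (simp add: R)
  qed simp
  then have "subfield ?M closure_ring" "ring.finite_dimension closure_ring L ?M"
    using R.simple_extension_is_subfield[OF subfield, of y] R.finite_dimension_simple_extension[OF subfield, of y]
    unfolding M by (simp_all add: R)
  moreover have "L \<subseteq> ?M" using R.simple_extension_incl[of L y] unfolding M by (simp add: R)
  ultimately show "extension_field ?M" "ring.finite_dimension closure_ring L ?M" "L \<subseteq> ?M"
    using base by (auto simp: extension_field_def)
qed

end

section \<open>Central embedding problems with a cyclic kernel of prime order\<close>

locale central_embedding = extension_field K for K :: "'f::field alg_closure set" +
  fixes p :: nat and \<zeta> :: 'f and E :: "'e monoid" and q :: "'e \<Rightarrow> 'f alg_closure \<Rightarrow> 'f alg_closure" and t :: 'e
  assumes p: "Factorial_Ring.prime p" and \<zeta>: "primitive_root_of_unity p \<zeta>"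
    and galois: "galois_extension K" and finite_gal: "finite (carrier (gal K))"
    and group_E: "group E" and q_hom: "q \<in> hom E (gal K)" and q_surj: "q ` carrier E = carrier (gal K)"
    and t_closed: "t \<in> carrier E" and t_central: "\<And>e. e \<in> carrier E \<Longrightarrow> t \<otimes>\<^bsub>E\<^esub> e = e \<otimes>\<^bsub>E\<^esub> t"
    and t_order: "group.ord E t = p"
    and ker_q: "\<And>e. e \<in> carrier E \<Longrightarrow> q e = \<one>\<^bsub>gal K\<^esub> \<longleftrightarrow> (\<exists>n::nat. e = t [^]\<^bsub>E\<^esub> n)"
begin

sublocale E: group E by (rule group_E)

text \<open>
  A crossed homomorphism to the multiplicative group of \<open>K\<close> that restricts to the identification
  of the kernel with the roots of unity.  Its existence expresses that the cohomology class of the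
  extension becomes trivial in \<open>H\<^sup>2(Gal(K/F), K\<^sup>\<times>)\<close>.
\<close>

definition splitting :: "('e \<Rightarrow> 'f alg_closure) \<Rightarrow> bool" where
  "splitting f \<longleftrightarrow> (\<forall>e\<in>carrier E. f e \<in> K \<and> f e \<noteq> 0) \<and>
     (\<forall>e\<in>carrier E. \<forall>e'\<in>carrier E. f (e \<otimes>\<^bsub>E\<^esub> e') = f e * q e (f e')) \<and> f t = to_ac \<zeta>"

lemma p_pos: "p > 0" and p_gt_1: "p > 1"
  using prime_gt_0_nat[OF p] prime_gt_1_nat[OF p] by simp_all

lemma \<zeta>_pow: "\<zeta> ^ p = 1" and \<zeta>_nonzero [simp]: "\<zeta> \<noteq> 0" and \<zeta>_pow_neq: "0 < k \<Longrightarrow> k < p \<Longrightarrow> \<zeta> ^ k \<noteq> 1"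
proof -
  show "\<zeta> ^ p = 1" "0 < k \<Longrightarrow> k < p \<Longrightarrow> \<zeta> ^ k \<noteq> 1" using \<zeta> by (auto simp: primitive_root_of_unity_def)
  then show "\<zeta> \<noteq> 0" using p_pos by (intro notI) (simp add: power_0_left)
qed

lemma \<zeta>_pow_eq_1: "\<zeta> ^ n = 1 \<longleftrightarrow> p dvd n"
  using root_of_unity_mod[OF \<zeta>_pow, of n] \<zeta>_pow_neq[of "n mod p"] p_pos
  by (metis dvd_eq_mod_eq_0 gr_zeroI mod_less_divisor power_0)

lemma t_pow_eq_1: "t [^]\<^bsub>E\<^esub> (n::nat) = \<one>\<^bsub>E\<^esub> \<longleftrightarrow> p dvd n"
  using E.pow_eq_id[OF t_closed, of n] by (simp add: t_order)

lemma t_pow_closed [simp]: "t [^]\<^bsub>E\<^esub> (n::nat) \<in> carrier E"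
  by (simp add: t_closed)

lemma t_pow_central: "e \<in> carrier E \<Longrightarrow> t [^]\<^bsub>E\<^esub> (n::nat) \<otimes>\<^bsub>E\<^esub> e = e \<otimes>\<^bsub>E\<^esub> t [^]\<^bsub>E\<^esub> n"
proof (induction n)
  case (Suc n)
  have "t [^]\<^bsub>E\<^esub> Suc n \<otimes>\<^bsub>E\<^esub> e = t [^]\<^bsub>E\<^esub> n \<otimes>\<^bsub>E\<^esub> (e \<otimes>\<^bsub>E\<^esub> t)"
    using Suc.prems by (simp add: E.m_assoc t_closed t_central)
  also have "\<dots> = e \<otimes>\<^bsub>E\<^esub> t [^]\<^bsub>E\<^esub> Suc n"
    using Suc by (simp add: E.m_assoc[symmetric] t_closed)
  finally show ?case .
qed simp

lemma q_closed [simp]: "e \<in> carrier E \<Longrightarrow> q e \<in> carrier (gal K)"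
  using q_hom by (auto simp: hom_def)

lemma q_mult: "e \<in> carrier E \<Longrightarrow> e' \<in> carrier E \<Longrightarrow> q (e \<otimes>\<^bsub>E\<^esub> e') = q e \<otimes>\<^bsub>gal K\<^esub> q e'"
  using q_hom by (auto simp: hom_def)

lemma q_t_pow: "q (t [^]\<^bsub>E\<^esub> (n::nat)) = \<one>\<^bsub>gal K\<^esub>"
  using ker_q[of "t [^]\<^bsub>E\<^esub> n"] by auto

lemma q_one: "q \<one>\<^bsub>E\<^esub> = \<one>\<^bsub>gal K\<^esub>"
  using q_t_pow[of 0] by simp

lemma one_gal_apply: "x \<in> K \<Longrightarrow> \<one>\<^bsub>gal K\<^esub> x = x"
  by (simp add: one_gal)

lemma q_mult_apply: "e \<in> carrier E \<Longrightarrow> e' \<in> carrier E \<Longrightarrow> x \<in> K \<Longrightarrow> q (e \<otimes>\<^bsub>E\<^esub> e') x = q e (q e' x)"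
  by (simp add: q_mult gal_mult_apply)

lemma q_eqD:
  assumes "e \<in> carrier E" "e' \<in> carrier E" "q e = q e'"
  obtains n :: nat where "e = t [^]\<^bsub>E\<^esub> n \<otimes>\<^bsub>E\<^esub> e'"
proof -
  have "q (e \<otimes>\<^bsub>E\<^esub> inv\<^bsub>E\<^esub> e') = q e' \<otimes>\<^bsub>gal K\<^esub> q (inv\<^bsub>E\<^esub> e')" using assms by (simp add: q_mult)
  also have "\<dots> = \<one>\<^bsub>gal K\<^esub>" using assms(2) by (simp add: q_mult[symmetric] q_one)
  finally obtain n :: nat where "e \<otimes>\<^bsub>E\<^esub> inv\<^bsub>E\<^esub> e' = t [^]\<^bsub>E\<^esub> n" using ker_q assms by auto
  then have "e = t [^]\<^bsub>E\<^esub> n \<otimes>\<^bsub>E\<^esub> e'" using assms by (metis E.inv_solve_right' E.m_closed E.inv_closed)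
  then show ?thesis by (rule that)
qed

definition lift :: "('f alg_closure \<Rightarrow> 'f alg_closure) \<Rightarrow> 'e" where
  "lift = inv_into (carrier E) q"

lemma lift: "\<sigma> \<in> carrier (gal K) \<Longrightarrow> lift \<sigma> \<in> carrier E" "\<sigma> \<in> carrier (gal K) \<Longrightarrow> q (lift \<sigma>) = \<sigma>"
  unfolding lift_def using q_surj by (auto intro: inv_into_into f_inv_into_f)

lemma fixed_in_base: "x \<in> K \<Longrightarrow> (\<And>\<sigma>. \<sigma> \<in> carrier (gal K) \<Longrightarrow> \<sigma> x = x) \<Longrightarrow> x \<in> range to_ac"
  using galois by (auto simp: galois_extension_def)

text \<open>
  From a solution \<open>L\<close>: the eigenvector \<open>y\<close> of the kernel gives the crossed homomorphism
  \<open>e \<mapsto> e(y) / y\<close>.  That its values lie in \<open>K\<close> is shown by expanding them with respect to a basis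
  \<open>m\<close> of \<open>K\<close> whose dual basis for the trace form consists of multiples of the inverses.
\<close>

lemma solvable_imp_splitting:
  assumes solvable: "embedding_problem_solvable K E q"
    and J: "finite J" "\<And>j. j \<in> J \<Longrightarrow> m j \<in> K" "N \<noteq> 0" "N \<in> K"
    and dual: "\<And>\<sigma>. \<sigma> \<in> carrier (gal K) \<Longrightarrow> (\<Sum>j\<in>J. \<sigma> (inverse (m j)) * m j) = (if \<sigma> = \<one>\<^bsub>gal K\<^esub> then N else 0)"
  shows "\<exists>f. splitting f"
proof -
  obtain L \<phi> where L: "galois_extension L" "K \<subseteq> L" "\<phi> \<in> iso (gal L) E"
    and restr: "\<And>\<sigma>. \<sigma> \<in> carrier (gal L) \<Longrightarrow> q (\<phi> \<sigma>) = restrict \<sigma> K"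
    using solvable unfolding embedding_problem_solvable_def by blast
  interpret L: extension_field L
    using L(1) by (auto simp: extension_field_def galois_extension_def)
  define \<psi> where "\<psi> = inv_into (carrier (gal L)) \<phi>"
  have \<psi>_iso: "\<psi> \<in> iso E (gal L)"
    unfolding \<psi>_def by (rule L.G.iso_set_sym[OF L(3)])
  have \<psi>_closed [simp]: "\<psi> e \<in> carrier (gal L)" if "e \<in> carrier E" for e
    using \<psi>_iso that by (auto simp: iso_def hom_def)
  have \<psi>_inj: "e = e'" if "e \<in> carrier E" "e' \<in> carrier E" "\<psi> e = \<psi> e'" for e e'
    using \<psi>_iso that by (auto simp: iso_def bij_betw_def inj_on_def)
  have \<psi>_surj: "\<exists>e\<in>carrier E. \<sigma> = \<psi> e" if "\<sigma> \<in> carrier (gal L)" for \<sigma>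
    using \<psi>_iso that by (auto simp: iso_def bij_betw_def)
  have \<psi>_mult: "\<psi> (e \<otimes>\<^bsub>E\<^esub> e') x = \<psi> e (\<psi> e' x)" if "e \<in> carrier E" "e' \<in> carrier E" "x \<in> L" for e e' x
    using \<psi>_iso that by (auto simp: iso_def hom_def L.gal_mult_apply)
  have \<psi>_one: "\<psi> \<one>\<^bsub>E\<^esub> x = x" if "x \<in> L" for x
    using hom_one[OF _ group_E L.group_gal, of \<psi>] \<psi>_iso that by (simp add: iso_def one_gal)
  have \<psi>_K: "\<psi> e x = q e x" if "e \<in> carrier E" "x \<in> K" for e x
  proof -
    have "\<phi> ` carrier (gal L) = carrier E" using L(3) by (auto simp: iso_def bij_betw_def)
    then have "\<phi> (\<psi> e) = e" using that f_inv_into_f[of e \<phi> "carrier (gal L)"] unfolding \<psi>_def by simp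
    then show ?thesis using restr[OF \<psi>_closed[OF that(1)]] that(2) by simp
  qed
  let ?\<tau> = "\<psi> t"
  have \<tau>_pow_inj: "inj_on (\<lambda>k. \<psi> (t [^]\<^bsub>E\<^esub> k)) {..<p}"
  proof (rule linorder_inj_onI)
    fix k l :: nat assume kl: "k < l" "k \<in> {..<p}" "l \<in> {..<p}"
    show "\<psi> (t [^]\<^bsub>E\<^esub> k) \<noteq> \<psi> (t [^]\<^bsub>E\<^esub> l)"
    proof
      assume "\<psi> (t [^]\<^bsub>E\<^esub> k) = \<psi> (t [^]\<^bsub>E\<^esub> l)"
      then have "t [^]\<^bsub>E\<^esub> k = t [^]\<^bsub>E\<^esub> l" by (rule \<psi>_inj[rotated 2]) auto
      also have "\<dots> = t [^]\<^bsub>E\<^esub> k \<otimes>\<^bsub>E\<^esub> t [^]\<^bsub>E\<^esub> (l - k)"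
        using kl(1) by (simp add: E.nat_pow_mult t_closed)
      finally have "t [^]\<^bsub>E\<^esub> k \<otimes>\<^bsub>E\<^esub> t [^]\<^bsub>E\<^esub> (l - k) = t [^]\<^bsub>E\<^esub> k \<otimes>\<^bsub>E\<^esub> \<one>\<^bsub>E\<^esub>" by simp
      then have "t [^]\<^bsub>E\<^esub> (l - k) = \<one>\<^bsub>E\<^esub>" by (subst (asm) E.l_cancel) auto
      then show False using t_pow_eq_1 kl by (auto dest: dvd_imp_le)
    qed
  qed auto
  \<comment> \<open>A Lagrange resolvent: an eigenvector of \<open>t\<close> with the eigenvalue \<open>\<zeta>\<close>, unless it vanishes.\<close>
  define res where "res x = (\<Sum>k<p. inverse (to_ac \<zeta>) ^ k * \<psi> (t [^]\<^bsub>E\<^esub> k) x)" for x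
  have "\<exists>x\<in>L. res x \<noteq> 0"
  proof (rule ccontr)
    assume "\<not> (\<exists>x\<in>L. res x \<noteq> 0)"
    then have z: "res x = 0" if "x \<in> L" for x using that by blast
    let ?i = "inv_into {..<p} (\<lambda>k. \<psi> (t [^]\<^bsub>E\<^esub> k))"
    let ?S = "(\<lambda>k. \<psi> (t [^]\<^bsub>E\<^esub> k)) ` {..<p}" and ?a = "\<lambda>\<sigma>. inverse (to_ac \<zeta>) ^ ?i \<sigma>"
    have "(\<Sum>\<sigma>\<in>?S. ?a \<sigma> * \<sigma> x) = res x" for x
      unfolding res_def by (subst sum.reindex[OF \<tau>_pow_inj]) (auto simp: inv_into_f_f[OF \<tau>_pow_inj] intro!: sum.cong)
    then have 0: "(\<Sum>\<sigma>\<in>?S. ?a \<sigma> * \<sigma> x) = 0" if "x \<in> L" for x using z[OF that] by simp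
    have S: "finite ?S" "?S \<subseteq> carrier (gal L)" by auto
    have 1: "\<psi> (t [^]\<^bsub>E\<^esub> (0::nat)) \<in> ?S" by (rule imageI) (use p_pos in simp)
    from L.automorphisms_independent[of ?S ?a, OF S 0 1] show False by simp
  qed
  then obtain x where x: "x \<in> L" "res x \<noteq> 0" by blast
  define y where "y = res x"
  have y: "y \<in> L" "y \<noteq> 0" using x unfolding y_def res_def by (auto intro!: L.sum_in L.mult_in L.power_in L.inverse_in)
  have \<tau>_y: "?\<tau> y = to_ac \<zeta> * y"
  proof -
    obtain n where n: "p = Suc n" using p_pos by (cases p) auto
    let ?c = "\<lambda>k. inverse (to_ac \<zeta>) ^ k * \<psi> (t [^]\<^bsub>E\<^esub> k) x"
    have z: "inverse (to_ac \<zeta>) ^ k = to_ac (inverse \<zeta> ^ k)" for k by simp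
    have "?\<tau> y = (\<Sum>k<p. inverse (to_ac \<zeta>) ^ k * ?\<tau> (\<psi> (t [^]\<^bsub>E\<^esub> k) x))"
      unfolding y_def res_def z using t_closed x(1)
      by (subst L.gal_sum) (auto simp: L.gal_mult L.gal_base simp del: to_ac_power to_ac_inverse intro!: L.mult_in sum.cong)
    also have "\<dots> = (\<Sum>k<p. to_ac \<zeta> * ?c (Suc k))"
    proof (intro sum.cong refl)
      fix k
      have "?\<tau> (\<psi> (t [^]\<^bsub>E\<^esub> k) x) = \<psi> (t [^]\<^bsub>E\<^esub> Suc k) x"
        using \<psi>_mult[OF t_closed t_pow_closed x(1), of k] E.nat_pow_Suc2[OF t_closed, of k] by simp
      then show "inverse (to_ac \<zeta>) ^ k * ?\<tau> (\<psi> (t [^]\<^bsub>E\<^esub> k) x) = to_ac \<zeta> * ?c (Suc k)" by simp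
    qed
    also have "\<dots> = to_ac \<zeta> * (\<Sum>k<p. ?c (Suc k))" by (simp only: sum_distrib_left)
    also have "(\<Sum>k<p. ?c (Suc k)) = y"
    proof -
      have "?c p = ?c 0"
        using t_pow_eq_1[of p] t_pow_eq_1[of 0] \<zeta>_pow by (simp add: power_inverse to_ac_power[symmetric] del: to_ac_power)
      then have "(\<Sum>k<p. ?c (Suc k)) = ?c 0 + (\<Sum>k<n. ?c (Suc k))"
        unfolding n by (simp only: sum.lessThan_Suc add.commute)
      also have "\<dots> = (\<Sum>k<p. ?c k)" unfolding n by (rule sum.lessThan_Suc_shift[symmetric])
      finally show ?thesis by (simp add: y_def res_def)
    qed
    finally show ?thesis .
  qed
  \<comment> \<open>The elements fixed by the kernel lie in \<open>K\<close>: their coefficients with respect to \<open>m\<close> are traces.\<close>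
  have fixed_in_K: "x \<in> K" if x: "x \<in> L" "?\<tau> x = x" for x
  proof -
    have \<tau>n: "\<psi> (t [^]\<^bsub>E\<^esub> n) z = z" if "z \<in> L" "?\<tau> z = z" for z and n :: nat
      using that by (induction n) (simp_all add: \<psi>_one \<psi>_mult t_closed)
    \<comment> \<open>The trace to \<open>F\<close>; the choice of lifts is immaterial for elements fixed by \<open>t\<close>.\<close>
    define T where "T z = (\<Sum>\<sigma>\<in>carrier (gal K). \<psi> (lift \<sigma>) z)" for z
    have T_base: "T z \<in> K" if z: "z \<in> L" "?\<tau> z = z" for z
    proof -
      have Tz: "T z \<in> L" unfolding T_def using z lift by (intro L.sum_in) simp
      have "\<rho> (T z) = T z" if \<rho>: "\<rho> \<in> carrier (gal L)" for \<rho>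
      proof -
        obtain e where e: "e \<in> carrier E" "\<rho> = \<psi> e" using \<psi>_surj[OF \<rho>] by blast
        have "\<rho> (T z) = (\<Sum>\<sigma>\<in>carrier (gal K). \<psi> e (\<psi> (lift \<sigma>) z))"
          unfolding T_def e(2) using e z lift by (subst L.gal_sum) auto
        also have "\<dots> = (\<Sum>\<sigma>\<in>carrier (gal K). \<psi> (lift (q e \<otimes>\<^bsub>gal K\<^esub> \<sigma>)) z)"
        proof (intro sum.cong refl)
          fix \<sigma> assume \<sigma>: "\<sigma> \<in> carrier (gal K)"
          have c: "e \<otimes>\<^bsub>E\<^esub> lift \<sigma> \<in> carrier E" "lift (q e \<otimes>\<^bsub>gal K\<^esub> \<sigma>) \<in> carrier E"
            using e \<sigma> lift by (auto intro!: lift)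
          have "q (e \<otimes>\<^bsub>E\<^esub> lift \<sigma>) = q (lift (q e \<otimes>\<^bsub>gal K\<^esub> \<sigma>))"
            using e \<sigma> lift by (simp add: q_mult)
          then obtain n :: nat where "e \<otimes>\<^bsub>E\<^esub> lift \<sigma> = t [^]\<^bsub>E\<^esub> n \<otimes>\<^bsub>E\<^esub> lift (q e \<otimes>\<^bsub>gal K\<^esub> \<sigma>)"
            using q_eqD[OF c] by blast
          then have "e \<otimes>\<^bsub>E\<^esub> lift \<sigma> = lift (q e \<otimes>\<^bsub>gal K\<^esub> \<sigma>) \<otimes>\<^bsub>E\<^esub> t [^]\<^bsub>E\<^esub> n" using c by (simp add: t_pow_central)
          then have "\<psi> e (\<psi> (lift \<sigma>) z) = \<psi> (lift (q e \<otimes>\<^bsub>gal K\<^esub> \<sigma>)) (\<psi> (t [^]\<^bsub>E\<^esub> n) z)"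
            using \<psi>_mult[OF e(1) lift(1)[OF \<sigma>] z(1)] \<psi>_mult[OF c(2) t_pow_closed z(1), of n] by simp
          then show "\<psi> e (\<psi> (lift \<sigma>) z) = \<psi> (lift (q e \<otimes>\<^bsub>gal K\<^esub> \<sigma>)) z" by (simp add: \<tau>n[OF z])
        qed
        also have "\<dots> = T z" unfolding T_def
          by (rule sum.reindex_bij_witness[of _ "\<lambda>\<tau>. inv\<^bsub>gal K\<^esub> (q e) \<otimes>\<^bsub>gal K\<^esub> \<tau>" "\<lambda>\<tau>. q e \<otimes>\<^bsub>gal K\<^esub> \<tau>"])
            (use e in \<open>auto simp: G.m_assoc[symmetric]\<close>)
        finally show ?thesis .
      qed
      then have "T z \<in> range to_ac" using L(1) Tz by (auto simp: galois_extension_def)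
      then show ?thesis by auto
    qed
    have m: "inverse (m j) \<in> K" "inverse (m j) \<in> L" if "j \<in> J" for j using J(2)[OF that] L(2) by auto
    have "(\<Sum>j\<in>J. T (x * inverse (m j)) * m j) = (\<Sum>j\<in>J. \<Sum>\<sigma>\<in>carrier (gal K). \<psi> (lift \<sigma>) x * (\<sigma> (inverse (m j)) * m j))"
      unfolding T_def sum_distrib_right
    proof (intro sum.cong refl)
      fix j \<sigma> assume "j \<in> J" "\<sigma> \<in> carrier (gal K)"
      then show "\<psi> (lift \<sigma>) (x * inverse (m j)) * m j = \<psi> (lift \<sigma>) x * (\<sigma> (inverse (m j)) * m j)"
        using lift[of \<sigma>] m[of j] x(1) by (simp add: L.gal_mult \<psi>_K mult.assoc)
    qed
    also have "\<dots> = (\<Sum>\<sigma>\<in>carrier (gal K). \<psi> (lift \<sigma>) x * (\<Sum>j\<in>J. \<sigma> (inverse (m j)) * m j))"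
      by (subst sum.swap) (simp only: sum_distrib_left)
    also have "\<dots> = (\<Sum>\<sigma>\<in>carrier (gal K). if \<sigma> = \<one>\<^bsub>gal K\<^esub> then \<psi> (lift \<one>\<^bsub>gal K\<^esub>) x * N else 0)"
      by (intro sum.cong refl) (simp add: dual)
    also have "\<dots> = \<psi> (lift \<one>\<^bsub>gal K\<^esub>) x * N" using finite_gal by simp
    also have "\<psi> (lift \<one>\<^bsub>gal K\<^esub>) x = x"
    proof -
      have "lift \<one>\<^bsub>gal K\<^esub> \<in> carrier E" "q (lift \<one>\<^bsub>gal K\<^esub>) = \<one>\<^bsub>gal K\<^esub>" using lift by auto
      then obtain n :: nat where "lift \<one>\<^bsub>gal K\<^esub> = t [^]\<^bsub>E\<^esub> n" using ker_q by blast
      then show ?thesis using \<tau>n[OF x] by simp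
    qed
    finally have "x = (\<Sum>j\<in>J. T (x * inverse (m j)) * m j) / N" using J(3) by simp
    moreover have "T (x * inverse (m j)) \<in> K" if "j \<in> J" for j
    proof (rule T_base)
      show "x * inverse (m j) \<in> L" using x(1) m[OF that] by auto
      have "?\<tau> (inverse (m j)) = inverse (m j)"
        using \<psi>_K[OF t_closed m(1)[OF that]] q_t_pow[of 1] m(1)[OF that] by (simp add: t_closed one_gal)
      then show "?\<tau> (x * inverse (m j)) = x * inverse (m j)"
        using x m[OF that] by (simp add: L.gal_mult t_closed)
    qed
    ultimately show ?thesis using J(2,4) by (metis (no_types, lifting) divide_in mult_in sum_in)
  qed
  define f where "f e = \<psi> e y / y" for e
  have f_K: "f e \<in> K" "f e \<noteq> 0" if e: "e \<in> carrier E" for e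
  proof -
    have "?\<tau> (\<psi> e y) = \<psi> e (to_ac \<zeta> * y)"
      using \<psi>_mult[OF t_closed e y(1)] \<psi>_mult[OF e t_closed y(1)] t_central[OF e] \<tau>_y by simp
    then have "?\<tau> (f e) = f e"
      unfolding f_def using e y \<tau>_y by (simp add: L.gal_divide t_closed L.gal_mult)
    then show "f e \<in> K" using e y unfolding f_def by (intro fixed_in_K) auto
    show "f e \<noteq> 0" using e y by (simp add: f_def)
  qed
  have "f (e \<otimes>\<^bsub>E\<^esub> e') = f e * q e (f e')" if e: "e \<in> carrier E" "e' \<in> carrier E" for e e'
  proof -
    have "\<psi> (e \<otimes>\<^bsub>E\<^esub> e') y = \<psi> e (f e' * y)"
      using \<psi>_mult[OF e y(1)] y by (simp add: f_def)
    also have "\<dots> = q e (f e') * \<psi> e y"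
      using e y f_K[OF e(2)] L(2) by (subst L.gal_mult) (auto simp: \<psi>_K)
    finally show ?thesis using y by (simp add: f_def field_simps)
  qed
  moreover have "f t = to_ac \<zeta>" using \<tau>_y y by (simp add: f_def)
  ultimately have "splitting f" unfolding splitting_def using f_K by blast
  then show ?thesis by blast
qed

text \<open>
  Automorphisms of a field over \<open>F\<close> that contains \<open>K\<close> map \<open>K\<close> to itself, since they multiply the
  radicals that generate \<open>K\<close> by roots of unity.
\<close>

lemma radicals_stable:
  assumes K: "K = adjoin S" and S: "\<And>r. r \<in> S \<Longrightarrow> r ^ p \<in> range to_ac"
    and L: "extension_field L" "K \<subseteq> L" and \<tau>: "\<tau> \<in> carrier (gal L)" and x: "x \<in> K"
  shows "\<tau> x \<in> K"
proof -
  interpret L: extension_field L by fact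
  interpret R: Ring.field "closure_ring :: 'f alg_closure ring" by (rule field_from_type_algebra)
  note \<tau>_simps = L.gal_add[OF \<tau>] L.gal_mult[OF \<tau>] L.gal_inverse[OF \<tau>] L.gal_uminus[OF \<tau>]
  have R: "\<And>a b. a \<otimes>\<^bsub>closure_ring\<^esub> b = a * b" "\<And>a b. a \<oplus>\<^bsub>closure_ring\<^esub> b = a + b"
    "\<one>\<^bsub>closure_ring\<^esub> = 1" "\<zero>\<^bsub>closure_ring\<^esub> = 0" "carrier closure_ring = UNIV" for a b :: "'f alg_closure"
    by (simp_all add: ring_of_type_algebra_def)
  have neg: "\<ominus>\<^bsub>closure_ring\<^esub> a = - a" for a :: "'f alg_closure"
    by (rule R.minus_equality) (simp_all add: R)
  have inv: "inv\<^bsub>closure_ring\<^esub> a = inverse a" if "a \<noteq> 0" for a :: "'f alg_closure"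
    by (rule R.inv_char) (use that in \<open>simp_all add: R\<close>)
  have "x \<in> K \<and> \<tau> x \<in> K" if "x \<in> generate_field closure_ring (range to_ac \<union> S)" for x
    using that
  proof (induction rule: generate_field.induct)
    case (incl h)
    then have hK: "h \<in> K" unfolding K adjoin_def by (rule generate_field.incl)
    show ?case
    proof (cases "h \<in> range to_ac \<or> h = 0")
      case True
      then show ?thesis using hK \<tau> by (auto simp: L.gal_base L.gal_0)
    next
      case False
      then have "h ^ p \<in> range to_ac" using incl S by blast
      then have "\<tau> h ^ p = h ^ p" using L.gal_power[OF \<tau>, of h p] hK L(2) \<tau> by (auto simp: L.gal_base)
      then have "(\<tau> h / h) ^ p = 1" using False by (simp add: power_divide)
      then obtain n where "\<tau> h / h = to_ac \<zeta> ^ n"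
        using roots_of_unity_powers[OF p_pos primitive_root_to_ac[OF \<zeta>]] by blast
      then have "\<tau> h = to_ac \<zeta> ^ n * h" using False by (simp add: field_simps)
      then show ?thesis using hK by (auto intro!: mult_in power_in)
    qed
  next
    case (m_inv h)
    then have "h \<noteq> 0" by (simp add: R)
    moreover have "h \<in> L" using m_inv L(2) by blast
    ultimately show ?case using m_inv by (simp add: inv L.gal_inverse[OF \<tau>] inverse_in)
  qed (use L(2) \<tau> in \<open>auto simp: R neg \<tau>_simps L.gal_1 subset_eq\<close>)
  then show ?thesis using x unfolding K adjoin_def by blast
qed

text \<open>
  Conversely, by Hilbert's theorem 90 the \<open>p\<close>-th power of the crossed homomorphism \<open>f\<close> is
  \<open>e \<mapsto> e(w) / w\<close>, and the group \<open>E\<close> acts on \<open>L = K(y)\<close> with \<open>y\<^sup>p = w\<close> by \<open>e(y) = f(e) y\<close>.  As \<open>t\<close>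
  is a commutator, \<open>y\<close> does not lie in \<open>K\<close>.
\<close>

lemma splitting_imp_solvable:
  assumes f: "splitting f"
    and comm: "g \<in> carrier E" "h \<in> carrier E" "g \<otimes>\<^bsub>E\<^esub> h = h \<otimes>\<^bsub>E\<^esub> g \<otimes>\<^bsub>E\<^esub> t"
    and K: "K = adjoin S" and S: "\<And>r. r \<in> S \<Longrightarrow> r ^ p \<in> range to_ac"
  shows "embedding_problem_solvable K E q"
proof -
  have f_in [simp]: "f e \<in> K" "f e \<noteq> 0" if "e \<in> carrier E" for e using f that by (auto simp: splitting_def)
  have f_mult: "f (e \<otimes>\<^bsub>E\<^esub> e') = f e * q e (f e')" if "e \<in> carrier E" "e' \<in> carrier E" for e e'
    using f that by (auto simp: splitting_def)
  have f_t: "f t = to_ac \<zeta>" using f by (simp add: splitting_def)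
  have "f \<one>\<^bsub>E\<^esub> = f \<one>\<^bsub>E\<^esub> * f \<one>\<^bsub>E\<^esub>" using f_mult[of "\<one>\<^bsub>E\<^esub>" "\<one>\<^bsub>E\<^esub>"] by (simp add: q_one one_gal_apply)
  then have f_one: "f \<one>\<^bsub>E\<^esub> = 1" using f_in(2)[of "\<one>\<^bsub>E\<^esub>"] by (metis E.one_closed mult_cancel_left1)
  have f_t_mult: "f (t [^]\<^bsub>E\<^esub> n \<otimes>\<^bsub>E\<^esub> e) = to_ac \<zeta> ^ n * f e" if e: "e \<in> carrier E" for e and n :: nat
  proof (induction n)
    case (Suc n)
    have "f (t [^]\<^bsub>E\<^esub> Suc n \<otimes>\<^bsub>E\<^esub> e) = f (t \<otimes>\<^bsub>E\<^esub> (t [^]\<^bsub>E\<^esub> n \<otimes>\<^bsub>E\<^esub> e))"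
      using e E.nat_pow_Suc2[OF t_closed, of n] by (simp add: E.m_assoc t_closed)
    also have "\<dots> = f t * f (t [^]\<^bsub>E\<^esub> n \<otimes>\<^bsub>E\<^esub> e)"
      using e q_t_pow[of 1] by (subst f_mult) (auto simp: t_closed one_gal_apply)
    finally show ?case using Suc by (simp add: f_t)
  qed (use e in simp)
  have f_t_pow: "f (t [^]\<^bsub>E\<^esub> n) = to_ac \<zeta> ^ n" for n :: nat
    using f_t_mult[of "\<one>\<^bsub>E\<^esub>" n] by (simp add: f_one)
  have f_pow_cong: "f e ^ p = f e' ^ p" if e: "e \<in> carrier E" "e' \<in> carrier E" "q e = q e'" for e e'
  proof -
    obtain n :: nat where "e = t [^]\<^bsub>E\<^esub> n \<otimes>\<^bsub>E\<^esub> e'" by (rule q_eqD[OF e])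
    moreover have "(to_ac \<zeta> ^ n) ^ p = (1 :: 'f alg_closure)"
      using \<zeta>_pow by (metis power_mult mult.commute to_ac_1 to_ac_power power_one)
    ultimately show ?thesis using f_t_mult[OF e(2), of n] by (simp add: power_mult_distrib)
  qed
  obtain w where w: "w \<in> K" "w \<noteq> 0" "\<And>\<sigma>. \<sigma> \<in> carrier (gal K) \<Longrightarrow> \<sigma> w = f (lift \<sigma>) ^ p * w"
  proof (rule hilbert_90[OF finite_gal, of "\<lambda>\<sigma>. f (lift \<sigma>) ^ p"])
    fix \<sigma> \<tau> assume st: "\<sigma> \<in> carrier (gal K)" "\<tau> \<in> carrier (gal K)"
    have "f (lift (\<sigma> \<otimes>\<^bsub>gal K\<^esub> \<tau>)) ^ p = f (lift \<sigma> \<otimes>\<^bsub>E\<^esub> lift \<tau>) ^ p"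
      using st lift by (intro f_pow_cong) (auto simp: q_mult)
    also have "\<dots> = f (lift \<sigma>) ^ p * \<sigma> (f (lift \<tau>) ^ p)"
      using st lift by (simp add: f_mult power_mult_distrib gal_power)
    finally show "f (lift (\<sigma> \<otimes>\<^bsub>gal K\<^esub> \<tau>)) ^ p = f (lift \<sigma>) ^ p * \<sigma> (f (lift \<tau>) ^ p)" .
  qed (use lift in \<open>auto intro!: power_in\<close>)
  have q_w: "q e w = f e ^ p * w" if "e \<in> carrier E" for e
    using w(3)[of "q e"] f_pow_cong[of "lift (q e)" e] that lift by simp
  obtain y where y: "y ^ p = w" using nth_root_exists[OF p_pos] by blast
  have y0: "y \<noteq> 0" using y w(2) p_pos by (intro notI) (simp add: power_0_left)
  have \<zeta>K: "to_ac \<zeta> ^ n \<in> K" for n by (intro power_in base_in)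
  \<comment> \<open>Otherwise \<open>e \<mapsto> f(e) y / e(y)\<close> would be a homomorphism from \<open>E\<close> to the \<open>p\<close>-th roots of unity that is nontrivial on the commutator \<open>t\<close>.\<close>
  have yK: "y \<notin> K"
  proof
    assume yK: "y \<in> K"
    define \<chi> where "\<chi> e = f e * y / q e y" for e
    have qy: "q e y \<in> K" "q e y \<noteq> 0" if "e \<in> carrier E" for e using that yK y0 by auto
    have \<chi>_base: "\<exists>n. \<chi> e = to_ac \<zeta> ^ n" if e: "e \<in> carrier E" for e
    proof -
      have "(q e y) ^ p = f e ^ p * y ^ p" using q_w[OF e] gal_power[of "q e" y p] e yK y by simp
      then have "\<chi> e ^ p = 1" using qy[OF e] e y0 by (simp add: \<chi>_def power_divide power_mult_distrib)
      then show ?thesis using roots_of_unity_powers[OF p_pos primitive_root_to_ac[OF \<zeta>]] by blast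
    qed
    have \<chi>_mult: "\<chi> (e \<otimes>\<^bsub>E\<^esub> e') = \<chi> e * \<chi> e'" if e: "e \<in> carrier E" "e' \<in> carrier E" for e e'
    proof -
      obtain n where n: "\<chi> e' = to_ac \<zeta> ^ n" using \<chi>_base[OF e(2)] by blast
      have "f e' = to_ac \<zeta> ^ n * q e' y / y" using n qy[OF e(2)] y0 by (simp add: \<chi>_def field_simps)
      then have "q e (f e') = q e (to_ac \<zeta> ^ n * q e' y / y)" by simp
      also have "\<dots> = to_ac \<zeta> ^ n * q e (q e' y) / q e y"
        using e yK qy[OF e(2)] \<zeta>K by (simp add: gal_divide gal_mult gal_power mult_in)
      finally show ?thesis
        using e yK qy[OF e(1)] qy[OF e(2)] unfolding \<chi>_def[of "e \<otimes>\<^bsub>E\<^esub> e'"]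
        by (simp add: f_mult q_mult_apply n) (simp add: \<chi>_def)
    qed
    have \<chi>_t: "\<chi> t = to_ac \<zeta>" using q_t_pow[of 1] y0 yK by (simp add: \<chi>_def f_t t_closed one_gal_apply)
    have "\<chi> g * \<chi> h = \<chi> h * \<chi> g * \<chi> t"
      using comm by (metis \<chi>_mult E.m_closed t_closed)
    moreover have "\<chi> g \<noteq> 0" "\<chi> h \<noteq> 0" using comm qy y0 by (auto simp: \<chi>_def)
    ultimately have "to_ac \<zeta> = to_ac 1" unfolding \<chi>_t by simp
    then show False using \<zeta>_pow_neq[of 1] p_gt_1 by (simp only: to_ac_eq_iff) simp
  qed
  define L where "L = radical_extension p y"
  have yw: "y ^ p \<in> K" using y w(1) by simp
  interpret L: extension_field L
    unfolding L_def by (rule radical_extension_field[OF p_pos yw])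
  have KL: "K \<subseteq> L" unfolding L_def by (rule radical_extension_incl[OF p_pos yw])
  have L_def': "L = {\<Sum>i<p. k i * y ^ i | k. \<forall>i. k i \<in> K}" unfolding L_def radical_extension_def ..
  have coord_unique: "k i = l i" if "\<And>i. k i \<in> K" "\<And>i. l i \<in> K" "(\<Sum>i<p. k i * y ^ i) = (\<Sum>i<p. l i * y ^ i)" "i < p" for k l i
    using radical_powers_independent[OF p \<zeta> yw yK, of "\<lambda>i. k i - l i" i] that by (auto simp: left_diff_distrib sum_subtractf)
  define co where "co x = (SOME k. (\<forall>i. k i \<in> K) \<and> x = (\<Sum>i<p. k i * y ^ i))" for x
  have co: "co x i \<in> K" "x = (\<Sum>i<p. co x i * y ^ i)" if "x \<in> L" for x i
    using someI_ex[of "\<lambda>k. (\<forall>i. k i \<in> K) \<and> x = (\<Sum>i<p. k i * y ^ i)"] that unfolding L_def' co_def by blast+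
  \<comment> \<open>The extension of \<open>q e\<close> to \<open>L\<close> that maps \<open>y\<close> to \<open>f(e) y\<close>, in coordinates.\<close>
  define \<Psi> where "\<Psi> e = (\<lambda>x\<in>L. \<Sum>i<p. q e (co x i) * (f e * y) ^ i)" for e
  have in_L: "(\<Sum>i<p. k i * y ^ i) \<in> L" if "\<And>i. k i \<in> K" for k using that unfolding L_def' by blast
  have \<Psi>: "\<Psi> e (\<Sum>i<p. k i * y ^ i) = (\<Sum>i<p. q e (k i) * (f e * y) ^ i)" if k: "\<And>i. k i \<in> K" for e k
  proof -
    have kL: "(\<Sum>i<p. k i * y ^ i) \<in> L" using k by (rule in_L)
    have "co (\<Sum>i<p. k i * y ^ i) i = k i" if "i < p" for i
      by (rule coord_unique[OF co(1)[OF kL] k co(2)[OF kL, symmetric] that])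
    then show ?thesis unfolding \<Psi>_def using kL by simp
  qed
  have \<Psi>_closed: "\<Psi> e x \<in> L" if e: "e \<in> carrier E" and x: "x \<in> L" for e x
  proof -
    have "\<Psi> e x = (\<Sum>i<p. (q e (co x i) * f e ^ i) * y ^ i)"
      using x by (simp add: \<Psi>_def power_mult_distrib mult.assoc)
    also have "\<dots> \<in> L" using e co(1)[OF x] by (intro in_L mult_in power_in) simp_all
    finally show ?thesis .
  qed
  have \<Psi>_add: "\<Psi> e (x + x') = \<Psi> e x + \<Psi> e x'" if e: "e \<in> carrier E" and x: "x \<in> L" "x' \<in> L" for e x x'
  proof -
    have "x + x' = (\<Sum>i<p. (co x i + co x' i) * y ^ i)"
      using co(2)[OF x(1)] co(2)[OF x(2)] by (simp add: distrib_right sum.distrib)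
    then have "\<Psi> e (x + x') = (\<Sum>i<p. q e (co x i + co x' i) * (f e * y) ^ i)"
      using \<Psi>[of "\<lambda>i. co x i + co x' i" e] co(1) x by (simp add: add_in)
    then show ?thesis using e x co(1) by (simp add: \<Psi>_def gal_add distrib_right sum.distrib)
  qed
  have \<Psi>_sum: "\<Psi> e (\<Sum>i\<in>I. x i) = (\<Sum>i\<in>I. \<Psi> e (x i))" if e: "e \<in> carrier E" and x: "\<And>i. i \<in> I \<Longrightarrow> x i \<in> L" for e I and x :: "nat \<Rightarrow> _"
  proof -
    have "\<Psi> e 0 + \<Psi> e 0 = \<Psi> e 0" using \<Psi>_add[OF e L.zero_in L.zero_in] by simp
    then have z: "\<Psi> e 0 = 0" by (simp only: add_cancel_left_right)
    show ?thesis using x by (induction I rule: infinite_finite_induct) (auto simp: z \<Psi>_add[OF e] L.sum_in)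
  qed
  have mono_L: "k * y ^ n \<in> L" and \<Psi>_mono: "e \<in> carrier E \<Longrightarrow> \<Psi> e (k * y ^ n) = q e k * (f e * y) ^ n" if k: "k \<in> K" for e k n
  proof -
    have "z ^ n = (z ^ p) ^ (n div p) * z ^ (n mod p)" for z :: "'f alg_closure"
      by (simp only: power_mult[symmetric] power_add[symmetric] mult_div_mod_eq)
    note pow_split = this
    have red: "k * y ^ n = (k * w ^ (n div p)) * y ^ (n mod p)" for k
      using pow_split[of y] by (simp add: y mult.assoc)
    let ?k = "\<lambda>i. if i = n mod p then k * w ^ (n div p) else 0"
    have kK: "?k i \<in> K" for i using k w(1) by (auto intro!: mult_in power_in)
    have "(\<Sum>i<p. ?k i * y ^ i) = (\<Sum>i<p. if i = n mod p then (k * w ^ (n div p)) * y ^ i else 0)"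
      by (intro sum.cong) auto
    then have sum: "(\<Sum>i<p. ?k i * y ^ i) = k * y ^ n" unfolding red using p_pos by simp
    show "k * y ^ n \<in> L" using in_L[of ?k, OF kK] by (simp only: sum)
    assume e: "e \<in> carrier E"
    have "\<Psi> e (k * y ^ n) = (\<Sum>i<p. q e (?k i) * (f e * y) ^ i)" using \<Psi>[of ?k, OF kK, of e] by (simp only: sum)
    also have "\<dots> = (\<Sum>i<p. if i = n mod p then q e (k * w ^ (n div p)) * (f e * y) ^ i else 0)"
      using e by (intro sum.cong) (auto simp: gal_0)
    also have "\<dots> = q e (k * w ^ (n div p)) * (f e * y) ^ (n mod p)" using p_pos by simp
    also have "q e (k * w ^ (n div p)) = q e k * ((f e * y) ^ p) ^ (n div p)"
      using e k w(1) by (simp add: gal_mult gal_power power_in q_w power_mult_distrib y)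
    also have "\<dots> * (f e * y) ^ (n mod p) = q e k * (f e * y) ^ n"
      by (simp only: pow_split[of "f e * y"] mult.assoc)
    finally show "\<Psi> e (k * y ^ n) = q e k * (f e * y) ^ n" .
  qed
  have \<Psi>_mult: "\<Psi> e (x * x') = \<Psi> e x * \<Psi> e x'" if e: "e \<in> carrier E" and x: "x \<in> L" "x' \<in> L" for e x x'
  proof -
    have xx: "x * x' = (\<Sum>i<p. \<Sum>j<p. (co x i * co x' j) * y ^ (i + j))"
    proof -
      have "x * x' = (\<Sum>i<p. co x i * y ^ i) * (\<Sum>j<p. co x' j * y ^ j)"
        by (rule arg_cong2[OF co(2)[OF x(1)] co(2)[OF x(2)]])
      then show ?thesis by (simp add: sum_product power_add mult.assoc mult.left_commute)
    qed
    have "\<Psi> e (x * x') = (\<Sum>i<p. \<Sum>j<p. \<Psi> e ((co x i * co x' j) * y ^ (i + j)))"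
      unfolding xx using co(1) x by (subst \<Psi>_sum[OF e]) (auto simp: \<Psi>_sum[OF e] mono_L mult_in intro!: L.sum_in mono_L)
    also have "\<dots> = (\<Sum>i<p. \<Sum>j<p. (q e (co x i) * (f e * y) ^ i) * (q e (co x' j) * (f e * y) ^ j))"
    proof (intro sum.cong refl)
      fix i j
      have c: "co x i \<in> K" "co x' j \<in> K" using co(1) x by auto
      show "\<Psi> e ((co x i * co x' j) * y ^ (i + j)) = (q e (co x i) * (f e * y) ^ i) * (q e (co x' j) * (f e * y) ^ j)"
        unfolding \<Psi>_mono[OF mult_in[OF c] e] gal_mult[OF q_closed[OF e] c] by (simp only: power_add mult_ac)
    qed
    also have "\<dots> = \<Psi> e x * \<Psi> e x'" using x by (simp add: \<Psi>_def sum_product)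
    finally show ?thesis .
  qed
  have \<Psi>_K: "\<Psi> e k = q e k" if "e \<in> carrier E" "k \<in> K" for e k
    using \<Psi>_mono[OF that(2,1), of 0] by simp
  have yL: "y \<in> L" using mono_L[of 1 1] by simp
  have \<Psi>_y: "\<Psi> e y = f e * y" if "e \<in> carrier E" for e
    using \<Psi>_mono[OF one_in that, of 1] that by (simp add: gal_1)
  have \<Psi>_comp: "\<Psi> (e \<otimes>\<^bsub>E\<^esub> e') x = \<Psi> e (\<Psi> e' x)" if e: "e \<in> carrier E" "e' \<in> carrier E" and x: "x \<in> L" for e e' x
  proof -
    have "\<Psi> e' x = (\<Sum>i<p. (q e' (co x i) * f e' ^ i) * y ^ i)"
      using x by (simp add: \<Psi>_def power_mult_distrib mult.assoc)
    then have "\<Psi> e (\<Psi> e' x) = (\<Sum>i<p. q e (q e' (co x i) * f e' ^ i) * (f e * y) ^ i)"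
      using \<Psi>[of "\<lambda>i. q e' (co x i) * f e' ^ i" e] e co(1)[OF x] by (simp add: mult_in power_in)
    also have "\<dots> = (\<Sum>i<p. q (e \<otimes>\<^bsub>E\<^esub> e') (co x i) * (f (e \<otimes>\<^bsub>E\<^esub> e') * y) ^ i)"
      using e co(1)[OF x] by (simp add: gal_mult gal_power power_in q_mult_apply f_mult power_mult_distrib mult_ac)
    finally show ?thesis using x by (simp add: \<Psi>_def)
  qed
  have \<Psi>_one: "\<Psi> \<one>\<^bsub>E\<^esub> x = x" if x: "x \<in> L" for x
    using co(2)[OF x] co(1)[OF x] x by (simp add: \<Psi>_def f_one q_one one_gal_apply)
  have \<Psi>_gal: "\<Psi> e \<in> carrier (gal L)" if e: "e \<in> carrier E" for e
  proof -
    have b: "bij_betw (\<Psi> e) L L"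
    proof (rule bij_betw_byWitness[where f' = "\<Psi> (inv\<^bsub>E\<^esub> e)"])
      show "\<forall>x\<in>L. \<Psi> (inv\<^bsub>E\<^esub> e) (\<Psi> e x) = x"
        using \<Psi>_comp[of "inv\<^bsub>E\<^esub> e" e] \<Psi>_one e by simp
      show "\<forall>x\<in>L. \<Psi> e (\<Psi> (inv\<^bsub>E\<^esub> e) x) = x"
        using \<Psi>_comp[of e "inv\<^bsub>E\<^esub> e"] \<Psi>_one e by simp
    qed (use e \<Psi>_closed in auto)
    have ext: "\<Psi> e \<in> extensional L" by (simp add: \<Psi>_def)
    have one: "\<Psi> e 1 = 1" using \<Psi>_K[OF e, of 1] e by (simp add: gal_1)
    have base: "\<Psi> e (to_ac r) = to_ac r" for r using \<Psi>_K[OF e, of "to_ac r"] e by (simp add: gal_base)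
    show ?thesis unfolding carrier_gal by (intro conjI ballI allI b ext one base \<Psi>_mult[OF e] \<Psi>_add[OF e])
  qed
  have gal_L_eqI: "\<sigma> = \<tau>" if st: "\<sigma> \<in> carrier (gal L)" "\<tau> \<in> carrier (gal L)" and eq: "\<And>k. k \<in> K \<Longrightarrow> \<sigma> k = \<tau> k" "\<sigma> y = \<tau> y" for \<sigma> \<tau>
  proof (rule L.gal_eqI[OF st])
    fix x assume x: "x \<in> L"
    have c: "co x i \<in> K" "co x i \<in> L" "y ^ i \<in> L" for i using co(1)[OF x] KL yL by auto
    have expand: "\<rho> x = (\<Sum>i<p. \<rho> (co x i) * \<rho> y ^ i)" if "\<rho> \<in> carrier (gal L)" for \<rho>
      by (subst co(2)[OF x]) (simp add: L.gal_sum[OF that] L.gal_mult[OF that] L.gal_power[OF that] c yL L.mult_in)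
    show "\<sigma> x = \<tau> x" unfolding expand[OF st(1)] expand[OF st(2)] eq(1)[OF c(1)] eq(2) ..
  qed
  have \<Psi>_restrict: "restrict (\<Psi> e) K = q e" if e: "e \<in> carrier E" for e
  proof (rule extensionalityI[OF restrict_extensional])
    show "q e \<in> extensional K" using q_closed[OF e] unfolding carrier_gal by blast
  qed (simp add: \<Psi>_K[OF e])
  have \<Psi>_hom: "\<Psi> \<in> hom E (gal L)"
  proof (rule homI)
    fix e e' assume e: "e \<in> carrier E" "e' \<in> carrier E"
    show "\<Psi> (e \<otimes>\<^bsub>E\<^esub> e') = \<Psi> e \<otimes>\<^bsub>gal L\<^esub> \<Psi> e'"
      using e by (intro L.gal_eqI) (auto simp: \<Psi>_gal \<Psi>_comp L.gal_mult_apply)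
  qed (rule \<Psi>_gal)
  have \<Psi>_inj: "inj_on \<Psi> (carrier E)"
  proof (rule inj_onI)
    fix e e' assume e: "e \<in> carrier E" "e' \<in> carrier E" "\<Psi> e = \<Psi> e'"
    then have "q e = q e'" using \<Psi>_restrict by metis
    then obtain n :: nat where n: "e = t [^]\<^bsub>E\<^esub> n \<otimes>\<^bsub>E\<^esub> e'" using q_eqD[OF e(1,2)] by blast
    have "f e = f e'" using \<Psi>_y[OF e(1)] \<Psi>_y[OF e(2)] e(3) y0 by simp
    then have "to_ac (\<zeta> ^ n) = to_ac 1" using f_t_mult[OF e(2), of n] f_in(2)[OF e(2)] n by simp
    then have "p dvd n" using \<zeta>_pow_eq_1 by (simp only: to_ac_eq_iff)
    then show "e = e'" using n t_pow_eq_1[of n] e(2) by simp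
  qed
  have \<Psi>_surj: "\<exists>e\<in>carrier E. \<tau> = \<Psi> e" if \<tau>: "\<tau> \<in> carrier (gal L)" for \<tau>
  proof -
    have stable: "\<sigma> x \<in> K" if "\<sigma> \<in> carrier (gal L)" "x \<in> K" for \<sigma> x
      by (rule radicals_stable[OF K _ L.extension_field_axioms KL that]) (rule S)
    have \<tau>': "inv\<^bsub>gal L\<^esub> \<tau> \<in> carrier (gal L)" using \<tau> by simp
    have \<tau>\<tau>': "\<tau> ((inv\<^bsub>gal L\<^esub> \<tau>) x) = x" if "x \<in> L" for x
      using L.gal_mult_apply[OF \<tau> \<tau>' that] \<tau> that by (simp add: one_gal)
    have "bij_betw \<tau> K K"
    proof (rule bij_betw_imageI)
      show "inj_on \<tau> K" using L.gal_inj[OF \<tau>] KL by (auto intro!: inj_onI)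
      show "\<tau> ` K = K"
      proof (intro equalityI subsetI)
        fix x assume x: "x \<in> K"
        show "x \<in> \<tau> ` K" using \<tau>\<tau>'[of x] stable[OF \<tau>' x] x KL by (intro image_eqI[of _ _ "(inv\<^bsub>gal L\<^esub> \<tau>) x"]) auto
      qed (use stable[OF \<tau>] in auto)
    qed
    then have "bij_betw (restrict \<tau> K) K K" by (simp add: bij_betw_restrict_eq)
    moreover have "restrict \<tau> K (x * x') = restrict \<tau> K x * restrict \<tau> K x'"
      "restrict \<tau> K (x + x') = restrict \<tau> K x + restrict \<tau> K x'" if "x \<in> K" "x' \<in> K" for x x'
      using that KL L.gal_mult[OF \<tau>, of x x'] L.gal_add[OF \<tau>, of x x'] by (auto simp: mult_in add_in)
    ultimately have "restrict \<tau> K \<in> carrier (gal K)"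
      unfolding carrier_gal using L.gal_1[OF \<tau>] L.gal_base[OF \<tau>] by simp
    then obtain e where e: "e \<in> carrier E" "restrict \<tau> K = q e" using q_surj by (metis imageE)
    have \<tau>K: "\<tau> k = q e k" if "k \<in> K" for k using fun_cong[OF e(2), of k] that by simp
    have "\<tau> y ^ p = q e w" using L.gal_power[OF \<tau> yL, of p] \<tau>K[OF w(1)] y by simp
    then have "(\<tau> y / (f e * y)) ^ p = 1" using q_w[OF e(1)] e(1) y0 w(2) by (simp add: power_divide power_mult_distrib y)
    then obtain n where n: "\<tau> y / (f e * y) = to_ac \<zeta> ^ n"
      using roots_of_unity_powers[OF p_pos primitive_root_to_ac[OF \<zeta>]] by blast
    let ?e = "t [^]\<^bsub>E\<^esub> n \<otimes>\<^bsub>E\<^esub> e"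
    have e': "?e \<in> carrier E" using e(1) by simp
    have "\<tau> = \<Psi> ?e"
    proof (rule gal_L_eqI[OF \<tau> \<Psi>_gal[OF e']])
      show "\<tau> y = \<Psi> ?e y" using n e(1) y0 by (simp add: \<Psi>_y f_t_mult field_simps)
      fix k assume k: "k \<in> K"
      show "\<tau> k = \<Psi> ?e k" using e(1) k by (simp add: \<Psi>_K \<tau>K q_mult q_t_pow)
    qed
    then show ?thesis using e' by blast
  qed
  have \<Psi>_bij: "bij_betw \<Psi> (carrier E) (carrier (gal L))"
    using \<Psi>_inj \<Psi>_surj \<Psi>_gal by (auto simp: bij_betw_def)
  then have \<Psi>_iso: "\<Psi> \<in> iso E (gal L)" using \<Psi>_hom by (simp add: iso_def)
  have "galois_extension L"
    unfolding galois_extension_def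
  proof (intro conjI equalityI subsetI)
    interpret R: Ring.field "closure_ring :: 'f alg_closure ring" by (rule field_from_type_algebra)
    show "subfield L closure_ring" "\<And>x. x \<in> range to_ac \<Longrightarrow> x \<in> L" using L.subfield by auto
    interpret B: Ring.field "base_ring :: 'f ring" by (rule field_from_type_algebra)
    have "ring_hom_ring (base_ring :: 'f ring) closure_ring to_ac"
      by (intro ring_hom_ringI2 B.ring_axioms R.ring_axioms ring_hom_memI) (auto simp: ring_of_type_algebra_def)
    then have F: "subfield (range (to_ac :: 'f \<Rightarrow> _)) closure_ring"
      using ring_hom_ring.img_is_subfield(2)[OF _ B.carrier_is_subfield, of closure_ring to_ac]
      by (simp add: ring_of_type_algebra_def)
    show "R.finite_dimension (range to_ac) L"
      using R.telescopic_base_dim(1)[OF F subfield _ radical_extension_finite[OF p_pos yw]] galois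
      unfolding L_def galois_extension_def by blast
  next
    fix x :: "'f alg_closure" assume "x \<in> range to_ac"
    then show "x \<in> {x \<in> L. \<forall>\<sigma>\<in>carrier (gal L). \<sigma> x = x}" using L.gal_base by auto
  next
    fix x assume "x \<in> {x \<in> L. \<forall>\<sigma>\<in>carrier (gal L). \<sigma> x = x}"
    then have x: "x \<in> L" "\<And>\<sigma>. \<sigma> \<in> carrier (gal L) \<Longrightarrow> \<sigma> x = x" by auto
    have "(\<Sum>i<p. (co x i * to_ac \<zeta> ^ i) * y ^ i) = \<Psi> t x"
      using x(1) co(1)[OF x(1)] q_t_pow[of 1]
      by (simp add: \<Psi>_def f_t power_mult_distrib mult.assoc t_closed one_gal_apply)
    also have "\<dots> = (\<Sum>i<p. co x i * y ^ i)" using x(2)[OF \<Psi>_gal[OF t_closed]] co(2)[OF x(1)] by simp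
    finally have eq: "co x i * to_ac \<zeta> ^ i = co x i" if "i < p" for i
      by (rule coord_unique[of "\<lambda>i. co x i * to_ac \<zeta> ^ i" "co x", OF mult_in[OF co(1)[OF x(1)] \<zeta>K] co(1)[OF x(1)] _ that])
    have "co x i = 0" if "0 < i" "i < p" for i
    proof -
      have "to_ac (\<zeta> ^ i) \<noteq> to_ac 1" using \<zeta>_pow_neq[OF that] by (simp only: to_ac_eq_iff not_False_eq_True)
      then show ?thesis using eq[OF that(2)] by simp
    qed
    then have "(\<Sum>i<p. co x i * y ^ i) = (\<Sum>i<p. if i = 0 then co x 0 else 0)"
      by (intro sum.cong) auto
    then have "x = co x 0" using co(2)[OF x(1)] p_pos by simp
    then have xK: "x \<in> K" using co(1)[OF x(1), of 0] by simp
    show "x \<in> range to_ac"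
    proof (rule fixed_in_base[OF xK])
      fix \<sigma> assume "\<sigma> \<in> carrier (gal K)"
      then show "\<sigma> x = x" using lift[of \<sigma>] \<Psi>_K[of "lift \<sigma>" x] xK x(2)[OF \<Psi>_gal[of "lift \<sigma>"]] by simp
    qed
  qed
  moreover have "inv_into (carrier E) \<Psi> \<in> iso (gal L) E" by (rule E.iso_set_sym[OF \<Psi>_iso])
  moreover have "q (inv_into (carrier E) \<Psi> \<sigma>) = restrict \<sigma> K" if "\<sigma> \<in> carrier (gal L)" for \<sigma>
    using \<Psi>_restrict[of "inv_into (carrier E) \<Psi> \<sigma>"] that \<Psi>_bij
    by (metis bij_betw_def f_inv_into_f inv_into_into)
  ultimately show ?thesis using KL unfolding embedding_problem_solvable_def by blast
qed

end

section \<open>Kummer extensions\<close>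

text \<open>
  The extension generated by independent \<open>p\<close>-th roots \<open>R i\<close>: its degree is as large as possible, and for
  each root there is an automorphism that moves only this one.
\<close>

locale kummer_extension = extension_field K for K :: "'f::field alg_closure set" +
  fixes p :: nat and \<zeta> :: 'f and I :: "'i set" and R :: "'i \<Rightarrow> 'f alg_closure"
  assumes p_prime: "Factorial_Ring.prime p" and zeta: "primitive_root_of_unity p \<zeta>" and char: "of_nat p \<noteq> (0 :: 'f)"
    and finite_I: "finite I" and R_nonzero: "\<And>i. i \<in> I \<Longrightarrow> R i \<noteq> 0" and R_pow: "\<And>i. i \<in> I \<Longrightarrow> R i ^ p \<in> range to_ac"
    and K_adjoin: "K = adjoin (R ` I)" and galois_K: "galois_extension K"
    and card_gal: "card (carrier (gal K)) = p ^ card I"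
    and generators: "\<And>i. i \<in> I \<Longrightarrow> \<exists>\<sigma>\<in>carrier (gal K). \<sigma> (R i) = to_ac \<zeta> * R i \<and> (\<forall>j\<in>I - {i}. \<sigma> (R j) = R j)"
begin

definition exponents :: "('i \<Rightarrow> nat) set" where
  "exponents = I \<rightarrow>\<^sub>E {..<p}"

text \<open>
  The monomials in the roots with exponents below \<open>p\<close> form a basis of \<open>K\<close> over \<open>F\<close> that consists of
  eigenvectors of the Galois group.
\<close>

definition monomial :: "('i \<Rightarrow> nat) \<Rightarrow> 'f alg_closure" where
  "monomial \<chi> = (\<Prod>i\<in>I. R i ^ \<chi> i)"

definition trace :: "'f alg_closure \<Rightarrow> 'f alg_closure" where
  "trace x = (\<Sum>\<sigma>\<in>carrier (gal K). \<sigma> x)"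

definition dimension :: 'f where
  "dimension = of_nat (p ^ card I)"

lemma p_positive: "p > 0"
  using prime_gt_0_nat[OF p_prime] .

lemma finite_gal: "finite (carrier (gal K))"
  using card_gal p_positive by (metis card.infinite power_eq_0_iff not_gr_zero)

lemma dimension_nonzero: "dimension \<noteq> 0"
  using char by (simp add: dimension_def)

lemma finite_exponents [simp]: "finite exponents"
  unfolding exponents_def using finite_I by (intro finite_PiE) auto

lemma card_exponents: "card exponents = p ^ card I"
  unfolding exponents_def using finite_I by (simp add: card_PiE)

lemma R_in: "i \<in> I \<Longrightarrow> R i \<in> K"
  unfolding K_adjoin adjoin_def by (rule generate_field.incl) auto

lemma monomial_in [simp]: "monomial \<chi> \<in> K" and monomial_nonzero [simp]: "monomial \<chi> \<noteq> 0"
proof -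
  have "(\<Prod>i\<in>A. R i ^ \<chi> i) \<in> K" if "A \<subseteq> I" for A
    using that R_in by (induction A rule: infinite_finite_induct) (auto intro!: mult_in power_in)
  then show "monomial \<chi> \<in> K" by (simp add: monomial_def)
  show "monomial \<chi> \<noteq> 0" using finite_I R_nonzero by (auto simp: monomial_def)
qed

lemma gal_monomial:
  assumes "\<sigma> \<in> carrier (gal K)" shows "\<sigma> (monomial \<chi>) = (\<Prod>i\<in>I. \<sigma> (R i) ^ \<chi> i)"
proof -
  have "\<sigma> (\<Prod>i\<in>A. R i ^ \<chi> i) = (\<Prod>i\<in>A. \<sigma> (R i) ^ \<chi> i) \<and> (\<Prod>i\<in>A. R i ^ \<chi> i) \<in> K" if "finite A" "A \<subseteq> I" for A
    using that R_in assms
    by (induction A rule: finite_induct) (auto simp: gal_1 gal_mult gal_power power_in mult_in)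
  then show ?thesis using finite_I by (simp add: monomial_def)
qed

lemma gal_eq_one:
  assumes \<sigma>: "\<sigma> \<in> carrier (gal K)" and fixed: "\<And>i. i \<in> I \<Longrightarrow> \<sigma> (R i) = R i"
  shows "\<sigma> = \<one>\<^bsub>gal K\<^esub>"
proof (rule gal_eqI[OF \<sigma>])
  interpret C: Ring.field "closure_ring :: 'f alg_closure ring" by (rule field_from_type_algebra)
  note \<sigma>_simps = gal_add[OF \<sigma>] gal_mult[OF \<sigma>] gal_inverse[OF \<sigma>] gal_uminus[OF \<sigma>]
  have C: "\<And>a b. a \<otimes>\<^bsub>closure_ring\<^esub> b = a * b" "\<And>a b. a \<oplus>\<^bsub>closure_ring\<^esub> b = a + b"
    "\<one>\<^bsub>closure_ring\<^esub> = 1" "\<zero>\<^bsub>closure_ring\<^esub> = 0" "carrier closure_ring = UNIV" for a b :: "'f alg_closure"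
    by (simp_all add: ring_of_type_algebra_def)
  have neg: "\<ominus>\<^bsub>closure_ring\<^esub> a = - a" for a :: "'f alg_closure"
    by (rule C.minus_equality) (simp_all add: C)
  have inv: "inv\<^bsub>closure_ring\<^esub> a = inverse a" if "a \<noteq> 0" for a :: "'f alg_closure"
    by (rule C.inv_char) (use that in \<open>simp_all add: C\<close>)
  fix x assume x: "x \<in> K"
  have "x \<in> K \<and> \<sigma> x = x" if "x \<in> generate_field closure_ring (range to_ac \<union> R ` I)" for x
    using that
  proof (induction rule: generate_field.induct)
    case (incl h)
    then show ?case using \<sigma> fixed R_in by (auto simp: gal_base)
  next
    case (m_inv h)
    then have "h \<noteq> 0" by (simp add: C)
    then show ?case using m_inv by (auto simp: inv \<sigma>_simps inverse_in)
  qed (use \<sigma> in \<open>auto simp: C neg \<sigma>_simps gal_1\<close>)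
  then have "\<sigma> x = x" using x unfolding K_adjoin adjoin_def by blast
  then show "\<sigma> x = \<one>\<^bsub>gal K\<^esub> x" using x by (simp add: one_gal)
qed auto

lemma geometric_sum_root_of_unity:
  fixes z :: "'f alg_closure"
  assumes "z ^ p = 1" shows "(\<Sum>k<p. z ^ k) = (if z = 1 then of_nat p else 0)"
  using power_diff_1_eq[of z p] assms by auto

text \<open>Orthogonality of the characters by which the Galois group acts on the monomials.\<close>

lemma monomial_dual:
  assumes \<sigma>: "\<sigma> \<in> carrier (gal K)"
  shows "(\<Sum>\<chi>\<in>exponents. \<sigma> (inverse (monomial \<chi>)) * monomial \<chi>) = (if \<sigma> = \<one>\<^bsub>gal K\<^esub> then to_ac dimension else 0)"
proof -
  define z where "z i = R i / \<sigma> (R i)" for i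
  have zp: "z i ^ p = 1" and z1: "z i = 1 \<longleftrightarrow> \<sigma> (R i) = R i" if i: "i \<in> I" for i
  proof -
    have "\<sigma> (R i) ^ p = R i ^ p" using gal_power[OF \<sigma> R_in[OF i], of p] R_pow[OF i] \<sigma> by (auto simp: gal_base)
    then show "z i ^ p = 1" using R_nonzero[OF i] by (simp add: z_def power_divide)
    show "z i = 1 \<longleftrightarrow> \<sigma> (R i) = R i" using R_nonzero[OF i] R_in[OF i] \<sigma> by (auto simp: z_def)
  qed
  have "(\<Sum>\<chi>\<in>exponents. \<sigma> (inverse (monomial \<chi>)) * monomial \<chi>) = (\<Sum>\<chi>\<in>exponents. \<Prod>i\<in>I. z i ^ \<chi> i)"
  proof (intro sum.cong refl)
    fix \<chi>
    have "\<sigma> (inverse (monomial \<chi>)) * monomial \<chi> = monomial \<chi> / \<sigma> (monomial \<chi>)"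
      by (simp add: gal_inverse[OF \<sigma>] divide_inverse mult.commute)
    then show "\<sigma> (inverse (monomial \<chi>)) * monomial \<chi> = (\<Prod>i\<in>I. z i ^ \<chi> i)"
      unfolding gal_monomial[OF \<sigma>] by (simp add: monomial_def z_def power_divide prod_dividef)
  qed
  also have "\<dots> = (\<Prod>i\<in>I. \<Sum>k<p. z i ^ k)"
    unfolding exponents_def using finite_I by (subst prod_sum_PiE) auto
  also have "\<dots> = (\<Prod>i\<in>I. if \<sigma> (R i) = R i then of_nat p else 0)"
    by (intro prod.cong refl) (simp add: geometric_sum_root_of_unity zp z1)
  also have "\<dots> = (if \<sigma> = \<one>\<^bsub>gal K\<^esub> then to_ac dimension else 0)"
  proof (cases "\<forall>i\<in>I. \<sigma> (R i) = R i")
    case True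
    then have "\<sigma> = \<one>\<^bsub>gal K\<^esub>" using gal_eq_one[OF \<sigma>] by blast
    then show ?thesis using True by (simp add: dimension_def)
  next
    case False
    then obtain i where "i \<in> I" "\<sigma> (R i) \<noteq> R i" by blast
    moreover from this have "\<sigma> \<noteq> \<one>\<^bsub>gal K\<^esub>" using R_in by (auto simp: one_gal)
    ultimately show ?thesis using finite_I by (auto simp: prod_zero_iff)
  qed
  finally show ?thesis .
qed

lemma trace_gal:
  assumes "\<sigma> \<in> carrier (gal K)" "x \<in> K" shows "trace (\<sigma> x) = trace x" "\<sigma> (trace x) = trace x"
proof -
  have "trace (\<sigma> x) = (\<Sum>\<tau>\<in>carrier (gal K). (\<tau> \<otimes>\<^bsub>gal K\<^esub> \<sigma>) x)"
    unfolding trace_def using assms by (intro sum.cong) (auto simp: gal_mult_apply)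
  also have "\<dots> = trace x" unfolding trace_def
    by (rule sum.reindex_bij_witness[of _ "\<lambda>\<tau>. \<tau> \<otimes>\<^bsub>gal K\<^esub> inv\<^bsub>gal K\<^esub> \<sigma>" "\<lambda>\<tau>. \<tau> \<otimes>\<^bsub>gal K\<^esub> \<sigma>"])
      (use assms in \<open>auto simp: G.m_assoc\<close>)
  finally show "trace (\<sigma> x) = trace x" .
  have "\<sigma> (trace x) = (\<Sum>\<tau>\<in>carrier (gal K). (\<sigma> \<otimes>\<^bsub>gal K\<^esub> \<tau>) x)"
    unfolding trace_def using assms by (subst gal_sum) (auto simp: gal_mult_apply)
  also have "\<dots> = trace x" unfolding trace_def
    by (rule sum.reindex_bij_witness[of _ "\<lambda>\<tau>. inv\<^bsub>gal K\<^esub> \<sigma> \<otimes>\<^bsub>gal K\<^esub> \<tau>" "\<lambda>\<tau>. \<sigma> \<otimes>\<^bsub>gal K\<^esub> \<tau>"])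
      (use assms in \<open>auto simp: G.m_assoc[symmetric]\<close>)
  finally show "\<sigma> (trace x) = trace x" .
qed

lemma trace_base: "x \<in> K \<Longrightarrow> trace x \<in> range to_ac"
proof -
  assume x: "x \<in> K"
  have "trace x \<in> K" unfolding trace_def using x by (intro sum_in) simp
  then show ?thesis using galois_K trace_gal(2)[OF _ x] by (auto simp: galois_extension_def)
qed

lemma trace_scalar: "x \<in> K \<Longrightarrow> trace (to_ac r * x) = to_ac r * trace x"
  by (simp add: trace_def gal_mult gal_base sum_distrib_left)

lemma trace_sum: "(\<And>a. a \<in> A \<Longrightarrow> g a \<in> K) \<Longrightarrow> trace (\<Sum>a\<in>A. g a) = (\<Sum>a\<in>A. trace (g a))"
  unfolding trace_def by (simp add: gal_sum cong: sum.cong_simp) (rule sum.swap)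

text \<open>
  The trace form pairs distinct monomials to zero after inversion of one of them, so the coefficients
  with respect to the basis of monomials are traces.
\<close>

definition coordinate :: "'f alg_closure \<Rightarrow> ('i \<Rightarrow> nat) \<Rightarrow> 'f" where
  "coordinate x \<chi> = of_ac (trace (x * inverse (monomial \<chi>))) / dimension"

lemma to_ac_coordinate: "x \<in> K \<Longrightarrow> to_ac (coordinate x \<chi>) = trace (x * inverse (monomial \<chi>)) / to_ac dimension"
  using trace_base[of "x * inverse (monomial \<chi>)"] by (simp add: coordinate_def to_ac_of_ac mult_in inverse_in)

lemma monomials_span:
  assumes x: "x \<in> K" shows "x = (\<Sum>\<chi>\<in>exponents. to_ac (coordinate x \<chi>) * monomial \<chi>)"
proof -
  have "(\<Sum>\<chi>\<in>exponents. trace (x * inverse (monomial \<chi>)) * monomial \<chi>) =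
      (\<Sum>\<chi>\<in>exponents. \<Sum>\<sigma>\<in>carrier (gal K). \<sigma> x * (\<sigma> (inverse (monomial \<chi>)) * monomial \<chi>))"
    using x by (simp add: trace_def sum_distrib_right gal_mult inverse_in mult.assoc)
  also have "\<dots> = (\<Sum>\<sigma>\<in>carrier (gal K). \<sigma> x * (\<Sum>\<chi>\<in>exponents. \<sigma> (inverse (monomial \<chi>)) * monomial \<chi>))"
    by (subst sum.swap) (simp add: sum_distrib_left)
  also have "\<dots> = (\<Sum>\<sigma>\<in>carrier (gal K). if \<sigma> = \<one>\<^bsub>gal K\<^esub> then x * to_ac dimension else 0)"
    using x by (intro sum.cong refl) (simp add: monomial_dual one_gal)
  also have "\<dots> = x * to_ac dimension" using finite_gal by simp
  finally have "(\<Sum>\<chi>\<in>exponents. trace (x * inverse (monomial \<chi>)) * monomial \<chi>) = x * to_ac dimension" .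
  moreover have "(\<Sum>\<chi>\<in>exponents. to_ac (coordinate x \<chi>) * monomial \<chi>) =
      (\<Sum>\<chi>\<in>exponents. trace (x * inverse (monomial \<chi>)) * monomial \<chi>) / to_ac dimension"
    using x by (simp add: to_ac_coordinate sum_divide_distrib)
  ultimately show ?thesis using dimension_nonzero by simp
qed

lemma coordinate_monomial:
  assumes "\<chi> \<in> exponents" "\<chi>' \<in> exponents"
  shows "coordinate (monomial \<chi>) \<chi>' = (if \<chi> = \<chi>' then 1 else 0)"
proof (cases "\<chi> = \<chi>'")
  case True
  have "trace 1 = to_ac dimension" by (simp add: trace_def gal_1 card_gal dimension_def)
  then have "to_ac (coordinate (monomial \<chi>) \<chi>') = to_ac 1"
    using True dimension_nonzero by (simp add: to_ac_coordinate)
  then have "coordinate (monomial \<chi>) \<chi>' = 1" by (simp only: to_ac_eq_iff)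
  then show ?thesis using True by simp
next
  case False
  then obtain i where i: "i \<in> I" "\<chi> i \<noteq> \<chi>' i"
    using assms unfolding exponents_def by (metis PiE_ext)
  obtain \<sigma> where \<sigma>: "\<sigma> \<in> carrier (gal K)" "\<sigma> (R i) = to_ac \<zeta> * R i" "\<And>j. j \<in> I - {i} \<Longrightarrow> \<sigma> (R j) = R j"
    using generators[OF i(1)] by blast
  have m: "\<sigma> (monomial \<eta>) = to_ac (\<zeta> ^ \<eta> i) * monomial \<eta>" for \<eta>
  proof -
    have "\<sigma> (monomial \<eta>) = (to_ac \<zeta> * R i) ^ \<eta> i * (\<Prod>j\<in>I - {i}. \<sigma> (R j) ^ \<eta> j)"
      unfolding gal_monomial[OF \<sigma>(1)] using finite_I i(1) \<sigma>(2) by (simp add: prod.remove)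
    also have "(\<Prod>j\<in>I - {i}. \<sigma> (R j) ^ \<eta> j) = (\<Prod>j\<in>I - {i}. R j ^ \<eta> j)" using \<sigma>(3) by (intro prod.cong) auto
    also have "(to_ac \<zeta> * R i) ^ \<eta> i * \<dots> = to_ac (\<zeta> ^ \<eta> i) * monomial \<eta>"
      unfolding monomial_def using finite_I i(1) by (simp add: prod.remove power_mult_distrib mult.assoc)
    finally show ?thesis .
  qed
  have \<zeta>: "\<zeta> ^ p = 1" "\<And>k. 0 < k \<Longrightarrow> k < p \<Longrightarrow> \<zeta> ^ k \<noteq> 1" using zeta by (auto simp: primitive_root_of_unity_def)
  then have \<zeta>0: "\<zeta> \<noteq> 0" using p_positive by (metis power_0_left zero_neq_one not_gr_zero)
  have neq: "\<zeta> ^ \<chi> i \<noteq> \<zeta> ^ \<chi>' i"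
  proof -
    have lt: "\<chi> i < p" "\<chi>' i < p" using assms i(1) by (auto simp: exponents_def)
    have *: "\<zeta> ^ k \<noteq> \<zeta> ^ l" if "k < l" "l < p" for k l
      using that \<zeta>(2)[of "l - k"] \<zeta>0 power_add[of \<zeta> k "l - k"] by auto
    show ?thesis using *[of "\<chi> i" "\<chi>' i"] *[of "\<chi>' i" "\<chi> i"] lt i(2) by (cases "\<chi> i < \<chi>' i") auto
  qed
  let ?z = "monomial \<chi> * inverse (monomial \<chi>')"
  have zK: "?z \<in> K" by (auto intro!: mult_in inverse_in)
  have "\<sigma> ?z = to_ac (\<zeta> ^ \<chi> i / \<zeta> ^ \<chi>' i) * ?z"
    using \<sigma>(1) by (simp add: gal_mult gal_inverse inverse_in m divide_inverse)
  then have "trace ?z = to_ac (\<zeta> ^ \<chi> i / \<zeta> ^ \<chi>' i) * trace ?z"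
    using trace_gal(1)[OF \<sigma>(1) zK] trace_scalar[OF zK] by metis
  moreover have "to_ac (\<zeta> ^ \<chi> i / \<zeta> ^ \<chi>' i) \<noteq> to_ac 1"
    unfolding to_ac_eq_iff using neq \<zeta>0 by simp
  ultimately have "trace ?z = 0" by (metis mult_cancel_right1 to_ac_1)
  then have "to_ac (coordinate (monomial \<chi>) \<chi>') = to_ac 0" by (simp add: to_ac_coordinate)
  then have "coordinate (monomial \<chi>) \<chi>' = 0" by (simp only: to_ac_eq_iff)
  then show ?thesis using False by simp
qed

lemma coordinate_sum:
  assumes "\<And>a. a \<in> A \<Longrightarrow> g a \<in> K"
  shows "coordinate (\<Sum>a\<in>A. to_ac (r a) * g a) \<chi> = (\<Sum>a\<in>A. r a * coordinate (g a) \<chi>)"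
proof -
  have "to_ac (coordinate (\<Sum>a\<in>A. to_ac (r a) * g a) \<chi>) = trace (\<Sum>a\<in>A. to_ac (r a) * (g a * inverse (monomial \<chi>))) / to_ac dimension"
    using assms by (simp add: to_ac_coordinate sum_in mult_in sum_distrib_right mult.assoc)
  also have "\<dots> = (\<Sum>a\<in>A. to_ac (r a) * (trace (g a * inverse (monomial \<chi>)) / to_ac dimension))"
    using assms by (subst trace_sum) (auto simp: trace_scalar mult_in inverse_in sum_divide_distrib intro!: mult_in inverse_in)
  also have "\<dots> = to_ac (\<Sum>a\<in>A. r a * coordinate (g a) \<chi>)"
    using assms by (simp add: to_ac_sum to_ac_coordinate)
  finally show ?thesis by (simp only: to_ac_eq_iff)
qed

lemma monomials_independent:
  assumes "(\<Sum>\<chi>\<in>exponents. to_ac (r \<chi>) * monomial \<chi>) = 0" "\<chi>' \<in> exponents"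
  shows "r \<chi>' = 0"
proof -
  have "0 = coordinate (\<Sum>\<chi>\<in>exponents. to_ac (r \<chi>) * monomial \<chi>) \<chi>'"
    using assms(1) by (simp add: coordinate_def trace_def gal_0)
  also have "\<dots> = (\<Sum>\<chi>\<in>exponents. r \<chi> * coordinate (monomial \<chi>) \<chi>')"
    by (rule coordinate_sum) simp
  also have "\<dots> = (\<Sum>\<chi>\<in>exponents. if \<chi> = \<chi>' then r \<chi> else 0)"
    using assms(2) by (intro sum.cong refl) (simp add: coordinate_monomial)
  also have "\<dots> = r \<chi>'" using assms(2) by simp
  finally show ?thesis by simp
qed

end

section \<open>Modules over split algebras\<close>

text \<open>
  Otherwise the images of the basis vectors would be linearly dependent.
\<close>

lemma iso_algebras_card_le:
  assumes "iso_algebras (sc_algebra S) (sc_algebra T)" "finite (sc_index S)" "finite (sc_index T)"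
  shows "card (sc_index S) \<le> card (sc_index T)"
proof (rule ccontr)
  assume less: "\<not> card (sc_index S) \<le> card (sc_index T)"
  obtain h where h0: "h \<in> algebra_isos (sc_algebra S) (sc_algebra T)" using assms(1) by (auto simp: iso_algebras_def)
  note h = algebra_isosD[OF h0]
  obtain r where r: "\<exists>i\<in>sc_index S. r i \<noteq> 0" "\<And>j. j \<in> sc_index T \<Longrightarrow> (\<Sum>i\<in>sc_index S. r i * h (basis_vector i) j) = 0"
    using underdetermined_system[OF assms(3,2), of "\<lambda>i. h (basis_vector i)"] less by auto
  let ?x = "\<lambda>k. \<Sum>i\<in>sc_index S. r i * basis_vector i k"
  have b: "basis_vector i \<in> carrier (sc_algebra S)" if "i \<in> sc_index S" for i
    using that by (auto simp: sc_carrier basis_vector_def)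
  have "h ?x = (\<lambda>k. \<Sum>i\<in>sc_index S. r i * h (basis_vector i) k)"
    by (rule algebra_isos_sum[OF h0]) (rule b)
  moreover have "(\<Sum>i\<in>sc_index S. r i * h (basis_vector i) k) = 0" for k
  proof (cases "k \<in> sc_index T")
    case False
    then show ?thesis using h(1)[OF b] by (intro sum.neutral) (auto simp: sc_carrier)
  qed (use r(2) in simp)
  ultimately have "h ?x = (\<lambda>k. 0)" by simp
  also have "\<dots> = h (\<lambda>k. 0)" using algebra_isos_sum[OF h0, of "{}" "\<lambda>_. \<lambda>k. 0" "\<lambda>_. 0"] by simp
  finally have "h ?x = h (\<lambda>k. 0)" .
  moreover have "?x \<in> carrier (sc_algebra S)" using b by (auto simp: sc_carrier intro!: sum.neutral)
  ultimately have z: "?x = (\<lambda>k. 0)" using h(6) by (auto simp: bij_betw_def inj_on_def sc_carrier)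
  have "r i = 0" if "i \<in> sc_index S" for i
  proof -
    have "?x i = (\<Sum>j\<in>sc_index S. if j = i then r j else 0)" by (intro sum.cong) (auto simp: basis_vector_def)
    then show ?thesis using that assms(2) fun_cong[OF z, of i] by simp
  qed
  then show False using r(1) by blast
qed

text \<open>
  If \<open>M\<^sub>m(N)\<close> is the algebra of the \<open>n \<times> n\<close> matrices, then the image of \<open>F\<^sup>n\<close> under the matrix unit
  \<open>E\<^sub>0\<^sub>0\<close> is a module over \<open>N\<close>, and \<open>F\<^sup>n\<close> is the direct sum of \<open>m\<close> copies of it.
\<close>

lemma split_algebra_module:
  fixes N :: "('i, 'f::field) sc_table"
  assumes split: "table_equiv N (unit_table :: (_, 'f) sc_table)"
    and fin: "finite (sc_index N)" and card: "card (sc_index N) = d ^ 2"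
    and alg: "assoc_algebra base_ring (sc_algebra N)" and nontriv: "\<one>\<^bsub>sc_algebra N\<^esub> \<noteq> \<zero>\<^bsub>sc_algebra N\<^esub>"
  obtains V and act :: "('i \<Rightarrow> 'f) \<Rightarrow> (nat \<Rightarrow> 'f) \<Rightarrow> (nat \<Rightarrow> 'f)" and v
  where "v \<in> V" "v \<noteq> (\<lambda>_. 0)"
    "\<And>x w. x \<in> carrier (sc_algebra N) \<Longrightarrow> w \<in> V \<Longrightarrow> act x w \<in> V"
    "\<And>w. w \<in> V \<Longrightarrow> act \<one>\<^bsub>sc_algebra N\<^esub> w = w"
    "\<And>x y w. x \<in> carrier (sc_algebra N) \<Longrightarrow> y \<in> carrier (sc_algebra N) \<Longrightarrow> w \<in> V \<Longrightarrow> act (x \<otimes>\<^bsub>sc_algebra N\<^esub> y) w = act x (act y w)"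
    "\<And>x y w. x \<in> carrier (sc_algebra N) \<Longrightarrow> y \<in> carrier (sc_algebra N) \<Longrightarrow> act (\<lambda>k. x k + y k) w = (\<lambda>k. act x w k + act y w k)"
    "\<And>r x w. x \<in> carrier (sc_algebra N) \<Longrightarrow> act (\<lambda>k. r * x k) w = (\<lambda>k. r * act x w k)"
    "\<And>(A :: 'z set) u. finite A \<Longrightarrow> d < card A \<Longrightarrow> (\<And>a. a \<in> A \<Longrightarrow> u a \<in> V) \<Longrightarrow>
      \<exists>r. (\<exists>a\<in>A. r a \<noteq> 0) \<and> (\<forall>k. (\<Sum>a\<in>A. r a * u a k) = 0)"
proof -
  obtain m n :: nat where mn: "m > 0" "n > 0"
    and i0: "iso_algebras (sc_algebra (sc_tensor (mat_table {..<m}) N)) (sc_algebra (sc_tensor (mat_table {..<n}) (unit_table :: (_, 'f) sc_table)))"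
    using split unfolding table_equiv_def by blast
  let ?T = "sc_tensor (mat_table {..<m}) N" and ?M = "mat_table {..<n} :: (nat \<times> nat, 'f) sc_table"
  have iso: "iso_algebras (sc_algebra ?T) (sc_algebra ?M)"
    by (rule iso_algebras_trans[OF i0 iso_algebras_trans[OF iso_tensor_commute unit_tensor_iso]])
  have "card (sc_index ?M) \<le> card (sc_index ?T)"
    by (rule iso_algebras_card_le[OF iso_algebras_sym[OF iso]]) (use fin in auto)
  then have "n ^ 2 \<le> (m * d) ^ 2" by (simp add: card_cartesian_product card power2_eq_square mult_ac)
  \<comment> \<open>The dimensions over \<open>F\<close> of the two sides are \<open>n\<^sup>2\<close> and \<open>(m d)\<^sup>2\<close>.\<close>
  then have nmd: "n \<le> m * d" by (simp add: power2_nat_le_eq_le)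
  obtain H where H0: "H \<in> algebra_isos (sc_algebra ?T) (sc_algebra ?M)" using iso by (auto simp: iso_algebras_def)
  note H = algebra_isosD[OF H0]
  interpret N: field_algebra "sc_algebra N" by (rule field_algebra.intro[OF alg])
  define E where "E r s y = (\<lambda>((i, j), k). if i = r \<and> j = s then y k else 0)" for r s :: nat and y :: "'i \<Rightarrow> 'f"
  have E_in: "E r s y \<in> carrier (sc_algebra ?T)" if "r < m" "s < m" "y \<in> carrier (sc_algebra N)" for r s y
    using that by (auto simp: E_def sc_carrier)
  have E_mult: "E r s y \<otimes>\<^bsub>sc_algebra ?T\<^esub> E r' s' y' = (if s = r' then E r s' (y \<otimes>\<^bsub>sc_algebra N\<^esub> y') else (\<lambda>k. 0))"
    if rs: "r < m" "s < m" "r' < m" "s' < m" and y: "y \<in> carrier (sc_algebra N)" "y' \<in> carrier (sc_algebra N)" for r s r' s' y y'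
  proof
    fix ijl :: "(nat \<times> nat) \<times> 'i"
    obtain i j l where ijl: "ijl = ((i, j), l)" by (metis prod.collapse)
    show "(E r s y \<otimes>\<^bsub>sc_algebra ?T\<^esub> E r' s' y') ijl = (if s = r' then E r s' (y \<otimes>\<^bsub>sc_algebra N\<^esub> y') else (\<lambda>k. 0)) ijl"
    proof (cases "l \<in> sc_index N")
      case True
      have slice: "(\<lambda>ij. E r s y (ij, u)) = (\<lambda>ij. if ij = (r, s) then y u else 0)" for r s :: nat and y :: "'i \<Rightarrow> 'f" and u
        by (auto simp: E_def)
      have m: "((\<lambda>ij. if ij = (r, s) then a else 0) \<otimes>\<^bsub>sc_algebra (mat_table {..<m})\<^esub> (\<lambda>ij. if ij = (r', s') then b else 0)) (i, j) =
          (if s = r' \<and> i = r \<and> j = s' then a * b else (0::'f))" for a b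
      proof -
        have S: "(\<Sum>k<m. (if (i, k) = (r, s) then a else 0) * (if (k, j) = (r', s') then b else 0)) =
            (\<Sum>k<m. if k = s then if s = r' \<and> i = r \<and> j = s' then a * b else 0 else 0)"
          by (intro sum.cong) auto
        show ?thesis
          by (subst mat_table_mult, simp, unfold S) (use rs in auto)
      qed
      show ?thesis
        using True unfolding ijl sc_tensor_mult_slice slice m
        by (auto simp: E_def sc_mult sum.cartesian_product' mult_ac)
    next
      case False
      then show ?thesis by (auto simp: ijl sc_mult E_def)
    qed
  qed
  define mv where "mv Q w = (\<lambda>i. if i < n then \<Sum>j<n. Q (i, j) * w j else 0)" for Q :: "nat \<times> nat \<Rightarrow> 'f" and w
  have mv_mult: "mv (Q \<otimes>\<^bsub>sc_algebra ?M\<^esub> Q') w = mv Q (mv Q' w)" for Q Q' w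
  proof
    fix i
    have "(\<Sum>j<n. (\<Sum>k<n. Q (i, k) * Q' (k, j)) * w j) = (\<Sum>k<n. Q (i, k) * (\<Sum>j<n. Q' (k, j) * w j))"
      unfolding sum_distrib_left sum_distrib_right by (subst sum.swap) (simp add: mult.assoc)
    then show "mv (Q \<otimes>\<^bsub>sc_algebra ?M\<^esub> Q') w i = mv Q (mv Q' w) i"
      by (simp add: mv_def mat_table_mult)
  qed
  have mv_zero: "mv (\<lambda>k. 0) w = (\<lambda>_. 0)" for w by (auto simp: mv_def)
  have mv_sum: "mv Q (\<lambda>k. \<Sum>a\<in>A. r a * u a k) = (\<lambda>k. \<Sum>a\<in>A. r a * mv Q (u a) k)" for Q r u and A :: "'y set"
  proof
    fix i
    have "(\<Sum>j<n. Q (i, j) * (\<Sum>a\<in>A. r a * u a j)) = (\<Sum>a\<in>A. r a * (\<Sum>j<n. Q (i, j) * u a j))"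
      unfolding sum_distrib_left by (subst sum.swap) (simp add: mult_ac)
    then show "mv Q (\<lambda>k. \<Sum>a\<in>A. r a * u a k) i = (\<Sum>a\<in>A. r a * mv Q (u a) i)" by (simp add: mv_def)
  qed
  have H_zero: "H (\<lambda>k. 0) = (\<lambda>k. 0)"
    using algebra_isos_sum[OF H0, of "{}" "\<lambda>_. \<lambda>k. 0" "\<lambda>_. 0"] by simp
  let ?e = "\<one>\<^bsub>sc_algebra N\<^esub>"
  define V where "V = range (mv (H (E 0 0 ?e)))"
  define act where "act x = mv (H (E 0 0 x))" for x
  have VE: "w = mv (H (E 0 0 ?e)) w" if "w \<in> V" for w
    using that mn E_mult[of 0 0 0 0 ?e ?e] H(2)[OF E_in E_in, of 0 0 ?e 0 0 ?e]
    unfolding V_def by (auto simp: mv_mult[symmetric])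
  have mvH: "mv (H (E r s x)) (mv (H (E r' s' y)) w) = (if s = r' then mv (H (E r s' (x \<otimes>\<^bsub>sc_algebra N\<^esub> y))) w else (\<lambda>_. 0))"
    if "r < m" "s < m" "r' < m" "s' < m" "x \<in> carrier (sc_algebra N)" "y \<in> carrier (sc_algebra N)" for r s r' s' x y w
  proof -
    have "H (E r s x) \<otimes>\<^bsub>sc_algebra ?M\<^esub> H (E r' s' y) = H (E r s x \<otimes>\<^bsub>sc_algebra ?T\<^esub> E r' s' y)"
      by (rule H(2)[symmetric]) (intro E_in that)+
    also have "\<dots> = (if s = r' then H (E r s' (x \<otimes>\<^bsub>sc_algebra N\<^esub> y)) else (\<lambda>_. 0))"
      unfolding E_mult[OF that] using H_zero by simp
    finally show ?thesis unfolding mv_mult[symmetric] using mv_zero by simp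
  qed
  have "\<exists>w. mv (H (E 0 0 ?e)) w \<noteq> (\<lambda>_. 0)"
  proof (rule ccontr)
    assume "\<not> (\<exists>w. mv (H (E 0 0 ?e)) w \<noteq> (\<lambda>_. 0))"
    then have z: "mv (H (E 0 0 ?e)) w i = 0" for w i by simp
    have Ee: "E 0 0 ?e \<in> carrier (sc_algebra ?T)" by (rule E_in) (use mn in simp_all)
    have "H (E 0 0 ?e) (i, j) = 0" for i j
    proof (cases "i < n \<and> j < n")
      case True
      have "(\<Sum>k<n. H (E 0 0 ?e) (i, k) * basis_vector j k) = (\<Sum>k<n. if k = j then H (E 0 0 ?e) (i, k) else 0)"
        by (intro sum.cong) (auto simp: basis_vector_def)
      then have "mv (H (E 0 0 ?e)) (basis_vector j) i = H (E 0 0 ?e) (i, j)" using True by (simp add: mv_def)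
      then show ?thesis using z by simp
    next
      case False
      then show ?thesis using H(1)[OF Ee] unfolding sc_carrier by auto
    qed
    then have "H (E 0 0 ?e) = H (\<lambda>k. 0)" unfolding H_zero by auto
    moreover have "inj_on H (carrier (sc_algebra ?T))" using H(6) by (simp add: bij_betw_def)
    moreover have "(\<lambda>k. 0) \<in> carrier (sc_algebra ?T)" by (simp add: sc_carrier)
    ultimately have "E 0 0 ?e = (\<lambda>k. 0)" using Ee by (meson inj_onD)
    then have "E 0 0 ?e ((0, 0), k) = 0" for k by simp
    then have "?e k = 0" for k by (simp add: E_def)
    then have "?e = \<zero>\<^bsub>sc_algebra N\<^esub>" by (auto simp: fun_eq_iff)
    then show False using nontriv by simp
  qed
  then obtain w0 where w0: "mv (H (E 0 0 ?e)) w0 \<noteq> (\<lambda>_. 0)" by blast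
  show ?thesis
  proof (rule that[of "mv (H (E 0 0 ?e)) w0" V act])
    fix x w assume x: "x \<in> carrier (sc_algebra N)"
    have "mv (H (E 0 0 x)) w = mv (H (E 0 0 ?e)) (mv (H (E 0 0 x)) w)"
      using mvH[of 0 0 0 0 ?e x w] mn x by simp
    then show "act x w \<in> V" unfolding act_def V_def by blast
    show "act (\<lambda>k. r * x k) w = (\<lambda>k. r * act x w k)" for r
    proof -
      have "E 0 0 (\<lambda>k. r * x k) = r \<odot>\<^bsub>sc_algebra ?T\<^esub> E 0 0 x" by (auto simp: E_def)
      then have "H (E 0 0 (\<lambda>k. r * x k)) = (\<lambda>k. r * H (E 0 0 x) k)"
        using H(5)[OF E_in[of 0 0 x], of r] mn x by simp
      then show ?thesis by (auto simp: act_def mv_def sum_distrib_left mult.assoc)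
    qed
    fix y assume y: "y \<in> carrier (sc_algebra N)"
    show "act (x \<otimes>\<^bsub>sc_algebra N\<^esub> y) w = act x (act y w)"
      using mvH[of 0 0 0 0 x y w] mn x y by (simp add: act_def)
    have "E 0 0 (\<lambda>k. x k + y k) = E 0 0 x \<oplus>\<^bsub>sc_algebra ?T\<^esub> E 0 0 y" by (auto simp: E_def)
    then have "H (E 0 0 (\<lambda>k. x k + y k)) = (\<lambda>k. H (E 0 0 x) k + H (E 0 0 y) k)"
      using H(3)[OF E_in[of 0 0 x] E_in[of 0 0 y]] mn x y by simp
    then show "act (\<lambda>k. x k + y k) w = (\<lambda>k. act x w k + act y w k)"
      by (auto simp: act_def mv_def sum.distrib distrib_right)
  next
    fix A :: "'z set" and u assume A: "finite A" "d < card A" and u: "\<And>a. a \<in> A \<Longrightarrow> u a \<in> V"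
    \<comment> \<open>The matrix units \<open>E\<^sub>i\<^sub>0\<close> carry \<open>u\<close> to \<open>m\<close> families in complementary subspaces of \<open>F\<^sup>n\<close>, too many vectors together.\<close>
    have "n < card ({..<m} \<times> A)" using nmd A mn by (simp add: card_cartesian_product) (meson le_less_trans mult_less_cancel1)
    then have "\<exists>r. (\<exists>ia\<in>{..<m} \<times> A. r ia \<noteq> 0) \<and>
        (\<forall>k\<in>{..<n}. (\<Sum>ia\<in>{..<m} \<times> A. r ia * mv (H (E (fst ia) 0 ?e)) (u (snd ia)) k) = 0)"
      using A(1) by (intro underdetermined_system) auto
    then obtain r where r: "\<exists>ia\<in>{..<m} \<times> A. r ia \<noteq> 0"
        "\<And>k. k < n \<Longrightarrow> (\<Sum>ia\<in>{..<m} \<times> A. r ia * mv (H (E (fst ia) 0 ?e)) (u (snd ia)) k) = 0" by auto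
    obtain i a where ia: "i < m" "a \<in> A" "r (i, a) \<noteq> 0" using r(1) by auto
    let ?s = "\<lambda>k. \<Sum>ia\<in>{..<m} \<times> A. r ia * mv (H (E (fst ia) 0 ?e)) (u (snd ia)) k"
    have "?s = (\<lambda>_. 0)"
    proof
      fix k
      show "?s k = 0"
      proof (cases "k < n")
        case True
        then show ?thesis by (rule r(2))
      next
        case False
        then show ?thesis by (simp add: mv_def)
      qed
    qed
    then have "mv (H (E 0 i ?e)) ?s = (\<lambda>_. 0)" by (auto simp: mv_def)
    moreover have "mv (H (E 0 i ?e)) ?s = (\<lambda>k. \<Sum>b\<in>A. r (i, b) * u b k)"
    proof
      fix k
      have "mv (H (E 0 i ?e)) ?s k = (\<Sum>jb\<in>{..<m} \<times> A. r jb * mv (H (E 0 i ?e)) (mv (H (E (fst jb) 0 ?e)) (u (snd jb))) k)"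
        by (simp only: mv_sum)
      also have "\<dots> = (\<Sum>jb\<in>{..<m} \<times> A. if fst jb = i then r jb * u (snd jb) k else 0)"
      proof (intro sum.cong refl)
        fix jb assume jb: "jb \<in> {..<m} \<times> A"
        have "mv (H (E 0 i ?e)) (mv (H (E (fst jb) 0 ?e)) (u (snd jb))) = (if i = fst jb then mv (H (E 0 0 ?e)) (u (snd jb)) else (\<lambda>_. 0))"
          using mvH[of 0 i "fst jb" 0 ?e ?e "u (snd jb)"] mn ia jb by auto
        then show "r jb * mv (H (E 0 i ?e)) (mv (H (E (fst jb) 0 ?e)) (u (snd jb))) k = (if fst jb = i then r jb * u (snd jb) k else 0)"
          using VE[OF u, of "snd jb", symmetric] jb by auto
      qed
      also have "\<dots> = (\<Sum>j<m. \<Sum>b\<in>A. if j = i then r (j, b) * u b k else 0)"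
        unfolding sum.cartesian_product by (intro sum.cong refl) auto
      also have "\<dots> = (\<Sum>j<m. if j = i then \<Sum>b\<in>A. r (j, b) * u b k else 0)"
        by (intro sum.cong refl) auto
      also have "\<dots> = (\<Sum>b\<in>A. r (i, b) * u b k)" using ia by simp
      finally show "mv (H (E 0 i ?e)) ?s k = (\<Sum>b\<in>A. r (i, b) * u b k)" .
    qed
    ultimately have "(\<lambda>k. \<Sum>b\<in>A. r (i, b) * u b k) = (\<lambda>_. 0)" by simp
    then have "\<forall>k. (\<Sum>b\<in>A. r (i, b) * u b k) = 0" by (simp add: fun_eq_iff)
    then show "\<exists>r. (\<exists>a\<in>A. r a \<noteq> 0) \<and> (\<forall>k. (\<Sum>a\<in>A. r a * u a k) = 0)"
      using ia by (intro exI[of _ "\<lambda>a. r (i, a)"]) auto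
  next
    show "mv (H (E 0 0 ?e)) w0 \<in> V" by (simp add: V_def)
    show "mv (H (E 0 0 ?e)) w0 \<noteq> (\<lambda>_. 0)" by (rule w0)
    fix w assume "w \<in> V"
    then show "act ?e w = w" unfolding act_def by (rule VE[symmetric])
  qed
qed

section \<open>Representations of the crossed product\<close>

lemma (in central_embedding) q_apply_in [simp]: "e \<in> carrier E \<Longrightarrow> x \<in> K \<Longrightarrow> q e x \<in> K"
  by (rule gal_in[OF q_closed])

text \<open>
  Modulo the relation \<open>t = \<zeta>\<close> the crossed product of the extension is generated by \<open>K\<close> and \<open>E\<close>, and
  \<open>mono k e\<close> stands for the product of \<open>k\<close> and \<open>e\<close>.  Besides the crossed product itself, the
  endomorphism algebra of \<open>K\<close> is an instance when the embedding problem has a splitting.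
\<close>

locale monomial_rep = central_embedding K p \<zeta> E q t + A: field_algebra A
  for K :: "'f::field alg_closure set" and p \<zeta> and E :: "'e monoid" and q t and A :: "('f, 'v) module" +
  fixes mono :: "'f alg_closure \<Rightarrow> 'e \<Rightarrow> 'v"
  assumes mono_closed [simp]: "k \<in> K \<Longrightarrow> e \<in> carrier E \<Longrightarrow> mono k e \<in> carrier A"
    and mono_mult: "k \<in> K \<Longrightarrow> k' \<in> K \<Longrightarrow> e \<in> carrier E \<Longrightarrow> e' \<in> carrier E \<Longrightarrow>
      mono k e \<otimes>\<^bsub>A\<^esub> mono k' e' = mono (k * q e k') (e \<otimes>\<^bsub>E\<^esub> e')"
    and mono_one: "\<one>\<^bsub>A\<^esub> = mono 1 \<one>\<^bsub>E\<^esub>"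
    and mono_t: "k \<in> K \<Longrightarrow> e \<in> carrier E \<Longrightarrow> mono k (t [^]\<^bsub>E\<^esub> (n::nat) \<otimes>\<^bsub>E\<^esub> e) = mono (to_ac \<zeta> ^ n * k) e"
    and mono_scalar: "k \<in> K \<Longrightarrow> e \<in> carrier E \<Longrightarrow> r \<odot>\<^bsub>A\<^esub> mono k e = mono (to_ac r * k) e"
    and mono_add: "k \<in> K \<Longrightarrow> k' \<in> K \<Longrightarrow> e \<in> carrier E \<Longrightarrow> mono (k + k') e = mono k e \<oplus>\<^bsub>A\<^esub> mono k' e"
begin

lemma mono_pow:
  assumes k: "k \<in> K" "q e k = k" and e: "e \<in> carrier E"
  shows "mono k e [^]\<^bsub>A\<^esub> (n::nat) = mono (k ^ n) (e [^]\<^bsub>E\<^esub> n)"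
proof (induction n)
  case (Suc n)
  have "q (e [^]\<^bsub>E\<^esub> n) k = k"
    using k e by (induction n) (simp_all add: q_one one_gal_apply q_mult_apply)
  then show ?case using Suc k e by (simp add: mono_mult power_in mult.commute)
qed (simp add: mono_one)

lemma mono_q_commute:
  assumes "k \<in> K" "k' \<in> K" "e \<in> carrier E" "e' \<in> carrier E"
    and "k * q e k' = to_ac \<kappa> * (k' * q e' k)" "e \<otimes>\<^bsub>E\<^esub> e' = t [^]\<^bsub>E\<^esub> (n::nat) \<otimes>\<^bsub>E\<^esub> (e' \<otimes>\<^bsub>E\<^esub> e)"
  shows "A.q_commute (\<zeta> ^ n * \<kappa>) (mono k e) (mono k' e')"
proof -
  have g: "k' * q e' k \<in> K" using assms by (intro mult_in) auto
  have "mono k e \<otimes>\<^bsub>A\<^esub> mono k' e' = mono (to_ac \<zeta> ^ n * (to_ac \<kappa> * (k' * q e' k))) (e' \<otimes>\<^bsub>E\<^esub> e)"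
    using assms g by (simp add: mono_mult mono_t mult_in)
  also have "\<dots> = mono (to_ac (\<zeta> ^ n * \<kappa>) * (k' * q e' k)) (e' \<otimes>\<^bsub>E\<^esub> e)"
    by (simp add: mult.assoc)
  also have "\<dots> = (\<zeta> ^ n * \<kappa>) \<odot>\<^bsub>A\<^esub> (mono k' e' \<otimes>\<^bsub>A\<^esub> mono k e)"
    using assms g by (simp only: mono_mult mono_scalar E.m_closed)
  finally show ?thesis by (simp add: A.q_commute_def)
qed

end

section \<open>The crossed product of a central extension\<close>

locale crossed_product_algebra = central_embedding K p \<zeta> E q t
  for K :: "'f::field alg_closure set" and p \<zeta> and E :: "'e monoid" and q t +
  fixes c :: "('f alg_closure \<Rightarrow> 'f alg_closure) \<Rightarrow> ('f alg_closure \<Rightarrow> 'f alg_closure) \<Rightarrow> 'f"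
    and s :: "('f alg_closure \<Rightarrow> 'f alg_closure) \<Rightarrow> 'e"
  assumes s: "\<And>\<sigma>. \<sigma> \<in> carrier (gal K) \<Longrightarrow> s \<sigma> \<in> carrier E" "\<And>\<sigma>. \<sigma> \<in> carrier (gal K) \<Longrightarrow> q (s \<sigma>) = \<sigma>"
    and factor: "\<And>\<sigma> \<sigma>'. \<sigma> \<in> carrier (gal K) \<Longrightarrow> \<sigma>' \<in> carrier (gal K) \<Longrightarrow>
      \<exists>n::nat. c \<sigma> \<sigma>' = \<zeta> ^ n \<and> s \<sigma> \<otimes>\<^bsub>E\<^esub> s \<sigma>' = t [^]\<^bsub>E\<^esub> n \<otimes>\<^bsub>E\<^esub> s (\<sigma> \<otimes>\<^bsub>gal K\<^esub> \<sigma>')"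
begin

text \<open>
  The scalar by which the lift \<open>e\<close> differs from the chosen lift of its image.  In terms of it the
  whole group \<open>E\<close> is represented in the crossed product, by \<open>e \<mapsto> coset_scalar e \<cdot> u\<^bsub>q e\<^esub>\<close>.
\<close>

definition coset_scalar :: "'e \<Rightarrow> 'f" where
  "coset_scalar e = \<zeta> ^ (SOME n. e = t [^]\<^bsub>E\<^esub> n \<otimes>\<^bsub>E\<^esub> s (q e))"

lemma t_pow_eqD:
  assumes "t [^]\<^bsub>E\<^esub> (n::nat) = t [^]\<^bsub>E\<^esub> (m::nat)" shows "\<zeta> ^ n = \<zeta> ^ m"
proof -
  have *: "\<zeta> ^ n = \<zeta> ^ m" if eq: "t [^]\<^bsub>E\<^esub> n = t [^]\<^bsub>E\<^esub> m" and le: "n \<le> m" for n m :: nat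
  proof -
    have "t [^]\<^bsub>E\<^esub> n \<otimes>\<^bsub>E\<^esub> t [^]\<^bsub>E\<^esub> (m - n) = t [^]\<^bsub>E\<^esub> m"
      using le by (simp add: E.nat_pow_mult t_closed)
    then have "t [^]\<^bsub>E\<^esub> n \<otimes>\<^bsub>E\<^esub> t [^]\<^bsub>E\<^esub> (m - n) = t [^]\<^bsub>E\<^esub> n" by (rule trans[OF _ eq[symmetric]])
    then have "t [^]\<^bsub>E\<^esub> (m - n) = \<one>\<^bsub>E\<^esub>" by (simp only: E.l_cancel_one t_pow_closed)
    then have "\<zeta> ^ (m - n) = 1" using t_pow_eq_1 \<zeta>_pow_eq_1 by blast
    then show ?thesis using power_add[of \<zeta> n "m - n"] le by simp
  qed
  show ?thesis
  proof (cases "n \<le> m")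
    case True
    then show ?thesis by (rule *[OF assms])
  next
    case False
    then show ?thesis using *[OF assms[symmetric]] by simp
  qed
qed

lemma coset_scalar_t_pow:
  assumes \<sigma>: "\<sigma> \<in> carrier (gal K)" shows "coset_scalar (t [^]\<^bsub>E\<^esub> (n::nat) \<otimes>\<^bsub>E\<^esub> s \<sigma>) = \<zeta> ^ n"
proof -
  let ?e = "t [^]\<^bsub>E\<^esub> n \<otimes>\<^bsub>E\<^esub> s \<sigma>"
  have qe: "q ?e = \<sigma>" using \<sigma> s by (simp add: q_mult q_t_pow)
  then have "?e = t [^]\<^bsub>E\<^esub> n \<otimes>\<^bsub>E\<^esub> s (q ?e)" by (simp only:)
  then have "\<exists>m::nat. ?e = t [^]\<^bsub>E\<^esub> m \<otimes>\<^bsub>E\<^esub> s (q ?e)" by (rule exI)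
  from someI_ex[OF this] have "t [^]\<^bsub>E\<^esub> n \<otimes>\<^bsub>E\<^esub> s \<sigma> = t [^]\<^bsub>E\<^esub> (SOME n::nat. ?e = t [^]\<^bsub>E\<^esub> n \<otimes>\<^bsub>E\<^esub> s (q ?e)) \<otimes>\<^bsub>E\<^esub> s \<sigma>"
    by (simp only: qe)
  then have "t [^]\<^bsub>E\<^esub> n = t [^]\<^bsub>E\<^esub> (SOME n::nat. ?e = t [^]\<^bsub>E\<^esub> n \<otimes>\<^bsub>E\<^esub> s (q ?e))"
    using s(1)[OF \<sigma>] by (simp only: E.r_cancel t_pow_closed)
  from t_pow_eqD[OF this] show ?thesis by (simp add: coset_scalar_def)
qed

lemma coset_form:
  assumes "e \<in> carrier E" obtains n :: nat where "e = t [^]\<^bsub>E\<^esub> n \<otimes>\<^bsub>E\<^esub> s (q e)"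
  using q_eqD[OF assms s(1)[OF q_closed[OF assms]] s(2)[OF q_closed[OF assms], symmetric]] that by blast

lemma coset_scalar_nonzero: "e \<in> carrier E \<Longrightarrow> coset_scalar e \<noteq> 0"
  by (simp add: coset_scalar_def)

lemma coset_scalar_s: "\<sigma> \<in> carrier (gal K) \<Longrightarrow> coset_scalar (s \<sigma>) = 1"
  using coset_scalar_t_pow[of \<sigma> 0] s by simp

lemma coset_scalar_t: "e \<in> carrier E \<Longrightarrow> coset_scalar (t [^]\<^bsub>E\<^esub> (n::nat) \<otimes>\<^bsub>E\<^esub> e) = \<zeta> ^ n * coset_scalar e"
proof -
  assume e: "e \<in> carrier E"
  obtain m :: nat where m: "e = t [^]\<^bsub>E\<^esub> m \<otimes>\<^bsub>E\<^esub> s (q e)" by (rule coset_form[OF e])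
  have "t [^]\<^bsub>E\<^esub> n \<otimes>\<^bsub>E\<^esub> e = t [^]\<^bsub>E\<^esub> (n + m) \<otimes>\<^bsub>E\<^esub> s (q e)"
    using s e by (subst m) (simp add: E.m_assoc[symmetric] E.nat_pow_mult t_closed)
  then show ?thesis using coset_scalar_t_pow[of "q e"] e m by (metis q_closed power_add)
qed

lemma coset_scalar_mult:
  assumes e: "e \<in> carrier E" "e' \<in> carrier E"
  shows "coset_scalar (e \<otimes>\<^bsub>E\<^esub> e') = coset_scalar e * coset_scalar e' * c (q e) (q e')"
proof -
  obtain n :: nat where n: "e = t [^]\<^bsub>E\<^esub> n \<otimes>\<^bsub>E\<^esub> s (q e)" by (rule coset_form[OF e(1)])
  obtain m :: nat where m: "e' = t [^]\<^bsub>E\<^esub> m \<otimes>\<^bsub>E\<^esub> s (q e')" by (rule coset_form[OF e(2)])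
  obtain k :: nat where k: "c (q e) (q e') = \<zeta> ^ k"
    "s (q e) \<otimes>\<^bsub>E\<^esub> s (q e') = t [^]\<^bsub>E\<^esub> k \<otimes>\<^bsub>E\<^esub> s (q e \<otimes>\<^bsub>gal K\<^esub> q e')"
    using factor[of "q e" "q e'"] e by auto
  have c: "s (q e) \<in> carrier E" "s (q e') \<in> carrier E" "q e \<otimes>\<^bsub>gal K\<^esub> q e' \<in> carrier (gal K)" using e s by auto
  have "e \<otimes>\<^bsub>E\<^esub> e' = t [^]\<^bsub>E\<^esub> n \<otimes>\<^bsub>E\<^esub> (s (q e) \<otimes>\<^bsub>E\<^esub> t [^]\<^bsub>E\<^esub> m) \<otimes>\<^bsub>E\<^esub> s (q e')"
    using c by (subst n, subst m) (simp add: E.m_assoc)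
  also have "\<dots> = t [^]\<^bsub>E\<^esub> n \<otimes>\<^bsub>E\<^esub> t [^]\<^bsub>E\<^esub> m \<otimes>\<^bsub>E\<^esub> (s (q e) \<otimes>\<^bsub>E\<^esub> s (q e'))"
    using c by (simp add: t_pow_central[OF c(1), of m, symmetric] E.m_assoc)
  also have "\<dots> = t [^]\<^bsub>E\<^esub> (n + m + k) \<otimes>\<^bsub>E\<^esub> s (q e \<otimes>\<^bsub>gal K\<^esub> q e')"
    unfolding k(2) using s(1)[OF c(3)] by (simp add: E.m_assoc[symmetric] E.nat_pow_mult t_closed)
  finally have "coset_scalar (e \<otimes>\<^bsub>E\<^esub> e') = \<zeta> ^ (n + m + k)" using coset_scalar_t_pow[OF c(3)] by simp
  moreover have "coset_scalar e = \<zeta> ^ n" "coset_scalar e' = \<zeta> ^ m"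
    using coset_scalar_t_pow[of "q e" n] coset_scalar_t_pow[of "q e'" m] e unfolding n[symmetric] m[symmetric] by auto
  ultimately show ?thesis by (simp add: k(1) power_add)
qed

lemma c_cocycle:
  assumes "\<sigma> \<in> carrier (gal K)" "\<tau> \<in> carrier (gal K)" "\<mu> \<in> carrier (gal K)"
  shows "c \<sigma> \<tau> * c (\<sigma> \<otimes>\<^bsub>gal K\<^esub> \<tau>) \<mu> = c \<tau> \<mu> * c \<sigma> (\<tau> \<otimes>\<^bsub>gal K\<^esub> \<mu>)"
proof -
  have "coset_scalar (s \<sigma> \<otimes>\<^bsub>E\<^esub> s \<tau> \<otimes>\<^bsub>E\<^esub> s \<mu>) = coset_scalar (s \<sigma> \<otimes>\<^bsub>E\<^esub> (s \<tau> \<otimes>\<^bsub>E\<^esub> s \<mu>))"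
    using assms s by (simp add: E.m_assoc)
  then show ?thesis using assms s by (simp add: coset_scalar_mult coset_scalar_s q_mult)
qed

abbreviation "CP \<equiv> crossed_product K c"

lemma CP_carrier: "x \<in> carrier CP \<longleftrightarrow> (\<forall>\<sigma>. if \<sigma> \<in> carrier (gal K) then x \<sigma> \<in> K else x \<sigma> = 0)"
  by (simp add: crossed_product_def)

lemma CP_in: "x \<in> carrier CP \<Longrightarrow> x \<sigma> \<in> K"
  by (cases "\<sigma> \<in> carrier (gal K)") (auto simp: CP_carrier split: if_splits)

lemma CP_out: "x \<in> carrier CP \<Longrightarrow> \<sigma> \<notin> carrier (gal K) \<Longrightarrow> x \<sigma> = 0"
  by (auto simp: CP_carrier split: if_splits)

lemma CPI: "(\<And>\<sigma>. \<sigma> \<in> carrier (gal K) \<Longrightarrow> x \<sigma> \<in> K) \<Longrightarrow> (\<And>\<sigma>. \<sigma> \<notin> carrier (gal K) \<Longrightarrow> x \<sigma> = 0) \<Longrightarrow> x \<in> carrier CP"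
  by (simp add: CP_carrier)

lemma CP_simps:
  "x \<oplus>\<^bsub>CP\<^esub> y = (\<lambda>\<rho>. x \<rho> + y \<rho>)" "r \<odot>\<^bsub>CP\<^esub> x = (\<lambda>\<rho>. to_ac r * x \<rho>)" "\<zero>\<^bsub>CP\<^esub> = (\<lambda>\<rho>. 0)"
  "\<one>\<^bsub>CP\<^esub> = (\<lambda>\<rho>. if \<rho> = \<one>\<^bsub>gal K\<^esub> then to_ac (inverse (c \<one>\<^bsub>gal K\<^esub> \<one>\<^bsub>gal K\<^esub>)) else 0)"
  by (simp_all add: crossed_product_def)

lemma CP_mult: "(x \<otimes>\<^bsub>CP\<^esub> y) \<rho> = (\<Sum>\<sigma>\<in>carrier (gal K). \<Sum>\<tau>\<in>carrier (gal K).
    if \<sigma> \<otimes>\<^bsub>gal K\<^esub> \<tau> = \<rho> then x \<sigma> * \<sigma> (y \<tau>) * to_ac (c \<sigma> \<tau>) else 0)"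
  by (simp add: crossed_product_def)

lemma CP_mult_closed:
  assumes "x \<in> carrier CP" "y \<in> carrier CP" shows "x \<otimes>\<^bsub>CP\<^esub> y \<in> carrier CP"
proof (rule CPI)
  fix \<rho>
  show "(x \<otimes>\<^bsub>CP\<^esub> y) \<rho> \<in> K" unfolding CP_mult
    using CP_in[OF assms(1)] CP_in[OF assms(2)] by (intro sum_in) (auto intro!: mult_in)
  assume "\<rho> \<notin> carrier (gal K)"
  then show "(x \<otimes>\<^bsub>CP\<^esub> y) \<rho> = 0" unfolding CP_mult by (intro sum.neutral ballI) auto
qed

lemma abelian_group_CP: "abelian_group CP"
proof (rule abelian_groupI)
  fix x assume x: "x \<in> carrier CP"
  show "\<exists>y\<in>carrier CP. y \<oplus>\<^bsub>CP\<^esub> x = \<zero>\<^bsub>CP\<^esub>"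
  proof (rule bexI)
    show "(\<lambda>\<rho>. - x \<rho>) \<in> carrier CP" using CP_in[OF x] CP_out[OF x] by (intro CPI) auto
  qed (simp add: CP_simps)
next
  fix x y assume xy: "x \<in> carrier CP" "y \<in> carrier CP"
  show "x \<oplus>\<^bsub>CP\<^esub> y \<in> carrier CP" unfolding CP_simps
    using CP_in[OF xy(1)] CP_in[OF xy(2)] CP_out[OF xy(1)] CP_out[OF xy(2)] by (intro CPI) auto
qed (auto simp: CP_simps CP_carrier add_ac)

lemma CP_mult_assoc:
  assumes x: "x \<in> carrier CP" and y: "y \<in> carrier CP" and z: "z \<in> carrier CP"
  shows "x \<otimes>\<^bsub>CP\<^esub> y \<otimes>\<^bsub>CP\<^esub> z = x \<otimes>\<^bsub>CP\<^esub> (y \<otimes>\<^bsub>CP\<^esub> z)"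
proof
  fix \<rho>
  let ?G = "carrier (gal K)"
  let ?m = "\<lambda>\<sigma> \<tau>. \<sigma> \<otimes>\<^bsub>gal K\<^esub> \<tau>"
  define S where "S = (\<Sum>\<alpha>\<in>?G. \<Sum>\<beta>\<in>?G. \<Sum>\<tau>\<in>?G. if ?m (?m \<alpha> \<beta>) \<tau> = \<rho> then
      x \<alpha> * \<alpha> (y \<beta>) * \<alpha> (\<beta> (z \<tau>)) * to_ac (c \<alpha> \<beta> * c (?m \<alpha> \<beta>) \<tau>) else 0)"
  have "(x \<otimes>\<^bsub>CP\<^esub> y \<otimes>\<^bsub>CP\<^esub> z) \<rho> = (\<Sum>\<sigma>\<in>?G. \<Sum>\<tau>\<in>?G. \<Sum>\<alpha>\<in>?G. \<Sum>\<beta>\<in>?G. if ?m \<alpha> \<beta> = \<sigma> then if ?m \<sigma> \<tau> = \<rho> then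
      x \<alpha> * \<alpha> (y \<beta>) * to_ac (c \<alpha> \<beta>) * \<sigma> (z \<tau>) * to_ac (c \<sigma> \<tau>) else 0 else 0)"
    unfolding CP_mult by (intro sum.cong refl) (auto simp: sum_distrib_right intro!: sum.cong sum.neutral)
  also have "\<dots> = (\<Sum>\<alpha>\<in>?G. \<Sum>\<beta>\<in>?G. \<Sum>\<tau>\<in>?G. \<Sum>\<sigma>\<in>?G. if ?m \<alpha> \<beta> = \<sigma> then if ?m \<sigma> \<tau> = \<rho> then
      x \<alpha> * \<alpha> (y \<beta>) * to_ac (c \<alpha> \<beta>) * \<sigma> (z \<tau>) * to_ac (c \<sigma> \<tau>) else 0 else 0)"
    (is "(\<Sum>\<sigma>\<in>?G. \<Sum>\<tau>\<in>?G. \<Sum>\<alpha>\<in>?G. \<Sum>\<beta>\<in>?G. ?f \<sigma> \<tau> \<alpha> \<beta>) = _")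
  proof -
    have "(\<Sum>\<sigma>\<in>?G. \<Sum>\<tau>\<in>?G. \<Sum>\<alpha>\<in>?G. \<Sum>\<beta>\<in>?G. ?f \<sigma> \<tau> \<alpha> \<beta>) = (\<Sum>\<tau>\<in>?G. \<Sum>\<sigma>\<in>?G. \<Sum>\<alpha>\<in>?G. \<Sum>\<beta>\<in>?G. ?f \<sigma> \<tau> \<alpha> \<beta>)"
      by (rule sum.swap)
    also have "\<dots> = (\<Sum>\<tau>\<in>?G. \<Sum>\<alpha>\<in>?G. \<Sum>\<sigma>\<in>?G. \<Sum>\<beta>\<in>?G. ?f \<sigma> \<tau> \<alpha> \<beta>)" by (rule sum.cong[OF refl], rule sum.swap)
    also have "\<dots> = (\<Sum>\<alpha>\<in>?G. \<Sum>\<tau>\<in>?G. \<Sum>\<sigma>\<in>?G. \<Sum>\<beta>\<in>?G. ?f \<sigma> \<tau> \<alpha> \<beta>)" by (rule sum.swap)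
    also have "\<dots> = (\<Sum>\<alpha>\<in>?G. \<Sum>\<tau>\<in>?G. \<Sum>\<beta>\<in>?G. \<Sum>\<sigma>\<in>?G. ?f \<sigma> \<tau> \<alpha> \<beta>)" by (rule sum.cong[OF refl], rule sum.cong[OF refl], rule sum.swap)
    also have "\<dots> = (\<Sum>\<alpha>\<in>?G. \<Sum>\<beta>\<in>?G. \<Sum>\<tau>\<in>?G. \<Sum>\<sigma>\<in>?G. ?f \<sigma> \<tau> \<alpha> \<beta>)" by (rule sum.cong[OF refl], rule sum.swap)
    finally show ?thesis .
  qed
  also have "\<dots> = S" unfolding S_def
  proof (intro sum.cong refl)
    fix \<alpha> \<beta> \<tau> assume a: "\<alpha> \<in> ?G" "\<beta> \<in> ?G" "\<tau> \<in> ?G"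
    then have "?m \<alpha> \<beta> \<in> ?G" by simp
    then show "(\<Sum>\<sigma>\<in>?G. if ?m \<alpha> \<beta> = \<sigma> then if ?m \<sigma> \<tau> = \<rho> then
        x \<alpha> * \<alpha> (y \<beta>) * to_ac (c \<alpha> \<beta>) * \<sigma> (z \<tau>) * to_ac (c \<sigma> \<tau>) else 0 else 0) =
      (if ?m (?m \<alpha> \<beta>) \<tau> = \<rho> then x \<alpha> * \<alpha> (y \<beta>) * \<alpha> (\<beta> (z \<tau>)) * to_ac (c \<alpha> \<beta> * c (?m \<alpha> \<beta>) \<tau>) else 0)"
      using finite_gal a CP_in[OF z] by (simp add: gal_mult_apply)
  qed
  finally have 1: "(x \<otimes>\<^bsub>CP\<^esub> y \<otimes>\<^bsub>CP\<^esub> z) \<rho> = S" .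
  have "(x \<otimes>\<^bsub>CP\<^esub> (y \<otimes>\<^bsub>CP\<^esub> z)) \<rho> = (\<Sum>\<alpha>\<in>?G. \<Sum>\<sigma>\<in>?G. \<Sum>\<beta>\<in>?G. \<Sum>\<tau>\<in>?G. if ?m \<beta> \<tau> = \<sigma> then if ?m \<alpha> \<sigma> = \<rho> then
      x \<alpha> * \<alpha> (y \<beta> * \<beta> (z \<tau>) * to_ac (c \<beta> \<tau>)) * to_ac (c \<alpha> \<sigma>) else 0 else 0)"
    unfolding CP_mult[of x]
  proof (intro sum.cong refl)
    fix \<alpha> \<sigma> assume a: "\<alpha> \<in> ?G" "\<sigma> \<in> ?G"
    have K: "y \<beta> * \<beta> (z \<tau>) * to_ac (c \<beta> \<tau>) \<in> K" if "\<beta> \<in> ?G" for \<beta> \<tau>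
      using CP_in[OF y] CP_in[OF z] that by (auto intro!: mult_in)
    have "\<alpha> ((y \<otimes>\<^bsub>CP\<^esub> z) \<sigma>) = (\<Sum>\<beta>\<in>?G. \<Sum>\<tau>\<in>?G. \<alpha> (if ?m \<beta> \<tau> = \<sigma> then y \<beta> * \<beta> (z \<tau>) * to_ac (c \<beta> \<tau>) else 0))"
      unfolding CP_mult using a(1) K by (simp add: gal_sum sum_in cong: sum.cong_simp)
    then show "(if ?m \<alpha> \<sigma> = \<rho> then x \<alpha> * \<alpha> ((y \<otimes>\<^bsub>CP\<^esub> z) \<sigma>) * to_ac (c \<alpha> \<sigma>) else 0) =
      (\<Sum>\<beta>\<in>?G. \<Sum>\<tau>\<in>?G. if ?m \<beta> \<tau> = \<sigma> then if ?m \<alpha> \<sigma> = \<rho> then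
        x \<alpha> * \<alpha> (y \<beta> * \<beta> (z \<tau>) * to_ac (c \<beta> \<tau>)) * to_ac (c \<alpha> \<sigma>) else 0 else 0)"
      using a(1) by (auto simp: sum_distrib_left sum_distrib_right gal_0 intro!: sum.cong sum.neutral)
  qed
  also have "\<dots> = (\<Sum>\<alpha>\<in>?G. \<Sum>\<beta>\<in>?G. \<Sum>\<tau>\<in>?G. \<Sum>\<sigma>\<in>?G. if ?m \<beta> \<tau> = \<sigma> then if ?m \<alpha> \<sigma> = \<rho> then
      x \<alpha> * \<alpha> (y \<beta> * \<beta> (z \<tau>) * to_ac (c \<beta> \<tau>)) * to_ac (c \<alpha> \<sigma>) else 0 else 0)"
    (is "(\<Sum>\<alpha>\<in>?G. \<Sum>\<sigma>\<in>?G. \<Sum>\<beta>\<in>?G. \<Sum>\<tau>\<in>?G. ?g \<alpha> \<sigma> \<beta> \<tau>) = _")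
  proof -
    have "(\<Sum>\<alpha>\<in>?G. \<Sum>\<sigma>\<in>?G. \<Sum>\<beta>\<in>?G. \<Sum>\<tau>\<in>?G. ?g \<alpha> \<sigma> \<beta> \<tau>) = (\<Sum>\<alpha>\<in>?G. \<Sum>\<beta>\<in>?G. \<Sum>\<sigma>\<in>?G. \<Sum>\<tau>\<in>?G. ?g \<alpha> \<sigma> \<beta> \<tau>)"
      by (rule sum.cong[OF refl], rule sum.swap)
    also have "\<dots> = (\<Sum>\<alpha>\<in>?G. \<Sum>\<beta>\<in>?G. \<Sum>\<tau>\<in>?G. \<Sum>\<sigma>\<in>?G. ?g \<alpha> \<sigma> \<beta> \<tau>)" by (rule sum.cong[OF refl], rule sum.cong[OF refl], rule sum.swap)
    finally show ?thesis .
  qed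
  also have "\<dots> = S" unfolding S_def
  proof (intro sum.cong refl)
    fix \<alpha> \<beta> \<tau> assume a: "\<alpha> \<in> ?G" "\<beta> \<in> ?G" "\<tau> \<in> ?G"
    then have "?m \<beta> \<tau> \<in> ?G" by simp
    moreover have "\<alpha> (y \<beta> * \<beta> (z \<tau>) * to_ac (c \<beta> \<tau>)) * to_ac (c \<alpha> (?m \<beta> \<tau>)) =
        \<alpha> (y \<beta>) * \<alpha> (\<beta> (z \<tau>)) * to_ac (c \<alpha> \<beta> * c (?m \<alpha> \<beta>) \<tau>)"
      using a CP_in[OF y] CP_in[OF z] unfolding c_cocycle[OF a] by (simp add: gal_mult mult_in gal_base)
    ultimately show "(\<Sum>\<sigma>\<in>?G. if ?m \<beta> \<tau> = \<sigma> then if ?m \<alpha> \<sigma> = \<rho> then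
        x \<alpha> * \<alpha> (y \<beta> * \<beta> (z \<tau>) * to_ac (c \<beta> \<tau>)) * to_ac (c \<alpha> \<sigma>) else 0 else 0) =
      (if ?m (?m \<alpha> \<beta>) \<tau> = \<rho> then x \<alpha> * \<alpha> (y \<beta>) * \<alpha> (\<beta> (z \<tau>)) * to_ac (c \<alpha> \<beta> * c (?m \<alpha> \<beta>) \<tau>) else 0)"
      using finite_gal a by (simp add: G.m_assoc mult.assoc)
  qed
  finally show "(x \<otimes>\<^bsub>CP\<^esub> y \<otimes>\<^bsub>CP\<^esub> z) \<rho> = (x \<otimes>\<^bsub>CP\<^esub> (y \<otimes>\<^bsub>CP\<^esub> z)) \<rho>" using 1 by simp
qed

text \<open>The element \<open>k u\<^sub>e\<close>, where \<open>u\<^sub>e\<close> represents the group element \<open>e\<close>.\<close>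

definition mono :: "'f alg_closure \<Rightarrow> 'e \<Rightarrow> ('f alg_closure \<Rightarrow> 'f alg_closure) \<Rightarrow> 'f alg_closure" where
  "mono k e = (\<lambda>\<rho>. if \<rho> = q e then k * to_ac (coset_scalar e) else 0)"

lemma mono_closed [simp]: "k \<in> K \<Longrightarrow> e \<in> carrier E \<Longrightarrow> mono k e \<in> carrier CP"
  by (rule CPI) (auto simp: mono_def)

lemma mono_mult_left:
  assumes "e \<in> carrier E" "x \<in> carrier CP" "\<rho> \<in> carrier (gal K)"
  shows "(mono k e \<otimes>\<^bsub>CP\<^esub> x) (q e \<otimes>\<^bsub>gal K\<^esub> \<rho>) = k * to_ac (coset_scalar e * c (q e) \<rho>) * q e (x \<rho>)"
proof -
  have "(mono k e \<otimes>\<^bsub>CP\<^esub> x) (q e \<otimes>\<^bsub>gal K\<^esub> \<rho>) = (\<Sum>\<sigma>\<in>carrier (gal K). if \<sigma> = q e then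
      \<Sum>\<tau>\<in>carrier (gal K). if \<tau> = \<rho> then k * to_ac (coset_scalar e * c (q e) \<rho>) * q e (x \<rho>) else 0 else 0)"
    unfolding CP_mult using assms by (intro sum.cong refl) (auto simp: mono_def intro!: sum.cong sum.neutral)
  then show ?thesis using assms finite_gal by simp
qed

lemma mono_mult:
  assumes "k \<in> K" "k' \<in> K" "e \<in> carrier E" "e' \<in> carrier E"
  shows "mono k e \<otimes>\<^bsub>CP\<^esub> mono k' e' = mono (k * q e k') (e \<otimes>\<^bsub>E\<^esub> e')"
proof
  fix \<rho>
  show "(mono k e \<otimes>\<^bsub>CP\<^esub> mono k' e') \<rho> = mono (k * q e k') (e \<otimes>\<^bsub>E\<^esub> e') \<rho>"
  proof (cases "\<rho> \<in> carrier (gal K)")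
    case True
    let ?\<tau> = "inv\<^bsub>gal K\<^esub> (q e) \<otimes>\<^bsub>gal K\<^esub> \<rho>"
    have \<tau>: "?\<tau> \<in> carrier (gal K)" "\<rho> = q e \<otimes>\<^bsub>gal K\<^esub> ?\<tau>"
      using True assms(3) by (simp_all add: G.m_assoc[symmetric])
    have eq: "?\<tau> = q e' \<longleftrightarrow> \<rho> = q (e \<otimes>\<^bsub>E\<^esub> e')"
    proof -
      have "q e \<otimes>\<^bsub>gal K\<^esub> ?\<tau> = q e \<otimes>\<^bsub>gal K\<^esub> q e' \<longleftrightarrow> ?\<tau> = q e'"
        by (rule G.Units_l_cancel[OF _ \<tau>(1) q_closed[OF assms(4)]]) (simp add: assms(3))
      then show ?thesis unfolding \<tau>(2)[symmetric] q_mult[OF assms(3,4)] by blast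
    qed
    have "(mono k e \<otimes>\<^bsub>CP\<^esub> mono k' e') \<rho> = k * to_ac (coset_scalar e * c (q e) ?\<tau>) * q e (mono k' e' ?\<tau>)"
      using mono_mult_left[OF assms(3) mono_closed[OF assms(2,4)] \<tau>(1)] \<tau>(2) by simp
    then show ?thesis
      using assms by (auto simp: mono_def eq[symmetric] coset_scalar_mult gal_mult gal_base gal_0 mult_ac)
  next
    case False
    then show ?thesis
      using CP_out[OF CP_mult_closed[OF mono_closed mono_closed]] CP_out[OF mono_closed, of "k * q e k'" "e \<otimes>\<^bsub>E\<^esub> e'"] assms
      by (simp add: mult_in)
  qed
qed

lemma mono_one: "\<one>\<^bsub>CP\<^esub> = mono 1 \<one>\<^bsub>E\<^esub>"
proof -
  have "coset_scalar \<one>\<^bsub>E\<^esub> * coset_scalar \<one>\<^bsub>E\<^esub> * c \<one>\<^bsub>gal K\<^esub> \<one>\<^bsub>gal K\<^esub> = coset_scalar \<one>\<^bsub>E\<^esub>"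
    using coset_scalar_mult[of "\<one>\<^bsub>E\<^esub>" "\<one>\<^bsub>E\<^esub>"] by (simp add: q_one)
  then have "coset_scalar \<one>\<^bsub>E\<^esub> * c \<one>\<^bsub>gal K\<^esub> \<one>\<^bsub>gal K\<^esub> = 1" using coset_scalar_nonzero[of "\<one>\<^bsub>E\<^esub>"] by simp
  then have "inverse (c \<one>\<^bsub>gal K\<^esub> \<one>\<^bsub>gal K\<^esub>) = coset_scalar \<one>\<^bsub>E\<^esub>"
    using inverse_unique[of "c \<one>\<^bsub>gal K\<^esub> \<one>\<^bsub>gal K\<^esub>" "coset_scalar \<one>\<^bsub>E\<^esub>"] by (simp add: mult.commute)
  then show ?thesis by (auto simp: CP_simps mono_def q_one)
qed

lemma mono_t: "e \<in> carrier E \<Longrightarrow> mono k (t [^]\<^bsub>E\<^esub> (n::nat) \<otimes>\<^bsub>E\<^esub> e) = mono (to_ac \<zeta> ^ n * k) e"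
  by (auto simp: mono_def coset_scalar_t q_mult q_t_pow fun_eq_iff)

lemma mono_scalar: "r \<odot>\<^bsub>CP\<^esub> mono k e = mono (to_ac r * k) e"
  by (auto simp: CP_simps mono_def fun_eq_iff)

lemma assoc_algebra_CP: "assoc_algebra base_ring CP"
proof (rule assoc_algebraI)
  fix x assume x: "x \<in> carrier CP"
  have "(mono 1 \<one>\<^bsub>E\<^esub> \<otimes>\<^bsub>CP\<^esub> x) \<rho> = x \<rho>" for \<rho>
  proof (cases "\<rho> \<in> carrier (gal K)")
    case True
    have "coset_scalar \<one>\<^bsub>E\<^esub> * c \<one>\<^bsub>gal K\<^esub> \<rho> = 1"
      using coset_scalar_mult[of "\<one>\<^bsub>E\<^esub>" "s \<rho>"] True s by (simp add: q_one coset_scalar_s)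
    then show ?thesis using mono_mult_left[of "\<one>\<^bsub>E\<^esub>" x \<rho> 1] True x CP_in[OF x] by (simp add: q_one one_gal_apply)
  next
    case False
    then show ?thesis using CP_out[OF x] CP_out[OF CP_mult_closed[OF _ x]] by simp
  qed
  then show "\<one>\<^bsub>CP\<^esub> \<otimes>\<^bsub>CP\<^esub> x = x" unfolding mono_one by auto
  show "x \<otimes>\<^bsub>CP\<^esub> \<one>\<^bsub>CP\<^esub> = x"
  proof
    fix \<rho>
    show "(x \<otimes>\<^bsub>CP\<^esub> \<one>\<^bsub>CP\<^esub>) \<rho> = x \<rho>"
    proof (cases "\<rho> \<in> carrier (gal K)")
      case True
      have "coset_scalar \<one>\<^bsub>E\<^esub> * c \<rho> \<one>\<^bsub>gal K\<^esub> = 1"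
        using coset_scalar_mult[of "s \<rho>" "\<one>\<^bsub>E\<^esub>"] True s by (simp add: q_one coset_scalar_s)
      then have c1: "to_ac (coset_scalar \<one>\<^bsub>E\<^esub>) * to_ac (c \<rho> \<one>\<^bsub>gal K\<^esub>) = 1"
        unfolding to_ac_mult[symmetric] by simp
      have "(x \<otimes>\<^bsub>CP\<^esub> mono 1 \<one>\<^bsub>E\<^esub>) \<rho> = (\<Sum>\<sigma>\<in>carrier (gal K). \<Sum>\<tau>\<in>carrier (gal K).
          if \<tau> = \<one>\<^bsub>gal K\<^esub> then if \<sigma> = \<rho> then x \<rho> * (to_ac (coset_scalar \<one>\<^bsub>E\<^esub>) * to_ac (c \<rho> \<one>\<^bsub>gal K\<^esub>)) else 0 else 0)"
        unfolding CP_mult by (intro sum.cong refl) (auto simp: mono_def q_one gal_0 gal_base)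
      also have "\<dots> = x \<rho>" using True finite_gal unfolding c1 by simp
      finally show ?thesis unfolding mono_one .
    next
      case False
      then show ?thesis using CP_out[OF x] CP_out[OF CP_mult_closed[OF x mono_closed]] by (simp add: mono_one)
    qed
  qed
  show "r \<odot>\<^bsub>CP\<^esub> x \<in> carrier CP" for r
    using CP_in[OF x] CP_out[OF x] unfolding CP_simps by (intro CPI) auto
  show "(r + u) \<odot>\<^bsub>CP\<^esub> x = r \<odot>\<^bsub>CP\<^esub> x \<oplus>\<^bsub>CP\<^esub> u \<odot>\<^bsub>CP\<^esub> x" "(r * u) \<odot>\<^bsub>CP\<^esub> x = r \<odot>\<^bsub>CP\<^esub> (u \<odot>\<^bsub>CP\<^esub> x)" "1 \<odot>\<^bsub>CP\<^esub> x = x" for r u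
    by (simp_all add: CP_simps algebra_simps)
  fix y assume y: "y \<in> carrier CP"
  show "x \<otimes>\<^bsub>CP\<^esub> y \<in> carrier CP" using x y by (rule CP_mult_closed)
  show "r \<odot>\<^bsub>CP\<^esub> (x \<oplus>\<^bsub>CP\<^esub> y) = r \<odot>\<^bsub>CP\<^esub> x \<oplus>\<^bsub>CP\<^esub> r \<odot>\<^bsub>CP\<^esub> y" for r
    by (simp add: CP_simps algebra_simps)
  show "(r \<odot>\<^bsub>CP\<^esub> x) \<otimes>\<^bsub>CP\<^esub> y = r \<odot>\<^bsub>CP\<^esub> (x \<otimes>\<^bsub>CP\<^esub> y)" for r
    unfolding CP_simps(2)
    by (rule ext) (simp only: CP_mult sum_distrib_left, auto intro!: sum.cong simp: mult_ac CP_simps)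
  show "x \<otimes>\<^bsub>CP\<^esub> (r \<odot>\<^bsub>CP\<^esub> y) = r \<odot>\<^bsub>CP\<^esub> (x \<otimes>\<^bsub>CP\<^esub> y)" for r
    unfolding CP_simps(2) using CP_in[OF y]
    by (intro ext) (simp only: CP_mult sum_distrib_left, auto intro!: sum.cong simp: mult_ac gal_mult gal_base)
  fix z assume z: "z \<in> carrier CP"
  show "x \<otimes>\<^bsub>CP\<^esub> y \<otimes>\<^bsub>CP\<^esub> z = x \<otimes>\<^bsub>CP\<^esub> (y \<otimes>\<^bsub>CP\<^esub> z)" using x y z by (rule CP_mult_assoc)
  show "(x \<oplus>\<^bsub>CP\<^esub> y) \<otimes>\<^bsub>CP\<^esub> z = x \<otimes>\<^bsub>CP\<^esub> z \<oplus>\<^bsub>CP\<^esub> y \<otimes>\<^bsub>CP\<^esub> z"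
    unfolding CP_simps(1)
    by (intro ext) (simp only: CP_mult sum.distrib[symmetric], auto intro!: sum.cong simp: algebra_simps)
  show "z \<otimes>\<^bsub>CP\<^esub> (x \<oplus>\<^bsub>CP\<^esub> y) = z \<otimes>\<^bsub>CP\<^esub> x \<oplus>\<^bsub>CP\<^esub> z \<otimes>\<^bsub>CP\<^esub> y"
    unfolding CP_simps(1) using CP_in[OF x] CP_in[OF y]
    by (intro ext) (simp only: CP_mult sum.distrib[symmetric], auto intro!: sum.cong simp: algebra_simps gal_add)
qed (rule abelian_group_CP, simp add: mono_one)

lemma CP_nontrivial: "\<one>\<^bsub>CP\<^esub> \<noteq> \<zero>\<^bsub>CP\<^esub>"
proof
  assume "\<one>\<^bsub>CP\<^esub> = \<zero>\<^bsub>CP\<^esub>"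
  from fun_cong[OF this, of "\<one>\<^bsub>gal K\<^esub>"] show False
    using coset_scalar_nonzero[of "\<one>\<^bsub>E\<^esub>"] by (simp add: mono_one mono_def q_one CP_simps(3))
qed

lemma mono_add: "mono (k + k') e = mono k e \<oplus>\<^bsub>CP\<^esub> mono k' e"
  by (auto simp: CP_simps mono_def distrib_right)

sublocale CP: monomial_rep K p \<zeta> E q t CP mono
proof (intro monomial_rep.intro monomial_rep_axioms.intro)
  show "central_embedding K p \<zeta> E q t" by (rule central_embedding_axioms)
  show "field_algebra CP" by (rule field_algebra.intro[OF assoc_algebra_CP])
qed (rule mono_closed mono_mult mono_one mono_t mono_scalar mono_add; assumption)+

end

section \<open>Splittings and modules\<close>

text \<open>
  The comparison with \<open>K\<close> uses coordinates, hence the basis of monomials.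
\<close>

locale kummer_monomial_rep = monomial_rep K p \<zeta> E q t A mono + KM: kummer_extension K p \<zeta> I R
  for K :: "'f::field alg_closure set" and p \<zeta> and E :: "'e monoid" and q t and A :: "('f, 'v) module" and mono
    and I :: "'i set" and R
begin

text \<open>
  If the algebra splits, then it has a module \<open>V\<close> whose dimension over \<open>F\<close> is at most \<open>[K : F]\<close>.  For
  \<open>v \<noteq> 0\<close> the map \<open>k \<mapsto> k v\<close> from \<open>K\<close> to \<open>V\<close> is injective, so \<open>V = K v\<close>, and the coefficient of \<open>e v\<close>
  is a splitting.
\<close>

lemma split_imp_splitting:
  fixes N :: "('n, 'f) sc_table"
  assumes h0: "h \<in> algebra_isos A (sc_algebra N)" and split: "table_equiv N (unit_table :: (_, 'f) sc_table)"
    and fin: "finite (sc_index N)" and card: "card (sc_index N) = (p ^ card I) ^ 2"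
    and alg: "assoc_algebra base_ring (sc_algebra N)" and nontriv: "\<one>\<^bsub>sc_algebra N\<^esub> \<noteq> \<zero>\<^bsub>sc_algebra N\<^esub>"
  shows "\<exists>f. splitting f"
proof -
  note h = algebra_isosD[OF h0]
  show ?thesis
  proof (rule split_algebra_module[where 'z = "('i \<Rightarrow> nat) option", OF split fin card alg nontriv])
    fix V and act :: "('n \<Rightarrow> 'f) \<Rightarrow> (nat \<Rightarrow> 'f) \<Rightarrow> (nat \<Rightarrow> 'f)" and v
    assume v: "v \<in> V" "v \<noteq> (\<lambda>_. 0)"
      and act_in: "\<And>x w. x \<in> carrier (sc_algebra N) \<Longrightarrow> w \<in> V \<Longrightarrow> act x w \<in> V"
      and act_one: "\<And>w. w \<in> V \<Longrightarrow> act \<one>\<^bsub>sc_algebra N\<^esub> w = w"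
      and act_mult: "\<And>x y w. x \<in> carrier (sc_algebra N) \<Longrightarrow> y \<in> carrier (sc_algebra N) \<Longrightarrow> w \<in> V \<Longrightarrow>
        act (x \<otimes>\<^bsub>sc_algebra N\<^esub> y) w = act x (act y w)"
      and act_add: "\<And>x y w. x \<in> carrier (sc_algebra N) \<Longrightarrow> y \<in> carrier (sc_algebra N) \<Longrightarrow>
        act (\<lambda>k. x k + y k) w = (\<lambda>k. act x w k + act y w k)"
      and act_scalar: "\<And>r x w. x \<in> carrier (sc_algebra N) \<Longrightarrow> act (\<lambda>k. r * x k) w = (\<lambda>k. r * act x w k)"
      and dependent: "\<And>(Z :: ('i \<Rightarrow> nat) option set) u. finite Z \<Longrightarrow> p ^ card I < card Z \<Longrightarrow> (\<And>a. a \<in> Z \<Longrightarrow> u a \<in> V) \<Longrightarrow>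
        \<exists>r. (\<exists>a\<in>Z. r a \<noteq> 0) \<and> (\<forall>k. (\<Sum>a\<in>Z. r a * u a k) = 0)"
    define w where "w k e = act (h (mono k e)) v" for k e
    have w_in: "w k e \<in> V" if "k \<in> K" "e \<in> carrier E" for k e
      unfolding w_def using that by (intro act_in h(1) v(1) mono_closed)
    have w_one: "w 1 \<one>\<^bsub>E\<^esub> = v" unfolding w_def mono_one[symmetric] h(4) by (rule act_one[OF v(1)])
    have w_add: "w (k + k') e = (\<lambda>i. w k e i + w k' e i)" if "k \<in> K" "k' \<in> K" "e \<in> carrier E" for k k' e
    proof -
      have "h (mono (k + k') e) = (\<lambda>i. h (mono k e) i + h (mono k' e) i)"
        using that by (simp add: mono_add h(3))
      then show ?thesis unfolding w_def using that by (simp add: act_add h(1))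
    qed
    have w_scalar: "w (to_ac r * k) e = (\<lambda>i. r * w k e i)" if "k \<in> K" "e \<in> carrier E" for r k e
    proof -
      have "h (mono (to_ac r * k) e) = (\<lambda>i. r * h (mono k e) i)"
        using that h(5)[of "mono k e" r] by (simp add: mono_scalar)
      then show ?thesis unfolding w_def using that by (simp add: act_scalar h(1))
    qed
    have w_zero: "w 0 \<one>\<^bsub>E\<^esub> = (\<lambda>_. 0)" using w_scalar[of 1 "\<one>\<^bsub>E\<^esub>" 0] by simp
    have w_sum: "w (\<Sum>\<chi>\<in>Z. to_ac (r \<chi>) * KM.monomial \<chi>) \<one>\<^bsub>E\<^esub> = (\<lambda>i. \<Sum>\<chi>\<in>Z. r \<chi> * w (KM.monomial \<chi>) \<one>\<^bsub>E\<^esub> i)"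
      if "finite Z" for Z and r
      using that
    proof (induction Z rule: finite_induct)
      case (insert \<chi> Z)
      have "to_ac (r \<chi>) * KM.monomial \<chi> \<in> K" "(\<Sum>\<chi>\<in>Z. to_ac (r \<chi>) * KM.monomial \<chi>) \<in> K"
        by (auto intro!: sum_in mult_in)
      then show ?case using insert by (simp add: w_add w_scalar)
    qed (simp add: w_zero)
    have w_mult: "w (k * q e k') (e \<otimes>\<^bsub>E\<^esub> e') = act (h (mono k e)) (w k' e')"
      if "k \<in> K" "k' \<in> K" "e \<in> carrier E" "e' \<in> carrier E" for k k' e e'
      unfolding w_def using that v(1) by (simp add: mono_mult[symmetric] h(2) act_mult h(1))
    interpret N: field_algebra "sc_algebra N" by (rule field_algebra.intro[OF alg])
    have act_zero: "act x (\<lambda>_. 0) = (\<lambda>_. 0)" if x: "x \<in> carrier (sc_algebra N)" for x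
    proof -
      have z: "act (\<lambda>_. 0) v = (\<lambda>_. 0)" using act_scalar[OF x, of 0 v] by simp
      have "act (x \<otimes>\<^bsub>sc_algebra N\<^esub> \<zero>\<^bsub>sc_algebra N\<^esub>) v = act x (act \<zero>\<^bsub>sc_algebra N\<^esub> v)"
        using x v(1) by (intro act_mult) (auto simp: sc_carrier)
      moreover have "x \<otimes>\<^bsub>sc_algebra N\<^esub> (\<lambda>_. 0) = (\<lambda>_. 0)" using N.r_null[OF x] by simp
      ultimately show ?thesis using z by simp
    qed
    have w_nonzero: "w k e \<noteq> (\<lambda>_. 0)" if k: "k \<in> K" "k \<noteq> 0" "e \<in> carrier E" for k e
    proof
      assume z: "w k e = (\<lambda>_. 0)"
      let ?e = "inv\<^bsub>E\<^esub> e" and ?k = "inverse (q (inv\<^bsub>E\<^esub> e) k)"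
      have e: "?e \<in> carrier E" using k by simp
      have qk: "q ?e k \<in> K" using k e by simp
      have "q ?e k \<noteq> 0"
        using gal_inverse[of "q ?e" k] k e gal_mult[of "q ?e" k "inverse k"] inverse_in[of k] gal_1[of "q ?e"] by auto
      then have "v = w (?k * q ?e k) (?e \<otimes>\<^bsub>E\<^esub> e)" using k w_one by simp
      also have "\<dots> = act (h (mono ?k ?e)) (w k e)" using k e qk by (intro w_mult inverse_in) auto
      also have "\<dots> = (\<lambda>_. 0)" unfolding z using e qk by (intro act_zero h(1) mono_closed inverse_in)
      finally show False using v(2) by simp
    qed
    have w_inj: "k = k'" if "k \<in> K" "k' \<in> K" "w k \<one>\<^bsub>E\<^esub> = w k' \<one>\<^bsub>E\<^esub>" for k k'
    proof (rule ccontr)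
      assume neq: "k \<noteq> k'"
      have m: "to_ac (- 1) * k' \<in> K" using that by (auto intro: mult_in)
      have "w (k + to_ac (- 1) * k') \<one>\<^bsub>E\<^esub> = (\<lambda>_. 0)"
        using w_add[OF that(1) m E.one_closed] w_scalar[OF that(2) E.one_closed, of "- 1"] that(3) by simp
      moreover have "k + to_ac (- 1) * k' \<noteq> 0" using neq by simp
      ultimately show False using w_nonzero[OF add_in[OF that(1) m] _ E.one_closed] by simp
    qed
    \<comment> \<open>The vector \<open>e v\<close> and the multiples of \<open>v\<close> by the monomials are more vectors than the dimension of \<open>V\<close>.\<close>
    have "\<exists>k\<in>K. w 1 e = w k \<one>\<^bsub>E\<^esub>" if e: "e \<in> carrier E" for e
    proof -
      let ?X = "insert None (Some ` KM.exponents)"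
      let ?u = "\<lambda>a. case a of None \<Rightarrow> w 1 e | Some \<chi> \<Rightarrow> w (KM.monomial \<chi>) \<one>\<^bsub>E\<^esub>"
      have "card ?X = Suc (p ^ card I)" by (simp add: card_image KM.card_exponents)
      moreover have "?u a \<in> V" if "a \<in> ?X" for a using that e w_in by auto
      ultimately have "\<exists>r. (\<exists>a\<in>?X. r a \<noteq> 0) \<and> (\<forall>k. (\<Sum>a\<in>?X. r a * ?u a k) = 0)"
        by (intro dependent) simp_all
      then obtain r where r: "\<exists>a\<in>?X. r a \<noteq> 0" "\<And>k. (\<Sum>a\<in>?X. r a * ?u a k) = 0" by blast
      let ?s = "\<lambda>c. \<Sum>\<chi>\<in>KM.exponents. to_ac (c * r (Some \<chi>)) * KM.monomial \<chi>"
      have s_in: "?s c \<in> K" for c by (auto intro!: sum_in mult_in)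
      have ws: "w (?s c) \<one>\<^bsub>E\<^esub> i = c * (\<Sum>\<chi>\<in>KM.exponents. r (Some \<chi>) * w (KM.monomial \<chi>) \<one>\<^bsub>E\<^esub> i)" for c i
        unfolding w_sum[OF KM.finite_exponents] by (simp add: sum_distrib_left mult.assoc)
      have sum: "r None * w 1 e i + (\<Sum>\<chi>\<in>KM.exponents. r (Some \<chi>) * w (KM.monomial \<chi>) \<one>\<^bsub>E\<^esub> i) = 0" for i
        using r(2)[of i] by (simp add: sum.reindex)
      have "r None \<noteq> 0"
      proof
        assume r0: "r None = 0"
        then have "w (?s 1) \<one>\<^bsub>E\<^esub> = w 0 \<one>\<^bsub>E\<^esub>" unfolding w_zero using sum by (intro ext) (simp add: ws[of 1, simplified])
        then have "?s 1 = 0" using w_inj[OF s_in[of 1], of 0] by simp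
        then have "r (Some \<chi>) = 0" if "\<chi> \<in> KM.exponents" for \<chi>
          using KM.monomials_independent[of "\<lambda>\<chi>. 1 * r (Some \<chi>)" \<chi>] that by simp
        then show False using r(1) r0 by auto
      qed
      moreover have "w 1 e i = w (?s (- 1 / r None)) \<one>\<^bsub>E\<^esub> i" for i
        unfolding ws using sum[of i] calculation by (simp add: field_simps add_eq_0_iff)
      ultimately show ?thesis using s_in by blast
    qed
    then have "\<exists>f. \<forall>e\<in>carrier E. f e \<in> K \<and> w 1 e = w (f e) \<one>\<^bsub>E\<^esub>" by (intro bchoice) blast
    then obtain f where f: "\<And>e. e \<in> carrier E \<Longrightarrow> f e \<in> K" "\<And>e. e \<in> carrier E \<Longrightarrow> w 1 e = w (f e) \<one>\<^bsub>E\<^esub>" by blast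
    have "splitting f" unfolding splitting_def
    proof (intro conjI ballI)
      fix e assume e: "e \<in> carrier E"
      show "f e \<in> K" using f e by simp
      show "f e \<noteq> 0" using w_nonzero[of 1 e] f(2)[OF e] w_zero e by auto
      fix e' assume e': "e' \<in> carrier E"
      have qf: "q e (f e') \<in> K" using f e e' by simp
      have "w (f (e \<otimes>\<^bsub>E\<^esub> e')) \<one>\<^bsub>E\<^esub> = w 1 (e \<otimes>\<^bsub>E\<^esub> e')" using f(2) e e' by simp
      also have "\<dots> = act (h (mono 1 e)) (w 1 e')" using w_mult[of 1 1 e e'] e e' by (simp add: gal_1)
      also have "\<dots> = act (h (mono 1 e)) (w (f e') \<one>\<^bsub>E\<^esub>)" using f(2)[OF e'] by simp
      also have "\<dots> = w (q e (f e')) e" using w_mult[of 1 "f e'" e "\<one>\<^bsub>E\<^esub>"] f(1) e e' by simp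
      also have "\<dots> = act (h (mono (q e (f e')) \<one>\<^bsub>E\<^esub>)) (w 1 e)"
        using w_mult[of "q e (f e')" 1 "\<one>\<^bsub>E\<^esub>" e] qf e by (simp add: q_one one_gal_apply)
      also have "\<dots> = act (h (mono (q e (f e')) \<one>\<^bsub>E\<^esub>)) (w (f e) \<one>\<^bsub>E\<^esub>)" using f(2)[OF e] by simp
      also have "\<dots> = w (q e (f e') * f e) \<one>\<^bsub>E\<^esub>"
        using w_mult[of "q e (f e')" "f e" "\<one>\<^bsub>E\<^esub>" "\<one>\<^bsub>E\<^esub>"] qf f(1) e by (simp add: q_one one_gal_apply)
      finally have "f (e \<otimes>\<^bsub>E\<^esub> e') = q e (f e') * f e" using w_inj qf f(1) e e' by (simp add: mult_in)
      then show "f (e \<otimes>\<^bsub>E\<^esub> e') = f e * q e (f e')" by (simp add: mult.commute)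
    next
      have "w (f t) \<one>\<^bsub>E\<^esub> = w 1 t" using f(2) t_closed by simp
      also have "\<dots> = w (to_ac \<zeta>) \<one>\<^bsub>E\<^esub>"
        using mono_t[of 1 "\<one>\<^bsub>E\<^esub>" 1] t_closed by (simp add: w_def)
      finally show "f t = to_ac \<zeta>" using w_inj f(1) t_closed by simp
    qed
    then show "\<exists>f. splitting f" by blast
  qed
qed

end

locale kummer_central_embedding = central_embedding K p \<zeta> E q t + KM: kummer_extension K p \<zeta> I R
  for K :: "'f::field alg_closure set" and p \<zeta> and E :: "'e monoid" and q t and I :: "'i set" and R
begin

text \<open>The matrix of \<open>x \<mapsto> k f(e) e(x)\<close> with respect to the basis of monomials.\<close>

definition splitting_matrix :: "('e \<Rightarrow> 'f alg_closure) \<Rightarrow> 'f alg_closure \<Rightarrow> 'e \<Rightarrow> ('i \<Rightarrow> nat) \<times> ('i \<Rightarrow> nat) \<Rightarrow> 'f" where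
  "splitting_matrix f k e = (\<lambda>(\<chi>, \<eta>). if \<chi> \<in> KM.exponents \<and> \<eta> \<in> KM.exponents
     then KM.coordinate (k * f e * q e (KM.monomial \<eta>)) \<chi> else 0)"

lemma coordinate_scalar: "x \<in> K \<Longrightarrow> KM.coordinate (to_ac r * x) \<chi> = r * KM.coordinate x \<chi>"
  using KM.coordinate_sum[of "{()}" "\<lambda>_. x" "\<lambda>_. r" \<chi>] by simp

text \<open>
  The semilinear maps \<open>x \<mapsto> k f(e) e(x)\<close> multiply as the products \<open>k e\<close> do, because \<open>f\<close> is a crossed
  homomorphism.
\<close>

lemma splitting_matrix_rep:
  assumes f: "splitting f"
  shows "monomial_rep K p \<zeta> E q t (sc_algebra (mat_table KM.exponents)) (splitting_matrix f)"
proof -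
  have f_in: "f e \<in> K" "f e \<noteq> 0" if "e \<in> carrier E" for e using f that by (auto simp: splitting_def)
  have f_mult: "f (e \<otimes>\<^bsub>E\<^esub> e') = f e * q e (f e')" if "e \<in> carrier E" "e' \<in> carrier E" for e e'
    using f that by (auto simp: splitting_def)
  have f_t: "f t = to_ac \<zeta>" using f by (simp add: splitting_def)
  have "f \<one>\<^bsub>E\<^esub> = f \<one>\<^bsub>E\<^esub> * f \<one>\<^bsub>E\<^esub>" using f_mult[of "\<one>\<^bsub>E\<^esub>" "\<one>\<^bsub>E\<^esub>"] f_in by (simp add: q_one one_gal_apply)
  then have f_one: "f \<one>\<^bsub>E\<^esub> = 1" using f_in(2)[of "\<one>\<^bsub>E\<^esub>"] by (metis E.one_closed mult_cancel_left1)
  have f_t_pow: "f (t [^]\<^bsub>E\<^esub> n) = to_ac \<zeta> ^ n" for n :: nat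
  proof (induction n)
    case (Suc n)
    have "f (t [^]\<^bsub>E\<^esub> Suc n) = f (t [^]\<^bsub>E\<^esub> n) * q (t [^]\<^bsub>E\<^esub> n) (to_ac \<zeta>)"
      using f_mult[of "t [^]\<^bsub>E\<^esub> n" t] t_closed f_t by simp
    then show ?case by (simp add: Suc q_t_pow one_gal_apply mult.commute)
  qed (simp add: f_one)
  have in_K: "k * f e * q e x \<in> K" if "k \<in> K" "e \<in> carrier E" "x \<in> K" for k e x
    using that f_in by (intro mult_in) auto
  show ?thesis
  proof (intro monomial_rep.intro monomial_rep_axioms.intro)
    show "central_embedding K p \<zeta> E q t" by (rule central_embedding_axioms)
    show "field_algebra (sc_algebra (mat_table KM.exponents :: (_, 'f) sc_table))"
      by (rule field_algebra.intro[OF assoc_algebra_mat_table]) simp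
    show "\<one>\<^bsub>sc_algebra (mat_table KM.exponents)\<^esub> = splitting_matrix f 1 \<one>\<^bsub>E\<^esub>"
    proof
      fix x :: "('i \<Rightarrow> nat) \<times> ('i \<Rightarrow> nat)"
      show "\<one>\<^bsub>sc_algebra (mat_table KM.exponents)\<^esub> x = splitting_matrix f 1 \<one>\<^bsub>E\<^esub> x"
        by (cases x) (auto simp: splitting_matrix_def sc_one f_one q_one one_gal_apply KM.coordinate_monomial)
    qed
    fix k e assume k: "k \<in> K" and e: "e \<in> carrier E"
    show "splitting_matrix f k e \<in> carrier (sc_algebra (mat_table KM.exponents))"
      by (auto simp: splitting_matrix_def sc_carrier)
    show "r \<odot>\<^bsub>sc_algebra (mat_table KM.exponents)\<^esub> splitting_matrix f k e = splitting_matrix f (to_ac r * k) e" for r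
      using coordinate_scalar[OF in_K[OF k e KM.monomial_in]]
      by (auto simp: splitting_matrix_def mult.assoc)
    show "splitting_matrix f k (t [^]\<^bsub>E\<^esub> n \<otimes>\<^bsub>E\<^esub> e) = splitting_matrix f (to_ac \<zeta> ^ n * k) e" for n :: nat
      using e f_in by (auto simp: splitting_matrix_def f_mult f_t_pow q_t_pow q_mult one_gal_apply mult_ac fun_eq_iff)
    fix k' assume k': "k' \<in> K"
    show "splitting_matrix f (k + k') e = splitting_matrix f k e \<oplus>\<^bsub>sc_algebra (mat_table KM.exponents)\<^esub> splitting_matrix f k' e"
    proof -
      have "KM.coordinate (k * f e * q e (KM.monomial \<eta>) + k' * f e * q e (KM.monomial \<eta>)) \<chi> =
          KM.coordinate (k * f e * q e (KM.monomial \<eta>)) \<chi> + KM.coordinate (k' * f e * q e (KM.monomial \<eta>)) \<chi>" for \<eta> \<chi>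
        using KM.coordinate_sum[of "{k, k'}" "\<lambda>k. k * f e * q e (KM.monomial \<eta>)" "\<lambda>_. 1" \<chi>]
          KM.coordinate_sum[of "{0::nat, 1}" "\<lambda>i. (if i = 0 then k else k') * f e * q e (KM.monomial \<eta>)" "\<lambda>_. 1" \<chi>]
          in_K[OF k e KM.monomial_in] in_K[OF k' e KM.monomial_in] by simp
      then show ?thesis by (auto simp: splitting_matrix_def distrib_right)
    qed
    fix e' assume e': "e' \<in> carrier E"
    show "splitting_matrix f k e \<otimes>\<^bsub>sc_algebra (mat_table KM.exponents)\<^esub> splitting_matrix f k' e' =
        splitting_matrix f (k * q e k') (e \<otimes>\<^bsub>E\<^esub> e')"
    proof
      fix x :: "('i \<Rightarrow> nat) \<times> ('i \<Rightarrow> nat)"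
      obtain \<chi> \<eta> where x: "x = (\<chi>, \<eta>)" by (cases x)
      show "(splitting_matrix f k e \<otimes>\<^bsub>sc_algebra (mat_table KM.exponents)\<^esub> splitting_matrix f k' e') x =
        splitting_matrix f (k * q e k') (e \<otimes>\<^bsub>E\<^esub> e') x"
      proof (cases "\<chi> \<in> KM.exponents \<and> \<eta> \<in> KM.exponents")
        case True
        let ?y = "k' * f e' * q e' (KM.monomial \<eta>)"
        have y: "?y \<in> K" by (rule in_K[OF k' e' KM.monomial_in])
        have "k * f e * q e ?y = k * f e * q e (\<Sum>\<mu>\<in>KM.exponents. to_ac (KM.coordinate ?y \<mu>) * KM.monomial \<mu>)"
          using KM.monomials_span[OF y] by simp
        also have "\<dots> = (\<Sum>\<mu>\<in>KM.exponents. to_ac (KM.coordinate ?y \<mu>) * (k * f e * q e (KM.monomial \<mu>)))"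
          using e by (subst gal_sum) (auto simp: gal_mult gal_base sum_distrib_left mult_ac intro!: mult_in)
        finally have "KM.coordinate (k * f e * q e ?y) \<chi> =
            KM.coordinate (\<Sum>\<mu>\<in>KM.exponents. to_ac (KM.coordinate ?y \<mu>) * (k * f e * q e (KM.monomial \<mu>))) \<chi>" by simp
        also have "\<dots> = (\<Sum>\<mu>\<in>KM.exponents. KM.coordinate ?y \<mu> * KM.coordinate (k * f e * q e (KM.monomial \<mu>)) \<chi>)"
          by (rule KM.coordinate_sum) (rule in_K[OF k e KM.monomial_in])
        finally have 1: "KM.coordinate (k * f e * q e ?y) \<chi> =
            (\<Sum>\<mu>\<in>KM.exponents. KM.coordinate (k * f e * q e (KM.monomial \<mu>)) \<chi> * KM.coordinate ?y \<mu>)"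
          by (simp add: mult.commute)
        have c: "f e' \<in> K" "q e' (KM.monomial \<eta>) \<in> K" using f_in e' by auto
        have 2: "k * f e * q e ?y = k * q e k' * f (e \<otimes>\<^bsub>E\<^esub> e') * q (e \<otimes>\<^bsub>E\<^esub> e') (KM.monomial \<eta>)"
          using e e' k' c by (simp add: gal_mult mult_in f_mult q_mult_apply mult_ac)
        show ?thesis
          unfolding x mat_table_mult[OF KM.finite_exponents] splitting_matrix_def prod.case 2[symmetric]
          using True 1 by simp
      next
        case False
        then show ?thesis unfolding x mat_table_mult[OF KM.finite_exponents] by (auto simp: splitting_matrix_def)
      qed
    qed
  qed
qed

end

section \<open>Four commuting symbol pairs\<close>

definition four_symbols_group :: "nat \<Rightarrow> (((nat \<times> nat) \<times> (nat \<times> nat)) \<times> ((nat \<times> nat) \<times> (nat \<times> nat))) monoid" where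
  "four_symbols_group p = (symbol_group p \<times>\<times> symbol_group p) \<times>\<times> (symbol_group p \<times>\<times> symbol_group p)"

definition four_symbols_twist :: "nat \<Rightarrow> 'f::field \<Rightarrow> 'f \<Rightarrow> 'f \<Rightarrow> 'f \<Rightarrow> 'f \<Rightarrow>
    ((nat \<times> nat) \<times> (nat \<times> nat)) \<times> ((nat \<times> nat) \<times> (nat \<times> nat)) \<Rightarrow>
    ((nat \<times> nat) \<times> (nat \<times> nat)) \<times> ((nat \<times> nat) \<times> (nat \<times> nat)) \<Rightarrow> 'f" where
  "four_symbols_twist p \<zeta> a b c d = (\<lambda>(g, h) (g', h').
     (\<lambda>(g, h) (g', h'). symbol_twist p \<zeta> 1 a g g' * symbol_twist p \<zeta> 1 c h h') g g' *
     (\<lambda>(g, h) (g', h'). symbol_twist p \<zeta> a b g g' * symbol_twist p \<zeta> d c h h') h h')"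

text \<open>
  The tensor product of \<open>(1, a)\<close>, \<open>(1, c)\<close>, \<open>(a, b)\<close> and \<open>(d, c)\<close>.  The first two factors split; they are
  needed to reach the dimension of the crossed product.
\<close>

definition four_symbols_table :: "nat \<Rightarrow> 'f::field \<Rightarrow> 'f \<Rightarrow> 'f \<Rightarrow> 'f \<Rightarrow> 'f \<Rightarrow>
    (((nat \<times> nat) \<times> (nat \<times> nat)) \<times> ((nat \<times> nat) \<times> (nat \<times> nat)), 'f) sc_table" where
  "four_symbols_table p \<zeta> a b c d = sc_tensor
     (sc_tensor (symbol_table p \<zeta> 1 a) (symbol_table p \<zeta> 1 c)) (sc_tensor (symbol_table p \<zeta> a b) (symbol_table p \<zeta> d c))"

lemma four_symbols_table_twisted:
  "four_symbols_table p \<zeta> a b c d = twisted_table (four_symbols_group p) (four_symbols_twist p \<zeta> a b c d)"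
  unfolding four_symbols_table_def symbol_tensor_twisted twisted_table_DirProd
  by (simp only: four_symbols_group_def four_symbols_twist_def)

lemma card_four_symbols_group: "card (carrier (four_symbols_group p)) = (p ^ 4) ^ 2"
  by (simp add: four_symbols_group_def card_cartesian_product power2_eq_square power4_eq_xxxx mult_ac)

lemma (in field_algebra) four_symbol_pairs_projective_rep:
  assumes s: "symbol_pair p \<zeta> 1 a i1 j1" "symbol_pair p \<zeta> 1 c i2 j2" "symbol_pair p \<zeta> a b i3 j3" "symbol_pair p \<zeta> d c i4 j4"
    and c: "commuting_pairs i1 j1 i2 j2" "commuting_pairs i3 j3 i4 j4" "commuting_pairs i1 j1 i3 j3"
      "commuting_pairs i1 j1 i4 j4" "commuting_pairs i2 j2 i3 j3" "commuting_pairs i2 j2 i4 j4"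
    and p: "p > 0"
  shows "\<exists>\<rho>. projective_rep (four_symbols_group p) (four_symbols_twist p \<zeta> a b c d) A \<rho>"
proof -
  let ?w = "\<lambda>i j. (\<lambda>(r::nat, s::nat). i [^] r \<otimes> j [^] s)"
  have g: "group (symbol_group p \<times>\<times> symbol_group p)"
    using comm_group_residue_group[OF p] by (auto intro!: DirProd_group simp: comm_group_def)
  have w_in: "?w i j x \<in> carrier A" if "symbol_pair p \<zeta> u v i j" for u v i j x
    using that by (auto simp: symbol_pair_def split: prod.splits)
  have w_comm: "q_commute 1 (?w i j x) (?w i' j' y)"
    if "symbol_pair p \<zeta> u v i j" "symbol_pair p \<zeta> u' v' i' j'" "commuting_pairs i j i' j'" for u v u' v' i j i' j' x y
    using commuting_words[OF that] w_in[OF that(1)] w_in[OF that(2)]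
    by (cases x; cases y) (auto simp: q_commute_def symbol_pair_def)
  have comm: "(?w i1 j1 x \<otimes> ?w i2 j2 y) \<otimes> (?w i3 j3 z \<otimes> ?w i4 j4 w) = (?w i3 j3 z \<otimes> ?w i4 j4 w) \<otimes> (?w i1 j1 x \<otimes> ?w i2 j2 y)"
    for x y z w
  proof -
    have i: "?w i1 j1 x \<in> carrier A" "?w i2 j2 y \<in> carrier A" "?w i3 j3 z \<in> carrier A" "?w i4 j4 w \<in> carrier A"
      using w_in[OF s(1)] w_in[OF s(2)] w_in[OF s(3)] w_in[OF s(4)] by blast+
    have "q_commute ((1 * 1) * (1 * 1)) (?w i1 j1 x \<otimes> ?w i2 j2 y) (?w i3 j3 z \<otimes> ?w i4 j4 w)"
      by (intro q_commute_mult_right q_commute_mult_left w_comm[OF s(1) s(3) c(3)] w_comm[OF s(1) s(4) c(4)]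
          w_comm[OF s(2) s(3) c(5)] w_comm[OF s(2) s(4) c(6)] i m_closed)
    then show ?thesis unfolding q_commute_def using i by (simp del: split_paired_All)
  qed
  show ?thesis
    unfolding four_symbols_group_def four_symbols_twist_def
  proof (rule exI, rule projective_rep_commuting[OF two_symbol_pairs_projective_rep[OF s(1,2) c(1) p] two_symbol_pairs_projective_rep[OF s(3,4) c(2) p] g g])
    fix g h :: "(nat \<times> nat) \<times> (nat \<times> nat)"
    obtain x y where g: "g = (x, y)" by (cases g)
    obtain z w where h: "h = (z, w)" by (cases h)
    show "(\<lambda>(g, h). ?w i1 j1 g \<otimes> ?w i2 j2 h) g \<otimes> (\<lambda>(g, h). ?w i3 j3 g \<otimes> ?w i4 j4 h) h =
        (\<lambda>(g, h). ?w i3 j3 g \<otimes> ?w i4 j4 h) h \<otimes> (\<lambda>(g, h). ?w i1 j1 g \<otimes> ?w i2 j2 h) g"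
      unfolding g h prod.case by (rule comm[unfolded prod.case])
  qed
qed

lemma (in symbol_algebras) four_symbols_nondegenerate:
  assumes "a \<noteq> 0" "b \<noteq> 0" "c \<noteq> 0" "d \<noteq> 0"
  shows "nondegenerate_twist (four_symbols_group p) (four_symbols_twist p \<zeta> a b c d)"
  unfolding four_symbols_group_def four_symbols_twist_def
  by (rule nondegenerate_twist_DirProd[OF tensor_twist tensor_twist]) (use assms in auto)

text \<open>
  The factors \<open>(1, a)\<close> and \<open>(1, c)\<close> are matrix algebras.
\<close>

lemma (in symbol_algebras) four_symbols_equiv:
  assumes "a \<noteq> 0" "c \<noteq> 0"
  shows "table_equiv (four_symbols_table p \<zeta> a b c d) (sc_tensor (symb a b) (symb d c))"
  unfolding four_symbols_table_def
  by (rule table_equiv_split_left[OF table_equiv_trans[OF table_equiv_split_left[OF symbol_one_equiv[OF assms(1)]] symbol_one_equiv[OF assms(2)]]])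

section \<open>Embedding problems for the central product\<close>

text \<open>
  The elements \<open>xa, xb, xc, xd\<close> stand for \<open>s\<^sub>a\<^sup>-\<^sup>1, s\<^sub>b\<^sup>-\<^sup>1, s\<^sub>c\<^sup>-\<^sup>1, s\<^sub>d\<close>.  With this choice both pairs have the
  commutator \<open>t\<close>, and \<open>xa, xc\<close> act on their radicals by \<open>\<zeta>\<^sup>-\<^sup>1\<close>, as the first members of symbol pairs
  with second members \<open>ra, rc\<close> must do.
\<close>

locale heisenberg_embedding = central_embedding K p \<zeta> E q t
  for K :: "'f::field alg_closure set" and p \<zeta> and E :: "'e monoid" and q t +
  fixes a b c d :: 'f and ra rb rc rd :: "'f alg_closure" and xa xb xc xd :: 'e
  assumes nonzero: "a \<noteq> 0" "b \<noteq> 0" "c \<noteq> 0" "d \<noteq> 0"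
    and radicals: "ra ^ p = to_ac a" "rb ^ p = to_ac b" "rc ^ p = to_ac c" "rd ^ p = to_ac d"
    and K_adjoin: "K = adjoin {ra, rb, rc, rd}"
    and card_gal: "card (carrier (gal K)) = p ^ 4" and char: "of_nat p \<noteq> (0 :: 'f)"
    and gens: "xa \<in> carrier E" "xb \<in> carrier E" "xc \<in> carrier E" "xd \<in> carrier E"
    and gens_pow: "xa [^]\<^bsub>E\<^esub> p = \<one>\<^bsub>E\<^esub>" "xb [^]\<^bsub>E\<^esub> p = \<one>\<^bsub>E\<^esub>" "xc [^]\<^bsub>E\<^esub> p = \<one>\<^bsub>E\<^esub>" "xd [^]\<^bsub>E\<^esub> p = \<one>\<^bsub>E\<^esub>"
    and gens_t: "xa \<otimes>\<^bsub>E\<^esub> xb = t \<otimes>\<^bsub>E\<^esub> (xb \<otimes>\<^bsub>E\<^esub> xa)" "xc \<otimes>\<^bsub>E\<^esub> xd = t \<otimes>\<^bsub>E\<^esub> (xd \<otimes>\<^bsub>E\<^esub> xc)"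
    and gens_comm: "xa \<otimes>\<^bsub>E\<^esub> xc = xc \<otimes>\<^bsub>E\<^esub> xa" "xa \<otimes>\<^bsub>E\<^esub> xd = xd \<otimes>\<^bsub>E\<^esub> xa"
      "xb \<otimes>\<^bsub>E\<^esub> xc = xc \<otimes>\<^bsub>E\<^esub> xb" "xb \<otimes>\<^bsub>E\<^esub> xd = xd \<otimes>\<^bsub>E\<^esub> xb"
    and action_a: "q xa ra = ra / to_ac \<zeta>" "q xa rb = rb" "q xa rc = rc" "q xa rd = rd"
    and action_b: "q xb ra = ra" "q xb rb = rb / to_ac \<zeta>" "q xb rc = rc" "q xb rd = rd"
    and action_c: "q xc ra = ra" "q xc rb = rb" "q xc rc = rc / to_ac \<zeta>" "q xc rd = rd"
    and action_d: "q xd ra = ra" "q xd rb = rb" "q xd rc = rc" "q xd rd = to_ac \<zeta> * rd"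
begin

lemma radicals_in [simp]: "ra \<in> K" "rb \<in> K" "rc \<in> K" "rd \<in> K"
  unfolding K_adjoin adjoin_def by (auto intro: generate_field.incl)

lemma radicals_nonzero: "ra \<noteq> 0" "rb \<noteq> 0" "rc \<noteq> 0" "rd \<noteq> 0"
  using radicals nonzero p_pos by (auto simp: power_0_left)

end

lemma (in central_embedding) q_inv_apply:
  assumes "e \<in> carrier E" "x \<in> K" "q e x = to_ac u * x" "u \<noteq> 0"
  shows "q (inv\<^bsub>E\<^esub> e) x = x / to_ac u"
proof -
  have "x = q (inv\<^bsub>E\<^esub> e) (q e x)"
    using assms q_mult_apply[of "inv\<^bsub>E\<^esub> e" e x] by (simp add: q_one one_gal_apply)
  also have "\<dots> = to_ac u * q (inv\<^bsub>E\<^esub> e) x"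
    unfolding assms(3) using assms by (simp add: gal_mult gal_base)
  finally show ?thesis using assms(4) by (simp add: field_simps)
qed

sublocale heisenberg_embedding \<subseteq> KM: kummer_extension K p \<zeta> "{..<4::nat}" "\<lambda>i. [ra, rb, rc, rd] ! i"
proof (intro kummer_extension.intro kummer_extension_axioms.intro)
  have I: "{..<4::nat} = {0, 1, 2, 3}" by auto
  show "extension_field K" by (rule extension_field_axioms)
  show "K = adjoin ((\<lambda>i. [ra, rb, rc, rd] ! i) ` {..<4::nat})" unfolding I K_adjoin by simp
  fix i :: nat assume i: "i \<in> {..<4}"
  then have i: "i = 0 \<or> i = 1 \<or> i = 2 \<or> i = 3" by auto
  then show "[ra, rb, rc, rd] ! i \<noteq> 0" "([ra, rb, rc, rd] ! i) ^ p \<in> range to_ac"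
    using radicals_nonzero radicals by auto
  have inv: "q (inv\<^bsub>E\<^esub> e) x = to_ac \<zeta> * x" if "e \<in> carrier E" "x \<in> K" "q e x = x / to_ac \<zeta>" for e x
    using q_inv_apply[OF that(1,2), of "inverse \<zeta>"] that(3) by (simp add: divide_inverse mult.commute)
  have fix_inv: "q (inv\<^bsub>E\<^esub> e) x = x" if "e \<in> carrier E" "x \<in> K" "q e x = x" for e x
    using q_inv_apply[OF that(1,2), of 1] that(3) by simp
  show "\<exists>\<sigma>\<in>carrier (gal K). \<sigma> ([ra, rb, rc, rd] ! i) = to_ac \<zeta> * [ra, rb, rc, rd] ! i \<and>
      (\<forall>j\<in>{..<4} - {i}. \<sigma> ([ra, rb, rc, rd] ! j) = [ra, rb, rc, rd] ! j)"
    unfolding I using i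
  proof (elim disjE)
    assume "i = 0"
    then show "\<exists>\<sigma>\<in>carrier (gal K). \<sigma> ([ra, rb, rc, rd] ! i) = to_ac \<zeta> * [ra, rb, rc, rd] ! i \<and>
      (\<forall>j\<in>{0, 1, 2, 3} - {i}. \<sigma> ([ra, rb, rc, rd] ! j) = [ra, rb, rc, rd] ! j)"
      using gens by (intro bexI[of _ "q (inv\<^bsub>E\<^esub> xa)"]) (auto simp: inv fix_inv action_a)
  next
    assume "i = 1"
    then show "\<exists>\<sigma>\<in>carrier (gal K). \<sigma> ([ra, rb, rc, rd] ! i) = to_ac \<zeta> * [ra, rb, rc, rd] ! i \<and>
      (\<forall>j\<in>{0, 1, 2, 3} - {i}. \<sigma> ([ra, rb, rc, rd] ! j) = [ra, rb, rc, rd] ! j)"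
      using gens by (intro bexI[of _ "q (inv\<^bsub>E\<^esub> xb)"]) (auto simp: inv fix_inv action_b)
  next
    assume "i = 2"
    then show "\<exists>\<sigma>\<in>carrier (gal K). \<sigma> ([ra, rb, rc, rd] ! i) = to_ac \<zeta> * [ra, rb, rc, rd] ! i \<and>
      (\<forall>j\<in>{0, 1, 2, 3} - {i}. \<sigma> ([ra, rb, rc, rd] ! j) = [ra, rb, rc, rd] ! j)"
      using gens by (intro bexI[of _ "q (inv\<^bsub>E\<^esub> xc)"]) (auto simp: inv fix_inv action_c)
  next
    assume "i = 3"
    then show "\<exists>\<sigma>\<in>carrier (gal K). \<sigma> ([ra, rb, rc, rd] ! i) = to_ac \<zeta> * [ra, rb, rc, rd] ! i \<and>
      (\<forall>j\<in>{0, 1, 2, 3} - {i}. \<sigma> ([ra, rb, rc, rd] ! j) = [ra, rb, rc, rd] ! j)"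
      using gens by (intro bexI[of _ "q xd"]) (auto simp: action_d)
  qed
qed (use p \<zeta> char galois card_gal in auto)

sublocale heisenberg_embedding \<subseteq> SA: symbol_algebras p \<zeta>
  by (rule symbol_algebras.intro[OF p_gt_1 \<zeta>])

context monomial_rep
begin

lemma mono_commute:
  assumes "k \<in> K" "k' \<in> K" "e \<in> carrier E" "e' \<in> carrier E"
    and "k * q e k' = k' * q e' k" "e \<otimes>\<^bsub>E\<^esub> e' = e' \<otimes>\<^bsub>E\<^esub> e"
  shows "A.q_commute 1 (mono k e) (mono k' e')"
  using mono_q_commute[OF assms(1-4), of 1 0] assms(5,6) assms(1-4) by simp

text \<open>
  The factor \<open>\<zeta>\<close> from the commutator \<open>t\<close> cancels the factor \<open>\<zeta>\<^sup>-\<^sup>1\<close> from the action on the coefficients.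
\<close>

lemma mono_commute_t:
  assumes "k \<in> K" "k' \<in> K" "e \<in> carrier E" "e' \<in> carrier E"
    and "to_ac \<zeta> * (k * q e k') = k' * q e' k" "e \<otimes>\<^bsub>E\<^esub> e' = t \<otimes>\<^bsub>E\<^esub> (e' \<otimes>\<^bsub>E\<^esub> e)"
  shows "A.q_commute 1 (mono k e) (mono k' e')"
proof -
  have "k * q e k' = to_ac (inverse \<zeta>) * (k' * q e' k)" unfolding assms(5)[symmetric] by simp
  then show ?thesis using mono_q_commute[OF assms(1-4), of "inverse \<zeta>" 1] assms(6) t_closed by simp
qed

lemma mono_symbol_pair:
  assumes k: "k \<in> K" "k' \<in> K" "e \<in> carrier E" "e' \<in> carrier E"
    and "q e k = k" "q e' k' = k'" "k ^ p = to_ac u" "k' ^ p = to_ac v" "e [^]\<^bsub>E\<^esub> p = \<one>\<^bsub>E\<^esub>" "e' [^]\<^bsub>E\<^esub> p = \<one>\<^bsub>E\<^esub>"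
    and "k' * q e' k = to_ac \<zeta> * (k * q e k')" "e' \<otimes>\<^bsub>E\<^esub> e = e \<otimes>\<^bsub>E\<^esub> e'"
  shows "A.symbol_pair p \<zeta> u v (mono k e) (mono k' e')"
proof -
  have "A.q_commute \<zeta> (mono k' e') (mono k e)"
    using mono_q_commute[OF k(2,1,4,3), of \<zeta> 0] assms(11,12) k by simp
  moreover have "mono k e [^]\<^bsub>A\<^esub> p = u \<odot>\<^bsub>A\<^esub> \<one>\<^bsub>A\<^esub>" "mono k' e' [^]\<^bsub>A\<^esub> p = v \<odot>\<^bsub>A\<^esub> \<one>\<^bsub>A\<^esub>"
    unfolding mono_one mono_pow[OF k(1) assms(5) k(3)] mono_pow[OF k(2) assms(6) k(4)] assms(7-10)
    by (simp_all add: mono_scalar)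
  ultimately show ?thesis using k by (simp add: A.symbol_pair_def)
qed

end

locale heisenberg_rep = heisenberg_embedding K p \<zeta> E q t a b c d ra rb rc rd xa xb xc xd + monomial_rep K p \<zeta> E q t A mono
  for K :: "'f::field alg_closure set" and p \<zeta> and E :: "'e monoid" and q t a b c d ra rb rc rd xa xb xc xd
    and A :: "('f, 'v) module" and mono
begin

lemma q_units: "x \<in> K \<Longrightarrow> q \<one>\<^bsub>E\<^esub> x = x" "e \<in> carrier E \<Longrightarrow> q e 1 = 1"
  by (simp_all add: q_one one_gal_apply gal_1)

lemmas actions = q_units action_a action_b action_c action_d gens gens_pow gens_comm radicals

text \<open>
  The factors \<open>xb\<close> and \<open>xd\<close> are attached to \<open>ra\<close> and \<open>rc\<close> to make the third and fourth pair commute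
  with the first two: \<open>xa\<close> commutes neither with \<open>ra\<close> nor with \<open>xb\<close>, but with their product.
\<close>

lemma four_symbols_rep: "\<exists>\<rho>. projective_rep (four_symbols_group p) (four_symbols_twist p \<zeta> a b c d) A \<rho>"
proof (rule A.four_symbol_pairs_projective_rep)
  show "A.symbol_pair p \<zeta> 1 a (mono 1 xa) (mono ra \<one>\<^bsub>E\<^esub>)"
    by (rule mono_symbol_pair) (simp_all add: actions)
  show "A.symbol_pair p \<zeta> 1 c (mono 1 xc) (mono rc \<one>\<^bsub>E\<^esub>)"
    by (rule mono_symbol_pair) (simp_all add: actions)
  show "A.symbol_pair p \<zeta> a b (mono ra xb) (mono rb \<one>\<^bsub>E\<^esub>)"
    by (rule mono_symbol_pair) (simp_all add: actions)
  show "A.symbol_pair p \<zeta> d c (mono rd \<one>\<^bsub>E\<^esub>) (mono rc xd)"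
    by (rule mono_symbol_pair) (simp_all add: actions mult_ac)
  show "A.commuting_pairs (mono 1 xa) (mono ra \<one>\<^bsub>E\<^esub>) (mono 1 xc) (mono rc \<one>\<^bsub>E\<^esub>)"
    unfolding A.commuting_pairs_def by (intro conjI; rule mono_commute) (simp_all add: actions mult_ac)
  show "A.commuting_pairs (mono ra xb) (mono rb \<one>\<^bsub>E\<^esub>) (mono rd \<one>\<^bsub>E\<^esub>) (mono rc xd)"
    unfolding A.commuting_pairs_def by (intro conjI; rule mono_commute) (simp_all add: actions mult_ac)
  show "A.commuting_pairs (mono 1 xa) (mono ra \<one>\<^bsub>E\<^esub>) (mono rd \<one>\<^bsub>E\<^esub>) (mono rc xd)"
    unfolding A.commuting_pairs_def by (intro conjI; rule mono_commute) (simp_all add: actions mult_ac)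
  show "A.commuting_pairs (mono 1 xc) (mono rc \<one>\<^bsub>E\<^esub>) (mono ra xb) (mono rb \<one>\<^bsub>E\<^esub>)"
    unfolding A.commuting_pairs_def by (intro conjI; rule mono_commute) (simp_all add: actions mult_ac)
  show "A.commuting_pairs (mono 1 xa) (mono ra \<one>\<^bsub>E\<^esub>) (mono ra xb) (mono rb \<one>\<^bsub>E\<^esub>)"
    unfolding A.commuting_pairs_def
  proof (intro conjI)
    show "A.q_commute 1 (mono 1 xa) (mono ra xb)"
      by (rule mono_commute_t) (simp_all add: actions gens_t)
  qed (rule mono_commute; simp add: actions mult_ac)+
  show "A.commuting_pairs (mono 1 xc) (mono rc \<one>\<^bsub>E\<^esub>) (mono rd \<one>\<^bsub>E\<^esub>) (mono rc xd)"
    unfolding A.commuting_pairs_def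
  proof (intro conjI)
    show "A.q_commute 1 (mono 1 xc) (mono rc xd)"
      by (rule mono_commute_t) (simp_all add: actions gens_t)
  qed (rule mono_commute; simp add: actions mult_ac)+
qed (rule p_pos)

end

locale heisenberg_crossed_product = heisenberg_embedding K p \<zeta> E q t a b c d ra rb rc rd xa xb xc xd +
    crossed_product_algebra K p \<zeta> E q t \<gamma> s
  for K :: "'f::field alg_closure set" and p \<zeta> and E :: "'e monoid" and q t a b c d ra rb rc rd xa xb xc xd and \<gamma> s
begin

lemma finsum_CP:
  assumes "finite B" "\<And>b. b \<in> B \<Longrightarrow> f b \<in> carrier CP"
  shows "finsum CP f B = (\<lambda>\<rho>. \<Sum>b\<in>B. f b \<rho>)"
  using assms by (induction B rule: finite_induct) (auto simp: Pi_def CP_simps(1,3))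

text \<open>
  The crossed product is spanned over \<open>F\<close> by the products of the monomials with the lifts of the Galois
  group; their number is the order of the group that indexes the four symbols.
\<close>

lemma CP_span:
  assumes x: "x \<in> carrier CP"
  shows "\<exists>r. x = finsum CP (\<lambda>j. r j \<odot>\<^bsub>CP\<^esub> mono (KM.monomial (fst j)) (s (snd j))) (KM.exponents \<times> carrier (gal K))"
proof (rule exI[of _ "\<lambda>j. KM.coordinate (x (snd j)) (fst j)"], rule ext)
  fix \<rho>
  let ?r = "\<lambda>j. KM.coordinate (x (snd j)) (fst j)"
  have "finsum CP (\<lambda>j. ?r j \<odot>\<^bsub>CP\<^esub> mono (KM.monomial (fst j)) (s (snd j))) (KM.exponents \<times> carrier (gal K)) \<rho> =
      (\<Sum>j\<in>KM.exponents \<times> carrier (gal K). (?r j \<odot>\<^bsub>CP\<^esub> mono (KM.monomial (fst j)) (s (snd j))) \<rho>)"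
    using finite_gal s(1) by (subst finsum_CP) auto
  also have "\<dots> = (\<Sum>j\<in>KM.exponents \<times> carrier (gal K). if snd j = \<rho> then to_ac (?r j) * KM.monomial (fst j) else 0)"
    by (intro sum.cong refl) (auto simp: CP_simps(2) mono_def s coset_scalar_s)
  also have "\<dots> = (\<Sum>\<chi>\<in>KM.exponents. \<Sum>\<sigma>\<in>carrier (gal K). if \<sigma> = \<rho> then to_ac (KM.coordinate (x \<sigma>) \<chi>) * KM.monomial \<chi> else 0)"
    unfolding sum.cartesian_product by (intro sum.cong refl) auto
  also have "\<dots> = x \<rho>"
  proof (cases "\<rho> \<in> carrier (gal K)")
    case True
    then show ?thesis using finite_gal KM.monomials_span[OF CP_in[OF x, of \<rho>]] by simp
  next
    case False
    then have "(\<Sum>\<chi>\<in>KM.exponents. \<Sum>\<sigma>\<in>carrier (gal K). if \<sigma> = \<rho> then to_ac (KM.coordinate (x \<sigma>) \<chi>) * KM.monomial \<chi> else 0) = 0"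
      by (intro sum.neutral ballI) auto
    then show ?thesis using CP_out[OF x False] by simp
  qed
  finally show "x \<rho> = finsum CP (\<lambda>j. ?r j \<odot>\<^bsub>CP\<^esub> mono (KM.monomial (fst j)) (s (snd j))) (KM.exponents \<times> carrier (gal K)) \<rho>"
    by (rule HOL.sym)
qed

lemma twist: "nondegenerate_twist (four_symbols_group p) (four_symbols_twist p \<zeta> a b c d)"
  by (rule SA.four_symbols_nondegenerate[OF nonzero])

lemma four_symbols_iso_CP: "iso_algebras (sc_algebra (four_symbols_table p \<zeta> a b c d)) CP"
proof -
  interpret H: heisenberg_rep K p \<zeta> E q t a b c d ra rb rc rd xa xb xc xd CP mono
    by (rule heisenberg_rep.intro[OF heisenberg_embedding_axioms CP.monomial_rep_axioms])
  obtain \<rho> where \<rho>: "projective_rep (four_symbols_group p) (four_symbols_twist p \<zeta> a b c d) CP \<rho>"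
    using H.four_symbols_rep by blast
  have "card (KM.exponents \<times> carrier (gal K)) \<le> card (carrier (four_symbols_group p))"
    by (simp add: card_cartesian_product KM.card_exponents card_gal card_four_symbols_group power2_eq_square)
  then show ?thesis
    unfolding four_symbols_table_twisted
    by (intro nondegenerate_twist.twisted_algebra_iso[OF twist assoc_algebra_CP CP_nontrivial \<rho> _ _ _ CP_span])
       (use finite_gal s(1) in auto)
qed

text \<open>
  The crossed product is the tensor product of \<open>(1, a)\<close>, \<open>(1, c)\<close>, \<open>(a, b)\<close> and \<open>(d, c)\<close>, of which the first two
  split, and \<open>(d, c)\<close> is the inverse of \<open>(c, d)\<close>.
\<close>

theorem crossed_product_class:
  "brauer_class CP = brauer_diff (symbol_class p \<zeta> a b) (symbol_class p \<zeta> c d)"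
proof -
  have "brauer_class CP = table_class (four_symbols_table p \<zeta> a b c d)"
    unfolding table_class_def by (rule brauer_class_iso[OF four_symbols_iso_CP abelian_group_CP])
  also have "\<dots> = table_class (sc_tensor (SA.symb a b) (SA.symb d c))"
    by (rule table_class_cong[OF SA.four_symbols_equiv[OF nonzero(1,3)]])
  also have "\<dots> = brauer_diff (symbol_class p \<zeta> a b) (symbol_class p \<zeta> c d)"
    by (rule SA.brauer_diff_symbol[OF nonzero, symmetric])
  finally show ?thesis .
qed

lemma four_symbols_split_iff:
  "table_equiv (four_symbols_table p \<zeta> a b c d) (unit_table :: (_, 'f) sc_table) \<longleftrightarrow>
     symbol_class p \<zeta> a b = symbol_class p \<zeta> c d"
  unfolding SA.symbol_tensor_trivial_iff[OF nonzero, symmetric]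
proof
  assume "table_equiv (four_symbols_table p \<zeta> a b c d) (unit_table :: (_, 'f) sc_table)"
  then show "table_equiv (sc_tensor (SA.symb a b) (SA.symb d c)) (unit_table :: (_, 'f) sc_table)"
    by (rule table_equiv_trans[OF table_equiv_sym[OF SA.four_symbols_equiv[OF nonzero(1,3)]]])
next
  assume "table_equiv (sc_tensor (SA.symb a b) (SA.symb d c)) (unit_table :: (_, 'f) sc_table)"
  then show "table_equiv (four_symbols_table p \<zeta> a b c d) (unit_table :: (_, 'f) sc_table)"
    by (rule table_equiv_trans[OF SA.four_symbols_equiv[OF nonzero(1,3)]])
qed

text \<open>
  A splitting represents the four symbols by matrices of size \<open>p\<^sup>4\<close>, so their tensor product, which has the
  same dimension, is the matrix algebra.  The converse is the module argument, applied to the crossed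
  product.
\<close>

lemma splitting_iff: "(\<exists>f. splitting f) \<longleftrightarrow> symbol_class p \<zeta> a b = symbol_class p \<zeta> c d"
  unfolding four_symbols_split_iff[symmetric]
proof
  assume "\<exists>f. splitting f"
  then obtain f where f: "splitting f" by blast
  let ?M = "mat_table KM.exponents :: (_, 'f) sc_table"
  have rep: "monomial_rep K p \<zeta> E q t (sc_algebra ?M) (kummer_central_embedding.splitting_matrix K p q {..<4} (\<lambda>i. [ra, rb, rc, rd] ! i) f)"
    by (rule kummer_central_embedding.splitting_matrix_rep[OF kummer_central_embedding.intro[OF central_embedding_axioms KM.kummer_extension_axioms] f])
  interpret H: heisenberg_rep K p \<zeta> E q t a b c d ra rb rc rd xa xb xc xd "sc_algebra ?M"
      "kummer_central_embedding.splitting_matrix K p q {..<4} (\<lambda>i. [ra, rb, rc, rd] ! i) f"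
    by (rule heisenberg_rep.intro[OF heisenberg_embedding_axioms rep])
  obtain \<rho> where \<rho>: "projective_rep (four_symbols_group p) (four_symbols_twist p \<zeta> a b c d) (sc_algebra ?M) \<rho>"
    using H.four_symbols_rep by blast
  have "card KM.exponents > 0" using p_pos by (simp add: KM.card_exponents)
  then obtain \<chi> where \<chi>: "\<chi> \<in> KM.exponents" by (auto simp: card_gt_0_iff)
  have nontriv: "\<one>\<^bsub>sc_algebra ?M\<^esub> \<noteq> \<zero>\<^bsub>sc_algebra ?M\<^esub>"
  proof
    assume "\<one>\<^bsub>sc_algebra ?M\<^esub> = \<zero>\<^bsub>sc_algebra ?M\<^esub>"
    from fun_cong[OF this, of "(\<chi>, \<chi>)"] show False using \<chi> by (simp add: sc_one)
  qed
  have "iso_algebras (sc_algebra (four_symbols_table p \<zeta> a b c d)) (sc_algebra ?M)"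
    unfolding four_symbols_table_twisted
    by (rule nondegenerate_twist.twisted_table_iso[OF twist assoc_algebra_mat_table nontriv \<rho>])
       (simp_all add: card_cartesian_product KM.card_exponents card_four_symbols_group power2_eq_square)
  moreover have "table_equiv ?M (unit_table :: (_, 'f) sc_table)"
    using \<chi> by (intro table_equiv_mat_unit KM.finite_exponents) auto
  ultimately show "table_equiv (four_symbols_table p \<zeta> a b c d) (unit_table :: (_, 'f) sc_table)"
    by (rule table_equiv_trans[OF table_equiv_iso])
next
  assume split: "table_equiv (four_symbols_table p \<zeta> a b c d) (unit_table :: (_, 'f) sc_table)"
  have rep: "kummer_monomial_rep K p \<zeta> E q t CP mono {..<4} (\<lambda>i. [ra, rb, rc, rd] ! i)"
    by (rule kummer_monomial_rep.intro[OF CP.monomial_rep_axioms KM.kummer_extension_axioms])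
  have "iso_algebras CP (sc_algebra (four_symbols_table p \<zeta> a b c d))"
    by (rule iso_algebras_sym[OF four_symbols_iso_CP closed_algebra_sc_algebra])
  then obtain h where h: "h \<in> algebra_isos CP (sc_algebra (four_symbols_table p \<zeta> a b c d))"
    by (auto simp: iso_algebras_def)
  have index: "sc_index (four_symbols_table p \<zeta> a b c d) = carrier (four_symbols_group p)"
    unfolding four_symbols_table_twisted by (simp add: twisted_table_def)
  have fin: "finite (carrier (four_symbols_group p))" by (simp add: four_symbols_group_def)
  show "\<exists>f. splitting f"
  proof (rule kummer_monomial_rep.split_imp_splitting[OF rep h split])
    show "finite (sc_index (four_symbols_table p \<zeta> a b c d))" unfolding index by (rule fin)
    show "card (sc_index (four_symbols_table p \<zeta> a b c d)) = (p ^ card {..<4::nat}) ^ 2"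
      unfolding index card_four_symbols_group by simp
    show "assoc_algebra base_ring (sc_algebra (four_symbols_table p \<zeta> a b c d))"
      unfolding four_symbols_table_twisted by (rule nondegenerate_twist.assoc_algebra_twisted[OF twist])
    show "\<one>\<^bsub>sc_algebra (four_symbols_table p \<zeta> a b c d)\<^esub> \<noteq> \<zero>\<^bsub>sc_algebra (four_symbols_table p \<zeta> a b c d)\<^esub>"
      unfolding four_symbols_table_twisted by (rule nondegenerate_twist.one_not_zero_twisted[OF twist])
  qed
qed

theorem solvable_iff: "embedding_problem_solvable K E q \<longleftrightarrow> symbol_class p \<zeta> a b = symbol_class p \<zeta> c d"
  unfolding splitting_iff[symmetric]
proof
  assume "embedding_problem_solvable K E q"
  then show "\<exists>f. splitting f"
    by (rule solvable_imp_splitting[of KM.exponents KM.monomial "to_ac KM.dimension"])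
       (use KM.dimension_nonzero in \<open>auto simp: KM.monomial_dual\<close>)
next
  assume "\<exists>f. splitting f"
  then obtain f where f: "splitting f" by blast
  have "xa \<otimes>\<^bsub>E\<^esub> xb = xb \<otimes>\<^bsub>E\<^esub> xa \<otimes>\<^bsub>E\<^esub> t" unfolding gens_t(1) using gens by (intro t_central) simp
  then show "embedding_problem_solvable K E q"
    by (rule splitting_imp_solvable[OF f gens(1,2) _ K_adjoin]) (use radicals in auto)
qed

end

section \<open>The obstruction\<close>

context central_embedding
begin

text \<open>
  Needed both for the existence of an obstruction and for transferring the criterion for solvability,
  which mentions no factor set, from the crossed product.
\<close>

lemma factor_set_exists: "\<exists>\<gamma>. factor_set K E q t \<zeta> \<gamma>"
proof -
  let ?G = "carrier (gal K)"
  have "\<exists>n::nat. lift \<sigma> \<otimes>\<^bsub>E\<^esub> lift \<tau> = t [^]\<^bsub>E\<^esub> n \<otimes>\<^bsub>E\<^esub> lift (\<sigma> \<otimes>\<^bsub>gal K\<^esub> \<tau>)"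
    if in_G: "\<sigma> \<in> ?G" "\<tau> \<in> ?G" for \<sigma> \<tau>
  proof -
    have "q (lift \<sigma> \<otimes>\<^bsub>E\<^esub> lift \<tau>) = q (lift (\<sigma> \<otimes>\<^bsub>gal K\<^esub> \<tau>))"
      using in_G by (simp add: q_mult lift)
    then obtain n :: nat where "lift \<sigma> \<otimes>\<^bsub>E\<^esub> lift \<tau> = t [^]\<^bsub>E\<^esub> n \<otimes>\<^bsub>E\<^esub> lift (\<sigma> \<otimes>\<^bsub>gal K\<^esub> \<tau>)"
      by (rule q_eqD[rotated 2]) (use in_G lift in auto)
    then show ?thesis by blast
  qed
  then have "\<exists>N. \<forall>\<sigma>\<in>?G. \<forall>\<tau>\<in>?G. lift \<sigma> \<otimes>\<^bsub>E\<^esub> lift \<tau> = t [^]\<^bsub>E\<^esub> (N \<sigma> \<tau> :: nat) \<otimes>\<^bsub>E\<^esub> lift (\<sigma> \<otimes>\<^bsub>gal K\<^esub> \<tau>)"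
    by metis
  then obtain N where N: "\<And>\<sigma> \<tau>. \<sigma> \<in> ?G \<Longrightarrow> \<tau> \<in> ?G \<Longrightarrow>
      lift \<sigma> \<otimes>\<^bsub>E\<^esub> lift \<tau> = t [^]\<^bsub>E\<^esub> (N \<sigma> \<tau> :: nat) \<otimes>\<^bsub>E\<^esub> lift (\<sigma> \<otimes>\<^bsub>gal K\<^esub> \<tau>)"
    by blast
  have "factor_set K E q t \<zeta> (\<lambda>\<sigma> \<tau>. \<zeta> ^ N \<sigma> \<tau>)"
    unfolding factor_set_def
  proof (intro exI[of _ lift] conjI ballI)
    fix \<sigma> \<tau> assume "\<sigma> \<in> ?G" "\<tau> \<in> ?G"
    then show "\<exists>n. \<zeta> ^ N \<sigma> \<tau> = \<zeta> ^ n \<and> lift \<sigma> \<otimes>\<^bsub>E\<^esub> lift \<tau> = t [^]\<^bsub>E\<^esub> n \<otimes>\<^bsub>E\<^esub> lift (\<sigma> \<otimes>\<^bsub>gal K\<^esub> \<tau>)"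
      by (intro exI[of _ "N \<sigma> \<tau>"] conjI refl N)
  qed (auto simp: lift)
  then show ?thesis by blast
qed

lemma factor_set_crossed_product:
  assumes "factor_set K E q t \<zeta> \<gamma>"
  shows "\<exists>s. crossed_product_algebra K p \<zeta> E q t \<gamma> s"
proof -
  obtain s where s: "\<forall>\<sigma>\<in>carrier (gal K). s \<sigma> \<in> carrier E \<and> q (s \<sigma>) = \<sigma>"
    "\<forall>\<sigma>\<in>carrier (gal K). \<forall>\<tau>\<in>carrier (gal K). \<exists>n::nat. \<gamma> \<sigma> \<tau> = \<zeta> ^ n \<and>
       s \<sigma> \<otimes>\<^bsub>E\<^esub> s \<tau> = t [^]\<^bsub>E\<^esub> n \<otimes>\<^bsub>E\<^esub> s (\<sigma> \<otimes>\<^bsub>gal K\<^esub> \<tau>)"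
    using assms unfolding factor_set_def by (elim exE conjE) rule
  have "crossed_product_algebra K p \<zeta> E q t \<gamma> s"
    by (intro crossed_product_algebra.intro crossed_product_algebra_axioms.intro central_embedding_axioms) (use s in simp_all)
  then show ?thesis by blast
qed

end

context heisenberg_embedding
begin

theorem obstruction_iff:
  "is_obstruction K E q t \<zeta> \<beta> \<longleftrightarrow> \<beta> = brauer_diff (symbol_class p \<zeta> a b) (symbol_class p \<zeta> c d)"
proof -
  have "brauer_class (crossed_product K \<gamma>) = brauer_diff (symbol_class p \<zeta> a b) (symbol_class p \<zeta> c d)"
    if \<gamma>: "factor_set K E q t \<zeta> \<gamma>" for \<gamma>
  proof -
    obtain s where "crossed_product_algebra K p \<zeta> E q t \<gamma> s" using factor_set_crossed_product[OF \<gamma>] by (rule exE)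
    then show ?thesis
      by (rule heisenberg_crossed_product.crossed_product_class[OF heisenberg_crossed_product.intro[OF heisenberg_embedding_axioms]])
  qed
  then show ?thesis using factor_set_exists unfolding is_obstruction_def by auto
qed

theorem solvable_iff_symbols: "embedding_problem_solvable K E q \<longleftrightarrow> symbol_class p \<zeta> a b = symbol_class p \<zeta> c d"
proof -
  obtain \<gamma> where \<gamma>: "factor_set K E q t \<zeta> \<gamma>" using factor_set_exists by (rule exE)
  obtain s where "crossed_product_algebra K p \<zeta> E q t \<gamma> s" using factor_set_crossed_product[OF \<gamma>] by (rule exE)
  then show ?thesis
    by (rule heisenberg_crossed_product.solvable_iff[OF heisenberg_crossed_product.intro[OF heisenberg_embedding_axioms]])
qed

end

section \<open>The group of order \<open>p\<^sup>5\<close>\<close>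

text \<open>
  The commutators of the generators in the form in which they are used, with one or both generators
  replaced by the inverse.
\<close>

lemma (in group) commutator_relations:
  assumes "g \<in> carrier G" "h \<in> carrier G"
  shows "inv g \<otimes> inv h = group_commutator G g h \<otimes> (inv h \<otimes> inv g)"
    and "inv g \<otimes> h = h \<otimes> inv (group_commutator G g h) \<otimes> inv g"
proof -
  have c: "x \<otimes> (inv x \<otimes> y) = y" "inv x \<otimes> (x \<otimes> y) = y" if "x \<in> carrier G" "y \<in> carrier G" for x y
    using that by (simp_all add: m_assoc[symmetric])
  show "inv g \<otimes> inv h = group_commutator G g h \<otimes> (inv h \<otimes> inv g)"
    and "inv g \<otimes> h = h \<otimes> inv (group_commutator G g h) \<otimes> inv g"
    using assms by (simp_all add: group_commutator_def inv_mult_group m_assoc c)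
qed

lemma ep_gens_closed:
  assumes "p > 1"
  shows "ep_a p \<in> carrier (Ep p)" "ep_b p \<in> carrier (Ep p)" "ep_c p \<in> carrier (Ep p)" "ep_d p \<in> carrier (Ep p)"
    "ep_tau p \<in> carrier (Ep p)"
  using assms by (simp_all add: ep_a_def ep_b_def ep_c_def ep_d_def ep_tau_def ep_class_closed)

lemma ep_tau_neq_one:
  assumes "p > 1" shows "ep_tau p \<noteq> \<one>\<^bsub>Ep p\<^esub>"
proof
  assume "ep_tau p = \<one>\<^bsub>Ep p\<^esub>"
  moreover have "\<one>\<^bsub>Ep p\<^esub> = ep_kernel p" by (simp add: Ep_def central_product_def)
  moreover have "((0, 0, 1), (0, 0, 0)) \<in> ep_tau p"
    unfolding ep_tau_def ep_class_def
    by (rule group.rcos_self[OF group_ep_cover[OF assms] _ ep_kernel_subgroup[OF assms]]) (use assms in simp)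
  ultimately show False by (auto simp: ep_kernel_eq[OF assms])
qed

lemma ep_tau_ord:
  assumes "Factorial_Ring.prime p" shows "group.ord (Ep p) (ep_tau p) = p"
proof -
  have p: "p > 1" using prime_gt_1_nat[OF assms] .
  interpret E: group "Ep p" by (rule group_Ep[OF p])
  note tau = ep_gens_closed(5)[OF p]
  have "E.ord (ep_tau p) dvd p" using E.pow_eq_id[OF tau, of p] Ep_relations(5)[OF p] by simp
  moreover have "E.ord (ep_tau p) \<noteq> 1"
    using E.pow_eq_id[OF tau, of 1] ep_tau_neq_one[OF p] tau by auto
  ultimately show ?thesis using assms by (auto simp: prime_nat_iff)
qed

lemma ep_tau_central:
  assumes "p > 1" "w \<in> carrier (Ep p)" shows "ep_tau p \<otimes>\<^bsub>Ep p\<^esub> w = w \<otimes>\<^bsub>Ep p\<^esub> ep_tau p"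
  using Ep_relations(6)[OF assms(1)] assms(2) by (simp add: group_center_def)

lemma generate_ep_tau:
  assumes p: "p > 1" shows "generate (Ep p) {ep_tau p} = range (\<lambda>n::nat. ep_tau p [^]\<^bsub>Ep p\<^esub> n)"
proof -
  interpret E: group "Ep p" by (rule group_Ep[OF p])
  note tau = ep_gens_closed(5)[OF p]
  show ?thesis
  proof (intro equalityI subsetI)
    fix w assume "w \<in> generate (Ep p) {ep_tau p}"
    then show "w \<in> range (\<lambda>n::nat. ep_tau p [^]\<^bsub>Ep p\<^esub> n)"
    proof (induction rule: generate.induct)
      case one
      show ?case by (rule range_eqI[of _ _ 0]) simp
    next
      case (incl h)
      then show ?case by (intro range_eqI[of _ _ 1]) (use tau in simp)
    next
      case (inv h)
      have "ep_tau p [^]\<^bsub>Ep p\<^esub> (p - 1) \<otimes>\<^bsub>Ep p\<^esub> ep_tau p = \<one>\<^bsub>Ep p\<^esub>"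
        using Ep_relations(5)[OF p] p E.nat_pow_Suc[of "ep_tau p" "p - 1"] by simp
      then have "inv\<^bsub>Ep p\<^esub> (ep_tau p) = ep_tau p [^]\<^bsub>Ep p\<^esub> (p - 1)"
        using tau by (intro E.inv_equality) auto
      then show ?case using inv by (intro range_eqI[of _ _ "p - 1"]) simp
    next
      case (eng h1 h2)
      then obtain m n :: nat where "h1 = ep_tau p [^]\<^bsub>Ep p\<^esub> m" "h2 = ep_tau p [^]\<^bsub>Ep p\<^esub> n" by auto
      then show ?case by (intro range_eqI[of _ _ "m + n"]) (use tau in \<open>simp add: E.nat_pow_mult\<close>)
    qed
  next
    fix w assume "w \<in> range (\<lambda>n::nat. ep_tau p [^]\<^bsub>Ep p\<^esub> n)"
    then obtain n :: nat where w: "w = ep_tau p [^]\<^bsub>Ep p\<^esub> n" by auto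
    show "w \<in> generate (Ep p) {ep_tau p}" unfolding w
      by (induction n) (auto intro: generate.one generate.eng generate.incl)
  qed
qed

lemma generate_ep_tau_normal:
  assumes p: "p > 1" shows "generate (Ep p) {ep_tau p} \<lhd> Ep p"
proof -
  interpret E: group "Ep p" by (rule group_Ep[OF p])
  note tau = ep_gens_closed(5)[OF p]
  show ?thesis
  proof (rule E.normal_invI)
    show "subgroup (generate (Ep p) {ep_tau p}) (Ep p)" using tau by (intro E.generate_is_subgroup) simp
    fix x h assume x: "x \<in> carrier (Ep p)" and h: "h \<in> generate (Ep p) {ep_tau p}"
    then obtain n :: nat where n: "h = ep_tau p [^]\<^bsub>Ep p\<^esub> n" by (auto simp: generate_ep_tau[OF p])
    have hx: "h \<otimes>\<^bsub>Ep p\<^esub> x = x \<otimes>\<^bsub>Ep p\<^esub> h"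
      unfolding n by (rule E.group_commutes_pow[OF ep_tau_central[OF p x] tau x])
    have "h \<in> carrier (Ep p)" unfolding n using tau by simp
    then have "x \<otimes>\<^bsub>Ep p\<^esub> h \<otimes>\<^bsub>Ep p\<^esub> inv\<^bsub>Ep p\<^esub> x = h"
      unfolding hx[symmetric] using x by (simp add: E.m_assoc)
    then show "x \<otimes>\<^bsub>Ep p\<^esub> h \<otimes>\<^bsub>Ep p\<^esub> inv\<^bsub>Ep p\<^esub> x \<in> generate (Ep p) {ep_tau p}" using h by simp
  qed
qed

text \<open>
  The image of the cosets under \<open>\<theta>\<close> makes \<open>Ep p\<close> an extension of the Galois group whose kernel consists of the
  powers of \<open>\<tau>\<close>.
\<close>

lemma ep_central_embedding:
  fixes K :: "'f::field alg_closure set"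
  assumes p: "Factorial_Ring.prime p" and \<zeta>: "primitive_root_of_unity p \<zeta>"
    and galois: "galois_extension K" and fin: "finite (carrier (gal K))"
    and \<theta>: "\<theta> \<in> iso (Ep p Mod generate (Ep p) {ep_tau p}) (gal K)"
  shows "central_embedding K p \<zeta> (Ep p) (\<lambda>x. \<theta> (generate (Ep p) {ep_tau p} #>\<^bsub>Ep p\<^esub> x)) (ep_tau p)"
proof -
  have p1: "p > 1" using prime_gt_1_nat[OF p] .
  let ?T = "generate (Ep p) {ep_tau p}"
  interpret E: group "Ep p" by (rule group_Ep[OF p1])
  interpret T: normal ?T "Ep p" by (rule generate_ep_tau_normal[OF p1])
  interpret L: extension_field K using galois by (auto simp: extension_field_def galois_extension_def)
  have \<theta>_hom: "\<theta> \<in> hom (Ep p Mod ?T) (gal K)" and \<theta>_bij: "bij_betw \<theta> (carrier (Ep p Mod ?T)) (carrier (gal K))"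
    using \<theta> by (auto simp: iso_def)
  have coset: "?T #>\<^bsub>Ep p\<^esub> e \<in> carrier (Ep p Mod ?T)" if "e \<in> carrier (Ep p)" for e
    by (rule hom_in_carrier[OF T.r_coset_hom_Mod that])
  have \<theta>_one: "\<theta> ?T = \<one>\<^bsub>gal K\<^esub>"
    using hom_one[OF \<theta>_hom T.factorgroup_is_group L.G.group_axioms] by simp
  show ?thesis
  proof (intro central_embedding.intro central_embedding_axioms.intro)
    show "extension_field K" by (rule L.extension_field_axioms)
    show "(\<lambda>x. \<theta> (?T #>\<^bsub>Ep p\<^esub> x)) \<in> hom (Ep p) (gal K)"
      using hom_compose[OF T.r_coset_hom_Mod \<theta>_hom] by (simp add: comp_def)
    have "carrier (Ep p Mod ?T) = (\<lambda>x. ?T #>\<^bsub>Ep p\<^esub> x) ` carrier (Ep p)"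
      by (auto simp: FactGroup_def RCOSETS_def)
    then show "(\<lambda>x. \<theta> (?T #>\<^bsub>Ep p\<^esub> x)) ` carrier (Ep p) = carrier (gal K)"
      using \<theta>_bij by (simp add: bij_betw_def image_image[symmetric] image_comp[symmetric])
    fix e assume e: "e \<in> carrier (Ep p)"
    show "ep_tau p \<otimes>\<^bsub>Ep p\<^esub> e = e \<otimes>\<^bsub>Ep p\<^esub> ep_tau p" by (rule ep_tau_central[OF p1 e])
    have T_in: "?T \<in> carrier (Ep p Mod ?T)"
      using group.is_monoid[OF T.factorgroup_is_group, THEN monoid.one_closed] by simp
    have "\<theta> (?T #>\<^bsub>Ep p\<^esub> e) = \<one>\<^bsub>gal K\<^esub> \<longleftrightarrow> ?T #>\<^bsub>Ep p\<^esub> e = ?T"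
      unfolding \<theta>_one[symmetric] using inj_on_eq_iff[OF bij_betw_imp_inj_on[OF \<theta>_bij] coset[OF e] T_in] .
    also have "\<dots> \<longleftrightarrow> e \<in> ?T"
      using E.coset_join1[OF _ e T.subgroup_axioms] E.coset_join2[OF e T.subgroup_axioms] by (rule iffI)
    also have "\<dots> \<longleftrightarrow> (\<exists>n::nat. e = ep_tau p [^]\<^bsub>Ep p\<^esub> n)"
      unfolding generate_ep_tau[OF p1] by auto
    finally show "\<theta> (?T #>\<^bsub>Ep p\<^esub> e) = \<one>\<^bsub>gal K\<^esub> \<longleftrightarrow> (\<exists>n::nat. e = ep_tau p [^]\<^bsub>Ep p\<^esub> n)" .
  qed (rule p \<zeta> galois fin E.group_axioms ep_gens_closed(5)[OF p1] ep_tau_ord[OF p])+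
qed

lemma of_nat_prime_nonzero:
  assumes "Factorial_Ring.prime p" "p \<noteq> CHAR('f::field)" shows "of_nat p \<noteq> (0 :: 'f)"
proof
  assume "of_nat p = (0 :: 'f)"
  then have "CHAR('f) = 1" using assms by (auto simp: of_nat_eq_0_iff_char_dvd prime_nat_iff)
  then show False using of_nat_eq_0_iff_char_dvd[of 1, where 'a = 'f] by simp
qed

lemma card_Cp4: "p > 0 \<Longrightarrow> card (carrier (Cp4 p)) = p ^ 4"
  by (simp add: Cp4_def card_cartesian_product carrier_integer_mod_group power4_eq_xxxx mult_ac)

theorem corollary3p3:
  fixes p :: nat and \<zeta> a b c d :: "'f::field"
    and ra rb rc rd :: "'f alg_closure"
    and K :: "'f alg_closure set"
    and \<theta> :: "ep_elem set \<Rightarrow> 'f alg_closure \<Rightarrow> 'f alg_closure"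
    and q :: "ep_elem \<Rightarrow> 'f alg_closure \<Rightarrow> 'f alg_closure"
  assumes "global_field TYPE('f)"
    and "Factorial_Ring.prime p" and "odd p" and "p \<noteq> CHAR('f)"
    and "primitive_root_of_unity p \<zeta>"
    and "a \<noteq> 0" and "b \<noteq> 0" and "c \<noteq> 0" and "d \<noteq> 0"
    and "ra ^ p = to_ac a" and "rb ^ p = to_ac b" and "rc ^ p = to_ac c" and "rd ^ p = to_ac d"
    and "K = adjoin {ra, rb, rc, rd}"
    and "galois_extension K" and "gal K \<cong> Cp4 p"
    and "\<theta> \<in> iso (Ep p Mod generate (Ep p) {ep_tau p}) (gal K)"
    and "q = (\<lambda>x. \<theta> (generate (Ep p) {ep_tau p} #>\<^bsub>Ep p\<^esub> x))"
    and "kummer_generator K \<zeta> ra {rb, rc, rd} (q (ep_a p))"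
    and "kummer_generator K \<zeta> rb {ra, rc, rd} (q (ep_b p))"
    and "kummer_generator K \<zeta> rc {ra, rb, rd} (q (ep_c p))"
    and "kummer_generator K \<zeta> rd {ra, rb, rc} (q (ep_d p))"
  shows "(\<forall>\<beta>. is_obstruction K (Ep p) q (ep_tau p) \<zeta> \<beta> \<longleftrightarrow>
            \<beta> = brauer_diff (symbol_class p \<zeta> a b) (symbol_class p \<zeta> c d)) \<and>
         brauer_diff (symbol_class p \<zeta> a b) (symbol_class p \<zeta> c d) \<in> brauer_torsion p \<and>
         (embedding_problem_solvable K (Ep p) q \<longleftrightarrow>
            symbol_class p \<zeta> a b = symbol_class p \<zeta> c d)"
proof -
  have p: "p > 1" using prime_gt_1_nat[OF assms(2)] .
  interpret E: group "Ep p" by (rule group_Ep[OF p])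
  note gens = ep_gens_closed[OF p]
  have "card (carrier (gal K)) = card (carrier (Cp4 p))"
    using assms(16) unfolding is_iso_def iso_def by (auto intro: bij_betw_same_card)
  then have card: "card (carrier (gal K)) = p ^ 4" using card_Cp4 p by simp
  then have fin: "finite (carrier (gal K))" using p by (intro card_ge_0_finite) simp
  interpret C: central_embedding K p \<zeta> "Ep p" q "ep_tau p"
    unfolding assms(18) by (rule ep_central_embedding[OF assms(2,5,15) fin assms(17)])
  have ka: "q (ep_a p) ra = to_ac \<zeta> * ra" "q (ep_a p) rb = rb" "q (ep_a p) rc = rc" "q (ep_a p) rd = rd"
    and kb: "q (ep_b p) ra = ra" "q (ep_b p) rb = to_ac \<zeta> * rb" "q (ep_b p) rc = rc" "q (ep_b p) rd = rd"
    and kc: "q (ep_c p) ra = ra" "q (ep_c p) rb = rb" "q (ep_c p) rc = to_ac \<zeta> * rc" "q (ep_c p) rd = rd"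
    and kd: "q (ep_d p) ra = ra" "q (ep_d p) rb = rb" "q (ep_d p) rc = rc" "q (ep_d p) rd = to_ac \<zeta> * rd"
    using assms(19-22) by (auto simp: kummer_generator_def)
  have r_in: "ra \<in> K" "rb \<in> K" "rc \<in> K" "rd \<in> K"
    unfolding assms(14) adjoin_def by (auto intro: generate_field.incl)
  have inv_scale: "q (inv\<^bsub>Ep p\<^esub> e) x = x / to_ac \<zeta>" if "e \<in> carrier (Ep p)" "x \<in> K" "q e x = to_ac \<zeta> * x" for e x
    by (rule C.q_inv_apply[OF that C.\<zeta>_nonzero])
  have inv_fix: "q (inv\<^bsub>Ep p\<^esub> e) x = x" if "e \<in> carrier (Ep p)" "x \<in> K" "q e x = x" for e x
    using C.q_inv_apply[OF that(1,2), of 1] that(3) by simp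
  have inv_pow: "inv\<^bsub>Ep p\<^esub> e [^]\<^bsub>Ep p\<^esub> p = \<one>\<^bsub>Ep p\<^esub>" if "e \<in> carrier (Ep p)" "e [^]\<^bsub>Ep p\<^esub> p = \<one>\<^bsub>Ep p\<^esub>" for e
    using that by (simp add: E.nat_pow_inv)
  note rel = Ep_relations[OF p]
  have "heisenberg_embedding_axioms K p \<zeta> (Ep p) q (ep_tau p) a b c d ra rb rc rd
      (inv\<^bsub>Ep p\<^esub> ep_a p) (inv\<^bsub>Ep p\<^esub> ep_b p) (inv\<^bsub>Ep p\<^esub> ep_c p) (ep_d p)"
  proof (rule heisenberg_embedding_axioms.intro)
    show "of_nat p \<noteq> (0 :: 'f)" by (rule of_nat_prime_nonzero[OF assms(2,4)])
    show "inv\<^bsub>Ep p\<^esub> ep_a p \<otimes>\<^bsub>Ep p\<^esub> inv\<^bsub>Ep p\<^esub> ep_b p = ep_tau p \<otimes>\<^bsub>Ep p\<^esub> (inv\<^bsub>Ep p\<^esub> ep_b p \<otimes>\<^bsub>Ep p\<^esub> inv\<^bsub>Ep p\<^esub> ep_a p)"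
      using E.commutator_relations(1)[OF gens(1,2)] rel(7) by simp
    have "inv\<^bsub>Ep p\<^esub> ep_c p \<otimes>\<^bsub>Ep p\<^esub> ep_d p = ep_d p \<otimes>\<^bsub>Ep p\<^esub> ep_tau p \<otimes>\<^bsub>Ep p\<^esub> inv\<^bsub>Ep p\<^esub> ep_c p"
      using E.commutator_relations(2)[OF gens(3,4)] rel(8) gens(5) by simp
    then show "inv\<^bsub>Ep p\<^esub> ep_c p \<otimes>\<^bsub>Ep p\<^esub> ep_d p = ep_tau p \<otimes>\<^bsub>Ep p\<^esub> (ep_d p \<otimes>\<^bsub>Ep p\<^esub> inv\<^bsub>Ep p\<^esub> ep_c p)"
      using gens by (simp add: ep_tau_central[OF p gens(4), symmetric] E.m_assoc)
    show "inv\<^bsub>Ep p\<^esub> ep_a p \<otimes>\<^bsub>Ep p\<^esub> inv\<^bsub>Ep p\<^esub> ep_c p = inv\<^bsub>Ep p\<^esub> ep_c p \<otimes>\<^bsub>Ep p\<^esub> inv\<^bsub>Ep p\<^esub> ep_a p"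
      using E.commutator_relations(1)[OF gens(1,3)] rel(9) gens by simp
    show "inv\<^bsub>Ep p\<^esub> ep_b p \<otimes>\<^bsub>Ep p\<^esub> inv\<^bsub>Ep p\<^esub> ep_c p = inv\<^bsub>Ep p\<^esub> ep_c p \<otimes>\<^bsub>Ep p\<^esub> inv\<^bsub>Ep p\<^esub> ep_b p"
      using E.commutator_relations(1)[OF gens(2,3)] rel(11) gens by simp
    show "inv\<^bsub>Ep p\<^esub> ep_a p \<otimes>\<^bsub>Ep p\<^esub> ep_d p = ep_d p \<otimes>\<^bsub>Ep p\<^esub> inv\<^bsub>Ep p\<^esub> ep_a p"
      using E.commutator_relations(2)[OF gens(1,4)] rel(10) gens by simp
    show "inv\<^bsub>Ep p\<^esub> ep_b p \<otimes>\<^bsub>Ep p\<^esub> ep_d p = ep_d p \<otimes>\<^bsub>Ep p\<^esub> inv\<^bsub>Ep p\<^esub> ep_b p"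
      using E.commutator_relations(2)[OF gens(2,4)] rel(12) gens by simp
  qed (rule assms(6-14) card kd E.inv_closed gens inv_scale[OF _ _ ka(1)] inv_scale[OF _ _ kb(2)] inv_scale[OF _ _ kc(3)]
      inv_fix[OF _ _ ka(2)] inv_fix[OF _ _ ka(3)] inv_fix[OF _ _ ka(4)] inv_fix[OF _ _ kb(1)] inv_fix[OF _ _ kb(3)]
      inv_fix[OF _ _ kb(4)] inv_fix[OF _ _ kc(1)] inv_fix[OF _ _ kc(2)] inv_fix[OF _ _ kc(4)]
      inv_pow[OF _ rel(1)] inv_pow[OF _ rel(2)] inv_pow[OF _ rel(3)] rel(4) r_in)+
  then interpret H: heisenberg_embedding K p \<zeta> "Ep p" q "ep_tau p" a b c d ra rb rc rd
      "inv\<^bsub>Ep p\<^esub> ep_a p" "inv\<^bsub>Ep p\<^esub> ep_b p" "inv\<^bsub>Ep p\<^esub> ep_c p" "ep_d p"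
    by (rule heisenberg_embedding.intro[OF C.central_embedding_axioms])
  have "brauer_diff (symbol_class p \<zeta> a b) (symbol_class p \<zeta> c d) \<in> brauer_torsion p"
    unfolding H.SA.brauer_diff_symbol[OF assms(6-9)] by (rule H.SA.symbol_tensor_torsion[OF assms(6-9)])
  then show ?thesis using H.obstruction_iff H.solvable_iff_symbols by blast
qed

end
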